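(* Let $n\ge1$, fix $t\in(0,1)$ and $p\in[0,\infty]$. Let $f,g,h:\mathbb{R}^n\to[0,\infty)$ be $\gamma$-integrable, with $f$ and $g$ log-concave, and set $A=\int f\,\mathrm d\gamma>0$ and $B=\int g\,\mathrm d\gamma>0$ (both assumed positive). Assume that $$h((1-t)x+ty)\ge M_p^t(f(x),g(y))\qquad\text{for every }x,y\in\mathbb{R}^n.$$ Define $\mathrm d\mu_f=\frac fA\,\mathrm d\gamma$ and $\mathrm d\mu_g=\frac gB\,\mathrm d\gamma$, and let $b_f,b_g$ be the barycenters of $\mu_f,\mu_g$, respectively. Put $b_t=(1-t)b_f+tb_g$ and $r=p/(1+np)$, with $r=1/n$ when $p=\infty$. Then $$\int h\,\mathrm d\gamma\ \ge\ e^{-|b_t|^2/2}\,M_r^t\!\left(Ae^{|b_f|^2/2},\,Be^{|b_g|^2/2}\right).$$ In particular, if $b_f=b_g$, then $\int h\,\mathrm d\gamma\ge M_r^t(A,B)$.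
   Context: $\gamma$ is the standard Gaussian measure on $\mathbb{R}^n$. The barycenter of a probability measure $\mu$ is $\int x\,\mathrm d\mu$. Weighted power mean: for $t\in(0,1)$, $a,b\ge0$, $p\in[0,\infty]$, $M_p^t(a,b)=((1-t)a^p+tb^p)^{1/p}$ if $ab>0$ and $M_p^t(a,b)=0$ if $ab=0$, with the usual limiting interpretations when $ab>0$: $M_0^t(a,b)=a^{1-t}b^t$ and $M_\infty^t(a,b)=\max\{a,b\}$. *)

theory Defs
  imports "HOL-Analysis.Analysis"
begin

text \<open>
  The standard Gaussian measure on \<open>\<real>\<^sup>n\<close>. The base measure is \<^const>\<open>lebesgue\<close> rather than
  \<^const>\<open>lborel\<close>, so that integrability means Lebesgue measurability: a log-concave function
  need not be Borel on the boundary of its support.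
\<close>

definition std_gaussian :: "(real ^ 'n) measure" where
  "std_gaussian =
     density lebesgue (\<lambda>x. ennreal (exp (- (norm x)\<^sup>2 / 2) / sqrt (2 * pi) ^ CARD('n)))"

definition barycenter :: "'a::euclidean_space measure \<Rightarrow> 'a" where
  "barycenter \<mu> = (\<integral>x. x \<partial>\<mu>)"

text \<open>
  The weights are restricted to the open unit interval because \<open>0 powr 0 = 0\<close>; at the
  endpoints the inequality is trivial under the usual convention.
\<close>

definition log_concave :: "('a::real_vector \<Rightarrow> real) \<Rightarrow> bool" where
  "log_concave f \<longleftrightarrow>
     (\<forall>x. 0 \<le> f x) \<and>
     (\<forall>x y s. 0 < s \<and> s < 1 \<longrightarrow>
        f ((1 - s) *\<^sub>R x + s *\<^sub>R y) \<ge> f x powr (1 - s) * f y powr s)"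

text \<open>
  The power mean of order \<open>p \<in> [0, \<infinity>]\<close>, meant for \<open>a, b \<ge> 0\<close> and \<open>0 < t < 1\<close>. It vanishes as
  soon as one argument does, for every order, including \<open>p = \<infinity>\<close>.
\<close>

definition power_mean :: "ennreal \<Rightarrow> real \<Rightarrow> real \<Rightarrow> real \<Rightarrow> real" where
  "power_mean p t a b =
     (if a * b = 0 then 0
      else if p = 0 then a powr (1 - t) * b powr t
      else if p = \<infinity> then max a b
      else ((1 - t) * a powr enn2real p + t * b powr enn2real p) powr (1 / enn2real p))"

end

theory Submission
  imports Defs "HOL-Probability.Probability"
begin

text \<open>
  The power mean of order \<open>p\<close> is the maximum over \<open>s \<in> (0, 1)\<close> of
  \<open>exp (- kl s t / p) * a powr (1 - s) * b powr s\<close>, where \<open>kl s t\<close> is the relative entropy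
  of the weights \<open>(1 - s, s)\<close> with respect to \<open>(1 - t, t)\<close>. As \<open>1 / r = n + 1 / p\<close>, it
  therefore suffices to show, for each \<open>s\<close>, that \<open>f x powr (1 - s) * g y powr s \<le> h ((1 - t) x + t y)\<close>
  implies
  \<open>exp (- n * kl s t) * exp (Q / 2) * A powr (1 - s) * B powr s \<le> \<integral>h d\<gamma>\<close>, where
  \<open>Q = (1 - s) |b\<^sub>f|\<^sup>2 + s |b\<^sub>g|\<^sup>2 - |b\<^sub>t|\<^sup>2\<close>.

  Rotating two independent copies of \<open>(f, g, h)\<close> turns an inequality for even functions with constant
  \<open>c\<close> into a submultiplicative one, and iterating the rotation produces the factor
  \<open>exp (Q / 2)\<close>. For even functions themselves one slices along a principal axis of the covariance
  of \<open>f\<close> and applies this, by induction on the dimension, to the fibres. Their barycenters are not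
  zero, so \<open>Q\<close> could be negative; but the means of the fibres contract by a fixed factor under each
  rotation (a Poincare-type bound for functions orthogonal to linear ones), so the loss
  disappears in the limit. On the line, level sets of even functions are symmetric
  intervals, whose Gaussian measure is a concave function of the length.
\<close>


section \<open>The Gaussian measure and its invariances\<close>

text \<open>The axis is chosen for \<open>f\<close> alone, so nothing controls the fibre barycenters
  of \<open>g\<close>. Completing the square in the barycenter of \<open>g\<close> still bounds
  \<open>Q\<close> below by a multiple of the squared barycenter of \<open>f\<close>, provided
  \<open>t\<^sup>2 < s\<close>; if this fails, then \<open>(1 - t)\<^sup>2 < 1 - s\<close>, and
  \<open>f\<close> and \<open>g\<close> can exchange roles. The constant lost in a rotation is the
  unknown best constant \<open>C\<close> for even functions itself: with \<open>I\<close> the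
  integral of \<open>h\<close>, each rotation squares \<open>I / C\<close>. A fixed gain for the
  iterates therefore survives extraction of a root and contradicts maximality of \<open>C\<close>.
  This requires \<open>C > 0\<close>, for which a crude bound is proved, and a number of rotations
  chosen before the functions, so the contraction factor must be absolute; its value
  \<open>1 - 1 / 2176\<close> has no significance. The hypothesis compares values pointwise, and
  \<open>f\<close>, \<open>g\<close> may be unbounded and non-Borel. At the end they are replaced by
  versions that are continuous on an open support, for which the supremal convolution is a Borel
  substitute for \<open>h\<close>, and are then truncated.\<close>

definition gauss :: "'a::euclidean_space measure" where
  "gauss = density lborel (\<lambda>x. ennreal (exp (- (norm x)\<^sup>2 / 2) / sqrt (2 * pi) ^ DIM('a)))"

lemma sets_gauss [measurable_cong, simp]: "sets gauss = sets borel"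
  and space_gauss [simp]: "space gauss = UNIV"
  by (simp_all add: gauss_def)

lemma measurable_gauss [simp]: "measurable gauss M = measurable borel M"
  by (rule measurable_cong_sets) simp_all

lemma nn_integral_gauss_real_1:
  "(\<integral>\<^sup>+x. ennreal (exp (- x\<^sup>2 / 2) / sqrt (2 * pi)) \<partial>lborel) = 1"
proof -
  interpret prob_space "density lborel (normal_density 0 1)"
    by (rule prob_space_normal_density) simp
  have "(\<integral>\<^sup>+x. ennreal (normal_density 0 1 x) \<partial>lborel) = 1"
    using emeasure_space_1 by (simp add: emeasure_density)
  then show ?thesis
    by (simp add: normal_density_def)
qed

lemma emeasure_gauss_UNIV: "emeasure (gauss :: 'a::euclidean_space measure) UNIV = 1"
proof -
  have eq: "ennreal (exp (- (norm x)\<^sup>2 / 2) / sqrt (2 * pi) ^ DIM('a))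
      = (\<Prod>b\<in>Basis. ennreal (exp (- (x \<bullet> b)\<^sup>2 / 2) / sqrt (2 * pi)))" for x :: 'a
  proof -
    have "(norm x)\<^sup>2 = (\<Sum>b\<in>Basis. (x \<bullet> b)\<^sup>2)"
      by (subst power2_norm_eq_inner, subst euclidean_inner) (simp add: power2_eq_square)
    then have "exp (- (norm x)\<^sup>2 / 2) = (\<Prod>b\<in>Basis. exp (- (x \<bullet> b)\<^sup>2 / 2))"
      by (simp add: exp_sum[symmetric] sum_negf sum_divide_distrib)
    then have "exp (- (norm x)\<^sup>2 / 2) / sqrt (2 * pi) ^ DIM('a)
        = (\<Prod>b\<in>Basis. exp (- (x \<bullet> b)\<^sup>2 / 2) / sqrt (2 * pi))"
      by (simp add: prod_dividef)
    then show ?thesis by (simp add: prod_ennreal)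
  qed
  have "emeasure (gauss :: 'a measure) UNIV
      = (\<integral>\<^sup>+x. ennreal (exp (- (norm x)\<^sup>2 / 2) / sqrt (2 * pi) ^ DIM('a)) \<partial>(lborel :: 'a measure))"
    by (simp add: gauss_def emeasure_density)
  also have "\<dots> = (\<integral>\<^sup>+x. (\<Prod>b\<in>Basis. ennreal (exp (- (x \<bullet> b)\<^sup>2 / 2) / sqrt (2 * pi))) \<partial>(lborel :: 'a measure))"
    by (simp only: eq)
  also have "\<dots> = (\<Prod>b\<in>(Basis::'a set). \<integral>\<^sup>+x. ennreal (exp (- x\<^sup>2 / 2) / sqrt (2 * pi)) \<partial>lborel)"
    by (rule nn_integral_lborel_prod) auto
  also have "\<dots> = 1"
    by (simp only: nn_integral_gauss_real_1 prod.neutral_const)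
  finally show ?thesis .
qed

lemma prob_space_gauss: "prob_space (gauss :: 'a::euclidean_space measure)"
  by (rule prob_spaceI) (simp add: emeasure_gauss_UNIV)

lemma pair_prob_space_gauss:
  "pair_prob_space (gauss :: 'a::euclidean_space measure) (gauss :: 'b::euclidean_space measure)"
  using prob_space_gauss[where 'a = 'a] prob_space_gauss[where 'a = 'b]
  by (simp add: pair_prob_space_def pair_sigma_finite_def prob_space_imp_sigma_finite)

interpretation gauss: prob_space "gauss :: 'a::euclidean_space measure"
  by (rule prob_space_gauss)

interpretation gauss2: pair_prob_space
  "gauss :: 'a::euclidean_space measure" "gauss :: 'b::euclidean_space measure"
  by (rule pair_prob_space_gauss)

lemma nn_integral_lborel_shift:
  fixes f :: "'a::euclidean_space \<Rightarrow> ennreal"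
  assumes [measurable]: "f \<in> borel_measurable borel"
  shows "(\<integral>\<^sup>+x. f (x + c) \<partial>lborel) = (\<integral>\<^sup>+x. f x \<partial>lborel)"
proof -
  have "(\<integral>\<^sup>+x. f x \<partial>lborel) = (\<integral>\<^sup>+x. f x \<partial>(distr lborel borel ((+) c)))"
    by (simp add: lborel_distr_plus)
  also have "\<dots> = (\<integral>\<^sup>+x. f (x + c) \<partial>lborel)"
    by (subst nn_integral_distr) (auto simp: add.commute)
  finally show ?thesis by simp
qed

text \<open>Fubini with \<open>y\<close> fixed first, then translation invariance in
  \<open>x\<close>. The rotations below are assembled from three shears, so that no determinant has
  to be computed.\<close>

lemma distr_shear_fst:
  fixes S :: "'b::euclidean_space \<Rightarrow> 'a::euclidean_space"
  assumes [measurable]: "S \<in> borel_measurable borel"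
  shows "distr (lborel \<Otimes>\<^sub>M lborel) (borel \<Otimes>\<^sub>M borel) (\<lambda>(x, y). (x + S y, y)) = lborel \<Otimes>\<^sub>M lborel"
proof (rule measure_eqI)
  show "sets (distr (lborel \<Otimes>\<^sub>M lborel) (borel \<Otimes>\<^sub>M borel) (\<lambda>(x, y). (x + S y, y)))
      = sets (lborel \<Otimes>\<^sub>M lborel :: ('a \<times> 'b) measure)"
    by (simp cong: sets_pair_measure_cong)
next
  fix A :: "('a \<times> 'b) set"
  assume "A \<in> sets (distr (lborel \<Otimes>\<^sub>M lborel) (borel \<Otimes>\<^sub>M borel) (\<lambda>(x, y). (x + S y, y)))"
  then have A[measurable]: "A \<in> sets (borel \<Otimes>\<^sub>M borel)" by simp
  have A': "A \<in> sets (lborel \<Otimes>\<^sub>M lborel)" 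
    using A by (simp cong: sets_pair_measure_cong)
  have "emeasure (distr (lborel \<Otimes>\<^sub>M lborel) (borel \<Otimes>\<^sub>M borel) (\<lambda>(x, y). (x + S y, y))) A
     = (\<integral>\<^sup>+z. indicator A (fst z + S (snd z), snd z) \<partial>(lborel \<Otimes>\<^sub>M lborel))"
    by (subst nn_integral_indicator[symmetric], simp, subst nn_integral_distr)
       (auto simp: case_prod_beta cong: measurable_cong_sets)
  also have "\<dots> = (\<integral>\<^sup>+y. \<integral>\<^sup>+x. indicator A (x + S y, y) \<partial>lborel \<partial>lborel)"
    by (subst lborel_pair.nn_integral_snd[symmetric]) (auto cong: measurable_cong_sets)
  also have "\<dots> = (\<integral>\<^sup>+y. \<integral>\<^sup>+x. indicator A (x, y) \<partial>lborel \<partial>lborel)"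
    by (intro nn_integral_cong nn_integral_lborel_shift) auto
  also have "\<dots> = (\<integral>\<^sup>+z. indicator A z \<partial>(lborel \<Otimes>\<^sub>M lborel))"
    by (subst lborel_pair.nn_integral_snd[symmetric]) (auto cong: measurable_cong_sets)
  also have "\<dots> = emeasure (lborel \<Otimes>\<^sub>M lborel) A"
    using A' by simp
  finally show "emeasure (distr (lborel \<Otimes>\<^sub>M lborel) (borel \<Otimes>\<^sub>M borel) (\<lambda>(x, y). (x + S y, y))) A
     = emeasure (lborel \<Otimes>\<^sub>M lborel) A" .
qed

lemma distr_shear_snd:
  fixes S :: "'a::euclidean_space \<Rightarrow> 'b::euclidean_space"
  assumes [measurable]: "S \<in> borel_measurable borel"
  shows "distr (lborel \<Otimes>\<^sub>M lborel) (borel \<Otimes>\<^sub>M borel) (\<lambda>(x, y). (x, y + S x)) = lborel \<Otimes>\<^sub>M lborel"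
proof -
  let ?sw = "\<lambda>(x, y). (y, x)"
  have sw: "lborel \<Otimes>\<^sub>M lborel = distr (lborel \<Otimes>\<^sub>M lborel) (borel \<Otimes>\<^sub>M borel) (?sw :: 'b \<times> 'a \<Rightarrow> 'a \<times> 'b)"
    by (rule trans[OF lborel_pair.distr_pair_swap distr_cong]) (auto cong: sets_pair_measure_cong)
  have sw': "lborel \<Otimes>\<^sub>M lborel = distr (lborel \<Otimes>\<^sub>M lborel) (borel \<Otimes>\<^sub>M borel) (?sw :: 'a \<times> 'b \<Rightarrow> 'b \<times> 'a)"
    by (rule trans[OF lborel_pair.distr_pair_swap distr_cong]) (auto cong: sets_pair_measure_cong)
  have "distr (lborel \<Otimes>\<^sub>M lborel) (borel \<Otimes>\<^sub>M borel) (\<lambda>(x, y). (x, y + S x))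
     = distr (distr (lborel \<Otimes>\<^sub>M lborel) (borel \<Otimes>\<^sub>M borel) (?sw :: 'b \<times> 'a \<Rightarrow> 'a \<times> 'b))
        (borel \<Otimes>\<^sub>M borel) (\<lambda>(x, y). (x, y + S x))"
    using sw by metis
  also have "\<dots> = distr (lborel \<Otimes>\<^sub>M lborel) (borel \<Otimes>\<^sub>M borel)
       ((\<lambda>(x, y). (x, y + S x)) \<circ> (?sw :: 'b \<times> 'a \<Rightarrow> 'a \<times> 'b))"
    by (rule distr_distr) (auto cong: measurable_cong_sets)
  also have "((\<lambda>(x, y). (x, y + S x)) \<circ> (?sw :: 'b \<times> 'a \<Rightarrow> 'a \<times> 'b)) = ?sw \<circ> (\<lambda>(x, y). (x + S y, y))"
    by auto
  also have "distr (lborel \<Otimes>\<^sub>M lborel) (borel \<Otimes>\<^sub>M borel) (?sw \<circ> (\<lambda>(x, y). (x + S y, y)))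
    = distr (distr (lborel \<Otimes>\<^sub>M lborel) (borel \<Otimes>\<^sub>M borel) (\<lambda>(x, y). (x + S y, y))) (borel \<Otimes>\<^sub>M borel) ?sw"
    by (rule distr_distr[symmetric]) (auto cong: measurable_cong_sets)
  also have "\<dots> = lborel \<Otimes>\<^sub>M lborel"
    unfolding distr_shear_fst[OF assms] sw[symmetric] ..
  finally show ?thesis .
qed

lemma distr_density_invariant:
  assumes T: "T \<in> M \<rightarrow>\<^sub>M N" "distr M N T = M" "sets N = sets M"
    and d: "d \<in> borel_measurable M" and inv: "\<And>x. x \<in> space M \<Longrightarrow> d (T x) = d x"
  shows "distr (density M d) N T = density M d"
proof -
  have dN: "d \<in> borel_measurable N"
    using d T(3) by (simp cong: measurable_cong_sets)
  have "density M d = density (distr M N T) d"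
    using T(2) by simp
  also have "\<dots> = distr (density M (\<lambda>x. d (T x))) N T"
    by (rule density_distr[OF dN T(1)])
  also have "density M (\<lambda>x. d (T x)) = density M d"
    using d measurable_compose[OF T(1) dN] inv by (intro density_cong) auto
  finally show ?thesis ..
qed

definition gauss_dens :: "'a::euclidean_space \<Rightarrow> real" where
  "gauss_dens x = exp (- (norm x)\<^sup>2 / 2) / sqrt (2 * pi) ^ DIM('a)"

lemma gauss_dens_measurable [measurable]: "gauss_dens \<in> borel_measurable borel"
  unfolding gauss_dens_def by measurable

lemma gauss_dens_pos: "0 < gauss_dens x"
  by (simp add: gauss_dens_def)

lemma gauss_eq: "gauss = density lborel (\<lambda>x. ennreal (gauss_dens x))"
  by (simp add: gauss_def gauss_dens_def)

lemma pair_gauss_eq: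
  "(gauss :: 'a::euclidean_space measure) \<Otimes>\<^sub>M (gauss :: 'b::euclidean_space measure)
    = density (lborel \<Otimes>\<^sub>M lborel) (\<lambda>(x, y). ennreal (gauss_dens x) * ennreal (gauss_dens y))"
  unfolding gauss_eq
  by (rule pair_measure_density)
    (auto simp flip: gauss_eq intro: sigma_finite_lborel prob_space_imp_sigma_finite prob_space_gauss)

text \<open>Each shear preserves Lebesgue measure, hence so does their product. By
  \<open>iso\<close> the product also preserves the Gaussian density, which depends only on the sum
  of the two squared norms.\<close>

lemma distr_gauss_shears:
  fixes S :: "'b::euclidean_space \<Rightarrow> 'a::euclidean_space" and S' :: "'a \<Rightarrow> 'b"
  defines "s1 \<equiv> \<lambda>(x, y). (x + S y, y)" and "s2 \<equiv> \<lambda>(x, y). (x, y + S' x)"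
  assumes [measurable]: "S \<in> borel_measurable borel" "S' \<in> borel_measurable borel"
    and iso: "\<And>x y. (norm (fst (s1 (s2 (s1 (x, y))))))\<^sup>2 + (norm (snd (s1 (s2 (s1 (x, y))))))\<^sup>2
        = (norm x)\<^sup>2 + (norm y)\<^sup>2"
  shows "distr (gauss \<Otimes>\<^sub>M gauss) (borel \<Otimes>\<^sub>M borel) (s1 \<circ> s2 \<circ> s1) = gauss \<Otimes>\<^sub>M gauss"
proof -
  let ?L = "lborel \<Otimes>\<^sub>M lborel :: ('a \<times> 'b) measure" and ?B = "borel \<Otimes>\<^sub>M borel :: ('a \<times> 'b) measure"
  have m1[measurable]: "s1 \<in> ?B \<rightarrow>\<^sub>M ?B" and m2[measurable]: "s2 \<in> ?B \<rightarrow>\<^sub>M ?B"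
    unfolding s1_def s2_def by measurable
  have sets: "sets ?L = sets ?B"
    by (simp cong: sets_pair_measure_cong)
  have mL: "f \<in> ?B \<rightarrow>\<^sub>M N \<Longrightarrow> f \<in> ?L \<rightarrow>\<^sub>M N" for f and N :: "'z measure"
    using sets by (simp cong: measurable_cong_sets)
  have d1: "distr ?L ?B s1 = ?L" and d2: "distr ?L ?B s2 = ?L"
    unfolding s1_def s2_def by (rule distr_shear_fst distr_shear_snd; measurable)+
  have "distr ?L ?B (s1 \<circ> s2 \<circ> s1) = distr (distr (distr ?L ?B s1) ?B s2) ?B s1"
    by (simp add: distr_distr mL comp_assoc)
  then have d: "distr ?L ?B (s1 \<circ> s2 \<circ> s1) = ?L"
    by (simp only: d1 d2)
  show ?thesis
    unfolding pair_gauss_eq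
  proof (rule distr_density_invariant)
    show "s1 \<circ> s2 \<circ> s1 \<in> ?L \<rightarrow>\<^sub>M ?B"
      by (intro mL) measurable
    show "(\<lambda>(x, y). ennreal (gauss_dens x) * ennreal (gauss_dens y)) \<in> borel_measurable ?L"
      by (intro mL) measurable
    fix z :: "'a \<times> 'b"
    obtain x y where z: "z = (x, y)" by (cases z)
    have eq: "gauss_dens a * gauss_dens b
        = exp (- ((norm a)\<^sup>2 + (norm b)\<^sup>2) / 2) / (sqrt (2 * pi) ^ DIM('a) * sqrt (2 * pi) ^ DIM('b))"
      for a :: 'a and b :: 'b
      by (simp add: gauss_dens_def add_divide_distrib flip: exp_add)
    show "(case (s1 \<circ> s2 \<circ> s1) z of (x, y) \<Rightarrow> ennreal (gauss_dens x) * ennreal (gauss_dens y))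
       = (case z of (x, y) \<Rightarrow> ennreal (gauss_dens x) * ennreal (gauss_dens y))"
      using iso[of x y]
      by (simp add: z case_prod_beta gauss_dens_pos less_imp_le eq flip: ennreal_mult)
  next
    show "distr ?L ?B (s1 \<circ> s2 \<circ> s1) = ?L" by (rule d)
    show "sets ?B = sets ?L" by (simp add: sets)
  qed
qed

text \<open>A rotation by \<theta> is a product of three shears with coefficients -tan(\<theta>/2),
  sin \<theta>, -tan(\<theta>/2). Here \<theta> is pi/4, which gives \<open>\<alpha>\<close> and
  \<open>\<beta>\<close>.\<close>

lemma distr_gauss_rotation:
  "distr (gauss \<Otimes>\<^sub>M gauss) (borel \<Otimes>\<^sub>M borel)
     (\<lambda>(u, v). ((u - v) /\<^sub>R sqrt 2, (u + v) /\<^sub>R sqrt 2))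
   = (gauss \<Otimes>\<^sub>M gauss :: ('a::euclidean_space \<times> 'a) measure)"
proof -
  define \<alpha> :: real where "\<alpha> = 1 - sqrt 2"
  define \<beta> :: real where "\<beta> = 1 / sqrt 2"
  have sq: "\<beta> * sqrt 2 = 1" "sqrt 2 = 2 * \<beta>"
    by (simp_all add: \<beta>_def real_div_sqrt)
  have c: "1 + \<alpha> * \<beta> = \<beta>" "\<beta> * \<alpha> + 1 = \<beta>"
    using sq(1) by (simp_all add: \<alpha>_def algebra_simps)
  have c': "\<alpha> + \<alpha> * \<beta> = - \<beta>"
    using c(1) sq(2) by (simp add: \<alpha>_def)
  define s1 where "s1 = (\<lambda>(x::'a, y::'a). (x + \<alpha> *\<^sub>R y, y))"
  define s2 where "s2 = (\<lambda>(x::'a, y::'a). (x, y + \<beta> *\<^sub>R x))"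
  have eq: "s1 (s2 (s1 (u, v))) = ((u - v) /\<^sub>R sqrt 2, (u + v) /\<^sub>R sqrt 2)" for u v
  proof -
    have "s1 (s2 (s1 (u, v))) =
       ((1 + \<alpha> * \<beta>) *\<^sub>R u + (\<alpha> + \<alpha> * (\<beta> * \<alpha> + 1)) *\<^sub>R v, \<beta> *\<^sub>R u + (\<beta> * \<alpha> + 1) *\<^sub>R v)"
      by (simp add: s1_def s2_def scaleR_add_left scaleR_add_right)
        (simp add: ring_distribs scaleR_add_left flip: scaleR_add_left)?
    then show ?thesis
      unfolding c c' by (simp add: scaleR_add_right scaleR_diff_right \<beta>_def inverse_eq_divide)
  qed
  have "distr (gauss \<Otimes>\<^sub>M gauss) (borel \<Otimes>\<^sub>M borel) (s1 \<circ> s2 \<circ> s1) = (gauss \<Otimes>\<^sub>M gauss :: ('a \<times> 'a) measure)"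
    unfolding s1_def s2_def
  proof (rule distr_gauss_shears, measurable, fold s1_def s2_def)
    fix x y :: 'a
    show "(norm (fst (s1 (s2 (s1 (x, y))))))\<^sup>2 + (norm (snd (s1 (s2 (s1 (x, y))))))\<^sup>2
        = (norm x)\<^sup>2 + (norm y)\<^sup>2"
      unfolding eq by (simp add: power2_norm_eq_inner inner_simps divide_simps inner_commute) 
        (simp add: algebra_simps inner_commute)?
  qed
  moreover have "s1 \<circ> s2 \<circ> s1 = (\<lambda>(u, v). ((u - v) /\<^sub>R sqrt 2, (u + v) /\<^sub>R sqrt 2))"
    using eq by (auto simp: fun_eq_iff)
  ultimately show ?thesis by simp
qed

text \<open>For a unit vector \<open>e\<close> this is the projection onto the orthogonal
  hyperplane. An integral over the hyperplane is written as an integral over the whole space of a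
  function of \<open>perp e v\<close>: the discarded coordinate integrates to 1, and the type need
  not change when the dimension drops.\<close>

definition perp :: "'a::euclidean_space \<Rightarrow> 'a \<Rightarrow> 'a" where
  "perp e v = v - (v \<bullet> e) *\<^sub>R e"

lemma perp_measurable [measurable]: "perp e \<in> borel_measurable borel"
  unfolding perp_def by measurable

text \<open>The three shears make up a quarter turn in the plane of \<open>e\<close> and the extra
  real axis. It puts \<open>r\<close> in place of the coordinate \<open>v \<bullet> e\<close> and
  moves the old coordinate, with its sign changed, to the second component, which is then
  forgotten.\<close>

lemma distr_gauss_perp:
  fixes e :: "'a::euclidean_space"
  assumes e: "norm e = 1"
  shows "distr (gauss \<Otimes>\<^sub>M gauss) borel (\<lambda>(v, r::real). perp e v + r *\<^sub>R e) = gauss"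
proof -
  have ee: "e \<bullet> e = 1" using e by (simp add: norm_eq_1)
  define s1 where "s1 = (\<lambda>(x::'a, y::real). (x + y *\<^sub>R e, y))"
  define s2 where "s2 = (\<lambda>(x::'a, y::real). (x, y + - (x \<bullet> e)))"
  have eq: "s1 (s2 (s1 (v, r))) = (perp e v + r *\<^sub>R e, - (v \<bullet> e))" for v r
    by (simp add: s1_def s2_def perp_def inner_simps ee algebra_simps)
  have "distr (gauss \<Otimes>\<^sub>M gauss) (borel \<Otimes>\<^sub>M borel) (s1 \<circ> s2 \<circ> s1) = (gauss \<Otimes>\<^sub>M gauss :: ('a \<times> real) measure)"
    unfolding s1_def s2_def
  proof (rule distr_gauss_shears, measurable, fold s1_def s2_def)
    fix x :: 'a and y :: real
    show "(norm (fst (s1 (s2 (s1 (x, y))))))\<^sup>2 + (norm (snd (s1 (s2 (s1 (x, y))))))\<^sup>2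
        = (norm x)\<^sup>2 + (norm y)\<^sup>2"
    proof -
      have "norm (perp e x + y *\<^sub>R e)^2 = x \<bullet> x - (x \<bullet> e)\<^sup>2 + y\<^sup>2"
        unfolding perp_def power2_norm_eq_inner
        by (simp add: inner_simps ee inner_commute[of e x] power2_eq_square)
      then show ?thesis
        unfolding eq fst_conv snd_conv by (simp add: power2_norm_eq_inner)
    qed
  qed
  then have "distr (distr (gauss \<Otimes>\<^sub>M gauss) (borel \<Otimes>\<^sub>M borel) (s1 \<circ> s2 \<circ> s1)) borel fst
     = distr (gauss \<Otimes>\<^sub>M gauss :: ('a \<times> real) measure) borel fst"
    by simp
  also have "\<dots> = gauss"
  proof -
    have "distr (gauss \<Otimes>\<^sub>M gauss :: ('a \<times> real) measure) gauss fst = gauss"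
      by (rule gauss.distr_pair_fst)
    then show ?thesis by (simp cong: distr_cong)
  qed
  also have "distr (distr (gauss \<Otimes>\<^sub>M gauss) (borel \<Otimes>\<^sub>M borel) (s1 \<circ> s2 \<circ> s1)) borel fst
     = distr (gauss \<Otimes>\<^sub>M gauss) borel (fst \<circ> (s1 \<circ> s2 \<circ> s1))"
  proof (rule distr_distr)
    have [measurable]: "s1 \<in> borel \<Otimes>\<^sub>M borel \<rightarrow>\<^sub>M borel \<Otimes>\<^sub>M borel" "s2 \<in> borel \<Otimes>\<^sub>M borel \<rightarrow>\<^sub>M borel \<Otimes>\<^sub>M borel"
      unfolding s1_def s2_def by measurable
    have "s1 \<circ> s2 \<circ> s1 \<in> borel \<Otimes>\<^sub>M borel \<rightarrow>\<^sub>M borel \<Otimes>\<^sub>M borel"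
      by measurable
    then show "s1 \<circ> s2 \<circ> s1 \<in> gauss \<Otimes>\<^sub>M gauss \<rightarrow>\<^sub>M borel \<Otimes>\<^sub>M borel"
      by (simp cong: measurable_cong_sets sets_pair_measure_cong)
  qed simp
  also have "fst \<circ> (s1 \<circ> s2 \<circ> s1) = (\<lambda>(v, r::real). perp e v + r *\<^sub>R e)"
    using eq by (auto simp: fun_eq_iff)
  finally show ?thesis .
qed

lemma measurable_gauss_pair [simp]:
  "measurable ((gauss :: 'a::euclidean_space measure) \<Otimes>\<^sub>M (gauss :: 'b::euclidean_space measure)) M
    = measurable (borel \<Otimes>\<^sub>M borel) M"
  by (rule measurable_cong_sets) (simp_all cong: sets_pair_measure_cong)

lemma nn_integral_gauss_rotation:
  fixes \<phi> :: "'a::euclidean_space \<times> 'a \<Rightarrow> ennreal"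
  assumes [measurable]: "\<phi> \<in> borel_measurable (borel \<Otimes>\<^sub>M borel)"
  shows "(\<integral>\<^sup>+u. \<integral>\<^sup>+v. \<phi> ((u - v) /\<^sub>R sqrt 2, (u + v) /\<^sub>R sqrt 2) \<partial>gauss \<partial>gauss)
    = (\<integral>\<^sup>+x. \<integral>\<^sup>+y. \<phi> (x, y) \<partial>gauss \<partial>gauss)"
proof -
  have "(\<integral>\<^sup>+u. \<integral>\<^sup>+v. \<phi> ((u - v) /\<^sub>R sqrt 2, (u + v) /\<^sub>R sqrt 2) \<partial>gauss \<partial>gauss)
      = (\<integral>\<^sup>+z. \<phi> ((\<lambda>(u, v). ((u - v) /\<^sub>R sqrt 2, (u + v) /\<^sub>R sqrt 2)) z) \<partial>(gauss \<Otimes>\<^sub>M gauss))"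
    by (subst gauss.nn_integral_fst[symmetric]) (simp_all add: case_prod_beta')
  also have "\<dots> = (\<integral>\<^sup>+z. \<phi> z \<partial>(gauss \<Otimes>\<^sub>M gauss))"
    by (subst (2) distr_gauss_rotation[symmetric], subst nn_integral_distr) simp_all
  also have "\<dots> = (\<integral>\<^sup>+x. \<integral>\<^sup>+y. \<phi> (x, y) \<partial>gauss \<partial>gauss)"
    by (subst gauss.nn_integral_fst[symmetric]) simp_all
  finally show ?thesis .
qed

lemma integral_gauss_rotation:
  fixes \<phi> :: "'a::euclidean_space \<times> 'a \<Rightarrow> 'b::euclidean_space"
  assumes \<phi>: "integrable (gauss \<Otimes>\<^sub>M gauss) \<phi>"
  shows "(\<integral>u. (\<integral>v. \<phi> ((u - v) /\<^sub>R sqrt 2, (u + v) /\<^sub>R sqrt 2) \<partial>gauss) \<partial>gauss)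
    = (\<integral>x. (\<integral>y. \<phi> (x, y) \<partial>gauss) \<partial>gauss)"
    and "integrable (gauss \<Otimes>\<^sub>M gauss) (\<lambda>(u, v). \<phi> ((u - v) /\<^sub>R sqrt 2, (u + v) /\<^sub>R sqrt 2))"
proof -
  have [measurable]: "\<phi> \<in> borel_measurable (borel \<Otimes>\<^sub>M borel)"
    using borel_measurable_integrable[OF \<phi>] by simp
  let ?R = "\<lambda>(u::'a, v::'a). ((u - v) /\<^sub>R sqrt 2, (u + v) /\<^sub>R sqrt 2)"
  have "integrable (distr (gauss \<Otimes>\<^sub>M gauss) (borel \<Otimes>\<^sub>M borel) ?R) \<phi>"
    using \<phi> by (simp add: distr_gauss_rotation)
  then have int: "integrable (gauss \<Otimes>\<^sub>M gauss) (\<lambda>z. \<phi> (?R z))"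
    by (subst (asm) integrable_distr_eq) simp_all
  then show i2: "integrable (gauss \<Otimes>\<^sub>M gauss) (\<lambda>(u, v). \<phi> ((u - v) /\<^sub>R sqrt 2, (u + v) /\<^sub>R sqrt 2))"
    by (simp add: case_prod_beta')
  have "(\<integral>u. (\<integral>v. \<phi> ((u - v) /\<^sub>R sqrt 2, (u + v) /\<^sub>R sqrt 2) \<partial>gauss) \<partial>gauss)
      = (\<integral>z. \<phi> (?R z) \<partial>(gauss \<Otimes>\<^sub>M gauss))"
    using gauss2.integral_fst[OF i2] by (simp add: case_prod_beta')
  also have "\<dots> = (\<integral>z. \<phi> z \<partial>(gauss \<Otimes>\<^sub>M gauss))"
    by (subst (2) distr_gauss_rotation[symmetric], subst integral_distr) simp_all
  also have "\<dots> = (\<integral>x. (\<integral>y. \<phi> (x, y) \<partial>gauss) \<partial>gauss)"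
    using gauss2.integral_fst[of "\<lambda>x y. \<phi> (x, y)"] \<phi> by simp
  finally show "(\<integral>u. (\<integral>v. \<phi> ((u - v) /\<^sub>R sqrt 2, (u + v) /\<^sub>R sqrt 2) \<partial>gauss) \<partial>gauss)
    = (\<integral>x. (\<integral>y. \<phi> (x, y) \<partial>gauss) \<partial>gauss)" .
qed

lemma nn_integral_gauss_perp:
  fixes \<phi> :: "'a::euclidean_space \<Rightarrow> ennreal"
  assumes [measurable]: "\<phi> \<in> borel_measurable borel" and e: "norm e = 1"
  shows "(\<integral>\<^sup>+v. \<integral>\<^sup>+r. \<phi> (perp e v + r *\<^sub>R e) \<partial>gauss \<partial>gauss) = (\<integral>\<^sup>+x. \<phi> x \<partial>gauss)"
    and "(\<integral>\<^sup>+r. \<integral>\<^sup>+v. \<phi> (perp e v + r *\<^sub>R e) \<partial>gauss \<partial>gauss) = (\<integral>\<^sup>+x. \<phi> x \<partial>gauss)"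
proof -
  have "(\<integral>\<^sup>+v. \<integral>\<^sup>+r. \<phi> (perp e v + r *\<^sub>R e) \<partial>gauss \<partial>gauss)
      = (\<integral>\<^sup>+z. \<phi> ((\<lambda>(v, r). perp e v + r *\<^sub>R e) z) \<partial>(gauss \<Otimes>\<^sub>M gauss))"
    by (subst gauss.nn_integral_fst[symmetric]) (simp_all add: case_prod_beta')
  also have "\<dots> = (\<integral>\<^sup>+x. \<phi> x \<partial>gauss)"
    by (subst (2) distr_gauss_perp[OF e, symmetric], subst nn_integral_distr) simp_all
  finally show *: "(\<integral>\<^sup>+v. \<integral>\<^sup>+r. \<phi> (perp e v + r *\<^sub>R e) \<partial>gauss \<partial>gauss) = (\<integral>\<^sup>+x. \<phi> x \<partial>gauss)" .
  have "(\<integral>\<^sup>+r. \<integral>\<^sup>+v. \<phi> (perp e v + r *\<^sub>R e) \<partial>gauss \<partial>gauss)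
      = (\<integral>\<^sup>+v. \<integral>\<^sup>+r. \<phi> (perp e v + r *\<^sub>R e) \<partial>gauss \<partial>gauss)"
    by (rule gauss2.Fubini') (simp add: case_prod_beta)
  with * show "(\<integral>\<^sup>+r. \<integral>\<^sup>+v. \<phi> (perp e v + r *\<^sub>R e) \<partial>gauss \<partial>gauss) = (\<integral>\<^sup>+x. \<phi> x \<partial>gauss)"
    by simp
qed

lemma integral_gauss_perp:
  fixes \<phi> :: "'a::euclidean_space \<Rightarrow> 'b::euclidean_space"
  assumes \<phi>: "integrable gauss \<phi>" and e: "norm e = 1"
  shows "(\<integral>v. (\<integral>r. \<phi> (perp e v + r *\<^sub>R e) \<partial>gauss) \<partial>gauss) = (\<integral>x. \<phi> x \<partial>gauss)"
    and "(\<integral>r. (\<integral>v. \<phi> (perp e v + r *\<^sub>R e) \<partial>gauss) \<partial>gauss) = (\<integral>x. \<phi> x \<partial>gauss)"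
    and "integrable (gauss \<Otimes>\<^sub>M gauss) (\<lambda>(v, r). \<phi> (perp e v + r *\<^sub>R e))"
proof -
  have [measurable]: "\<phi> \<in> borel_measurable borel"
    using borel_measurable_integrable[OF \<phi>] by simp
  have "integrable (distr (gauss \<Otimes>\<^sub>M gauss) borel (\<lambda>(v, r). perp e v + r *\<^sub>R e)) \<phi>"
    using \<phi> by (simp add: distr_gauss_perp[OF e])
  then have int: "integrable (gauss \<Otimes>\<^sub>M gauss) (\<lambda>z. \<phi> ((\<lambda>(v, r). perp e v + r *\<^sub>R e) z))"
    by (subst (asm) integrable_distr_eq) simp_all
  then show i2: "integrable (gauss \<Otimes>\<^sub>M gauss) (\<lambda>(v, r). \<phi> (perp e v + r *\<^sub>R e))"
    by (simp add: case_prod_beta')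
  have "(\<integral>v. (\<integral>r. \<phi> (perp e v + r *\<^sub>R e) \<partial>gauss) \<partial>gauss)
      = (\<integral>z. \<phi> ((\<lambda>(v, r). perp e v + r *\<^sub>R e) z) \<partial>(gauss \<Otimes>\<^sub>M gauss))"
    using gauss2.integral_fst[OF i2] by (simp add: case_prod_beta')
  also have "\<dots> = (\<integral>z. \<phi> z \<partial>gauss)"
    by (subst (2) distr_gauss_perp[OF e, symmetric], subst integral_distr) simp_all
  finally show *: "(\<integral>v. (\<integral>r. \<phi> (perp e v + r *\<^sub>R e) \<partial>gauss) \<partial>gauss) = (\<integral>x. \<phi> x \<partial>gauss)" .
  show "(\<integral>r. (\<integral>v. \<phi> (perp e v + r *\<^sub>R e) \<partial>gauss) \<partial>gauss) = (\<integral>x. \<phi> x \<partial>gauss)"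
    using gauss2.Fubini_integral[OF i2] * by simp
qed

lemma distr_gauss_uminus: "distr gauss borel uminus = (gauss :: 'a::euclidean_space measure)"
  unfolding gauss_eq
proof (rule distr_density_invariant)
  show "distr lborel borel uminus = (lborel :: 'a measure)"
    using lborel_affine[of "-1" "0::'a"] by (simp add: density_1)
qed (simp_all add: gauss_dens_def)

lemma integral_gauss_uminus:
  fixes \<phi> :: "'a::euclidean_space \<Rightarrow> 'b::euclidean_space"
  assumes [measurable]: "\<phi> \<in> borel_measurable borel"
  shows "(\<integral>x. \<phi> (- x) \<partial>gauss) = (\<integral>x. \<phi> x \<partial>gauss)"
  by (subst (2) distr_gauss_uminus[symmetric], subst integral_distr) simp_all

lemma integral_gauss_odd:
  fixes \<phi> :: "'a::euclidean_space \<Rightarrow> 'b::euclidean_space"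
  assumes [measurable]: "\<phi> \<in> borel_measurable borel" and odd: "\<And>x. \<phi> (- x) = - \<phi> x"
  shows "(\<integral>x. \<phi> x \<partial>gauss) = 0"
proof -
  have "(\<integral>x. \<phi> x \<partial>gauss) = - (\<integral>x. \<phi> x \<partial>gauss)"
    using integral_gauss_uminus[OF assms(1)] by (simp add: odd)
  then have "2 *\<^sub>R (\<integral>x. \<phi> x \<partial>gauss) = 0"
    by (metis add.right_inverse scaleR_2)
  then show ?thesis by simp
qed

lemma nn_integral_gauss_affine:
  fixes \<phi> :: "'a::euclidean_space \<Rightarrow> ennreal"
  assumes [measurable]: "\<phi> \<in> borel_measurable borel" and c: "0 < c"
  shows "(\<integral>\<^sup>+z. \<phi> z \<partial>gauss) = (\<integral>\<^sup>+x. \<phi> (a + c *\<^sub>R x) *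
      ennreal (c ^ DIM('a) * exp (((norm x)\<^sup>2 - (norm (a + c *\<^sub>R x))\<^sup>2) / 2)) \<partial>gauss)"
proof -
  have eq: "ennreal (gauss_dens (a + c *\<^sub>R x)) * \<phi> (a + c *\<^sub>R x) * ennreal (c ^ DIM('a))
     = ennreal (gauss_dens x) * (\<phi> (a + c *\<^sub>R x) *
      ennreal (c ^ DIM('a) * exp (((norm x)\<^sup>2 - (norm (a + c *\<^sub>R x))\<^sup>2) / 2)))" for x
  proof -
    have "gauss_dens (a + c *\<^sub>R x) = gauss_dens x * exp (((norm x)\<^sup>2 - (norm (a + c *\<^sub>R x))\<^sup>2) / 2)"
      by (simp add: gauss_dens_def diff_divide_distrib flip: exp_add)
    then show ?thesis
      using c gauss_dens_pos[of x] by (simp add: ennreal_mult mult_ac)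
  qed
  have "(\<integral>\<^sup>+z. \<phi> z \<partial>gauss) = (\<integral>\<^sup>+z. ennreal (gauss_dens z) * \<phi> z \<partial>lborel)"
    by (simp add: gauss_eq nn_integral_density)
  also have "\<dots> = (\<integral>\<^sup>+z. ennreal (gauss_dens z) * \<phi> z
       \<partial>density (distr lborel borel (\<lambda>x. a + c *\<^sub>R x)) (\<lambda>_. \<bar>c\<bar> ^ DIM('a)))"
    using c by (subst lborel_affine[of c a, symmetric]) simp_all
  also have "\<dots> = (\<integral>\<^sup>+x. ennreal (gauss_dens (a + c *\<^sub>R x)) * \<phi> (a + c *\<^sub>R x) * ennreal (c ^ DIM('a)) \<partial>lborel)"
    using c by (simp add: nn_integral_density nn_integral_distr mult_ac)
  also have "\<dots> = (\<integral>\<^sup>+x. \<phi> (a + c *\<^sub>R x) *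
      ennreal (c ^ DIM('a) * exp (((norm x)\<^sup>2 - (norm (a + c *\<^sub>R x))\<^sup>2) / 2)) \<partial>gauss)"
    unfolding eq by (simp add: gauss_eq nn_integral_density)
  finally show ?thesis .
qed

lemma integrable_gauss_real_square: "integrable gauss (\<lambda>r::real. r\<^sup>2)"
  "(\<integral>r. (r::real)\<^sup>2 \<partial>gauss) = 1"
proof -
  have g: "gauss = density lborel (\<lambda>x. ennreal (std_normal_density x))"
    by (simp add: gauss_eq gauss_dens_def normal_density_def)
  show "integrable gauss (\<lambda>r::real. r\<^sup>2)"
    unfolding g using integrable_std_normal_moment[of 2] by (simp add: integrable_density)
  show "(\<integral>r. (r::real)\<^sup>2 \<partial>gauss) = 1"
    unfolding g using integral_std_normal_moment_even[of 1] by (simp add: integral_density)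
qed

lemma integrable_gauss_real_inner_square:
  fixes e :: "'a::euclidean_space"
  assumes e: "norm e = 1"
  shows "integrable gauss (\<lambda>v. (v \<bullet> e)\<^sup>2)" "(\<integral>v. (v \<bullet> e)\<^sup>2 \<partial>gauss) = 1"
proof -
  have pe: "perp e v \<bullet> e = 0" and ee: "e \<bullet> e = 1" for v
    using e by (simp_all add: perp_def inner_simps norm_eq_1)
  have "(\<integral>\<^sup>+v. ennreal ((v \<bullet> e)\<^sup>2) \<partial>gauss)
     = (\<integral>\<^sup>+v. \<integral>\<^sup>+r. ennreal (((perp e v + r *\<^sub>R e) \<bullet> e)\<^sup>2) \<partial>(gauss :: real measure) \<partial>(gauss :: 'a measure))"
    using e by (subst nn_integral_gauss_perp) simp_all
  also have "\<dots> = (\<integral>\<^sup>+r. ennreal (r\<^sup>2) \<partial>(gauss :: real measure))"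
    by (simp add: inner_add_left pe ee gauss.emeasure_space_1[simplified])
  also have "\<dots> = 1"
    using integrable_gauss_real_square by (simp add: nn_integral_eq_integral)
  finally have 1: "(\<integral>\<^sup>+v. ennreal ((v \<bullet> e)\<^sup>2) \<partial>gauss) = 1" .
  show "integrable gauss (\<lambda>v. (v \<bullet> e)\<^sup>2)"
    by (rule integrableI_nonneg) (simp_all add: 1)
  show "(\<integral>v. (v \<bullet> e)\<^sup>2 \<partial>gauss) = 1"
    by (simp add: integral_eq_nn_integral 1)
qed

lemma integrable_gauss_norm_square: "integrable gauss (\<lambda>v::'a::euclidean_space. (norm v)\<^sup>2)"
proof -
  have "(norm v)\<^sup>2 = (\<Sum>b\<in>Basis. (v \<bullet> b)\<^sup>2)" for v :: 'a
    by (subst power2_norm_eq_inner, subst euclidean_inner) (simp add: power2_eq_square)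
  then show ?thesis
    by (simp add: integrable_gauss_real_inner_square)
qed

lemma integrable_gauss_norm: "integrable gauss (\<lambda>v::'a::euclidean_space. norm v)"
proof (rule Bochner_Integration.integrable_bound)
  show "integrable gauss (\<lambda>v::'a. 1 + (norm v)\<^sup>2)"
    by (intro Bochner_Integration.integrable_add gauss.integrable_const integrable_gauss_norm_square)
  show "AE v in gauss. norm (norm v) \<le> norm (1 + (norm (v::'a))\<^sup>2)"
  proof (rule AE_I2)
    fix v :: 'a
    have "0 \<le> (norm v - 1)\<^sup>2 + 1 + (norm v)\<^sup>2" by simp
    then show "norm (norm v) \<le> norm (1 + (norm v)\<^sup>2)"
      by (simp add: power2_eq_square algebra_simps)
  qed
qed simp

section \<open>Relative entropy of weights, and integration over levels\<close>

definition kl :: "real \<Rightarrow> real \<Rightarrow> real" where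
  "kl s t = (1 - s) * ln ((1 - s) / (1 - t)) + s * ln (s / t)"

text \<open>Jensen's inequality for \<open>ln\<close> with weights \<open>1 - s\<close> and
  \<open>s\<close>, at the two terms of the right side divided by these weights. The logarithms of
  the weight ratios add up to \<open>kl s t\<close>; for \<open>s = t\<close> this is the ordinary
  weighted AM-GM.\<close>

lemma weighted_am_gm_kl:
  assumes s: "0 < s" "s < 1" and t: "0 < t" "t < 1" and A: "0 \<le> A" and B: "0 \<le> B"
  shows "exp (- kl s t) * (A powr (1 - s) * B powr s) \<le> (1 - t) * A + t * B"
proof (cases "A = 0 \<or> B = 0")
  case True
  then show ?thesis using s t A B by auto
next
  case False
  then have AB: "0 < A" "0 < B" using A B by auto
  define a where "a = (1 - t) * A / (1 - s)"
  define b where "b = t * B / s"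
  have ab: "0 < a" "0 < b" using AB s t by (simp_all add: a_def b_def)
  have "(1 - s) * ln a + s * ln b \<le> ln ((1 - s) * a + s * b)"
    using concave_onD[OF ln_concave, of s a b] s ab by simp
  also have "(1 - s) * a + s * b = (1 - t) * A + t * B"
    using s by (simp add: a_def b_def)
  finally have "exp ((1 - s) * ln a + s * ln b) \<le> (1 - t) * A + t * B"
    using AB s t by (subst (asm) ln_ge_iff) (auto intro!: add_pos_pos)
  moreover have lns: "ln a = ln A - ln ((1 - s) / (1 - t))" "ln b = ln B - ln (s / t)"
    using AB s t by (simp_all add: a_def b_def ln_mult ln_div)
  have "(1 - s) * ln a + s * ln b = - kl s t + ((1 - s) * ln A + s * ln B)"
    unfolding lns kl_def by (simp add: algebra_simps)
  moreover have "exp ((1 - s) * ln A + s * ln B) = A powr (1 - s) * B powr s"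
    using AB by (simp add: powr_def exp_add)
  ultimately show ?thesis by (simp only: exp_add)
qed

lemma kl_self: "0 < t \<Longrightarrow> t < 1 \<Longrightarrow> kl t t = 0"
  by (simp add: kl_def)

lemma emeasure_layer:
  fixes c x :: real
  assumes "0 \<le> x" "x \<le> 1"
  shows "(\<integral>\<^sup>+l. indicator {0<..<1} l * indicator {lb. lb < x} l \<partial>lborel) = ennreal x"
proof -
  have "(\<integral>\<^sup>+l. indicator {0<..<1} l * indicator {lb. lb < x} l \<partial>lborel)
     = (\<integral>\<^sup>+l. indicator {0<..<x} l \<partial>lborel)"
    using assms by (intro nn_integral_cong) (auto simp: indicator_def)
  then show ?thesis using assms by simp
qed

text \<open>In the applications \<open>a\<close> and \<open>b\<close> are divided by their suprema,
  so that both superlevel sets are nonempty at every height \<open>l < 1\<close> and can be compared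
  at the same height. The result is an arithmetic mean with the weights \<open>1 - t\<close>,
  \<open>t\<close> of the arguments; the geometric mean with exponent \<open>s\<close> is recovered
  afterwards by \<open>weighted_am_gm_kl\<close>.\<close>

lemma layer_cake_mean:
  fixes M :: "'m measure" and N :: "'n measure" and a b :: "'m \<Rightarrow> real" and H :: "'m \<Rightarrow> ennreal"
  assumes M: "sigma_finite_measure M"
    and [measurable]: "a \<in> borel_measurable M" "b \<in> borel_measurable M" "H \<in> borel_measurable M"
    and a: "\<And>x. 0 \<le> a x" "\<And>x. a x \<le> 1" and b: "\<And>x. 0 \<le> b x" "\<And>x. b x \<le> 1"
    and c: "0 < c" and t: "0 \<le> t" "t \<le> 1"
    and le: "\<And>l. 0 < l \<Longrightarrow> l < 1 \<Longrightarrow>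
      ennreal (1 - t) * emeasure M {x\<in>space M. l < a x} + ennreal t * emeasure M {x\<in>space M. l < b x}
        \<le> emeasure M {x\<in>space M. ennreal (c * l) < H x}"
  shows "ennreal c * (ennreal (1 - t) * (\<integral>\<^sup>+x. a x \<partial>M) + ennreal t * (\<integral>\<^sup>+x. b x \<partial>M)) \<le> (\<integral>\<^sup>+x. H x \<partial>M)"
proof -
  interpret sigma_finite_measure M by fact
  interpret P: pair_sigma_finite lborel M
    by (simp add: pair_sigma_finite_def M sigma_finite_lborel)
  have swap: "(\<integral>\<^sup>+x. \<integral>\<^sup>+l. indicator {0<..<1::real} l * indicator {x\<in>space M. P l x} x \<partial>lborel \<partial>M)
     = (\<integral>\<^sup>+l. indicator {0<..<1} l * emeasure M {x\<in>space M. P l x} \<partial>lborel)"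
    if [measurable]: "Measurable.pred (lborel \<Otimes>\<^sub>M M) (\<lambda>(l, x). P l x)" for P
  proof -
    have "(\<integral>\<^sup>+x. \<integral>\<^sup>+l. indicator {0<..<1::real} l * indicator {x\<in>space M. P l x} x \<partial>lborel \<partial>M)
       = (\<integral>\<^sup>+l. \<integral>\<^sup>+x. indicator {0<..<1::real} l * indicator {x\<in>space M. P l x} x \<partial>M \<partial>lborel)"
      by (rule P.Fubini') (simp add: indicator_def[abs_def] case_prod_beta', measurable)
    also have "\<dots> = (\<integral>\<^sup>+l. indicator {0<..<1} l * emeasure M {x\<in>space M. P l x} \<partial>lborel)"
    proof (rule nn_integral_cong)
      fix l :: real
      have [measurable]: "{x\<in>space M. P l x} \<in> sets M"
        using that by measurable
      show "(\<integral>\<^sup>+x. indicator {0<..<1::real} l * indicator {x\<in>space M. P l x} x \<partial>M)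
         = indicator {0<..<1} l * emeasure M {x\<in>space M. P l x}"
        by (subst nn_integral_cmult) simp_all
    qed
    finally show ?thesis .
  qed
  have lay: "(\<integral>\<^sup>+x. ennreal (a x) \<partial>M) = (\<integral>\<^sup>+l. indicator {0<..<1} l * emeasure M {x\<in>space M. l < a x} \<partial>lborel)"
    if [measurable]: "a \<in> borel_measurable M" and a: "\<And>x. 0 \<le> a x" "\<And>x. a x \<le> 1" for a :: "'m \<Rightarrow> real"
  proof (subst swap[symmetric])
    show "(\<integral>\<^sup>+x. ennreal (a x) \<partial>M) = (\<integral>\<^sup>+x. \<integral>\<^sup>+l. indicator {0<..<1::real} l * indicator {x\<in>space M. l < a x} x \<partial>lborel \<partial>M)"
    proof (rule nn_integral_cong)
      fix x assume "x \<in> space M"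
      then show "ennreal (a x) = (\<integral>\<^sup>+l. indicator {0<..<1::real} l * indicator {x\<in>space M. l < a x} x \<partial>lborel)"
        by (subst emeasure_layer[symmetric, OF a]) (auto intro!: nn_integral_cong simp: indicator_def)
    qed
  qed measurable
  have "ennreal c * (ennreal (1 - t) * (\<integral>\<^sup>+x. a x \<partial>M) + ennreal t * (\<integral>\<^sup>+x. b x \<partial>M))
     = ennreal c * (\<integral>\<^sup>+l. indicator {0<..<1} l * (ennreal (1 - t) * emeasure M {x\<in>space M. l < a x}
          + ennreal t * emeasure M {x\<in>space M. l < b x}) \<partial>lborel)"
    by (simp add: lay a b nn_integral_add nn_integral_cmult distrib_left mult.left_commute[of "indicator _ _"])
  also have "\<dots> \<le> ennreal c * (\<integral>\<^sup>+l. indicator {0<..<1} l * emeasure M {x\<in>space M. ennreal (c * l) < H x} \<partial>lborel)"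
  proof (rule mult_left_mono, rule nn_integral_mono)
    fix l :: real
    show "indicator {0<..<1} l * (ennreal (1 - t) * emeasure M {x\<in>space M. l < a x}
          + ennreal t * emeasure M {x\<in>space M. l < b x})
        \<le> indicator {0<..<1} l * emeasure M {x\<in>space M. ennreal (c * l) < H x}"
      using le[of l] by (cases "0 < l \<and> l < 1") simp_all
  qed simp
  also have "\<dots> = ennreal c * (\<integral>\<^sup>+x. \<integral>\<^sup>+l. indicator {0<..<1::real} l * indicator {x\<in>space M. ennreal (c * l) < H x} x \<partial>lborel \<partial>M)"
    by (subst swap) simp_all
  also have "\<dots> = (\<integral>\<^sup>+x. ennreal c * (\<integral>\<^sup>+l. indicator {0<..<1::real} l * indicator {x\<in>space M. ennreal (c * l) < H x} x \<partial>lborel) \<partial>M)"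
    by (subst nn_integral_cmult) (simp_all add: indicator_def[abs_def])
  also have "\<dots> \<le> (\<integral>\<^sup>+x. H x \<partial>M)"
  proof (rule nn_integral_mono)
    fix x assume x: "x \<in> space M"
    show "ennreal c * (\<integral>\<^sup>+l. indicator {0<..<1::real} l * indicator {x\<in>space M. ennreal (c * l) < H x} x \<partial>lborel) \<le> H x"
    proof (cases "H x" rule: ennreal_cases)
      case (real r)
      have "(\<integral>\<^sup>+l. indicator {0<..<1::real} l * indicator {x\<in>space M. ennreal (c * l) < H x} x \<partial>lborel)
          \<le> (\<integral>\<^sup>+l. indicator {0..r / c} l \<partial>lborel)"
        using c x real by (intro nn_integral_mono) (auto simp: indicator_def ennreal_less_iff field_simps)
      also have "\<dots> = ennreal (r / c)" using c real by simp
      finally have "ennreal c * (\<integral>\<^sup>+l. indicator {0<..<1::real} l * indicator {x\<in>space M. ennreal (c * l) < H x} x \<partial>lborel)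
        \<le> ennreal c * ennreal (r / c)" by (rule mult_left_mono) simp
      also have "\<dots> = H x" using c real by (simp flip: ennreal_mult)
      finally show ?thesis .
    qed simp
  qed
  finally show ?thesis .
qed

section \<open>The Prekopa--Leindler inequality for the Gaussian measure\<close>

lemma log_concaveD:
  assumes "log_concave f"
  shows "0 \<le> f x"
    and "0 < s \<Longrightarrow> s < 1 \<Longrightarrow> f x powr (1 - s) * f y powr s \<le> f ((1 - s) *\<^sub>R x + s *\<^sub>R y)"
  using assms by (auto simp: log_concave_def)

lemma log_concave_mult:
  assumes f: "log_concave f" and g: "log_concave g"
  shows "log_concave (\<lambda>x. f x * g x)"
  unfolding log_concave_def
proof safe
  fix x y s assume s: "0 < (s::real)" "s < 1"
  have "(f x * g x) powr (1 - s) * (f y * g y) powr s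
     = (f x powr (1 - s) * f y powr s) * (g x powr (1 - s) * g y powr s)"
    using f g by (simp add: powr_mult log_concaveD(1))
  also have "\<dots> \<le> f ((1 - s) *\<^sub>R x + s *\<^sub>R y) * g ((1 - s) *\<^sub>R x + s *\<^sub>R y)"
    using f g s by (intro mult_mono) (auto simp: log_concaveD)
  finally show "(f x * g x) powr (1 - s) * (f y * g y) powr s
     \<le> f ((1 - s) *\<^sub>R x + s *\<^sub>R y) * g ((1 - s) *\<^sub>R x + s *\<^sub>R y)" .
qed (use f g in \<open>auto simp: log_concaveD(1)\<close>)

lemma log_concave_gauss_dens: "log_concave (gauss_dens :: real \<Rightarrow> real)"
  unfolding log_concave_def
proof safe
  fix x :: real show "0 \<le> gauss_dens x" by (simp add: gauss_dens_pos less_imp_le)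
next
  fix x y s :: real assume s: "0 < s" "s < 1"
  define c where "c = ln (sqrt (2 * pi))"
  have eq: "gauss_dens z = exp (- z\<^sup>2 / 2 - c)" for z :: real
    by (simp add: gauss_dens_def exp_diff c_def)
  have "(1 - s) * x\<^sup>2 + s * y\<^sup>2 - ((1 - s) * x + s * y)\<^sup>2 = s * (1 - s) * (x - y)\<^sup>2"
    by (simp add: power2_eq_square algebra_simps)
  then have "((1 - s) * x + s * y)\<^sup>2 \<le> (1 - s) * x\<^sup>2 + s * y\<^sup>2"
    using s by (smt (verit) mult_nonneg_nonneg zero_le_power2)
  then have "(1 - s) * (- x\<^sup>2 / 2 - c) + s * (- y\<^sup>2 / 2 - c) \<le> - ((1 - s) * x + s * y)\<^sup>2 / 2 - c"
    by (simp add: algebra_simps)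
  then show "gauss_dens x powr (1 - s) * gauss_dens y powr s \<le> gauss_dens ((1 - s) *\<^sub>R x + s *\<^sub>R y)"
    by (simp add: eq powr_def flip: exp_add)
qed

lemma log_concave_level_convex:
  assumes f: "log_concave f" and l: "0 < l" "l < f x" "l < f y" and u: "0 \<le> u" "u \<le> 1"
  shows "l < f ((1 - u) *\<^sub>R x + u *\<^sub>R y)"
proof (cases "u = 0 \<or> u = 1")
  case False
  then have u: "0 < u" "u < 1" using u by auto
  have "l = l powr (1 - u) * l powr u"
    using l by (simp flip: powr_add)
  also have "\<dots> < f x powr (1 - u) * f y powr u"
    using l u by (intro mult_strict_mono powr_less_mono2) auto
  also have "\<dots> \<le> f ((1 - u) *\<^sub>R x + u *\<^sub>R y)"
    using f u by (rule log_concaveD)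
  finally show ?thesis .
qed (use l in auto)

text \<open>A bounded set lies between \<open>Inf X\<close> and \<open>Sup X\<close>; an unbounded
  one makes the right side infinite. The bound through pairs of points replaces a description of
  convex level sets as intervals with endpoints.\<close>

lemma emeasure_lborel_le_diameter:
  fixes X :: "real set"
  assumes [measurable]: "X \<in> sets borel" and ne: "X \<noteq> {}"
  shows "emeasure lborel X \<le> (SUP p\<in>X\<times>X. ennreal (snd p - fst p))"
proof (cases "(SUP p\<in>X\<times>X. ennreal (snd p - fst p))" rule: ennreal_cases)
  case (real s)
  have le: "y - x \<le> s" if "x \<in> X" "y \<in> X" for x y
  proof -
    have "ennreal (y - x) \<le> ennreal s"
      using that by (subst real(2)[symmetric]) (rule SUP_upper2[of "(x, y)"], auto)
    then show ?thesis using real(1) by (simp add: ennreal_le_iff)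
  qed
  obtain x0 where x0: "x0 \<in> X" using ne by auto
  have bdd: "bdd_above X" "bdd_below X"
    using le[OF x0] le[OF _ x0] by (auto intro!: bdd_aboveI[of _ "x0 + s"] bdd_belowI[of _ "x0 - s"] simp: algebra_simps)
  have "Sup X - s \<le> x" if x: "x \<in> X" for x
    using cSup_least[OF ne, of "x + s"] le[OF x] by (force simp: algebra_simps)
  then have "Sup X - s \<le> Inf X"
    using ne by (intro cInf_greatest)
  moreover have "X \<subseteq> {Inf X..Sup X}"
    using bdd by (auto intro: cInf_lower cSup_upper)
  then have "emeasure lborel X \<le> emeasure lborel {Inf X..Sup X}"
    by (intro emeasure_mono) auto
  moreover have "Inf X \<le> Sup X"
    using bdd x0 by (meson cInf_lower cSup_upper order_trans)
  ultimately show ?thesis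
    unfolding real(2) by (simp add: order_trans[OF _ ennreal_leI])
next
  case top
  show ?thesis by (simp only: top top_greatest)
qed

lemma ennreal_combine_SUP_le:
  fixes \<alpha> \<beta> :: ennreal
  assumes ne: "I \<noteq> {}" "J \<noteq> {}"
    and le: "\<And>i j. i \<in> I \<Longrightarrow> j \<in> J \<Longrightarrow> \<alpha> * F i + \<beta> * G j \<le> Z"
  shows "\<alpha> * (SUP i\<in>I. F i) + \<beta> * (SUP j\<in>J. G j) \<le> Z"
proof -
  have "\<alpha> * (SUP i\<in>I. F i) + \<beta> * G j \<le> Z" if "j \<in> J" for j
  proof -
    have "\<alpha> * (SUP i\<in>I. F i) + \<beta> * G j = (SUP i\<in>I. \<alpha> * F i + \<beta> * G j)"
      using ne by (simp add: SUP_mult_left_ennreal ennreal_SUP_add_left)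
    also have "\<dots> \<le> Z" using le that by (intro SUP_least) auto
    finally show ?thesis .
  qed
  then have "(SUP j\<in>J. \<alpha> * (SUP i\<in>I. F i) + \<beta> * G j) \<le> Z" by (intro SUP_least) auto
  moreover have "\<alpha> * (SUP i\<in>I. F i) + \<beta> * (SUP j\<in>J. G j) = (SUP j\<in>J. \<alpha> * (SUP i\<in>I. F i) + \<beta> * G j)"
    using ennreal_SUP_add_right[OF ne(2), of "\<alpha> * (SUP i\<in>I. F i)" "\<lambda>j. \<beta> * G j"]
    by (simp only: SUP_mult_left_ennreal)
  ultimately show ?thesis by simp
qed

lemma log_combination_le:
  fixes t l :: real
  assumes "0 < t" "t < 1" "0 < l" "0 < A" "0 < B" "l < a / A" "l < b / B"
  shows "A powr (1 - t) * B powr t * l < a powr (1 - t) * b powr t"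
proof -
  have "A powr (1 - t) * B powr t * l = (l * A) powr (1 - t) * (l * B) powr t"
    using assms by (simp add: powr_mult flip: powr_add)
  also have "\<dots> < a powr (1 - t) * b powr t"
  proof (intro mult_strict_mono powr_less_mono2)
    show "l * A < a" "l * B < b" using assms by (simp_all add: pos_less_divide_eq)
    then have "0 < a" "0 < b" using assms by (meson mult_pos_pos order_less_trans)+
    then show "0 < a powr (1 - t)" by simp
  qed (use assms in simp_all)
  finally show ?thesis .
qed

text \<open>After division by the suprema, the level sets \<open>X\<close> and \<open>Y\<close> of
  equal height are convex and nonempty, and the combination of a segment in \<open>X\<close> with a
  segment in \<open>Y\<close> is a segment in \<open>Z\<close>: Brunn-Minkowski for lengths. AM-GM
  at \<open>s = t\<close>, where \<open>kl\<close> vanishes, finishes.\<close>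

lemma prekopa_leindler_lborel_real:
  fixes a b :: "real \<Rightarrow> real" and H :: "real \<Rightarrow> ennreal"
  assumes t: "0 < t" "t < 1"
    and a: "integrable lborel a" "log_concave a" "\<And>x. a x \<le> Ma"
    and b: "integrable lborel b" "log_concave b" "\<And>x. b x \<le> Mb"
    and H[measurable]: "H \<in> borel_measurable borel"
    and le: "\<And>x y. ennreal (a x powr (1 - t) * b y powr t) \<le> H ((1 - t) * x + t * y)"
  shows "ennreal ((\<integral>x. a x \<partial>lborel) powr (1 - t) * (\<integral>x. b x \<partial>lborel) powr t) \<le> (\<integral>\<^sup>+x. H x \<partial>lborel)"
proof (cases "(\<forall>x. a x = 0) \<or> (\<forall>x. b x = 0)")
  case True
  then have "(\<integral>x. a x \<partial>lborel) = 0 \<or> (\<integral>x. b x \<partial>lborel) = 0" by auto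
  then show ?thesis using t by auto
next
  case False
  have [measurable]: "a \<in> borel_measurable borel" "b \<in> borel_measurable borel"
    using a(1) b(1) by auto
  define A where "A = Sup (range a)"
  define B where "B = Sup (range b)"
  have bdd: "bdd_above (range a)" "bdd_above (range b)"
    using a(3) b(3) by (auto simp: bdd_above_def)
  have aA: "a x \<le> A" and bB: "b x \<le> B" for x
    unfolding A_def B_def using bdd by (auto intro!: cSUP_upper)
  have AB: "0 < A" "0 < B"
    using False aA bB log_concaveD(1)[OF a(2)] log_concaveD(1)[OF b(2)] by (metis order_antisym_conv less_eq_real_def order_trans)+
  define c where "c = A powr (1 - t) * B powr t"
  have c: "0 < c" using AB by (simp add: c_def)
  have main: "ennreal c * (ennreal (1 - t) * (\<integral>\<^sup>+x. ennreal (a x / A) \<partial>lborel) + ennreal t * (\<integral>\<^sup>+x. ennreal (b x / B) \<partial>lborel))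
      \<le> (\<integral>\<^sup>+x. H x \<partial>lborel)"
  proof (rule layer_cake_mean[OF sigma_finite_lborel])
    fix l :: real assume l: "0 < l" "l < 1"
    define X where "X = {x. l < a x / A}"
    define Y where "Y = {x. l < b x / B}"
    define Z where "Z = {x. ennreal (c * l) < H x}"
    have [measurable]: "X \<in> sets borel" "Y \<in> sets borel" "Z \<in> sets borel"
      unfolding X_def Y_def Z_def by measurable
    have "l * A < A" "l * B < B" using l AB by auto
    then have "\<exists>x. l * A < a x" "\<exists>x. l * B < b x"
      unfolding A_def B_def by (auto simp: less_cSUP_iff bdd)
    then have ne: "X \<noteq> {}" "Y \<noteq> {}"
      using AB by (auto simp: X_def Y_def field_simps)
    have Xc: "(1 - u) * x + u * y \<in> X" if "x \<in> X" "y \<in> X" "0 \<le> u" "u \<le> 1" for x y u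
      using log_concave_level_convex[OF a(2), of "l * A" x y u] that AB l
      by (simp add: X_def field_simps)
    have Yc: "(1 - u) * x + u * y \<in> Y" if "x \<in> Y" "y \<in> Y" "0 \<le> u" "u \<le> 1" for x y u
      using log_concave_level_convex[OF b(2), of "l * B" x y u] that AB l
      by (simp add: Y_def field_simps)
    have Z: "(1 - t) * x + t * y \<in> Z" if "x \<in> X" "y \<in> Y" for x y
    proof -
      have "c * l < a x powr (1 - t) * b y powr t"
        unfolding c_def using that l t AB by (intro log_combination_le) (auto simp: X_def Y_def)
      then have "ennreal (c * l) < ennreal (a x powr (1 - t) * b y powr t)"
        using c l by (simp add: ennreal_less_iff)
      also note le
      finally show ?thesis by (simp add: Z_def)
    qed
    have "ennreal (1 - t) * (SUP p\<in>X\<times>X. ennreal (snd p - fst p))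
        + ennreal t * (SUP p\<in>Y\<times>Y. ennreal (snd p - fst p)) \<le> emeasure lborel Z"
    proof (rule ennreal_combine_SUP_le)
      fix p q assume pq: "p \<in> X \<times> X" "q \<in> Y \<times> Y"
      define x1 where "x1 = fst p"
      \<comment> \<open>The pair may come in the wrong order. Replacing its second entry by the
        maximum does not change \<open>ennreal (snd p - fst p)\<close>, since negative reals are
        read as 0.\<close>
      define x2 where "x2 = max (fst p) (snd p)"
      define y1 where "y1 = fst q"
      define y2 where "y2 = max (fst q) (snd q)"
      have xy: "x1 \<in> X" "x2 \<in> X" "y1 \<in> Y" "y2 \<in> Y" "x1 \<le> x2" "y1 \<le> y2"
        using pq by (auto simp: x1_def x2_def y1_def y2_def max_def)
      define z1 where "z1 = (1 - t) * x1 + t * y1"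
      define z2 where "z2 = (1 - t) * x2 + t * y2"
      have "{z1..z2} \<subseteq> Z"
      proof
        fix z assume z: "z \<in> {z1..z2}"
        define u where "u = (if z1 = z2 then 0 else (z - z1) / (z2 - z1))"
        have u: "0 \<le> u" "u \<le> 1" "z = (1 - u) * z1 + u * z2"
          using z by (auto simp: u_def field_simps)
        have "z = (1 - t) * ((1 - u) * x1 + u * x2) + t * ((1 - u) * y1 + u * y2)"
          unfolding u(3) z1_def z2_def by (simp add: algebra_simps)
        with Z[OF Xc[OF xy(1,2) u(1,2)] Yc[OF xy(3,4) u(1,2)]] show "z \<in> Z" by simp
      qed
      then have "emeasure lborel {z1..z2} \<le> emeasure lborel Z"
        by (intro emeasure_mono) auto
      moreover have "z1 \<le> z2" unfolding z1_def z2_def using xy t by (intro add_mono mult_left_mono) auto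
      moreover have "z2 - z1 = (1 - t) * (x2 - x1) + t * (y2 - y1)"
        by (simp add: z1_def z2_def algebra_simps)
      moreover have "ennreal (snd p - fst p) = ennreal (x2 - x1)" "ennreal (snd q - fst q) = ennreal (y2 - y1)"
        by (auto simp: x1_def x2_def y1_def y2_def max_def ennreal_neg)
      ultimately show "ennreal (1 - t) * ennreal (snd p - fst p) + ennreal t * ennreal (snd q - fst q) \<le> emeasure lborel Z"
        using t xy by (simp flip: ennreal_mult ennreal_plus)
    qed (use ne in auto)
    moreover have "ennreal (1 - t) * emeasure lborel X + ennreal t * emeasure lborel Y
        \<le> ennreal (1 - t) * (SUP p\<in>X\<times>X. ennreal (snd p - fst p)) + ennreal t * (SUP p\<in>Y\<times>Y. ennreal (snd p - fst p))"
      using ne by (intro add_mono mult_left_mono emeasure_lborel_le_diameter) auto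
    ultimately show "ennreal (1 - t) * emeasure lborel {x \<in> space lborel. l < a x / A}
        + ennreal t * emeasure lborel {x \<in> space lborel. l < b x / B}
        \<le> emeasure lborel {x \<in> space lborel. ennreal (c * l) < H x}"
      by (simp add: X_def Y_def Z_def)
  qed (use t AB c aA bB log_concaveD(1)[OF a(2)] log_concaveD(1)[OF b(2)] in simp_all)
  define IA where "IA = (\<integral>x. a x \<partial>lborel)"
  define IB where "IB = (\<integral>x. b x \<partial>lborel)"
  have I: "0 \<le> IA" "0 \<le> IB"
    unfolding IA_def IB_def using log_concaveD(1)[OF a(2)] log_concaveD(1)[OF b(2)] by simp_all
  have "(\<integral>\<^sup>+x. ennreal (a x / A) \<partial>lborel) = ennreal (IA / A)"
    unfolding IA_def using a(1) AB log_concaveD(1)[OF a(2)] by (subst nn_integral_eq_integral) auto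
  moreover have "(\<integral>\<^sup>+x. ennreal (b x / B) \<partial>lborel) = ennreal (IB / B)"
    unfolding IB_def using b(1) AB log_concaveD(1)[OF b(2)] by (subst nn_integral_eq_integral) auto
  moreover have "ennreal (c * ((1 - t) * (IA / A) + t * (IB / B)))
      = ennreal c * (ennreal (1 - t) * ennreal (IA / A) + ennreal t * ennreal (IB / B))"
    using t AB c I by (simp add: ennreal_mult ennreal_plus del: times_divide_eq_right)
  ultimately have "ennreal (c * ((1 - t) * (IA / A) + t * (IB / B))) \<le> (\<integral>\<^sup>+x. H x \<partial>lborel)"
    using main by simp
  moreover have "IA powr (1 - t) * IB powr t \<le> c * ((1 - t) * (IA / A) + t * (IB / B))"
  proof -
    have "IA powr (1 - t) * IB powr t = c * ((IA / A) powr (1 - t) * (IB / B) powr t)"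
      using AB I by (simp add: c_def powr_divide)
    also have "\<dots> \<le> c * ((1 - t) * (IA / A) + t * (IB / B))"
      using weighted_am_gm_kl[OF t t, of "IA / A" "IB / B"] AB I c
      by (intro mult_left_mono) (simp_all add: kl_self t)
    finally show ?thesis .
  qed
  ultimately show ?thesis
    unfolding IA_def[symmetric] IB_def[symmetric] by (meson ennreal_leI order_trans)
qed

text \<open>The Gaussian density is log-concave and can be absorbed into all three
  functions.\<close>

lemma prekopa_leindler_gauss_real:
  fixes a b :: "real \<Rightarrow> real" and H :: "real \<Rightarrow> ennreal"
  assumes t: "0 < t" "t < 1"
    and a: "a \<in> borel_measurable borel" "log_concave a" "\<And>x. a x \<le> Ma"
    and b: "b \<in> borel_measurable borel" "log_concave b" "\<And>x. b x \<le> Mb"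
    and H[measurable]: "H \<in> borel_measurable borel"
    and le: "\<And>x y. ennreal (a x powr (1 - t) * b y powr t) \<le> H ((1 - t) * x + t * y)"
  shows "ennreal ((\<integral>x. a x \<partial>gauss) powr (1 - t) * (\<integral>x. b x \<partial>gauss) powr t) \<le> (\<integral>\<^sup>+x. H x \<partial>gauss)"
proof -
  note [measurable] = a(1) b(1)
  have int: "integrable lborel (\<lambda>x. gauss_dens x * c x)"
    and eq: "(\<integral>x. c x \<partial>gauss) = (\<integral>x. gauss_dens x * c x \<partial>lborel)"
    if [measurable]: "c \<in> borel_measurable borel" and c: "log_concave c" "\<And>x. c x \<le> Mc" for c :: "real \<Rightarrow> real" and Mc
  proof -
    have "integrable gauss c"
      using c by (intro gauss.integrable_const_bound[where B = Mc]) (auto simp: log_concaveD(1)[OF c(1)])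
    then show "integrable lborel (\<lambda>x. gauss_dens x * c x)"
      by (simp add: gauss_eq integrable_density gauss_dens_pos less_imp_le)
    show "(\<integral>x. c x \<partial>gauss) = (\<integral>x. gauss_dens x * c x \<partial>lborel)"
      by (simp add: gauss_eq integral_density gauss_dens_pos less_imp_le)
  qed
  have bnd: "gauss_dens x * c x \<le> Mc / sqrt (2 * pi)" if c: "\<And>x. 0 \<le> c x" "\<And>x. c x \<le> Mc" for c :: "real \<Rightarrow> real" and Mc x
  proof -
    have "gauss_dens x * c x \<le> (1 / sqrt (2 * pi)) * Mc"
      using c by (intro mult_mono) (auto simp: gauss_dens_def divide_simps)
    then show ?thesis by simp
  qed
  have "ennreal ((\<integral>x. gauss_dens x * a x \<partial>lborel) powr (1 - t) * (\<integral>x. gauss_dens x * b x \<partial>lborel) powr t)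
      \<le> (\<integral>\<^sup>+x. ennreal (gauss_dens x) * H x \<partial>lborel)"
  proof (rule prekopa_leindler_lborel_real[OF t, where Ma = "Ma / sqrt (2 * pi)" and Mb = "Mb / sqrt (2 * pi)"])
    fix x y :: real
    have "(gauss_dens x * a x) powr (1 - t) * (gauss_dens y * b y) powr t
       = (gauss_dens x powr (1 - t) * gauss_dens y powr t) * (a x powr (1 - t) * b y powr t)"
      using log_concaveD(1)[OF a(2)] log_concaveD(1)[OF b(2)]
      by (simp add: powr_mult gauss_dens_pos less_imp_le)
    also have "\<dots> \<le> gauss_dens ((1 - t) * x + t * y) * (a x powr (1 - t) * b y powr t)"
      using log_concaveD(2)[OF log_concave_gauss_dens t, of x y] by (intro mult_right_mono) auto
    finally have "ennreal ((gauss_dens x * a x) powr (1 - t) * (gauss_dens y * b y) powr t)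
       \<le> ennreal (gauss_dens ((1 - t) * x + t * y)) * ennreal (a x powr (1 - t) * b y powr t)"
      by (simp add: gauss_dens_pos less_imp_le flip: ennreal_mult)
    also have "\<dots> \<le> ennreal (gauss_dens ((1 - t) * x + t * y)) * H ((1 - t) * x + t * y)"
      by (intro mult_left_mono le) simp
    finally show "ennreal ((gauss_dens x * a x) powr (1 - t) * (gauss_dens y * b y) powr t)
      \<le> ennreal (gauss_dens ((1 - t) * x + t * y)) * H ((1 - t) * x + t * y)" .
  qed (use a b in \<open>auto intro!: int bnd log_concave_mult log_concave_gauss_dens simp: log_concaveD(1)\<close>)
  then show ?thesis
    using eq[OF a] eq[OF b] by (simp add: gauss_eq nn_integral_density)
qed

text \<open>Boundedness makes products with Gaussian-integrable functions integrable, in particular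
  all the moments below, and is inherited by fibres, marginals and self-convolutions. Unbounded
  functions come back at the end by truncation.\<close>

definition lcb :: "('a::euclidean_space \<Rightarrow> real) \<Rightarrow> bool" where
  "lcb f \<longleftrightarrow> f \<in> borel_measurable borel \<and> log_concave f \<and> (\<exists>M. \<forall>x. f x \<le> M)"

text \<open>The exponent \<open>s\<close> of the values and the weight \<open>t\<close> of the
  arguments are separate, because the power mean is a maximum over \<open>s\<close> while
  \<open>t\<close> is given. With values of \<open>h\<close> in \<open>ennreal\<close>, the bounding
  functions produced by integration need no finiteness argument.\<close>

definition admissible ::
    "real \<Rightarrow> real \<Rightarrow> ('a::euclidean_space \<Rightarrow> real) \<Rightarrow> ('a \<Rightarrow> real) \<Rightarrow> ('a \<Rightarrow> ennreal) \<Rightarrow> bool" where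
  "admissible s t f g h \<longleftrightarrow> h \<in> borel_measurable borel \<and>
     (\<forall>x y. ennreal (f x powr (1 - s) * g y powr s) \<le> h ((1 - t) *\<^sub>R x + t *\<^sub>R y))"

lemma lcbD:
  assumes "lcb f"
  shows "f \<in> borel_measurable borel" "log_concave f" "0 \<le> f x" "integrable gauss f"
proof -
  obtain M where M: "f x \<le> M" for x using assms by (auto simp: lcb_def)
  show *: "f \<in> borel_measurable borel" "log_concave f"
    using assms by (auto simp: lcb_def)
  show "0 \<le> f x" using *(2) by (rule log_concaveD)
  show "integrable gauss f"
    using M *(1) log_concaveD(1)[OF *(2)] by (intro gauss.integrable_const_bound[where B = M]) auto
qed

lemma lcb_compose:
  assumes f: "lcb f" and T: "T \<in> borel_measurable borel"
    and aff: "\<And>x y s. T ((1 - s) *\<^sub>R x + s *\<^sub>R y) = (1 - s) *\<^sub>R T x + s *\<^sub>R T y"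
  shows "lcb (\<lambda>x. f (T x))"
  unfolding lcb_def
proof (intro conjI)
  show "(\<lambda>x. f (T x)) \<in> borel_measurable borel"
    using lcbD(1)[OF f] T by measurable
  show "log_concave (\<lambda>x. f (T x))"
    using lcbD(2)[OF f] by (simp add: log_concave_def aff)
  show "\<exists>M. \<forall>x. f (T x) \<le> M" using f by (auto simp: lcb_def)
qed

lemma lcb_mult:
  assumes f: "lcb f" and g: "lcb g"
  shows "lcb (\<lambda>x. f x * g x)"
  unfolding lcb_def
proof (intro conjI)
  show "(\<lambda>x. f x * g x) \<in> borel_measurable borel"
    using lcbD(1)[OF f] lcbD(1)[OF g] by measurable
  show "log_concave (\<lambda>x. f x * g x)"
    using lcbD(2)[OF f] lcbD(2)[OF g] by (rule log_concave_mult)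
  obtain M N where "f x \<le> M" "g x \<le> N" for x using f g by (auto simp: lcb_def)
  then have "f x * g x \<le> M * N" for x
    using lcbD(3)[OF f] lcbD(3)[OF g] by (meson mult_mono order_trans)
  then show "\<exists>M. \<forall>x. f x * g x \<le> M" by auto
qed

text \<open>Eliminates one coordinate: for a unit vector \<open>e\<close>, the result no longer
  depends on the component of the argument along \<open>e\<close>.\<close>

definition avg :: "'a::euclidean_space \<Rightarrow> ('a \<Rightarrow> real) \<Rightarrow> 'a \<Rightarrow> real" where
  "avg e f x = (\<integral>r. f (perp e x + r *\<^sub>R e) \<partial>gauss)"

lemma perp_affine: "perp e ((1 - s) *\<^sub>R x + s *\<^sub>R y) = (1 - s) *\<^sub>R perp e x + s *\<^sub>R perp e y"
  by (simp add: perp_def inner_simps algebra_simps)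

lemma perp_add_affine:
  "perp e ((1 - s) *\<^sub>R x + s *\<^sub>R y) + ((1 - s) * r + s * q) *\<^sub>R e
    = (1 - s) *\<^sub>R (perp e x + r *\<^sub>R e) + s *\<^sub>R (perp e y + q *\<^sub>R e)"
  by (subst perp_affine) (simp add: scaleR_add_left scaleR_add_right)

lemma lcb_line:
  assumes "lcb f"
  shows "lcb (\<lambda>r::real. f (x + r *\<^sub>R e))"
proof (rule lcb_compose[OF assms])
  fix r q s :: real
  have "x = (1 - s) *\<^sub>R x + s *\<^sub>R x" by (simp add: algebra_simps)
  then show "x + ((1 - s) *\<^sub>R r + s *\<^sub>R q) *\<^sub>R e = (1 - s) *\<^sub>R (x + r *\<^sub>R e) + s *\<^sub>R (x + q *\<^sub>R e)"
    by (simp add: scaleR_add_right scaleR_add_left)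
qed measurable

lemma nn_integral_lcb: "lcb f \<Longrightarrow> (\<integral>\<^sup>+x. ennreal (f x) \<partial>gauss) = ennreal (\<integral>x. f x \<partial>gauss)"
  by (simp add: nn_integral_eq_integral lcbD)

lemma admissible_avg:
  assumes t: "0 < t" "t < 1" and f: "lcb f" and g: "lcb g" and adm: "admissible t t f g h"
  shows "admissible t t (avg e f) (avg e g) (\<lambda>x. \<integral>\<^sup>+r. h (perp e x + r *\<^sub>R e) \<partial>gauss)"
  unfolding admissible_def
proof (intro conjI allI)
  have h[measurable]: "h \<in> borel_measurable borel" using adm by (simp add: admissible_def)
  show "(\<lambda>x. \<integral>\<^sup>+ r. h (perp e x + r *\<^sub>R e) \<partial>gauss) \<in> borel_measurable borel"
    by measurable
  fix x y :: 'a
  show "ennreal (avg e f x powr (1 - t) * avg e g y powr t)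
     \<le> (\<integral>\<^sup>+r. h (perp e ((1 - t) *\<^sub>R x + t *\<^sub>R y) + r *\<^sub>R e) \<partial>gauss)"
    unfolding avg_def
  proof -
    have fl: "lcb (\<lambda>r::real. f (perp e x + r *\<^sub>R e))" and gl: "lcb (\<lambda>r::real. g (perp e y + r *\<^sub>R e))"
      using f g by (auto intro: lcb_line)
    obtain M N where MN: "f (perp e x + r *\<^sub>R e) \<le> M" "g (perp e y + r *\<^sub>R e) \<le> N" for r
      using f g by (auto simp: lcb_def)
    show "ennreal ((\<integral>r. f (perp e x + r *\<^sub>R e) \<partial>gauss) powr (1 - t) * (\<integral>r. g (perp e y + r *\<^sub>R e) \<partial>gauss) powr t)
     \<le> (\<integral>\<^sup>+r. h (perp e ((1 - t) *\<^sub>R x + t *\<^sub>R y) + r *\<^sub>R e) \<partial>gauss)"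
    proof (rule prekopa_leindler_gauss_real[OF t lcbD(1,2)[OF fl] MN(1) lcbD(1,2)[OF gl] MN(2)])
      fix r q :: real
      show "ennreal (f (perp e x + r *\<^sub>R e) powr (1 - t) * g (perp e y + q *\<^sub>R e) powr t)
         \<le> h (perp e ((1 - t) *\<^sub>R x + t *\<^sub>R y) + ((1 - t) * r + t * q) *\<^sub>R e)"
        using adm unfolding perp_add_affine by (simp add: admissible_def)
    qed measurable
  qed
qed

lemma lcb_avg:
  assumes f: "lcb f"
  shows "lcb (avg e f)"
  unfolding lcb_def
proof (intro conjI)
  note [measurable] = lcbD(1)[OF f]
  show "avg e f \<in> borel_measurable borel"
    unfolding avg_def by measurable
  obtain M where M: "f x \<le> M" for x using f by (auto simp: lcb_def)
  have int: "integrable gauss (\<lambda>r::real. f (x + r *\<^sub>R e))" for x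
    using lcbD(4)[OF lcb_line[OF f]] .
  have "avg e f x \<le> M" for x
    unfolding avg_def using gauss.integral_le_const[OF int] M by auto
  then show "\<exists>M. \<forall>x. avg e f x \<le> M" by auto
  show "log_concave (avg e f)"
    unfolding log_concave_def
  proof safe
    show "0 \<le> avg e f x" for x unfolding avg_def using lcbD(3)[OF f] by simp
    fix x y and s :: real assume s: "0 < s" "s < 1"
    have "admissible s s f f (\<lambda>x. ennreal (f x))"
      using log_concaveD[OF lcbD(2)[OF f]] s by (auto simp: admissible_def intro!: ennreal_leI)
    from admissible_avg[OF s f f this, of e]
    have "ennreal (avg e f x powr (1 - s) * avg e f y powr s)
       \<le> (\<integral>\<^sup>+r. ennreal (f (perp e ((1 - s) *\<^sub>R x + s *\<^sub>R y) + r *\<^sub>R e)) \<partial>gauss)"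
      by (simp add: admissible_def)
    also have "\<dots> = ennreal (avg e f ((1 - s) *\<^sub>R x + s *\<^sub>R y))"
      unfolding avg_def by (rule nn_integral_lcb[OF lcb_line[OF f]])
    finally show "avg e f x powr (1 - s) * avg e f y powr s \<le> avg e f ((1 - s) *\<^sub>R x + s *\<^sub>R y)"
      using lcbD(3)[OF f] by (subst (asm) ennreal_le_iff) (auto simp: avg_def)
  qed
qed

text \<open>Induction on the set of basis vectors on which \<open>f\<close> and \<open>g\<close>
  depend. Averaging along one of them preserves \<open>lcb\<close> and admissibility by the
  one-dimensional case and leaves all integrals unchanged; when no direction is left both functions
  are constant.\<close>

lemma prekopa_leindler_gauss:
  fixes f g :: "'a::euclidean_space \<Rightarrow> real"
  assumes t: "0 < t" "t < 1" and "lcb f" "lcb g" "admissible t t f g h"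
  shows "ennreal ((\<integral>x. f x \<partial>gauss) powr (1 - t) * (\<integral>x. g x \<partial>gauss) powr t) \<le> (\<integral>\<^sup>+x. h x \<partial>gauss)"
proof -
  have "finite B \<Longrightarrow> B \<subseteq> Basis \<Longrightarrow> lcb f \<Longrightarrow> lcb g \<Longrightarrow> admissible t t f g h
    \<Longrightarrow> (\<And>x y. (\<And>b. b \<in> B \<Longrightarrow> x \<bullet> b = y \<bullet> b) \<Longrightarrow> f x = f y \<and> g x = g y)
    \<Longrightarrow> ennreal ((\<integral>x. f x \<partial>gauss) powr (1 - t) * (\<integral>x. g x \<partial>gauss) powr t) \<le> (\<integral>\<^sup>+x. h x \<partial>gauss)"
    for B and f g :: "'a \<Rightarrow> real" and h
  proof (induction B arbitrary: f g h rule: finite_induct)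
    case empty
    have "f x = f 0" "g x = g 0" for x using empty(5)[of x 0] by auto
    then have fg: "f = (\<lambda>_. f 0)" "g = (\<lambda>_. g 0)" by auto
    have h: "ennreal (f 0 powr (1 - t) * g 0 powr t) \<le> h z" for z
    proof -
      have "ennreal (f z powr (1 - t) * g z powr t) \<le> h ((1 - t) *\<^sub>R z + t *\<^sub>R z)"
        using empty(4) unfolding admissible_def by blast
      moreover have "(1 - t) *\<^sub>R z + t *\<^sub>R z = z" by (simp add: algebra_simps)
      ultimately show ?thesis using fg by metis
    qed
    have "(\<integral>x. f x \<partial>gauss) = f 0" "(\<integral>x. g x \<partial>gauss) = g 0"
      by (subst fg, simp add: gauss.prob_space[simplified])+
    then have "ennreal ((\<integral>x. f x \<partial>gauss) powr (1 - t) * (\<integral>x. g x \<partial>gauss) powr t)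
       = (\<integral>\<^sup>+z. ennreal (f 0 powr (1 - t) * g 0 powr t) \<partial>(gauss :: 'a measure))"
      by (simp add: gauss.emeasure_space_1[simplified])
    also have "\<dots> \<le> (\<integral>\<^sup>+x. h x \<partial>gauss)"
      by (intro nn_integral_mono h)
    finally show ?case .
  next
    case (insert b B)
    have b: "norm b = 1" and bb: "b \<bullet> b = 1" using insert.prems(1) by auto
    have [measurable]: "h \<in> borel_measurable borel"
      using insert.prems(4) by (simp add: admissible_def)
    have "ennreal ((\<integral>x. avg b f x \<partial>gauss) powr (1 - t) * (\<integral>x. avg b g x \<partial>gauss) powr t)
       \<le> (\<integral>\<^sup>+x. \<integral>\<^sup>+r. h (perp b x + r *\<^sub>R b) \<partial>gauss \<partial>gauss)"
    proof (rule insert.IH)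
      show "B \<subseteq> Basis" using insert.prems(1) by simp
      show "lcb (avg b f)" "lcb (avg b g)" using insert.prems(2,3) by (auto intro: lcb_avg)
      show "admissible t t (avg b f) (avg b g) (\<lambda>x. \<integral>\<^sup>+ r. h (perp b x + r *\<^sub>R b) \<partial>gauss)"
        using insert.prems(2-4) by (intro admissible_avg t)
      fix x y assume xy: "\<And>c. c \<in> B \<Longrightarrow> x \<bullet> c = y \<bullet> c"
      have "f (perp b x + r *\<^sub>R b) = f (perp b y + r *\<^sub>R b) \<and> g (perp b x + r *\<^sub>R b) = g (perp b y + r *\<^sub>R b)" for r
      proof (rule insert.prems(5))
        fix c assume c: "c \<in> insert b B"
        show "(perp b x + r *\<^sub>R b) \<bullet> c = (perp b y + r *\<^sub>R b) \<bullet> c"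
        proof (cases "c = b")
          case False
          then have "b \<bullet> c = 0" using c insert.prems(1) insert.hyps by (intro inner_not_same_Basis) auto
          then show ?thesis using c False xy by (auto simp: perp_def inner_simps)
        qed (simp add: perp_def inner_simps bb)
      qed
      then show "avg b f x = avg b f y \<and> avg b g x = avg b g y"
        unfolding avg_def by simp
    qed
    then show ?case
      unfolding avg_def
      using insert.prems(2,3) by (simp add: integral_gauss_perp(1)[OF lcbD(4) b] nn_integral_gauss_perp(1)[OF _ b])
  qed
  from this[OF finite_Basis subset_refl assms(3-)] show ?thesis
    using euclidean_eqI by metis
qed

text \<open>Prekopa's theorem on marginals: the fibres over \<open>x\<close>, over \<open>x'\<close>
  and over their combination form an admissible triple, to which Prekopa-Leindler applies.\<close>

lemma lcb_integral_snd:
  fixes \<Phi> :: "'a::euclidean_space \<Rightarrow> 'b::euclidean_space \<Rightarrow> real"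
  assumes [measurable]: "(\<lambda>(x, y). \<Phi> x y) \<in> borel_measurable (borel \<Otimes>\<^sub>M borel)"
    and nn: "\<And>x y. 0 \<le> \<Phi> x y" and bd: "\<And>x y. \<Phi> x y \<le> M"
    and lc: "\<And>x y x' y' s. 0 < s \<Longrightarrow> s < 1 \<Longrightarrow> \<Phi> x y powr (1 - s) * \<Phi> x' y' powr s
      \<le> \<Phi> ((1 - s) *\<^sub>R x + s *\<^sub>R x') ((1 - s) *\<^sub>R y + s *\<^sub>R y')"
  shows "lcb (\<lambda>x. \<integral>y. \<Phi> x y \<partial>gauss)"
  unfolding lcb_def
proof (intro conjI)
  show "(\<lambda>x. \<integral>y. \<Phi> x y \<partial>gauss) \<in> borel_measurable borel" by measurable
  have sl: "lcb (\<Phi> x)" for x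
    unfolding lcb_def
  proof (intro conjI)
    show "\<Phi> x \<in> borel_measurable borel" by measurable
    have eq: "(1 - s) *\<^sub>R x + s *\<^sub>R x = x" for s :: real by (simp add: algebra_simps)
    show "log_concave (\<Phi> x)"
      unfolding log_concave_def using nn lc[of _ x _ x] by (simp add: eq)
    show "\<exists>M. \<forall>y. \<Phi> x y \<le> M" using bd by auto
  qed
  have "(\<integral>y. \<Phi> x y \<partial>gauss) \<le> M" for x
    using gauss.integral_le_const[OF lcbD(4)[OF sl]] bd by auto
  then show "\<exists>M. \<forall>x. (\<integral>y. \<Phi> x y \<partial>gauss) \<le> M" by auto
  show "log_concave (\<lambda>x. \<integral>y. \<Phi> x y \<partial>gauss)"
    unfolding log_concave_def
  proof safe
    show "0 \<le> (\<integral>y. \<Phi> x y \<partial>gauss)" for x using nn by simp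
    fix x x' and s :: real assume s: "0 < s" "s < 1"
    have "ennreal ((\<integral>y. \<Phi> x y \<partial>gauss) powr (1 - s) * (\<integral>y. \<Phi> x' y \<partial>gauss) powr s)
       \<le> (\<integral>\<^sup>+y. ennreal (\<Phi> ((1 - s) *\<^sub>R x + s *\<^sub>R x') y) \<partial>gauss)"
    proof (rule prekopa_leindler_gauss[OF s sl sl])
      show "admissible s s (\<Phi> x) (\<Phi> x') (\<lambda>y. ennreal (\<Phi> ((1 - s) *\<^sub>R x + s *\<^sub>R x') y))"
        unfolding admissible_def using lc[OF s] by (auto intro!: ennreal_leI)
    qed
    also have "\<dots> = ennreal (\<integral>y. \<Phi> ((1 - s) *\<^sub>R x + s *\<^sub>R x') y \<partial>gauss)"
      by (rule nn_integral_lcb[OF sl])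
    finally show "(\<integral>y. \<Phi> x y \<partial>gauss) powr (1 - s) * (\<integral>y. \<Phi> x' y \<partial>gauss) powr s
       \<le> (\<integral>y. \<Phi> ((1 - s) *\<^sub>R x + s *\<^sub>R x') y \<partial>gauss)"
      using nn by (subst (asm) ennreal_le_iff) auto
  qed
qed

section \<open>Even functions on the line\<close>

text \<open>The difference set has length \<open>2 * (y - z)\<close>, and the density on it lies
  between its values at \<open>y\<close> and at \<open>z\<close>. These slope bounds stand in for a
  derivative.\<close>

lemma measure_gauss_annulus:
  fixes y z :: real
  assumes z: "0 \<le> z" "z \<le> y"
  shows "2 * gauss_dens y * (y - z) \<le> measure gauss {-y..y} - measure gauss {-z..z}"
    and "measure gauss {-y..y} - measure gauss {-z..z} \<le> 2 * gauss_dens z * (y - z)"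
proof -
  define S where "S = {-y..y} - {-z..z}"
  have S[measurable]: "S \<in> sets borel" by (simp add: S_def)
  have "emeasure lborel S = ennreal (2 * (y - z))"
    unfolding S_def using z by (subst emeasure_Diff) (auto simp: ennreal_minus)
  then have lS: "(\<integral>\<^sup>+x. indicator S x \<partial>lborel) = ennreal (2 * (y - z))"
    by simp
  have meas: "measure gauss {-y..y} - measure gauss {-z..z} = measure gauss S"
    unfolding S_def using z by (intro gauss.finite_measure_Diff[symmetric]) auto
  have e: "emeasure gauss S = (\<integral>\<^sup>+x. ennreal (gauss_dens x) * indicator S x \<partial>lborel)"
    by (simp add: gauss_eq emeasure_density)
  have dens: "gauss_dens y \<le> gauss_dens x" "gauss_dens x \<le> gauss_dens z" if "x \<in> S" for x
  proof -
    have "z \<le> \<bar>x\<bar>" "\<bar>x\<bar> \<le> y" using that by (auto simp: S_def)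
    then have "z\<^sup>2 \<le> x\<^sup>2" "x\<^sup>2 \<le> y\<^sup>2"
      using z abs_le_square_iff[of z x] abs_le_square_iff[of x y] by simp_all
    then show "gauss_dens y \<le> gauss_dens x" "gauss_dens x \<le> gauss_dens z"
      by (auto simp: gauss_dens_def intro!: divide_right_mono)
  qed
  have "(\<integral>\<^sup>+x. ennreal (gauss_dens y) * indicator S x \<partial>lborel) \<le> emeasure gauss S"
    unfolding e by (intro nn_integral_mono) (auto simp: indicator_def intro!: ennreal_leI dens)
  then have "ennreal (gauss_dens y) * ennreal (2 * (y - z)) \<le> ennreal (measure gauss S)"
    by (simp add: nn_integral_cmult lS gauss.emeasure_eq_measure)
  then show "2 * gauss_dens y * (y - z) \<le> measure gauss {-y..y} - measure gauss {-z..z}"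
    using z unfolding meas by (simp add: gauss_dens_pos less_imp_le ac_simps flip: ennreal_mult)
  have "emeasure gauss S \<le> (\<integral>\<^sup>+x. ennreal (gauss_dens z) * indicator S x \<partial>lborel)"
    unfolding e by (intro nn_integral_mono) (auto simp: indicator_def intro!: ennreal_leI dens)
  then have "ennreal (measure gauss S) \<le> ennreal (gauss_dens z) * ennreal (2 * (y - z))"
    by (simp add: nn_integral_cmult lS gauss.emeasure_eq_measure)
  then show "measure gauss {-y..y} - measure gauss {-z..z} \<le> 2 * gauss_dens z * (y - z)"
    using z unfolding meas by (simp add: gauss_dens_pos less_imp_le ac_simps flip: ennreal_mult)
qed

text \<open>At the intermediate length \<open>z\<close>, the slope to the left is at least
  \<open>2 * gauss_dens z\<close> and the slope to the right at most this number.\<close>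

lemma measure_gauss_interval_concave:
  fixes x y t :: real
  assumes x: "0 \<le> x" and y: "0 \<le> y" and t: "0 \<le> t" "t \<le> 1"
  shows "(1 - t) * measure gauss {-x..x} + t * measure gauss {-y..y}
    \<le> measure gauss {-((1 - t) * x + t * y)..(1 - t) * x + t * y}"
proof -
  have *: "(1 - t) * measure gauss {-x..x} + t * measure gauss {-y..y}
    \<le> measure gauss {-((1 - t) * x + t * y)..(1 - t) * x + t * y}"
    if x: "0 \<le> x" "x \<le> y" and t: "0 \<le> t" "t \<le> 1" for x y t :: real
  proof -
    define z where "z = (1 - t) * x + t * y"
    have zx: "z - x = t * (y - x)" and yz: "y - z = (1 - t) * (y - x)"
      by (simp_all add: z_def algebra_simps)
    have z: "x \<le> z" "z \<le> y"
      using zx yz x t by (smt (verit) mult_nonneg_nonneg)+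
    have 1: "(1 - t) * (2 * gauss_dens z * (z - x)) \<le> (1 - t) * (measure gauss {-z..z} - measure gauss {-x..x})"
      using measure_gauss_annulus(1)[of x z] z x t by (intro mult_left_mono) auto
    have 2: "t * (measure gauss {-y..y} - measure gauss {-z..z}) \<le> t * (2 * gauss_dens z * (y - z))"
      using measure_gauss_annulus(2)[of z y] z x t by (intro mult_left_mono) auto
    have 3: "t * (2 * gauss_dens z * (y - z)) = (1 - t) * (2 * gauss_dens z * (z - x))"
      by (simp add: zx yz)
    have "t * (measure gauss {-y..y} - measure gauss {-z..z}) \<le> (1 - t) * (measure gauss {-z..z} - measure gauss {-x..x})"
      using 1 2 3 by linarith
    then show ?thesis unfolding z_def[symmetric] by (simp add: algebra_simps)
  qed
  show ?thesis
  proof (cases "x \<le> y")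
    case True then show ?thesis using * x t by blast
  next
    case False
    then have "(1 - (1 - t)) * measure gauss {-y..y} + (1 - t) * measure gauss {-x..x}
    \<le> measure gauss {-((1 - (1 - t)) * y + (1 - t) * x)..(1 - (1 - t)) * y + (1 - t) * x}"
      using y t by (intro *) auto
    then show ?thesis by (simp add: add.commute)
  qed
qed

text \<open>By inner regularity a compact subset of \<open>X\<close> suffices, and it lies in the
  symmetric interval that reaches to its point of largest modulus. The interval is thus indexed by a
  point of \<open>X\<close> itself, which can be paired with a point of the other level set.\<close>

lemma emeasure_gauss_symmetric_le:
  fixes X :: "real set"
  assumes X[measurable]: "X \<in> sets borel" and ne: "X \<noteq> {}"
  shows "emeasure gauss X \<le> (SUP x\<in>X. emeasure gauss {-\<bar>x\<bar>..\<bar>x\<bar>})"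
proof -
  have "emeasure gauss X = (SUP K\<in>{K. K \<subseteq> X \<and> compact K}. emeasure gauss K)"
    by (rule inner_regular) (simp_all add: gauss.emeasure_space_1[simplified])
  also have "\<dots> \<le> (SUP x\<in>X. emeasure gauss {-\<bar>x\<bar>..\<bar>x\<bar>})"
  proof (rule SUP_least)
    fix K assume K: "K \<in> {K. K \<subseteq> X \<and> compact K}"
    show "emeasure gauss K \<le> (SUP x\<in>X. emeasure gauss {-\<bar>x\<bar>..\<bar>x\<bar>})"
    proof (cases "K = {}")
      case False
      then obtain x where x: "x \<in> K" "\<And>y. y \<in> K \<Longrightarrow> \<bar>y\<bar> \<le> \<bar>x\<bar>"
        using continuous_attains_sup[of K "\<lambda>x. \<bar>x\<bar>"] K
        by (force intro: continuous_intros continuous_on_rabs)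
      then have "K \<subseteq> {-\<bar>x\<bar>..\<bar>x\<bar>}" by (auto simp: abs_le_iff minus_le_iff)
      then have "emeasure gauss K \<le> emeasure gauss {-\<bar>x\<bar>..\<bar>x\<bar>}" by (intro emeasure_mono) auto
      also have "\<dots> \<le> (SUP x\<in>X. emeasure gauss {-\<bar>x\<bar>..\<bar>x\<bar>})"
        using x K by (intro SUP_upper) auto
      finally show ?thesis .
    qed simp
  qed
  finally show ?thesis .
qed

text \<open>Level sets combine with the weights \<open>1 - t\<close>, \<open>t\<close>, by concavity
  of the measure of symmetric intervals; passing to the geometric mean with exponent
  \<open>s\<close> costs exactly \<open>exp (- kl s t)\<close>. Only monotonicity in the modulus is
  asked for, so that a marginal may be cut off by an indicator, and \<open>C\<close> carries the
  constant obtained on the fibres.\<close>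

lemma even_mean_gauss_real:
  fixes a b :: "real \<Rightarrow> real" and H :: "real \<Rightarrow> ennreal"
  assumes s: "0 < s" "s < 1" and t: "0 < t" "t < 1"
    and a[measurable]: "a \<in> borel_measurable borel" and a0: "\<And>x. 0 \<le> a x"
    and a_dec: "\<And>x y. \<bar>x\<bar> \<le> \<bar>y\<bar> \<Longrightarrow> a y \<le> a x"
    and b[measurable]: "b \<in> borel_measurable borel" and b0: "\<And>x. 0 \<le> b x"
    and b_dec: "\<And>x y. \<bar>x\<bar> \<le> \<bar>y\<bar> \<Longrightarrow> b y \<le> b x"
    and C: "0 \<le> C"
    and H[measurable]: "H \<in> borel_measurable borel"
    and le: "\<And>x y. ennreal (C * (a x powr (1 - s) * b y powr s)) \<le> H ((1 - t) * x + t * y)"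
  shows "ennreal (C * exp (- kl s t) * ((\<integral>x. a x \<partial>gauss) powr (1 - s) * (\<integral>x. b x \<partial>gauss) powr s))
    \<le> (\<integral>\<^sup>+x. H x \<partial>gauss)"
proof (cases "a 0 = 0 \<or> b 0 = 0 \<or> C = 0")
  case True
  have "a x = 0" if "a 0 = 0" for x using a_dec[of 0 x] a0[of x] that by simp
  moreover have "b x = 0" if "b 0 = 0" for x using b_dec[of 0 x] b0[of x] that by simp
  ultimately show ?thesis using True by auto
next
  case False
  define A where "A = a 0"
  define B where "B = b 0"
  have AB: "0 < A" "0 < B" and Cp: "0 < C"
    using False a0[of 0] b0[of 0] C by (auto simp: A_def B_def)
  have aA: "a x \<le> A" and bB: "b x \<le> B" for x
    using a_dec[of 0 x] b_dec[of 0 x] by (simp_all add: A_def B_def)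
  define c where "c = C * (A powr (1 - s) * B powr s)"
  have c: "0 < c" using AB Cp by (simp add: c_def)
  have main: "ennreal c * (ennreal (1 - t) * (\<integral>\<^sup>+x. ennreal (a x / A) \<partial>gauss) + ennreal t * (\<integral>\<^sup>+x. ennreal (b x / B) \<partial>gauss))
      \<le> (\<integral>\<^sup>+x. H x \<partial>gauss)"
  proof (rule layer_cake_mean)
    show "sigma_finite_measure (gauss :: real measure)" ..
    fix l :: real assume l: "0 < l" "l < 1"
    define X where "X = {x. l < a x / A}"
    define Y where "Y = {x. l < b x / B}"
    define Z where "Z = {x. ennreal (c * l) < H x}"
    have [measurable]: "X \<in> sets borel" "Y \<in> sets borel" "Z \<in> sets borel"
      unfolding X_def Y_def Z_def by measurable
    have "0 \<in> X" "0 \<in> Y" using l AB by (auto simp: X_def Y_def A_def B_def)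
    then have ne: "X \<noteq> {}" "Y \<noteq> {}" by auto
    have Xc: "x' \<in> X" if "x \<in> X" "\<bar>x'\<bar> \<le> \<bar>x\<bar>" for x x'
      using a_dec[OF that(2)] that(1) AB by (auto simp: X_def field_simps)
    have Yc: "x' \<in> Y" if "x \<in> Y" "\<bar>x'\<bar> \<le> \<bar>x\<bar>" for x x'
      using b_dec[OF that(2)] that(1) AB by (auto simp: Y_def field_simps)
    have Z: "(1 - t) * x + t * y \<in> Z" if "x \<in> X" "y \<in> Y" for x y
    proof -
      have "A powr (1 - s) * B powr s * l < a x powr (1 - s) * b y powr s"
        using that l s AB by (intro log_combination_le) (auto simp: X_def Y_def)
      then have "c * l < C * (a x powr (1 - s) * b y powr s)"
        using Cp by (simp add: c_def mult.assoc)
      then have "ennreal (c * l) < ennreal (C * (a x powr (1 - s) * b y powr s))"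
        using c l by (simp add: ennreal_less_iff)
      also note le
      finally show ?thesis by (simp add: Z_def)
    qed
    have "ennreal (1 - t) * (SUP x\<in>X. emeasure gauss {-\<bar>x\<bar>..\<bar>x\<bar>})
        + ennreal t * (SUP y\<in>Y. emeasure gauss {-\<bar>y\<bar>..\<bar>y\<bar>}) \<le> emeasure gauss Z"
    proof (rule ennreal_combine_SUP_le[OF ne])
      fix x y assume xy: "x \<in> X" "y \<in> Y"
      define z where "z = (1 - t) * \<bar>x\<bar> + t * \<bar>y\<bar>"
      have z0: "0 \<le> z" using t by (simp add: z_def)
      have "{-z..z} \<subseteq> Z"
      proof
        fix w assume w: "w \<in> {-z..z}"
        define u where "u = (if z = 0 then 0 else w / z)"
        have u: "\<bar>u\<bar> \<le> 1" "w = u * z"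
          using w z0 by (auto simp: u_def abs_le_iff divide_simps)
        have "\<bar>u * \<bar>x\<bar>\<bar> \<le> \<bar>x\<bar>" "\<bar>u * \<bar>y\<bar>\<bar> \<le> \<bar>y\<bar>"
          using u(1) by (auto simp: abs_mult mult_left_le_one_le)
        then have "(1 - t) * (u * \<bar>x\<bar>) + t * (u * \<bar>y\<bar>) \<in> Z"
          using xy by (intro Z) (auto intro: Xc Yc)
        then show "w \<in> Z" unfolding u(2) z_def by (simp add: algebra_simps)
      qed
      then have "emeasure gauss {-z..z} \<le> emeasure gauss Z"
        by (intro emeasure_mono) auto
      moreover have "(1 - t) * measure gauss {-\<bar>x\<bar>..\<bar>x\<bar>} + t * measure gauss {-\<bar>y\<bar>..\<bar>y\<bar>} \<le> measure gauss {-z..z}"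
        unfolding z_def using t by (intro measure_gauss_interval_concave) auto
      then have "ennreal (1 - t) * emeasure gauss {-\<bar>x\<bar>..\<bar>x\<bar>} + ennreal t * emeasure gauss {-\<bar>y\<bar>..\<bar>y\<bar>} \<le> emeasure gauss {-z..z}"
        using t by (simp add: gauss.emeasure_eq_measure flip: ennreal_mult ennreal_plus)
      ultimately show "ennreal (1 - t) * emeasure gauss {-\<bar>x\<bar>..\<bar>x\<bar>} + ennreal t * emeasure gauss {-\<bar>y\<bar>..\<bar>y\<bar>} \<le> emeasure gauss Z"
        by simp
    qed
    moreover have "ennreal (1 - t) * emeasure gauss X + ennreal t * emeasure gauss Y
        \<le> ennreal (1 - t) * (SUP x\<in>X. emeasure gauss {-\<bar>x\<bar>..\<bar>x\<bar>})
        + ennreal t * (SUP y\<in>Y. emeasure gauss {-\<bar>y\<bar>..\<bar>y\<bar>})"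
      using ne by (intro add_mono mult_left_mono emeasure_gauss_symmetric_le) auto
    ultimately show "ennreal (1 - t) * emeasure gauss {x \<in> space gauss. l < a x / A}
        + ennreal t * emeasure gauss {x \<in> space gauss. l < b x / B}
        \<le> emeasure gauss {x \<in> space gauss. ennreal (c * l) < H x}"
      by (simp add: X_def Y_def Z_def)
  qed (use t AB c aA bB a0 b0 in simp_all)
  have inta: "integrable gauss a" and intb: "integrable gauss b"
    using a0 aA b0 bB
    by (auto intro: gauss.integrable_const_bound[where B = A] gauss.integrable_const_bound[where B = B])
  define IA where "IA = (\<integral>x. a x \<partial>gauss)"
  define IB where "IB = (\<integral>x. b x \<partial>gauss)"
  have I: "0 \<le> IA" "0 \<le> IB"
    unfolding IA_def IB_def using a0 b0 by simp_all
  have "(\<integral>\<^sup>+x. ennreal (a x / A) \<partial>gauss) = ennreal (IA / A)"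
    unfolding IA_def using inta AB a0 by (subst nn_integral_eq_integral) auto
  moreover have "(\<integral>\<^sup>+x. ennreal (b x / B) \<partial>gauss) = ennreal (IB / B)"
    unfolding IB_def using intb AB b0 by (subst nn_integral_eq_integral) auto
  moreover have "ennreal (c * ((1 - t) * (IA / A) + t * (IB / B)))
      = ennreal c * (ennreal (1 - t) * ennreal (IA / A) + ennreal t * ennreal (IB / B))"
    using t AB c I by (simp add: ennreal_mult ennreal_plus del: times_divide_eq_right)
  ultimately have "ennreal (c * ((1 - t) * (IA / A) + t * (IB / B))) \<le> (\<integral>\<^sup>+x. H x \<partial>gauss)"
    using main by simp
  moreover have "C * exp (- kl s t) * (IA powr (1 - s) * IB powr s) \<le> c * ((1 - t) * (IA / A) + t * (IB / B))"
  proof -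
    have "C * exp (- kl s t) * (IA powr (1 - s) * IB powr s)
        = c * (exp (- kl s t) * ((IA / A) powr (1 - s) * (IB / B) powr s))"
      using AB I by (simp add: c_def powr_divide)
    also have "\<dots> \<le> c * ((1 - t) * (IA / A) + t * (IB / B))"
      using weighted_am_gm_kl[OF s t, of "IA / A" "IB / B"] AB I c
      by (intro mult_left_mono) simp_all
    finally show ?thesis .
  qed
  ultimately show ?thesis
    unfolding IA_def[symmetric] IB_def[symmetric] by (meson ennreal_leI order_trans)
qed

section \<open>Two copies rotated by 45 degrees\<close>

definition twist :: "('a::euclidean_space \<Rightarrow> real) \<Rightarrow> 'a \<Rightarrow> 'a \<Rightarrow> real" where
  "twist f u v = f ((u - v) /\<^sub>R sqrt 2) * f ((u + v) /\<^sub>R sqrt 2)"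

text \<open>For independent X, Y with density \<open>f\<close> with respect to \<open>gauss\<close>,
  this is the density of (X + Y) / sqrt 2, again with respect to \<open>gauss\<close>;
  \<open>twist f u\<close> is, up to normalisation, the conditional density of (Y - X) / sqrt 2 when
  the former equals \<open>u\<close>.\<close>

definition conv :: "('a::euclidean_space \<Rightarrow> real) \<Rightarrow> 'a \<Rightarrow> real" where
  "conv f u = (\<integral>v. twist f u v \<partial>gauss)"

text \<open>Stands for a function on the subspace \<open>L\<close>, composed with the orthogonal
  projection. An induction on \<open>dim L\<close> can thus keep the type and the measure
  fixed.\<close>

definition depends_on :: "'a::euclidean_space set \<Rightarrow> ('a \<Rightarrow> 'b) \<Rightarrow> bool" where
  "depends_on L f \<longleftrightarrow> (\<forall>x y. (\<forall>l\<in>L. x \<bullet> l = y \<bullet> l) \<longrightarrow> f x = f y)"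

definition even_fun :: "('a::euclidean_space \<Rightarrow> 'b) \<Rightarrow> bool" where
  "even_fun f \<longleftrightarrow> (\<forall>x. f (- x) = f x)"

text \<open>True for every \<open>f\<close>, even or not: exchanging the two copies changes the sign
  of \<open>v\<close>. This is why a constant known for even functions governs the fibres of the
  rotation for arbitrary functions.\<close>

lemma twist_even: "even_fun (twist f u)"
  by (simp add: even_fun_def twist_def mult.commute)

lemma twist_measurable:
  assumes [measurable]: "f \<in> borel_measurable borel"
  shows "(\<lambda>(u, v). twist f u v) \<in> borel_measurable (borel \<Otimes>\<^sub>M borel)"
  unfolding twist_def by measurable

lemma lcb_twist:
  assumes f: "lcb f" shows "lcb (twist f u)"
  unfolding twist_def
proof (rule lcb_mult; rule lcb_compose[OF f])
  have eq: "u = (1 - s) *\<^sub>R u + s *\<^sub>R u" for s :: real by (simp add: algebra_simps)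
  show "(u - ((1 - s) *\<^sub>R x + s *\<^sub>R y)) /\<^sub>R sqrt 2 = (1 - s) *\<^sub>R ((u - x) /\<^sub>R sqrt 2) + s *\<^sub>R ((u - y) /\<^sub>R sqrt 2)"
    "(u + ((1 - s) *\<^sub>R x + s *\<^sub>R y)) /\<^sub>R sqrt 2 = (1 - s) *\<^sub>R ((u + x) /\<^sub>R sqrt 2) + s *\<^sub>R ((u + y) /\<^sub>R sqrt 2)"
    for x y s
    by (subst eq[of s], simp add: scaleR_add_right scaleR_diff_right ac_simps)+
qed measurable

lemma lcb_conv:
  assumes f: "lcb f" shows "lcb (conv f)"
proof -
  note [measurable] = lcbD(1)[OF f]
  obtain M where M: "f x \<le> M" for x using f by (auto simp: lcb_def)
  have nn: "0 \<le> f x" for x by (rule lcbD(3)[OF f])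
  show ?thesis
    unfolding conv_def
  proof (rule lcb_integral_snd)
    show "twist f x y \<le> M * M" for x y
      unfolding twist_def using M nn by (meson mult_mono order_trans)
    fix x y x' y' :: 'a and s :: real assume s: "0 < s" "s < 1"
    let ?c = "\<lambda>x y. (1 - s) *\<^sub>R x + s *\<^sub>R y"
    have 1: "(?c x x' - ?c y y') /\<^sub>R sqrt 2 = ?c ((x - y) /\<^sub>R sqrt 2) ((x' - y') /\<^sub>R sqrt 2)"
      and 2: "(?c x x' + ?c y y') /\<^sub>R sqrt 2 = ?c ((x + y) /\<^sub>R sqrt 2) ((x' + y') /\<^sub>R sqrt 2)"
      by (simp_all add: scaleR_add_right scaleR_diff_right mult.commute)
    have "twist f x y powr (1 - s) * twist f x' y' powr s
      = (f ((x - y) /\<^sub>R sqrt 2) powr (1 - s) * f ((x' - y') /\<^sub>R sqrt 2) powr s)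
        * (f ((x + y) /\<^sub>R sqrt 2) powr (1 - s) * f ((x' + y') /\<^sub>R sqrt 2) powr s)"
      unfolding twist_def by (simp add: powr_mult nn)
    also have "\<dots> \<le> twist f (?c x x') (?c y y')"
      unfolding twist_def 1 2 using s nn by (intro mult_mono log_concaveD(2)[OF lcbD(2)[OF f]]) auto
    finally show "twist f x y powr (1 - s) * twist f x' y' powr s \<le> twist f (?c x x') (?c y y')" .
  qed (use nn in \<open>auto intro!: twist_measurable simp: twist_def\<close>)
qed

lemma conv_even: "even_fun f \<Longrightarrow> even_fun (conv f)"
proof -
  assume f: "even_fun f"
  have "twist f (- u) v = twist f u v" for u v
  proof -
    have "(- u - v) /\<^sub>R sqrt 2 = - ((u + v) /\<^sub>R sqrt 2)" "(- u + v) /\<^sub>R sqrt 2 = - ((u - v) /\<^sub>R sqrt 2)"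
      by (simp_all add: algebra_simps)
    then show ?thesis using f unfolding twist_def even_fun_def by (simp add: mult.commute)
  qed
  then have "twist f (- u) = twist f u" for u by (rule ext)
  then show ?thesis unfolding even_fun_def conv_def by simp
qed

lemma depends_on_twist: "depends_on L f \<Longrightarrow> depends_on L (twist f u)"
  unfolding depends_on_def twist_def
  by (intro allI impI arg_cong2[where f = "(*)"]) (auto simp: inner_simps)

lemma depends_on_conv: "depends_on L f \<Longrightarrow> depends_on L (conv f)"
proof -
  assume f: "depends_on L f"
  have "twist f x = twist f y" if "\<forall>l\<in>L. x \<bullet> l = y \<bullet> l" for x y
    using f that unfolding depends_on_def twist_def
    by (intro ext arg_cong2[where f = "(*)"]) (auto simp: inner_simps)
  then show ?thesis unfolding depends_on_def conv_def by metis
qed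

lemma integral_conv:
  fixes \<phi> :: "'a::euclidean_space \<Rightarrow> 'b::euclidean_space"
  assumes f: "lcb f" and [measurable]: "\<phi> \<in> borel_measurable borel"
    and int: "integrable (gauss \<Otimes>\<^sub>M gauss) (\<lambda>(x, y). (f x * f y) *\<^sub>R \<phi> ((x + y) /\<^sub>R sqrt 2))"
  shows "(\<integral>u. conv f u *\<^sub>R \<phi> u \<partial>gauss) = (\<integral>x. (\<integral>y. (f x * f y) *\<^sub>R \<phi> ((x + y) /\<^sub>R sqrt 2) \<partial>gauss) \<partial>gauss)"
proof -
  have u: "(((u - v) /\<^sub>R sqrt 2) + ((u + v) /\<^sub>R sqrt 2)) /\<^sub>R sqrt 2 = u" for u v :: 'a
  proof -
    have "(((u - v) /\<^sub>R sqrt 2) + ((u + v) /\<^sub>R sqrt 2)) /\<^sub>R sqrt 2 = inverse (sqrt 2) *\<^sub>R inverse (sqrt 2) *\<^sub>R (2 *\<^sub>R u)"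
      by (simp add: scaleR_add_right[symmetric] scaleR_2)
    also have "\<dots> = u" by (simp add: field_simps)
    finally show ?thesis .
  qed
  have "(\<integral>u. conv f u *\<^sub>R \<phi> u \<partial>gauss) = (\<integral>u. (\<integral>v. twist f u v *\<^sub>R \<phi> u \<partial>gauss) \<partial>gauss)"
    unfolding conv_def using lcbD(4)[OF lcb_twist[OF f]] by (simp add: integral_scaleR_left)
  also have "\<dots> = (\<integral>x. (\<integral>y. (f x * f y) *\<^sub>R \<phi> ((x + y) /\<^sub>R sqrt 2) \<partial>gauss) \<partial>gauss)"
    using integral_gauss_rotation(1)[OF int] by (simp add: twist_def u)
  finally show ?thesis .
qed

lemma integrable_lcb_mult:
  assumes f: "lcb f" and g: "integrable gauss (g :: 'a::euclidean_space \<Rightarrow> 'b::euclidean_space)"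
  shows "integrable gauss (\<lambda>x. f x *\<^sub>R g x)"
proof -
  obtain M where M: "f x \<le> M" for x using f by (auto simp: lcb_def)
  have [measurable]: "f \<in> borel_measurable borel" "g \<in> borel_measurable borel"
    using lcbD(1)[OF f] borel_measurable_integrable[OF g] by auto
  show ?thesis
    using g by (rule Bochner_Integration.integrable_bound[OF integrable_scaleR_right[of M]])
      (auto intro!: AE_I2 mult_mono simp: lcbD(3)[OF f] M order_trans[OF M abs_ge_self])
qed

lemma integrable_pair_mult:
  fixes f :: "'a::euclidean_space \<Rightarrow> real" and g :: "'b::euclidean_space \<Rightarrow> 'c::euclidean_space"
  assumes f: "integrable gauss f" and g: "integrable gauss g"
  shows "integrable (gauss \<Otimes>\<^sub>M gauss) (\<lambda>(x, y). f x *\<^sub>R g y)"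
proof (rule gauss2.Fubini_integrable)
  have [measurable]: "f \<in> borel_measurable borel" "g \<in> borel_measurable borel"
    using f g by (auto dest: borel_measurable_integrable)
  show "(\<lambda>(x, y). f x *\<^sub>R g y) \<in> borel_measurable (gauss \<Otimes>\<^sub>M gauss)" by measurable
  show "integrable gauss (\<lambda>x. \<integral>y. norm (case (x, y) of (x, y) \<Rightarrow> f x *\<^sub>R g y) \<partial>gauss)"
    using f g by simp
  show "AE x in gauss. integrable gauss (\<lambda>y. case (x, y) of (x, y) \<Rightarrow> f x *\<^sub>R g y)"
    using g by simp
qed

lemma integral_conv_1:
  assumes f: "lcb f"
  shows "(\<integral>u. conv f u \<partial>gauss) = (\<integral>x. f x \<partial>gauss)\<^sup>2"
proof -
  have "integrable (gauss \<Otimes>\<^sub>M gauss) (\<lambda>(x, y). (f x * f y) *\<^sub>R (1::real))"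
    using integrable_pair_mult[OF lcbD(4)[OF f] lcbD(4)[OF f]] by simp
  from integral_conv[OF f _ this] show ?thesis
    by (simp add: power2_eq_square)
qed

section \<open>Rotating an admissible triple\<close>

text \<open>The factor \<open>1 / c\<close> undoes the constant lost in the fibre over
  \<open>w\<close>, so that the self-convolutions are admissible again without a constant.\<close>

definition conv_bound :: "real \<Rightarrow> ('a::euclidean_space \<Rightarrow> ennreal) \<Rightarrow> 'a \<Rightarrow> ennreal" where
  "conv_bound c h w = ennreal (1 / c) * (\<integral>\<^sup>+v. h ((w - v) /\<^sub>R sqrt 2) * h ((w + v) /\<^sub>R sqrt 2) \<partial>gauss)"

definition even_const :: "'a::euclidean_space set \<Rightarrow> real \<Rightarrow> real \<Rightarrow> real \<Rightarrow> bool" where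
  "even_const L s t c \<longleftrightarrow> (\<forall>f g h. lcb f \<and> lcb g \<and> even_fun f \<and> even_fun g \<and> depends_on L f \<and> depends_on L g
     \<and> admissible s t f g h \<longrightarrow>
     ennreal (c * ((\<integral>x. f x \<partial>gauss) powr (1 - s) * (\<integral>x. g x \<partial>gauss) powr s)) \<le> (\<integral>\<^sup>+x. h x \<partial>gauss))"

lemma nn_integral_conv_bound:
  fixes h :: "'a::euclidean_space \<Rightarrow> ennreal"
  assumes [measurable]: "h \<in> borel_measurable borel"
  shows "(\<integral>\<^sup>+w. conv_bound c h w \<partial>gauss) = ennreal (1 / c) * (\<integral>\<^sup>+x. h x \<partial>gauss)\<^sup>2"
proof -
  have "(\<integral>\<^sup>+w. conv_bound c h w \<partial>gauss)
     = ennreal (1 / c) * (\<integral>\<^sup>+w. \<integral>\<^sup>+v. h ((w - v) /\<^sub>R sqrt 2) * h ((w + v) /\<^sub>R sqrt 2) \<partial>gauss \<partial>gauss)"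
    unfolding conv_bound_def by (rule nn_integral_cmult) simp
  also have "(\<integral>\<^sup>+w. \<integral>\<^sup>+v. h ((w - v) /\<^sub>R sqrt 2) * h ((w + v) /\<^sub>R sqrt 2) \<partial>gauss \<partial>gauss)
     = (\<integral>\<^sup>+x. \<integral>\<^sup>+y. h x * h y \<partial>gauss \<partial>gauss)"
    using nn_integral_gauss_rotation[of "\<lambda>(x, y). h x * h y"] by simp
  also have "\<dots> = (\<integral>\<^sup>+x. h x \<partial>gauss)\<^sup>2"
    by (simp add: nn_integral_cmult nn_integral_multc power2_eq_square)
  finally show ?thesis .
qed

text \<open>For fixed \<open>x\<close> and \<open>y\<close> the two twists are even in their last
  argument, and they are admissible together with the product of two values of \<open>h\<close>,
  because the rotation commutes with forming \<open>(1 - t) *\<^sub>R x + t *\<^sub>R y\<close>. The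
  constant for even functions applies to this triple.\<close>

lemma admissible_conv:
  assumes s: "0 < s" "s < 1" and c: "0 < c" "even_const L s t c"
    and f: "lcb f" "depends_on L f" and g: "lcb g" "depends_on L g"
    and adm: "admissible s t f g h"
  shows "admissible s t (conv f) (conv g) (conv_bound c h)"
  unfolding admissible_def
proof (intro conjI allI)
  have h[measurable]: "h \<in> borel_measurable borel" using adm by (simp add: admissible_def)
  show "conv_bound c h \<in> borel_measurable borel"
    unfolding conv_bound_def by measurable
  fix x y :: 'a
  define w where "w = (1 - t) *\<^sub>R x + t *\<^sub>R y"
  have "ennreal (c * ((\<integral>v. twist f x v \<partial>gauss) powr (1 - s) * (\<integral>v. twist g y v \<partial>gauss) powr s))
      \<le> (\<integral>\<^sup>+v. h ((w - v) /\<^sub>R sqrt 2) * h ((w + v) /\<^sub>R sqrt 2) \<partial>gauss)"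
  proof (rule c(2)[unfolded even_const_def, rule_format], intro conjI)
    show "admissible s t (twist f x) (twist g y) (\<lambda>v. h ((w - v) /\<^sub>R sqrt 2) * h ((w + v) /\<^sub>R sqrt 2))"
      unfolding admissible_def
    proof (intro conjI allI)
      fix v v' :: 'a
      have 1: "(w - ((1 - t) *\<^sub>R v + t *\<^sub>R v')) /\<^sub>R sqrt 2 = (1 - t) *\<^sub>R ((x - v) /\<^sub>R sqrt 2) + t *\<^sub>R ((y - v') /\<^sub>R sqrt 2)"
        and 2: "(w + ((1 - t) *\<^sub>R v + t *\<^sub>R v')) /\<^sub>R sqrt 2 = (1 - t) *\<^sub>R ((x + v) /\<^sub>R sqrt 2) + t *\<^sub>R ((y + v') /\<^sub>R sqrt 2)"
        by (simp_all add: w_def scaleR_add_right scaleR_diff_right mult.commute)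
      have "ennreal (twist f x v powr (1 - s) * twist g y v' powr s)
         = ennreal (f ((x - v) /\<^sub>R sqrt 2) powr (1 - s) * g ((y - v') /\<^sub>R sqrt 2) powr s)
          * ennreal (f ((x + v) /\<^sub>R sqrt 2) powr (1 - s) * g ((y + v') /\<^sub>R sqrt 2) powr s)"
        unfolding twist_def by (simp add: powr_mult lcbD(3)[OF f(1)] lcbD(3)[OF g(1)] ac_simps flip: ennreal_mult)
      also have "\<dots> \<le> h ((w - ((1 - t) *\<^sub>R v + t *\<^sub>R v')) /\<^sub>R sqrt 2) * h ((w + ((1 - t) *\<^sub>R v + t *\<^sub>R v')) /\<^sub>R sqrt 2)"
        unfolding 1 2 using adm unfolding admissible_def by (intro mult_mono) (blast | simp)+
      finally show "ennreal (twist f x v powr (1 - s) * twist g y v' powr s)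
        \<le> h ((w - ((1 - t) *\<^sub>R v + t *\<^sub>R v')) /\<^sub>R sqrt 2) * h ((w + ((1 - t) *\<^sub>R v + t *\<^sub>R v')) /\<^sub>R sqrt 2)" .
    qed measurable
  qed (use f g in \<open>auto intro: lcb_twist twist_even depends_on_twist\<close>)
  then have "ennreal (1 / c) * ennreal (c * (conv f x powr (1 - s) * conv g y powr s)) \<le> conv_bound c h w"
    unfolding conv_bound_def conv_def by (rule mult_left_mono) simp
  then show "ennreal (conv f x powr (1 - s) * conv g y powr s) \<le> conv_bound c h ((1 - t) *\<^sub>R x + t *\<^sub>R y)"
    using c(1) by (simp add: w_def flip: ennreal_mult)
qed

text \<open>In terms of the ratio \<open>I / c\<close> each rotation is a squaring, whence the
  exponent \<open>2 ^ j\<close>.\<close>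

lemma conv_iterate:
  assumes s: "0 < s" "s < 1" and c: "0 < c" "even_const L s t c"
    and f: "lcb f" "depends_on L f" and g: "lcb g" "depends_on L g"
    and adm: "admissible s t f g h" and I: "(\<integral>\<^sup>+x. h x \<partial>gauss) = ennreal I" "0 \<le> I"
  defines "F \<equiv> \<lambda>j. (conv ^^ j) f" and "G \<equiv> \<lambda>j. (conv ^^ j) g"
  shows "lcb (F j)" "depends_on L (F j)" "lcb (G j)" "depends_on L (G j)"
    and "\<exists>h'. admissible s t (F j) (G j) h' \<and> (\<integral>\<^sup>+x. h' x \<partial>gauss) = ennreal (c * (I / c) ^ (2 ^ j))"
proof -
  show F: "lcb (F j)" "depends_on L (F j)" for j
    unfolding F_def using f by (induction j) (auto intro: lcb_conv depends_on_conv)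
  show G: "lcb (G j)" "depends_on L (G j)" for j
    unfolding G_def using g by (induction j) (auto intro: lcb_conv depends_on_conv)
  show "\<exists>h'. admissible s t (F j) (G j) h' \<and> (\<integral>\<^sup>+x. h' x \<partial>gauss) = ennreal (c * (I / c) ^ (2 ^ j))"
  proof (induction j)
    case 0
    then show ?case using adm I c by (auto simp: F_def G_def)
  next
    case (Suc j)
    then obtain h' where h': "admissible s t (F j) (G j) h'" "(\<integral>\<^sup>+x. h' x \<partial>gauss) = ennreal (c * (I / c) ^ (2 ^ j))"
      by blast
    have "h' \<in> borel_measurable borel" using h'(1) by (simp add: admissible_def)
    then have "(\<integral>\<^sup>+w. conv_bound c h' w \<partial>gauss) = ennreal (1 / c) * (ennreal (c * (I / c) ^ (2 ^ j)))\<^sup>2"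
      by (simp add: nn_integral_conv_bound h'(2))
    also have "\<dots> = ennreal (c * (I / c) ^ (2 ^ Suc j))"
      using c(1) I(2) by (simp add: power2_eq_square power_mult mult.commute[of 2] flip: ennreal_mult)
    finally show ?case
      using admissible_conv[OF s c F(1,2) G(1,2) h'(1)]
      by (auto simp: F_def G_def)
  qed
qed

lemma admissible_swap: "admissible s t f g h \<Longrightarrow> admissible (1 - s) (1 - t) g f h"
  unfolding admissible_def by (simp add: add.commute mult.commute)

text \<open>With \<open>y\<close> frozen, \<open>h\<close> is bounded below along the affine map
  that sends \<open>x\<close> to the combination of \<open>x\<close> and \<open>y\<close>; its
  Jacobian and a quotient of Gaussian densities appear, and \<open>M\<close> turns the power
  \<open>1 - s\<close> of \<open>f\<close> into \<open>f\<close> itself. On the balls the exponent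
  differs from its value at the centres by an error linear in their norms, which is essential since
  the centres will move to infinity while \<rho> stays fixed.\<close>

lemma admissible_lower_one_sided:
  fixes f g :: "'a::euclidean_space \<Rightarrow> real"
  assumes s: "0 < s" "s < 1" and t: "0 < t" "t < 1" and f: "lcb f"
    and adm: "admissible s t f g h" and \<rho>: "0 \<le> \<rho>"
    and M: "0 < M" "\<And>x. x \<in> cball a \<rho> \<Longrightarrow> f x \<le> M" and y: "y \<in> cball b \<rho>"
  shows "ennreal ((1 - t) ^ DIM('a)
      * exp (((norm a)\<^sup>2 - (norm ((1 - t) *\<^sub>R a + t *\<^sub>R b))\<^sup>2) / 2 - (2 * \<rho> * (norm a + norm b) + \<rho>\<^sup>2))
      * (M powr (- s) * g y powr s * (\<integral>x. indicator (cball a \<rho>) x * f x \<partial>gauss)))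
    \<le> (\<integral>\<^sup>+x. h x \<partial>gauss)"
proof -
  define z where "z = (1 - t) *\<^sub>R a + t *\<^sub>R b"
  define D where "D = 2 * \<rho> * (norm a + norm b) + \<rho>\<^sup>2"
  define k where "k = (1 - t) ^ DIM('a) * exp (((norm a)\<^sup>2 - (norm z)\<^sup>2) / 2 - D) * (M powr (- s) * g y powr s)"
  have h[measurable]: "h \<in> borel_measurable borel" using adm by (simp add: admissible_def)
  have fm[measurable]: "f \<in> borel_measurable borel" by (rule lcbD(1)[OF f])
  have fn: "0 \<le> f x" for x by (rule lcbD(3)[OF f])
  have k0: "0 \<le> k" using t by (simp add: k_def)
  have zn: "norm z \<le> norm a + norm b"
  proof -
    have "norm z \<le> (1 - t) * norm a + t * norm b"
      unfolding z_def using t norm_triangle_ineq[of "(1 - t) *\<^sub>R a" "t *\<^sub>R b"] by simp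
    also have "\<dots> \<le> 1 * norm a + 1 * norm b" using t by (intro add_mono mult_right_mono) auto
    finally show ?thesis by simp
  qed
  have point: "ennreal (k * (indicator (cball a \<rho>) x * f x)) \<le> h (t *\<^sub>R y + (1 - t) *\<^sub>R x)
      * ennreal ((1 - t) ^ DIM('a) * exp (((norm x)\<^sup>2 - (norm (t *\<^sub>R y + (1 - t) *\<^sub>R x))\<^sup>2) / 2))" for x
  proof (cases "x \<in> cball a \<rho>")
    case True
    define w where "w = t *\<^sub>R y + (1 - t) *\<^sub>R x"
    have xa: "norm (x - a) \<le> \<rho>" and yb: "norm (y - b) \<le> \<rho>"
      using True y by (auto simp: dist_norm norm_minus_commute)
    have na: "norm a \<le> norm x + \<rho>" using xa norm_triangle_ineq2[of a x] by (simp add: norm_minus_commute)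
    have "(norm a)\<^sup>2 - 2 * \<rho> * norm a \<le> (norm x)\<^sup>2"
    proof (cases "norm a \<le> \<rho>")
      case True
      have "norm a * norm a \<le> 2 * \<rho> * norm a" using True \<rho> by (intro mult_right_mono) auto
      then have "(norm a)\<^sup>2 - 2 * \<rho> * norm a \<le> 0" by (simp add: power2_eq_square)
      then show ?thesis by (rule order_trans) simp
    next
      case False
      then have "(norm a - \<rho>)\<^sup>2 \<le> (norm x)\<^sup>2" using na by (intro power_mono) auto
      moreover have "(norm a - \<rho>)\<^sup>2 = (norm a)\<^sup>2 - 2 * \<rho> * norm a + \<rho>\<^sup>2" by (simp add: power2_diff)
      ultimately show ?thesis using zero_le_power2[of \<rho>] by linarith
    qed
    moreover have "(norm w)\<^sup>2 \<le> (norm z)\<^sup>2 + 2 * \<rho> * (norm a + norm b) + \<rho>\<^sup>2"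
    proof -
      have "w - z = (1 - t) *\<^sub>R (x - a) + t *\<^sub>R (y - b)" by (simp add: w_def z_def algebra_simps)
      then have "norm (w - z) \<le> (1 - t) * norm (x - a) + t * norm (y - b)"
        using t norm_triangle_ineq[of "(1 - t) *\<^sub>R (x - a)" "t *\<^sub>R (y - b)"] by simp
      also have "\<dots> \<le> (1 - t) * \<rho> + t * \<rho>" using t xa yb by (intro add_mono mult_left_mono) auto
      finally have "norm w \<le> norm z + \<rho>"
        using norm_triangle_ineq2[of w z] by (simp add: algebra_simps)
      then have "(norm w)\<^sup>2 \<le> (norm z + \<rho>)\<^sup>2" by (intro power_mono) auto
      also have "\<dots> = (norm z)\<^sup>2 + 2 * \<rho> * norm z + \<rho>\<^sup>2" by (simp add: power2_sum)
      also have "\<dots> \<le> (norm z)\<^sup>2 + 2 * \<rho> * (norm a + norm b) + \<rho>\<^sup>2"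
        using zn \<rho> by (intro add_mono mult_left_mono) auto
      finally show ?thesis .
    qed
    moreover have "2 * \<rho> * (norm a + norm b) = 2 * \<rho> * norm a + 2 * \<rho> * norm b" "0 \<le> 2 * \<rho> * norm b" "0 \<le> 2 * \<rho> * norm a"
      using \<rho> by (simp_all add: algebra_simps)
    ultimately have "((norm a)\<^sup>2 - (norm z)\<^sup>2) / 2 - D \<le> ((norm x)\<^sup>2 - (norm w)\<^sup>2) / 2"
      using zero_le_power2[of \<rho>] unfolding D_def by argo
    then have e: "exp (((norm a)\<^sup>2 - (norm z)\<^sup>2) / 2 - D) \<le> exp (((norm x)\<^sup>2 - (norm w)\<^sup>2) / 2)" by simp
    have fx: "f x * M powr (- s) \<le> f x powr (1 - s)"
    proof (cases "f x = 0")
      case False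
      then have "f x = f x powr (1 - s) * f x powr s" using fn[of x] by (simp flip: powr_add)
      also have "\<dots> \<le> f x powr (1 - s) * M powr s"
        using M(2)[OF True] fn[of x] s by (intro mult_left_mono powr_mono2) auto
      finally have "f x * M powr (- s) \<le> f x powr (1 - s) * M powr s * M powr (- s)"
        by (intro mult_right_mono) auto
      then show ?thesis using M(1) by (simp add: mult.assoc flip: powr_add)
    qed simp
    have "k * f x = (f x * M powr (- s)) * g y powr s * ((1 - t) ^ DIM('a) * exp (((norm a)\<^sup>2 - (norm z)\<^sup>2) / 2 - D))"
      by (simp add: k_def)
    also have "\<dots> \<le> f x powr (1 - s) * g y powr s * ((1 - t) ^ DIM('a) * exp (((norm x)\<^sup>2 - (norm w)\<^sup>2) / 2))"
      using e fx t by (intro mult_mono) auto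
    finally have "ennreal (k * f x) \<le> ennreal (f x powr (1 - s) * g y powr s) * ennreal ((1 - t) ^ DIM('a) * exp (((norm x)\<^sup>2 - (norm w)\<^sup>2) / 2))"
      using t by (simp add: ennreal_leI flip: ennreal_mult)
    also have "\<dots> \<le> h ((1 - t) *\<^sub>R x + t *\<^sub>R y) * ennreal ((1 - t) ^ DIM('a) * exp (((norm x)\<^sup>2 - (norm w)\<^sup>2) / 2))"
      using adm unfolding admissible_def by (intro mult_right_mono) (blast | simp)+
    finally show ?thesis using True by (simp add: w_def add.commute)
  qed simp
  have int: "integrable gauss (\<lambda>x. indicator (cball a \<rho>) x * f x)"
    using lcbD(4)[OF f] by (rule Bochner_Integration.integrable_bound) (auto simp: indicator_def)
  have "ennreal (k * (\<integral>x. indicator (cball a \<rho>) x * f x \<partial>gauss))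
     = (\<integral>\<^sup>+x. ennreal (k * (indicator (cball a \<rho>) x * f x)) \<partial>gauss)"
    using int k0 fn by (subst nn_integral_eq_integral) auto
  also have "\<dots> \<le> (\<integral>\<^sup>+x. h (t *\<^sub>R y + (1 - t) *\<^sub>R x)
      * ennreal ((1 - t) ^ DIM('a) * exp (((norm x)\<^sup>2 - (norm (t *\<^sub>R y + (1 - t) *\<^sub>R x))\<^sup>2) / 2)) \<partial>gauss)"
    by (intro nn_integral_mono point)
  also have "\<dots> = (\<integral>\<^sup>+x. h x \<partial>gauss)"
    using t by (subst nn_integral_gauss_affine[of h "1 - t" "t *\<^sub>R y"]) simp_all
  finally show ?thesis by (simp add: k_def D_def z_def mult.assoc)
qed

text \<open>The supremum over \<open>S\<close> need not be attained; half of it is enough and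
  accounts for the \<open>ln 2\<close> in the crude bound.\<close>

lemma sup_near:
  fixes f :: "'a \<Rightarrow> real"
  assumes bd: "\<And>x. f x \<le> C" and pos: "x0 \<in> S" "0 < f x0"
  obtains M x where "0 < M" "\<And>x. x \<in> S \<Longrightarrow> f x \<le> M" "x \<in> S" "M / 2 \<le> f x"
proof -
  define M where "M = Sup (f ` S)"
  have bdd: "bdd_above (f ` S)" using bd by (auto simp: bdd_above_def)
  have le: "f x \<le> M" if "x \<in> S" for x unfolding M_def using bdd that by (rule cSUP_upper[rotated])
  then have M: "0 < M" using pos by force
  then have "M / 2 < M" by simp
  then obtain x where "x \<in> S" "M / 2 < f x"
    unfolding M_def using pos(1) by (subst (asm) less_cSUP_iff[OF _ bdd]) auto
  then show ?thesis using that[of M x] M le by auto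
qed

text \<open>The geometric mean, with weights \<open>1 - s\<close> and \<open>s\<close>, of the
  one-sided bound and its mirror image under \<open>admissible_swap\<close>. The upper bounds
  \<open>Mf\<close>, \<open>Mg\<close> cancel against the values at near-maximal points, up to the
  factor 2 to the power \<open>2 * s * (1 - s)\<close>, which is at most 2. What remains is the
  sharp quadratic form at the centres, with errors of lower order.\<close>

lemma admissible_lower:
  fixes f g :: "'a::euclidean_space \<Rightarrow> real"
  assumes s: "0 < s" "s < 1" and t: "0 < t" "t < 1" and f: "lcb f" and g: "lcb g"
    and adm: "admissible s t f g h" and \<rho>: "0 \<le> \<rho>"
    and A: "0 < A" "A \<le> (\<integral>x. indicator (cball a \<rho>) x * f x \<partial>gauss)"
    and B: "0 < B" "B \<le> (\<integral>x. indicator (cball b \<rho>) x * g x \<partial>gauss)"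
  shows "ennreal (exp (real DIM('a) * ((1 - s) * ln (1 - t) + s * ln t) - ln 2 - (2 * \<rho> * (norm a + norm b) + \<rho>\<^sup>2)
      + ((1 - s) * (norm a)\<^sup>2 + s * (norm b)\<^sup>2 - (norm ((1 - t) *\<^sub>R a + t *\<^sub>R b))\<^sup>2) / 2
      + (1 - s) * ln A + s * ln B)) \<le> (\<integral>\<^sup>+x. h x \<partial>gauss)"
proof (cases "(\<integral>\<^sup>+x. h x \<partial>gauss)" rule: ennreal_cases)
  case (real I)
  define FA where "FA = (\<integral>x. indicator (cball a \<rho>) x * f x \<partial>gauss)"
  define GB where "GB = (\<integral>x. indicator (cball b \<rho>) x * g x \<partial>gauss)"
  define z where "z = (1 - t) *\<^sub>R a + t *\<^sub>R b"
  define D where "D = 2 * \<rho> * (norm a + norm b) + \<rho>\<^sup>2"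
  define n where "n = DIM('a)"
  have ex: "\<exists>x\<in>S. 0 < f x" if "0 < (\<integral>x. indicator S x * f x \<partial>gauss)" "lcb f" for S and f :: "'a \<Rightarrow> real"
  proof (rule ccontr)
    assume "\<not> ?thesis"
    then have "indicator S x * f x = 0" for x using lcbD(3)[OF that(2), of x] by (auto simp: indicator_def)
    then have "(\<lambda>x. indicator S x * f x) = (\<lambda>_. 0)" by (rule ext)
    then show False using that(1) by (simp only: lebesgue_integral_const) simp
  qed
  obtain C C' where C: "\<And>x. f x \<le> C" "\<And>x. g x \<le> C'" using f g by (auto simp: lcb_def)
  obtain x0 where x0: "x0 \<in> cball a \<rho>" "0 < f x0" using ex[OF _ f, of "cball a \<rho>"] A by auto
  obtain y0 where y0: "y0 \<in> cball b \<rho>" "0 < g y0" using ex[OF _ g, of "cball b \<rho>"] B by auto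
  obtain Mf x where Mf: "0 < Mf" "\<And>x. x \<in> cball a \<rho> \<Longrightarrow> f x \<le> Mf" "x \<in> cball a \<rho>" "Mf / 2 \<le> f x"
    using sup_near[where f = f and S = "cball a \<rho>", OF C(1) x0] by blast
  obtain Mg y where Mg: "0 < Mg" "\<And>y. y \<in> cball b \<rho> \<Longrightarrow> g y \<le> Mg" "y \<in> cball b \<rho>" "Mg / 2 \<le> g y"
    using sup_near[where f = g and S = "cball b \<rho>", OF C(2) y0] by blast
  have U: "(1 - t) ^ n * exp (((norm a)\<^sup>2 - (norm z)\<^sup>2) / 2 - D) * (Mf powr (- s) * g y powr s * FA) \<le> I" (is "?U \<le> I")
    using admissible_lower_one_sided[OF s t f adm \<rho> Mf(1,2) Mg(3)] real(1)
    unfolding real(2) by (simp add: FA_def D_def n_def z_def)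
  have W: "t ^ n * exp (((norm b)\<^sup>2 - (norm z)\<^sup>2) / 2 - D) * (Mg powr (- (1 - s)) * f x powr (1 - s) * GB) \<le> I" (is "?W \<le> I")
    using admissible_lower_one_sided[where a = b and b = a, OF _ _ _ _ g admissible_swap[OF adm] \<rho> Mg(1,2) Mf(3)] real(1) s t
    unfolding real(2) by (simp add: GB_def D_def n_def z_def add.commute)
  have pos: "0 < FA" "0 < GB" "0 < g y" "0 < f x" using A B Mf Mg by (auto simp: FA_def GB_def)
  have Upos: "0 < ?U" and Wpos: "0 < ?W" using pos t Mf(1) Mg(1) by simp_all
  have Ipos: "0 < I" using Upos U by linarith
  have lnU: "ln ?U = real n * ln (1 - t) + (((norm a)\<^sup>2 - (norm z)\<^sup>2) / 2 - D) - s * ln Mf + s * ln (g y) + ln FA"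
    using pos t Mf(1) by (simp add: ln_mult ln_realpow ln_powr)
  have lnW: "ln ?W = real n * ln t + (((norm b)\<^sup>2 - (norm z)\<^sup>2) / 2 - D) - (1 - s) * ln Mg + (1 - s) * ln (f x) + ln GB"
    using pos t Mg(1) by (simp add: ln_mult ln_realpow ln_powr algebra_simps)
  have gy: "ln Mg - ln 2 \<le> ln (g y)" and fx: "ln Mf - ln 2 \<le> ln (f x)"
    using ln_le_cancel_iff[THEN iffD2, OF _ _ Mg(4)] ln_le_cancel_iff[THEN iffD2, OF _ _ Mf(4)] Mg(1) Mf(1) pos
    by (simp_all add: ln_div)
  have FAl: "ln A \<le> ln FA" and GBl: "ln B \<le> ln GB"
    using A B pos by (simp_all add: FA_def GB_def)
  have "(1 - s) * ln ?U + s * ln ?W \<le> (1 - s) * ln I + s * ln I"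
    using U W Upos Wpos Ipos s by (intro add_mono mult_left_mono) simp_all
  also have "\<dots> = ln I" by (simp add: algebra_simps)
  finally have 1: "(1 - s) * ln ?U + s * ln ?W \<le> ln I" .
  have m1: "(1 - s) * (s * (ln Mg - ln 2)) \<le> (1 - s) * (s * ln (g y))"
    using gy s by (intro mult_left_mono) auto
  have m2: "s * ((1 - s) * (ln Mf - ln 2)) \<le> s * ((1 - s) * ln (f x))"
    using fx s by (intro mult_left_mono) auto
  have m3: "(1 - s) * ln A \<le> (1 - s) * ln FA" "s * ln B \<le> s * ln GB"
    using FAl GBl s by (simp_all add: mult_left_mono)
  have "0 \<le> (2 * s - 1)\<^sup>2" by simp
  then have "2 * (s * (1 - s)) \<le> 1" by (simp add: power2_eq_square algebra_simps)
  then have m4: "2 * (s * (1 - s)) * ln 2 \<le> 1 * ln (2::real)" by (intro mult_right_mono) auto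
  have "real n * ((1 - s) * ln (1 - t) + s * ln t) - ln 2 - D
      + ((1 - s) * (norm a)\<^sup>2 + s * (norm b)\<^sup>2 - (norm z)\<^sup>2) / 2 + (1 - s) * ln A + s * ln B
     \<le> (1 - s) * ln ?U + s * ln ?W"
    unfolding lnU lnW using m1 m2 m3 m4 by (simp add: field_simps)
  with 1 have "exp (real n * ((1 - s) * ln (1 - t) + s * ln t) - ln 2 - D
      + ((1 - s) * (norm a)\<^sup>2 + s * (norm b)\<^sup>2 - (norm z)\<^sup>2) / 2 + (1 - s) * ln A + s * ln B) \<le> I"
    using ln_ge_iff[OF Ipos] by (meson order_trans)
  then show ?thesis unfolding real(2) n_def D_def z_def by (rule ennreal_leI)
qed simp


section \<open>Means and variances under the rotation, and localisation of mass\<close>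

lemma integrable_gauss_norm_diff_square:
  "integrable gauss (\<lambda>x::'a::euclidean_space. (norm (x - a))\<^sup>2)"
proof -
  have "integrable gauss (\<lambda>x::'a. 2 * (norm x)\<^sup>2 + 2 * (norm a)\<^sup>2)"
    by (intro Bochner_Integration.integrable_add integrable_mult_right integrable_gauss_norm_square gauss.integrable_const)
  then show ?thesis
  proof (rule Bochner_Integration.integrable_bound)
    show "AE x in gauss. norm ((norm (x - a))\<^sup>2) \<le> norm (2 * (norm x)\<^sup>2 + 2 * (norm a)\<^sup>2)"
    proof (rule AE_I2)
      fix x :: 'a
      have "(norm (x - a))\<^sup>2 \<le> (norm x + norm a)\<^sup>2" by (intro power_mono norm_triangle_ineq4) simp
      also have "\<dots> \<le> 2 * (norm x)\<^sup>2 + 2 * (norm a)\<^sup>2"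
        using zero_le_power2[of "norm x - norm a"] by (simp add: power2_sum power2_diff)
      finally show "norm ((norm (x - a))\<^sup>2) \<le> norm (2 * (norm x)\<^sup>2 + 2 * (norm a)\<^sup>2)" by simp
    qed
  qed simp
qed

lemma integrable_gauss_id: "integrable gauss (\<lambda>x::'a::euclidean_space. x)"
  using integrable_gauss_norm by (subst (asm) integrable_norm_iff) simp_all

text \<open>Dividing a sum of two independent copies by sqrt 2 multiplies the mean by sqrt 2 and
  leaves the variance unchanged. The powers of \<open>A\<close> are due to the mass of
  \<open>conv f\<close>, which is the square of that of \<open>f\<close>.\<close>

lemma conv_moments:
  fixes f :: "'a::euclidean_space \<Rightarrow> real"
  assumes f: "lcb f"
  defines "A \<equiv> \<integral>x. f x \<partial>gauss"
  assumes m: "(\<integral>x. f x *\<^sub>R x \<partial>gauss) = A *\<^sub>R a"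
  shows "(\<integral>x. conv f x *\<^sub>R x \<partial>gauss) = (A\<^sup>2 * sqrt 2) *\<^sub>R a"
    and "(\<integral>x. conv f x * (norm (x - sqrt 2 *\<^sub>R a))\<^sup>2 \<partial>gauss)
      = A * (\<integral>x. f x * (norm (x - a))\<^sup>2 \<partial>gauss)"
proof -
  have [measurable]: "f \<in> borel_measurable borel" by (rule lcbD(1)[OF f])
  note int_id = integrable_gauss_id
  have i0: "integrable gauss f" by (rule lcbD(4)[OF f])
  have i1: "integrable gauss (\<lambda>x. f x *\<^sub>R x)"
    by (rule integrable_lcb_mult[OF f int_id])
  have i1a: "integrable gauss (\<lambda>x. f x *\<^sub>R (x - a))"
    by (rule integrable_lcb_mult[OF f]) (intro Bochner_Integration.integrable_diff int_id gauss.integrable_const)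
  note isq = integrable_gauss_norm_diff_square[of a]
  have i2: "integrable gauss (\<lambda>x. f x * (norm (x - a))\<^sup>2)"
    using integrable_lcb_mult[OF f isq] by simp
  have s2: "(x + y) /\<^sub>R sqrt 2 - sqrt 2 *\<^sub>R a = ((x - a) + (y - a)) /\<^sub>R sqrt 2" for x y
  proof -
    have c: "sqrt 2 = inverse (sqrt 2) * (2::real)" by (simp add: field_simps)
    have "sqrt 2 *\<^sub>R a = (a + a) /\<^sub>R sqrt 2"
      using arg_cong[OF c, of "\<lambda>r. r *\<^sub>R a"] by (simp only: scaleR_scaleR[symmetric] scaleR_2)
    then show ?thesis by (simp only: scaleR_diff_right[symmetric]) (simp add: algebra_simps)
  qed
  have P1: "integrable (gauss \<Otimes>\<^sub>M gauss) (\<lambda>(x, y). f x *\<^sub>R (f y *\<^sub>R y))"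
    by (rule integrable_pair_mult[OF i0 i1])
  have P1': "integrable (gauss \<Otimes>\<^sub>M gauss) (\<lambda>(x, y). f y *\<^sub>R (f x *\<^sub>R x))"
    using gauss2.integrable_product_swap[OF P1] by (simp add: case_prod_beta')
  have "integrable (gauss \<Otimes>\<^sub>M gauss) (\<lambda>(x, y). inverse (sqrt 2) *\<^sub>R (f x *\<^sub>R (f y *\<^sub>R y) + f y *\<^sub>R (f x *\<^sub>R x)))"
    using Bochner_Integration.integrable_add[OF P1 P1'] by (simp add: case_prod_beta')
  then have Q1: "integrable (gauss \<Otimes>\<^sub>M gauss) (\<lambda>(x, y). (f x * f y) *\<^sub>R ((x + y) /\<^sub>R sqrt 2))"
    by (simp add: case_prod_beta' scaleR_add_right algebra_simps)
  have lin: "(\<integral>y. \<alpha> *\<^sub>R (f y *\<^sub>R y) + f y *\<^sub>R v \<partial>gauss) = \<alpha> *\<^sub>R (A *\<^sub>R a) + A *\<^sub>R v" for \<alpha> v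
  proof -
    have "(\<integral>y. \<alpha> *\<^sub>R (f y *\<^sub>R y) + f y *\<^sub>R v \<partial>gauss)
       = (\<integral>y. \<alpha> *\<^sub>R (f y *\<^sub>R y) \<partial>gauss) + (\<integral>y. f y *\<^sub>R v \<partial>gauss)"
      using i0 i1 by (intro Bochner_Integration.integral_add integrable_scaleR_right integrable_scaleR_left) auto
    then show ?thesis using i0 m by (simp add: A_def del: scaleR_scaleR)
  qed
  have "(\<integral>x. conv f x *\<^sub>R x \<partial>gauss) = (\<integral>x. (\<integral>y. (f x * f y) *\<^sub>R ((x + y) /\<^sub>R sqrt 2) \<partial>gauss) \<partial>gauss)"
    by (rule integral_conv[OF f _ Q1]) simp
  also have "\<dots> = (\<integral>x. (\<integral>y. (f x / sqrt 2) *\<^sub>R (f y *\<^sub>R y) + f y *\<^sub>R ((f x / sqrt 2) *\<^sub>R x) \<partial>gauss) \<partial>gauss)"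
    by (intro Bochner_Integration.integral_cong refl) (simp add: scaleR_add_right algebra_simps divide_inverse)
  also have "\<dots> = (\<integral>x. (f x / sqrt 2) *\<^sub>R (A *\<^sub>R a) + (A / sqrt 2) *\<^sub>R (f x *\<^sub>R x) \<partial>gauss)"
    unfolding lin by (intro Bochner_Integration.integral_cong refl) (simp add: mult.commute)
  also have "\<dots> = (\<integral>x. f x *\<^sub>R ((A / sqrt 2) *\<^sub>R a) + (A / sqrt 2) *\<^sub>R (f x *\<^sub>R x) \<partial>gauss)"
    by (intro Bochner_Integration.integral_cong refl) (simp add: mult.commute)
  also have "\<dots> = (A / sqrt 2) *\<^sub>R (A *\<^sub>R a) + (A / sqrt 2) *\<^sub>R (A *\<^sub>R a)"
    using lin[of "A / sqrt 2" "(A / sqrt 2) *\<^sub>R a"] by (simp add: add.commute mult.commute)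
  also have "\<dots> = (A\<^sup>2 * sqrt 2) *\<^sub>R a"
  proof -
    have "A / sqrt 2 * A + A / sqrt 2 * A = A\<^sup>2 * sqrt 2"
      by (simp add: field_simps power2_eq_square)
    then show ?thesis by (simp flip: scaleR_add_left)
  qed
  finally show "(\<integral>x. conv f x *\<^sub>R x \<partial>gauss) = (A\<^sup>2 * sqrt 2) *\<^sub>R a" .
  have nsq': "(norm ((p + q) /\<^sub>R sqrt 2))\<^sup>2 = (norm p)\<^sup>2 / 2 + (norm q)\<^sup>2 / 2 + p \<bullet> q" for p q :: 'a
  proof -
    have "(norm ((p + q) /\<^sub>R sqrt 2))\<^sup>2 = (norm (p + q))\<^sup>2 / 2"
      by (simp only: norm_scaleR power_mult_distrib) (simp add: power_inverse)
    then show ?thesis unfolding dot_norm[of p q] by (simp only: diff_divide_distrib)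
  qed
  note nsq = nsq'[of "_ - a" "_ - a"]
  have P2: "integrable (gauss \<Otimes>\<^sub>M gauss) (\<lambda>(x, y). f x *\<^sub>R (f y * (norm (y - a))\<^sup>2))"
    by (rule integrable_pair_mult[OF i0 i2])
  have P2': "integrable (gauss \<Otimes>\<^sub>M gauss) (\<lambda>(x, y). f y *\<^sub>R (f x * (norm (x - a))\<^sup>2))"
    using gauss2.integrable_product_swap[OF P2] by (simp add: case_prod_beta')
  have P3: "integrable (gauss \<Otimes>\<^sub>M gauss) (\<lambda>(x, y). f x * f y * ((x - a) \<bullet> (y - a)))"
  proof (rule Bochner_Integration.integrable_bound[OF Bochner_Integration.integrable_add[OF P2 P2']])
    show "AE z in gauss \<Otimes>\<^sub>M gauss. norm (case z of (x, y) \<Rightarrow> f x * f y * ((x - a) \<bullet> (y - a)))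
       \<le> norm ((case z of (x, y) \<Rightarrow> f x *\<^sub>R (f y * (norm (y - a))\<^sup>2)) + (case z of (x, y) \<Rightarrow> f y *\<^sub>R (f x * (norm (x - a))\<^sup>2)))"
    proof (rule AE_I2, clarsimp)
      fix x y
      have "\<bar>(x - a) \<bullet> (y - a)\<bar> \<le> norm (x - a) * norm (y - a)" by (rule Cauchy_Schwarz_ineq2)
      also have "\<dots> \<le> (norm (y - a))\<^sup>2 + (norm (x - a))\<^sup>2"
        using zero_le_power2[of "norm (x - a) - norm (y - a)"] zero_le_power2[of "norm (x - a)"] zero_le_power2[of "norm (y - a)"]
        unfolding power2_diff by linarith
      finally have "f x * f y * \<bar>(x - a) \<bullet> (y - a)\<bar> \<le> f x * f y * ((norm (y - a))\<^sup>2 + (norm (x - a))\<^sup>2)"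
        using lcbD(3)[OF f] by (intro mult_left_mono) auto
      also have "\<dots> = f x * (f y * (norm (y - a))\<^sup>2) + f y * (f x * (norm (x - a))\<^sup>2)"
        by (simp add: algebra_simps)
      finally show "\<bar>f x * f y * ((x - a) \<bullet> (y - a))\<bar> \<le> \<bar>f x * (f y * (norm (y - a))\<^sup>2) + f y * (f x * (norm (x - a))\<^sup>2)\<bar>"
        using lcbD(3)[OF f] by (simp add: abs_mult)
    qed
  qed simp
  have Q2: "integrable (gauss \<Otimes>\<^sub>M gauss) (\<lambda>(x, y). (f x * f y) *\<^sub>R (norm ((x + y) /\<^sub>R sqrt 2 - sqrt 2 *\<^sub>R a))\<^sup>2)"
  proof -
    have "integrable (gauss \<Otimes>\<^sub>M gauss) (\<lambda>z. (1 / 2) * (case z of (x, y) \<Rightarrow> f x *\<^sub>R (f y * (norm (y - a))\<^sup>2))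
       + (1 / 2) * (case z of (x, y) \<Rightarrow> f y *\<^sub>R (f x * (norm (x - a))\<^sup>2))
       + (case z of (x, y) \<Rightarrow> f x * f y * ((x - a) \<bullet> (y - a))))"
      by (intro Bochner_Integration.integrable_add integrable_mult_right P2 P2' P3)
    also have "(\<lambda>z. (1 / 2) * (case z of (x, y) \<Rightarrow> f x *\<^sub>R (f y * (norm (y - a))\<^sup>2))
       + (1 / 2) * (case z of (x, y) \<Rightarrow> f y *\<^sub>R (f x * (norm (x - a))\<^sup>2))
       + (case z of (x, y) \<Rightarrow> f x * f y * ((x - a) \<bullet> (y - a))))
      = (\<lambda>(x, y). (f x * f y) *\<^sub>R (norm ((x + y) /\<^sub>R sqrt 2 - sqrt 2 *\<^sub>R a))\<^sup>2)"
      unfolding s2 nsq by (auto simp: fun_eq_iff algebra_simps)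
    finally show ?thesis .
  qed
  have cent: "(\<integral>x. f x *\<^sub>R (x - a) \<partial>gauss) = 0"
    using i0 i1 m by (simp add: scaleR_diff_right A_def)
  define V where "V = (\<integral>x. f x * (norm (x - a))\<^sup>2 \<partial>gauss)"
  have "(\<integral>x. conv f x *\<^sub>R (norm (x - sqrt 2 *\<^sub>R a))\<^sup>2 \<partial>gauss)
     = (\<integral>x. (\<integral>y. (f x * f y) *\<^sub>R (norm ((x + y) /\<^sub>R sqrt 2 - sqrt 2 *\<^sub>R a))\<^sup>2 \<partial>gauss) \<partial>gauss)"
    by (rule integral_conv[OF f _ Q2]) simp
  also have "\<dots> = (\<integral>x. (\<integral>y. (f x * (norm (x - a))\<^sup>2 / 2) * f y + (f x / 2) * (f y * (norm (y - a))\<^sup>2)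
       + (f x *\<^sub>R (x - a)) \<bullet> (f y *\<^sub>R (y - a)) \<partial>gauss) \<partial>gauss)"
    unfolding s2 nsq by (intro Bochner_Integration.integral_cong refl) (simp add: algebra_simps)
  also have "\<dots> = (\<integral>x. (f x * (norm (x - a))\<^sup>2 / 2) * A + (f x / 2) * V
       + (f x *\<^sub>R (x - a)) \<bullet> (\<integral>y. f y *\<^sub>R (y - a) \<partial>gauss) \<partial>gauss)"
    using i0 i2 i1a unfolding A_def V_def
    by (intro Bochner_Integration.integral_cong refl) (simp del: inner_scaleR_left inner_scaleR_right)
  also have "\<dots> = A * V"
    unfolding cent using i0 i2 by (simp add: V_def A_def)
  finally show "(\<integral>x. conv f x * (norm (x - sqrt 2 *\<^sub>R a))\<^sup>2 \<partial>gauss)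
      = A * (\<integral>x. f x * (norm (x - a))\<^sup>2 \<partial>gauss)"
    by (simp add: V_def)
qed

text \<open>Compares coefficients of \<open>2 ^ j\<close>: the quadratic form and the logarithms of
  the masses grow at this rate, the localisation error only like \<open>sqrt 2 ^ j\<close>.\<close>

lemma bounded_growth_imp_nonpos:
  fixes \<delta> :: real
  assumes "\<And>j. 2 ^ j * \<delta> \<le> K * sqrt 2 ^ j + K'"
  shows "\<delta> \<le> 0"
proof (rule ccontr)
  assume "\<not> \<delta> \<le> 0"
  then have \<delta>: "0 < \<delta>" by simp
  obtain j where j: "(\<bar>K\<bar> + \<bar>K'\<bar>) / \<delta> < sqrt 2 ^ j"
    using real_arch_pow[of "sqrt 2"] by auto
  have p: "2 ^ j = sqrt 2 ^ j * (sqrt 2 ^ j :: real)"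
    by (simp flip: power_mult_distrib)
  have one: "1 \<le> sqrt (2::real) ^ j" by (simp add: one_le_power)
  have "\<bar>K\<bar> + \<bar>K'\<bar> < sqrt 2 ^ j * \<delta>" using j \<delta> by (simp add: field_simps)
  then have "sqrt 2 ^ j * (\<bar>K\<bar> + \<bar>K'\<bar>) < sqrt 2 ^ j * (sqrt 2 ^ j * \<delta>)"
    by (intro mult_strict_left_mono) auto
  also have "\<dots> \<le> K * sqrt 2 ^ j + K'" using assms[of j] by (simp add: p mult.assoc)
  also have "\<dots> \<le> \<bar>K\<bar> * sqrt 2 ^ j + \<bar>K'\<bar> * sqrt 2 ^ j"
  proof (rule add_mono)
    show "K * sqrt 2 ^ j \<le> \<bar>K\<bar> * sqrt 2 ^ j" by (intro mult_right_mono) auto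
    have "K' \<le> \<bar>K'\<bar> * 1" by simp
    also have "\<dots> \<le> \<bar>K'\<bar> * sqrt 2 ^ j" using one by (intro mult_left_mono) auto
    finally show "K' \<le> \<bar>K'\<bar> * sqrt 2 ^ j" .
  qed
  finally show False by (simp add: algebra_simps)
qed

text \<open>The indicator of the ball is at least 1 minus the squared distance over the squared
  radius. The radius depends on the variance bound alone and so serves for all iterates; the
  \<open>+ 1\<close> keeps it positive when \<sigma> is 0.\<close>

lemma lcb_chebyshev:
  fixes F :: "'a::euclidean_space \<Rightarrow> real"
  assumes F: "lcb F" and V: "(\<integral>x. F x * (norm (x - m))\<^sup>2 \<partial>gauss) \<le> \<sigma> * (\<integral>x. F x \<partial>gauss)" and \<sigma>: "0 \<le> \<sigma>"
  shows "(\<integral>x. F x \<partial>gauss) / 2 \<le> (\<integral>x. indicator (cball m (sqrt (2 * \<sigma> + 1))) x * F x \<partial>gauss)"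
proof -
  define \<rho> where "\<rho> = 2 * \<sigma> + 1"
  have \<rho>: "0 < \<rho>" "2 * \<sigma> \<le> \<rho>" using \<sigma> by (simp_all add: \<rho>_def)
  have i0: "integrable gauss F" by (rule lcbD(4)[OF F])
  have i2: "integrable gauss (\<lambda>x. F x * (norm (x - m))\<^sup>2)"
    using integrable_lcb_mult[OF F integrable_gauss_norm_diff_square[of m]] by simp
  have i3: "integrable gauss (\<lambda>x. indicator (cball m (sqrt \<rho>)) x * F x)"
    using i0 by (rule Bochner_Integration.integrable_bound) (use lcbD(1)[OF F] in \<open>auto simp: indicator_def\<close>)
  define A where "A = (\<integral>x. F x \<partial>gauss)"
  have A: "0 \<le> A" unfolding A_def using lcbD(3)[OF F] by simp
  have "\<sigma> * A / \<rho> \<le> A / 2" using mult_right_mono[OF \<rho>(2) A] \<rho> by (simp add: field_simps)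
  moreover have "(\<integral>x. F x * (norm (x - m))\<^sup>2 \<partial>gauss) / \<rho> \<le> \<sigma> * A / \<rho>"
    using V \<rho> by (intro divide_right_mono) (auto simp: A_def)
  moreover have "(\<integral>x. F x - F x * (norm (x - m))\<^sup>2 / \<rho> \<partial>gauss) = A - (\<integral>x. F x * (norm (x - m))\<^sup>2 \<partial>gauss) / \<rho>"
    using i0 i2 by (simp add: A_def)
  moreover have "(\<integral>x. F x - F x * (norm (x - m))\<^sup>2 / \<rho> \<partial>gauss) \<le> (\<integral>x. indicator (cball m (sqrt \<rho>)) x * F x \<partial>gauss)"
  proof (rule integral_mono)
    show "integrable gauss (\<lambda>x. F x - F x * (norm (x - m))\<^sup>2 / \<rho>)" using i0 i2 by simp
    show "integrable gauss (\<lambda>x. indicator (cball m (sqrt \<rho>)) x * F x)" by (rule i3)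
    fix x :: 'a
    have Fx: "0 \<le> F x" by (rule lcbD(3)[OF F])
    show "F x - F x * (norm (x - m))\<^sup>2 / \<rho> \<le> indicator (cball m (sqrt \<rho>)) x * F x"
    proof (cases "x \<in> cball m (sqrt \<rho>)")
      case True then show ?thesis using Fx \<rho> by simp
    next
      case False
      then have "sqrt \<rho> \<le> norm (x - m)" by (simp add: dist_norm norm_minus_commute)
      then have "(sqrt \<rho>)\<^sup>2 \<le> (norm (x - m))\<^sup>2" using \<rho> by (intro power_mono) auto
      then have "F x * \<rho> \<le> F x * (norm (x - m))\<^sup>2" using Fx \<rho> by (intro mult_left_mono) auto
      then show ?thesis using False \<rho> by (simp add: field_simps)
    qed
  qed
  ultimately show ?thesis unfolding A_def[symmetric] \<rho>_def[symmetric] by linarith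
qed

lemma conv_iterate_moments:
  fixes f :: "'a::euclidean_space \<Rightarrow> real"
  assumes f: "lcb f" and A: "0 < (\<integral>x. f x \<partial>gauss)"
  defines "A \<equiv> \<integral>x. f x \<partial>gauss"
  defines "a \<equiv> (\<integral>x. f x *\<^sub>R x \<partial>gauss) /\<^sub>R A" and "F \<equiv> \<lambda>j. (conv ^^ j) f"
  shows "lcb (F j)" "(\<integral>x. F j x \<partial>gauss) = A ^ 2 ^ j"
    "(\<integral>x. F j x *\<^sub>R x \<partial>gauss) = (\<integral>x. F j x \<partial>gauss) *\<^sub>R (sqrt 2 ^ j *\<^sub>R a)"
    "(\<integral>x. F j x * (norm (x - sqrt 2 ^ j *\<^sub>R a))\<^sup>2 \<partial>gauss)
      = ((\<integral>x. f x * (norm (x - a))\<^sup>2 \<partial>gauss) / A) * (\<integral>x. F j x \<partial>gauss)"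
proof (induction j)
  case 0
  { case 1 then show ?case using f by (simp add: F_def) }
  { case 2 then show ?case by (simp add: F_def A_def) }
  { case 3 then show ?case using A by (simp add: F_def a_def flip: A_def) }
  { case 4 then show ?case using A by (simp add: F_def flip: A_def) }
next
  case (Suc j)
  note mom = conv_moments[OF Suc(1) Suc(3)]
  have FS: "F (Suc j) = conv (F j)" by (simp add: F_def)
  { case 1 then show ?case unfolding FS using Suc(1) by (rule lcb_conv) }
  { case 2 then show ?case unfolding FS using Suc by (simp add: integral_conv_1 power_mult mult.commute[of 2]) }
  { case 3 then show ?case unfolding FS mom(1) using Suc by (simp add: integral_conv_1 mult_ac) }
  { case 4 then show ?case unfolding FS using mom(2) Suc(4) Suc(1)
      by (simp add: integral_conv_1 power2_eq_square mult_ac) }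
qed

text \<open>
  Rotating a pair of copies replaces \<open>f\<close> by its self-convolution, at the price of an even function
  on the fibres, to which the constant \<open>c\<close> applies. Iterating doubles the barycenters' quadratic
  form while the spread stays bounded, so the crude bound \<open>admissible_lower\<close> becomes sharp.
\<close>

theorem even_const_barycenter:
  fixes f g :: "'a::euclidean_space \<Rightarrow> real"
  assumes s: "0 < s" "s < 1" and t: "0 < t" "t < 1" and c: "0 < c" "even_const L s t c"
    and f: "lcb f" "depends_on L f" and g: "lcb g" "depends_on L g"
    and adm: "admissible s t f g h"
    and A: "0 < (\<integral>x. f x \<partial>gauss)" and B: "0 < (\<integral>x. g x \<partial>gauss)"
  defines "A \<equiv> \<integral>x. f x \<partial>gauss" and "B \<equiv> \<integral>x. g x \<partial>gauss"
  defines "a \<equiv> (\<integral>x. f x *\<^sub>R x \<partial>gauss) /\<^sub>R A" and "b \<equiv> (\<integral>x. g x *\<^sub>R x \<partial>gauss) /\<^sub>R B"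
  defines "Q \<equiv> (1 - s) * (norm a)\<^sup>2 + s * (norm b)\<^sup>2 - (norm ((1 - t) *\<^sub>R a + t *\<^sub>R b))\<^sup>2"
  shows "ennreal (c * exp (Q / 2) * (A powr (1 - s) * B powr s)) \<le> (\<integral>\<^sup>+x. h x \<partial>gauss)"
proof (cases "(\<integral>\<^sup>+x. h x \<partial>gauss)" rule: ennreal_cases)
  case (real I)
  define F where "F = (\<lambda>j. (conv ^^ j) f)"
  define G where "G = (\<lambda>j. (conv ^^ j) g)"
  have AB: "0 < A" "0 < B" using A B by (simp_all add: A_def B_def)
  define \<sigma> where "\<sigma> = (\<integral>x. f x * (norm (x - a))\<^sup>2 \<partial>gauss) / A + (\<integral>x. g x * (norm (x - b))\<^sup>2 \<partial>gauss) / B"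
  have V: "0 \<le> (\<integral>x. f x * (norm (x - a))\<^sup>2 \<partial>gauss) / A" "0 \<le> (\<integral>x. g x * (norm (x - b))\<^sup>2 \<partial>gauss) / B"
    using AB lcbD(3)[OF f(1)] lcbD(3)[OF g(1)] by simp_all
  have \<sigma>: "0 \<le> \<sigma>" using V by (simp add: \<sigma>_def)
  define \<rho> where "\<rho> = sqrt (2 * \<sigma> + 1)"
  have \<rho>: "0 \<le> \<rho>" using \<sigma> by (simp add: \<rho>_def)
  have FG: "(conv ^^ j) f = F j" "(conv ^^ j) g = G j" for j by (simp_all add: F_def G_def)
  note Fm = conv_iterate_moments[OF f(1) A, folded A_def, folded a_def, unfolded FG]
  note Gm = conv_iterate_moments[OF g(1) B, folded B_def, folded b_def, unfolded FG]
  define K' where "K' = real DIM('a) * ((1 - s) * ln (1 - t) + s * ln t) - 2 * ln 2 - \<rho>\<^sup>2"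
  define Y where "Y = (1 - s) * ln A + s * ln B"
  \<comment> \<open>The crude bound for the iterates number \<open>j\<close>, whose masses are
    \<open>A ^ 2 ^ j\<close> and \<open>B ^ 2 ^ j\<close> and whose centres are \<open>a\<close> and
    \<open>b\<close> stretched by \<open>sqrt 2 ^ j\<close>, with the radius \<rho> unchanged.
    Everything of size \<open>2 ^ j\<close> is collected in the last summand.\<close>
  have step: "exp (K' - 2 * \<rho> * sqrt 2 ^ j * (norm a + norm b) + 2 ^ j * (Q / 2 + Y)) \<le> c * (I / c) ^ 2 ^ j" for j
  proof -
    obtain h' where h': "admissible s t (F j) (G j) h'" "(\<integral>\<^sup>+x. h' x \<partial>gauss) = ennreal (c * (I / c) ^ (2 ^ j))"
      using conv_iterate(5)[OF s c f g adm real(2,1)] unfolding F_def G_def by blast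
    have ca: "A ^ 2 ^ j / 2 \<le> (\<integral>x. indicator (cball (sqrt 2 ^ j *\<^sub>R a) \<rho>) x * F j x \<partial>gauss)"
    proof -
      have "((\<integral>x. f x * (norm (x - a))\<^sup>2 \<partial>gauss) / A) * A ^ 2 ^ j \<le> \<sigma> * A ^ 2 ^ j"
        using V AB by (intro mult_right_mono) (auto simp: \<sigma>_def)
      then show ?thesis
        using lcb_chebyshev[OF Fm(1) _ \<sigma>, of j "sqrt 2 ^ j *\<^sub>R a"]
        unfolding Fm(4) Fm(2) \<rho>_def[symmetric] by blast
    qed
    have cb: "B ^ 2 ^ j / 2 \<le> (\<integral>x. indicator (cball (sqrt 2 ^ j *\<^sub>R b) \<rho>) x * G j x \<partial>gauss)"
    proof -
      have "((\<integral>x. g x * (norm (x - b))\<^sup>2 \<partial>gauss) / B) * B ^ 2 ^ j \<le> \<sigma> * B ^ 2 ^ j"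
        using V AB by (intro mult_right_mono) (auto simp: \<sigma>_def)
      then show ?thesis
        using lcb_chebyshev[OF Gm(1) _ \<sigma>, of j "sqrt 2 ^ j *\<^sub>R b"]
        unfolding Gm(4) Gm(2) \<rho>_def[symmetric] by blast
    qed
    have sq: "(sqrt 2 ^ j)\<^sup>2 = (2::real) ^ j"
      by (simp flip: power_mult add: mult.commute[of j] power_mult)
    have comb: "(1 - t) *\<^sub>R sqrt 2 ^ j *\<^sub>R a + t *\<^sub>R sqrt 2 ^ j *\<^sub>R b = sqrt 2 ^ j *\<^sub>R ((1 - t) *\<^sub>R a + t *\<^sub>R b)"
      by (simp add: scaleR_add_right mult.commute)
    have nq: "(1 - s) * (norm (sqrt 2 ^ j *\<^sub>R a))\<^sup>2 + s * (norm (sqrt 2 ^ j *\<^sub>R b))\<^sup>2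
        - (norm ((1 - t) *\<^sub>R sqrt 2 ^ j *\<^sub>R a + t *\<^sub>R sqrt 2 ^ j *\<^sub>R b))\<^sup>2 = 2 ^ j * Q"
    proof -
      have "(norm (sqrt 2 ^ j *\<^sub>R v))\<^sup>2 = 2 ^ j * (norm v)\<^sup>2" for v :: 'a
        by (simp add: power_mult_distrib sq)
      then show ?thesis
        unfolding comb by (simp only: Q_def right_diff_distrib distrib_left mult.left_commute)
    qed
    have nn: "2 * \<rho> * (norm (sqrt 2 ^ j *\<^sub>R a) + norm (sqrt 2 ^ j *\<^sub>R b)) = 2 * \<rho> * sqrt 2 ^ j * (norm a + norm b)"
      by (simp add: algebra_simps)
    have lns: "ln (A ^ 2 ^ j / 2) = 2 ^ j * ln A - ln 2" "ln (B ^ 2 ^ j / 2) = 2 ^ j * ln B - ln 2"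
      using AB by (simp_all add: ln_div ln_realpow)
    have "ennreal (exp (real DIM('a) * ((1 - s) * ln (1 - t) + s * ln t) - ln 2
        - (2 * \<rho> * sqrt 2 ^ j * (norm a + norm b) + \<rho>\<^sup>2)
        + 2 ^ j * Q / 2 + (1 - s) * (2 ^ j * ln A - ln 2) + s * (2 ^ j * ln B - ln 2))) \<le> ennreal (c * (I / c) ^ 2 ^ j)"
      using admissible_lower[OF s t Fm(1) Gm(1) h'(1) \<rho> _ ca _ cb] AB
      unfolding nq nn lns h'(2) by simp
    moreover have "real DIM('a) * ((1 - s) * ln (1 - t) + s * ln t) - ln 2
        - (2 * \<rho> * sqrt 2 ^ j * (norm a + norm b) + \<rho>\<^sup>2)
        + 2 ^ j * Q / 2 + (1 - s) * (2 ^ j * ln A - ln 2) + s * (2 ^ j * ln B - ln 2)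
       = K' - 2 * \<rho> * sqrt 2 ^ j * (norm a + norm b) + 2 ^ j * (Q / 2 + Y)"
      by (simp add: K'_def Y_def algebra_simps)
    ultimately show ?thesis using real(1) c(1) by (simp add: ennreal_le_iff)
  qed
  have I: "0 < I"
  proof (rule ccontr)
    assume "\<not> 0 < I"
    then have "I = 0" using real(1) by simp
    then show False using step[of 0] by (simp add: not_le[symmetric])
  qed
  \<comment> \<open>Logarithms of \<open>step\<close>: its right side contributes
    \<open>2 ^ j\<close> times \<open>ln I - ln c\<close>, so both constants \<open>c\<close> and
    \<open>K'\<close> that do not scale drop out of the limit except through this
    difference.\<close>
  have "2 ^ j * (Q / 2 + Y - (ln I - ln c)) \<le> (2 * \<rho> * (norm a + norm b)) * sqrt 2 ^ j + (ln c - K')" for j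
  proof -
    have "K' - 2 * \<rho> * sqrt 2 ^ j * (norm a + norm b) + 2 ^ j * (Q / 2 + Y) \<le> ln (c * (I / c) ^ 2 ^ j)"
      using step[of j] I c(1) by (subst ln_ge_iff) auto
    also have "\<dots> = ln c + 2 ^ j * (ln I - ln c)"
      using I c(1) by (simp add: ln_mult ln_realpow ln_div)
    finally show ?thesis by (simp add: algebra_simps)
  qed
  then have "Q / 2 + Y - (ln I - ln c) \<le> 0" by (rule bounded_growth_imp_nonpos)
  then have "exp (ln c + Q / 2 + Y) \<le> I" using I by (subst ln_ge_iff[symmetric]) auto
  moreover have "exp (ln c + Q / 2 + Y) = c * exp (Q / 2) * (A powr (1 - s) * B powr s)"
    using c(1) AB by (simp add: exp_add Y_def powr_def)
  ultimately show ?thesis unfolding real(2) by (simp add: ennreal_leI)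
qed simp

section \<open>Even log-concave densities on the line\<close>

text \<open>\<open>y\<close> is a convex combination of \<open>x\<close> and \<open>- x\<close>, at
  which \<open>f\<close> takes the same value.\<close>

lemma even_log_concave_decreasing:
  fixes f :: "real \<Rightarrow> real"
  assumes f: "log_concave f" and even: "\<And>x. f (- x) = f x" and le: "\<bar>y\<bar> \<le> \<bar>x\<bar>"
  shows "f x \<le> f y"
proof (cases "\<bar>y\<bar> = \<bar>x\<bar>")
  case True
  then have "y = x \<or> y = - x" by (auto simp: abs_if split: if_splits)
  then show ?thesis using even by auto
next
  case False
  then have lt: "\<bar>y\<bar> < \<bar>x\<bar>" using le by simp
  then have x: "x \<noteq> 0" by auto
  define s where "s = (1 - y / x) / 2"
  have "\<bar>y / x\<bar> < 1" using lt by simp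
  then have s: "0 < s" "s < 1" by (auto simp: s_def abs_less_iff simp del: abs_divide)
  have "(1 - s) *\<^sub>R x + s *\<^sub>R (- x) = y" using x by (simp add: s_def field_simps)
  then have "f x powr (1 - s) * f x powr s \<le> f y"
    using log_concaveD(2)[OF f s, of x "- x"] even by simp
  moreover have "f x powr (1 - s) * f x powr s = f x"
    using log_concaveD(1)[OF f, of x] by (cases "f x = 0") (simp_all flip: powr_add)
  ultimately show ?thesis by simp
qed

text \<open>Density with respect to Lebesgue measure; in the application it is a marginal relative
  to \<open>gauss\<close>, multiplied by \<open>gauss_dens\<close>.\<close>

locale even_log_concave_density =
  fixes p :: "real \<Rightarrow> real"
  assumes p_log_concave: "log_concave p" and p_even: "\<And>x. p (- x) = p x"
    and p_measurable [measurable]: "p \<in> borel_measurable borel"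
    and p_integrable: "integrable lborel p" and p_integral: "(\<integral>x. p x \<partial>lborel) = 1"
begin

lemma p_nonneg: "0 \<le> p x"
  by (rule log_concaveD(1)[OF p_log_concave])

lemma p_decreasing: "\<bar>y\<bar> \<le> \<bar>x\<bar> \<Longrightarrow> p x \<le> p y"
  by (rule even_log_concave_decreasing[OF p_log_concave p_even])

lemma p_le_0: "p x \<le> p 0"
  by (rule p_decreasing) simp

lemma p_0_pos: "0 < p 0"
proof (rule ccontr)
  assume "\<not> 0 < p 0"
  then have "p x = 0" for x using p_le_0[of x] p_nonneg[of x] by simp
  then have "p = (\<lambda>_. 0)" by (rule ext)
  then show False using p_integral by simp
qed

lemma nn_integral_p: "(\<integral>\<^sup>+x. ennreal (p x) \<partial>lborel) = 1"
  using p_integrable p_integral p_nonneg by (simp add: nn_integral_eq_integral)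

text \<open>Both \<open>x\<close> and \<open>y\<close> are convex combinations of 0 and
  \<open>x + y\<close>, with complementary weights, so the two instances of log-concavity multiply
  to this bound.\<close>

lemma p_submultiplicative:
  assumes x: "0 \<le> x" and y: "0 \<le> y"
  shows "p (x + y) * p 0 \<le> p x * p y"
proof (cases "x = 0 \<or> y = 0")
  case False
  then have xy: "0 < x" "0 < y" using x y by auto
  define u where "u = x / (x + y)"
  have u: "0 < u" "u < 1" using xy by (auto simp: u_def)
  have ux: "(1 - u) *\<^sub>R 0 + u *\<^sub>R (x + y) = x" using xy by (simp add: u_def)
  have uy: "(1 - (1 - u)) *\<^sub>R 0 + (1 - u) *\<^sub>R (x + y) = y" using xy by (simp add: u_def field_simps)
  have "p 0 * p (x + y) = (p 0 powr (1 - u) * p (x + y) powr u) * (p 0 powr u * p (x + y) powr (1 - u))"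
  proof -
    have "p 0 powr (1 - u) * p 0 powr u = p 0" using p_0_pos by (simp flip: powr_add)
    moreover have "p (x + y) powr u * p (x + y) powr (1 - u) = p (x + y)"
      using p_nonneg[of "x + y"] by (cases "p (x + y) = 0") (simp_all flip: powr_add)
    ultimately show ?thesis by (metis mult.assoc mult.commute)
  qed
  also have "\<dots> \<le> p x * p y"
    using log_concaveD(2)[OF p_log_concave u, of 0 "x + y"] log_concaveD(2)[OF p_log_concave, of "1 - u" 0 "x + y"] u
    unfolding ux uy by (intro mult_mono) (auto simp: p_nonneg)
  finally show ?thesis by (simp add: mult.commute)
qed (use x y in auto)

lemma nn_integral_even:
  fixes f :: "real \<Rightarrow> ennreal"
  assumes [measurable]: "f \<in> borel_measurable borel" and even: "\<And>x. f (- x) = f x"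
  shows "(\<integral>\<^sup>+x. f x \<partial>lborel) = 2 * (\<integral>\<^sup>+x. f x * indicator {0<..} x \<partial>lborel)"
proof -
  have "(\<integral>\<^sup>+x. f x * indicator {..<0} x \<partial>lborel) = (\<integral>\<^sup>+x. f (0 + (-1) * x) * indicator {..<0} (0 + (-1) * x) \<partial>lborel)"
    by (subst nn_integral_real_affine[where c = "-1" and t = 0]) simp_all
  also have "\<dots> = (\<integral>\<^sup>+x. f x * indicator {0<..} x \<partial>lborel)"
    by (intro nn_integral_cong) (auto simp: even indicator_def)
  finally have neg: "(\<integral>\<^sup>+x. f x * indicator {..<0} x \<partial>lborel) = (\<integral>\<^sup>+x. f x * indicator {0<..} x \<partial>lborel)" .
  have "(\<integral>\<^sup>+x. f x \<partial>lborel) = (\<integral>\<^sup>+x. f x * indicator {0<..} x + f x * indicator {..<0} x \<partial>lborel)"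
  proof (rule nn_integral_cong_AE)
    have "AE x in lborel. x \<noteq> (0::real)" by (rule AE_lborel_singleton)
    then show "AE x in lborel. f x = f x * indicator {0<..} x + f x * indicator {..<0} x"
      by eventually_elim (auto simp: indicator_def)
  qed
  also have "\<dots> = 2 * (\<integral>\<^sup>+x. f x * indicator {0<..} x \<partial>lborel)"
    by (subst nn_integral_add) (simp_all add: neg mult_2)
  finally show ?thesis .
qed

lemma nn_integral_p_half: "(\<integral>\<^sup>+x. ennreal (p x) * indicator {0<..} x \<partial>lborel) = ennreal (1 / 2)"
proof -
  have "1 = 2 * (\<integral>\<^sup>+x. ennreal (p x) * indicator {0<..} x \<partial>lborel)"
    using nn_integral_even[of "\<lambda>x. ennreal (p x)"] by (simp add: p_even nn_integral_p)
  then show ?thesis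
  proof (cases "\<integral>\<^sup>+x. ennreal (p x) * indicator {0<..} x \<partial>lborel" rule: ennreal_cases)
    case (real c)
    with \<open>1 = _\<close> have "ennreal 1 = ennreal (2 * c)" by (simp add: ennreal_mult)
    then have "c = 1 / 2" using real(1) by (subst (asm) ennreal_inj) auto
    with real(2) show ?thesis by simp
  qed (use ennreal_mult_top in simp)
qed

text \<open>On the positive side the set is, up to an endpoint, a ray starting at \<open>r\<close>.
  The substitution of \<open>r + 2 * x\<close> and submultiplicativity at \<open>r + x\<close> and
  \<open>x\<close> bound the tail by \<delta> times the full mass of the half line, which is 1/2,
  times the Jacobian 2. The two sides together give \<open>2 * \<delta>\<close>.\<close>

lemma p_tail:
  assumes \<delta>: "0 \<le> \<delta>"
  shows "(\<integral>\<^sup>+x. ennreal (p x) * indicator {x. p x < \<delta> * p 0} x \<partial>lborel) \<le> ennreal (2 * \<delta>)"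
proof (cases "\<exists>x. p x < \<delta> * p 0")
  case True
  define S where "S = {x. p x < \<delta> * p 0}"
  define S0 where "S0 = S \<inter> {0<..}"
  have [measurable]: "S \<in> sets borel" unfolding S_def by measurable
  define r where "r = Inf (S \<inter> {0..})"
  obtain x1 where x1: "x1 \<in> S" using True by (auto simp: S_def)
  have "\<bar>x1\<bar> \<in> S" using x1 p_decreasing[of x1 "\<bar>x1\<bar>"] by (auto simp: S_def)
  then have ne: "S \<inter> {0..} \<noteq> {}" by auto
  have bdd: "bdd_below (S \<inter> {0..})" by (auto intro: bdd_belowI[of _ 0])
  have r0: "0 \<le> r" unfolding r_def using ne by (intro cInf_greatest) auto
  have up: "y \<in> S" if ry: "r < y" for y
  proof -
    obtain x where "x \<in> S \<inter> {0..}" "x < y"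
      using ry cInf_less_iff[OF ne bdd, of y] unfolding r_def by blast
    then show ?thesis using p_decreasing[of x y] by (auto simp: S_def)
  qed
  have lo: "r \<le> y" if "y \<in> S" "0 < y" for y
    unfolding r_def using that bdd by (intro cInf_lower) auto
  have half: "(\<integral>\<^sup>+x. ennreal (p x) * indicator S x * indicator {0<..} x \<partial>lborel) \<le> ennreal \<delta>"
  proof -
    have "(\<integral>\<^sup>+x. ennreal (p x) * indicator S x * indicator {0<..} x \<partial>lborel)
       \<le> (\<integral>\<^sup>+x. ennreal (p x) * indicator {r<..} x \<partial>lborel)"
    proof (rule nn_integral_mono_AE)
      have "AE x in lborel. x \<noteq> r" by (rule AE_lborel_singleton)
      then show "AE x in lborel. ennreal (p x) * indicator S x * indicator {0<..} x \<le> ennreal (p x) * indicator {r<..} x"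
        by eventually_elim (use lo in \<open>force simp: indicator_def\<close>)
    qed
    also have "\<dots> = (\<integral>\<^sup>+x. ennreal (p (r + 2 * x)) * indicator {r<..} (r + 2 * x) * 2 \<partial>lborel)"
      by (subst nn_integral_real_affine[where c = 2 and t = r]) (simp_all add: nn_integral_cmult[symmetric] mult_ac)
    also have "\<dots> \<le> (\<integral>\<^sup>+x. ennreal (2 * \<delta>) * (ennreal (p x) * indicator {0<..} x) \<partial>lborel)"
    proof (rule nn_integral_mono)
      fix x :: real
      show "ennreal (p (r + 2 * x)) * indicator {r<..} (r + 2 * x) * 2 \<le> ennreal (2 * \<delta>) * (ennreal (p x) * indicator {0<..} x)"
      proof (cases "0 < x")
        case x: True
        have "p (r + 2 * x) * p 0 \<le> p (r + x) * p x"
          using p_submultiplicative[of "r + x" x] r0 x by (simp add: add.assoc flip: mult_2)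
        also have "\<dots> \<le> (\<delta> * p 0) * p x"
          using up[of "r + x"] x p_nonneg by (intro mult_right_mono) (auto simp: S_def)
        finally have "p (r + 2 * x) \<le> \<delta> * p x" using p_0_pos by (simp add: mult_ac)
        then have "2 * p (r + 2 * x) \<le> 2 * \<delta> * p x" by simp
        then show ?thesis using x \<delta> p_nonneg
          by (simp add: ennreal_leI mult_ac flip: ennreal_mult ennreal_numeral)
      qed simp
    qed
    also have "\<dots> = ennreal (2 * \<delta>) * ennreal (1 / 2)"
      by (subst nn_integral_cmult) (simp_all only: nn_integral_p_half, measurable)
    also have "\<dots> = ennreal \<delta>"
      using \<delta> by (subst ennreal_mult[symmetric]) simp_all
    finally show ?thesis .
  qed
  have "(\<integral>\<^sup>+x. ennreal (p x) * indicator S x \<partial>lborel)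
     = 2 * (\<integral>\<^sup>+x. ennreal (p x) * indicator S x * indicator {0<..} x \<partial>lborel)"
    by (rule nn_integral_even) (auto simp: p_even S_def indicator_def)
  also have "\<dots> \<le> 2 * ennreal \<delta>" by (intro mult_left_mono half) simp
  also have "\<dots> = ennreal (2 * \<delta>)" using \<delta> by (simp flip: ennreal_numeral ennreal_mult)
  finally show ?thesis by (simp add: S_def)
next
  case False
  then have "{x. p x < \<delta> * p 0} = {}" by auto
  then show ?thesis by simp
qed

text \<open>Takes half of the logarithmic decay of \<open>p\<close>: one factor of its square will
  pay for a Cauchy-Schwarz weight, and the other is left over and is still integrable.\<close>

definition w :: "real \<Rightarrow> real" where
  "w x = sqrt (p x / p 0)"

lemma w_measurable [measurable]: "w \<in> borel_measurable borel"
  unfolding w_def[abs_def] by measurable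

lemma w_props: "0 \<le> w x" "w x \<le> 1" "\<bar>y\<bar> \<le> \<bar>x\<bar> \<Longrightarrow> w x \<le> w y" "p x = p 0 * (w x)\<^sup>2"
  using p_nonneg[of x] p_le_0[of x] p_0_pos p_decreasing[of y x]
  by (auto simp: w_def divide_right_mono)

lemma w_submultiplicative: "0 \<le> x \<Longrightarrow> 0 \<le> y \<Longrightarrow> w (x + y) \<le> w x * w y"
  using p_submultiplicative[of x y] p_0_pos
  by (simp add: w_def divide_simps flip: real_sqrt_mult)

text \<open>\<open>a\<close> is the distance at which \<open>w\<close> falls to 1/2, that is
  \<open>p\<close> to a quarter of \<open>p 0\<close>. As \<open>w\<close> halves at least over each
  further length \<open>2 * a\<close>, its integral J over the half line satisfies J \<le>
  \<open>2 * a\<close> + J/2. Since \<open>p\<close> is at most \<open>p 0 * w\<close> and has mass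
  1/2 there, \<open>p 0 * a\<close> is bounded below. All later estimates use \<open>p\<close> only
  through this scale, hence their constants are absolute.\<close>

lemma scale_exists:
  obtains a where "0 < a" "\<And>y. \<bar>y\<bar> < a \<Longrightarrow> p 0 / 4 \<le> p y"
    "(\<integral>\<^sup>+x. ennreal (w x) * indicator {0<..} x \<partial>lborel) \<le> ennreal (4 * a)" "1 / 8 \<le> p 0 * a"
proof -
  define E where "E = {x. 0 \<le> x \<and> w x \<le> 1 / 2}"
  have sq: "1 / 2 = sqrt (1 / 4)" by (simp add: real_sqrt_divide)
  have half: "1 / 2 < w x \<longleftrightarrow> p 0 / 4 < p x" for x
    unfolding w_def sq real_sqrt_less_iff using p_0_pos by (simp add: field_simps)
  have "E \<noteq> {}"
  proof
    assume "E = {}"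
    then have "\<bar>x\<bar> \<notin> E" for x by simp
    then have "1 / 2 < w \<bar>x\<bar>" for x by (simp add: E_def not_le)
    then have w_gt: "p 0 / 4 < p \<bar>x\<bar>" for x using half by blast
    have p_abs: "p \<bar>x\<bar> \<le> p x" for x by (rule p_decreasing) simp
    have "p 0 / 4 \<le> p x" for x
      using w_gt[of x] p_abs[of x] by linarith
    then have "(\<integral>\<^sup>+x. ennreal (p 0 / 4) \<partial>(lborel :: real measure)) \<le> (\<integral>\<^sup>+x. ennreal (p x) \<partial>lborel)"
      by (intro nn_integral_mono ennreal_leI)
    then have "\<top> \<le> (1 :: ennreal)" using p_0_pos by (simp add: nn_integral_p ennreal_mult_top)
    then show False using ennreal_one_less_top by (simp add: not_le[symmetric])
  qed
  define a where "a = Inf E"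
  have bdd: "bdd_below E" by (auto simp: E_def intro: bdd_belowI[of _ 0])
  have a_lt: "1 / 2 < w y" if "\<bar>y\<bar> < a" for y
  proof (rule ccontr)
    assume "\<not> 1 / 2 < w y"
    then have "\<bar>y\<bar> \<in> E" using w_props(3)[of y "\<bar>y\<bar>"] by (auto simp: E_def)
    then have "a \<le> \<bar>y\<bar>" unfolding a_def using bdd by (rule cInf_lower)
    with that show False by simp
  qed
  have "\<exists>x0>0. 0 < p x0"
  proof (rule ccontr)
    assume "\<not> ?thesis"
    then have "p x = 0" if "0 < x" for x using that p_nonneg[of x] by force
    then have "(\<integral>\<^sup>+x. ennreal (p x) * indicator {0<..} x \<partial>lborel) = (\<integral>\<^sup>+x. 0 \<partial>(lborel :: real measure))"
      by (intro nn_integral_cong) (auto simp: indicator_def)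
    then show False by (simp add: nn_integral_p_half)
  qed
  then obtain x0 where x0: "0 < x0" "0 < p x0" by blast
  define q where "q = p x0 / p 0"
  have q: "0 < q" "q \<le> 1" using x0 p_0_pos p_le_0[of x0] by (auto simp: q_def)
  \<comment> \<open>Any \<open>u\<close> in the unit interval with \<open>q powr u\<close> above 1/4
    would do: log-concavity between 0 and \<open>x0\<close> then shows that \<open>p\<close> is
    still above \<open>p 0 / 4\<close> at \<open>u * x0\<close>, so that \<open>a\<close> is
    positive.\<close>
  define u where "u = ln 4 / (2 * ln 4 + 1 - ln q)"
  have u: "0 < u" "u < 1"
    using q by (auto simp: u_def divide_simps) (smt (verit) ln_gt_zero ln_le_zero_iff)+
  have "- ln q * u < ln 4"
  proof -
    have "- ln q * ln 4 < ln 4 * (2 * ln 4 + 1 - ln q)"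
      by (simp add: algebra_simps) (smt (verit) ln_gt_zero mult_pos_pos)
    moreover have "0 < 2 * ln 4 + 1 - ln q" using q by (smt (verit) ln_gt_zero ln_le_zero_iff)
    ultimately have "(- ln q * ln 4) / (2 * ln 4 + 1 - ln q) < ln 4"
      by (simp only: pos_divide_less_eq)
    then show ?thesis by (simp add: u_def)
  qed
  then have "exp (- ln 4) < exp (u * ln q)" by (simp add: mult.commute)
  moreover have "exp (- ln 4) = (1 / 4 :: real)" by (simp add: exp_minus inverse_eq_divide)
  moreover have "exp (u * ln q) = q powr u" using q by (simp add: powr_def)
  ultimately have "1 / 4 < q powr u" by (simp only:)
  then have "p 0 * (1 / 4) < p 0 * q powr u" using p_0_pos by (intro mult_strict_left_mono) auto
  also have "\<dots> = p 0 powr (1 - u) * p x0 powr u"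
    using p_0_pos x0 by (simp add: q_def powr_divide powr_diff)
  also have "\<dots> \<le> p (u * x0)"
    using log_concaveD(2)[OF p_log_concave u, of 0 x0] by simp
  finally have ux: "1 / 2 < w (u * x0)" using half by simp
  have "u * x0 \<le> a"
    unfolding a_def
  proof (rule cInf_greatest[OF \<open>E \<noteq> {}\<close>], rule ccontr)
    fix y assume y: "y \<in> E" "\<not> u * x0 \<le> y"
    then have "w (u * x0) \<le> w y" by (intro w_props(3)) (auto simp: E_def)
    with y(1) ux show False by (simp add: E_def)
  qed
  then have a0: "0 < a" using u x0 by (smt (verit) mult_pos_pos)
  have w2a: "w (2 * a) \<le> 1 / 2"
  proof -
    have "Inf E < 2 * a" using a0 by (simp add: a_def)
    then obtain x where "x \<in> E" "x < 2 * a"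
      using cInf_less_iff[OF \<open>E \<noteq> {}\<close> bdd] by blast
    then show ?thesis using w_props(3)[of x "2 * a"] by (auto simp: E_def)
  qed
  \<comment> \<open>Truncation makes the integral finite, so that half of it can be moved to the
    other side.\<close>
  define J where "J n = (\<integral>\<^sup>+x. ennreal (w x) * indicator {0<..<real n} x \<partial>lborel)" for n :: nat
  have J: "J n \<le> ennreal (4 * a)" for n
  proof -
    have "J n \<le> (\<integral>\<^sup>+x. indicator {0<..real n} x \<partial>lborel)"
      unfolding J_def using w_props(2) by (intro nn_integral_mono) (auto simp: indicator_def)
    also have "\<dots> < \<top>" by simp
    finally obtain c where c: "J n = ennreal c" "0 \<le> c" by (cases "J n" rule: ennreal_cases) auto
    have "J n \<le> (\<integral>\<^sup>+x. indicator {0..2 * a} x + ennreal (w x) * indicator {2 * a<..<real n} x \<partial>lborel)"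
      unfolding J_def using w_props(2) by (intro nn_integral_mono) (auto simp: indicator_def)
    also have "\<dots> = ennreal (2 * a) + (\<integral>\<^sup>+x. ennreal (w x) * indicator {2 * a<..<real n} x \<partial>lborel)"
      using a0 by (subst nn_integral_add) simp_all
    also have "(\<integral>\<^sup>+x. ennreal (w x) * indicator {2 * a<..<real n} x \<partial>lborel)
       = (\<integral>\<^sup>+x. ennreal (w (x + 2 * a)) * indicator {2 * a<..<real n} (x + 2 * a) \<partial>lborel)"
      by (rule nn_integral_lborel_shift[symmetric]) simp
    also have "\<dots> \<le> (\<integral>\<^sup>+x. ennreal (1 / 2) * (ennreal (w x) * indicator {0<..<real n} x) \<partial>lborel)"
    proof (rule nn_integral_mono)
      fix x :: real
      show "ennreal (w (x + 2 * a)) * indicator {2 * a<..<real n} (x + 2 * a)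
         \<le> ennreal (1 / 2) * (ennreal (w x) * indicator {0<..<real n} x)"
      proof (cases "0 < x \<and> x + 2 * a < real n")
        case True
        have "w (x + 2 * a) \<le> w x * w (2 * a)" using True a0 by (intro w_submultiplicative) auto
        also have "\<dots> \<le> w x * (1 / 2)" using w2a w_props(1) by (intro mult_left_mono) auto
        finally have "ennreal (w (x + 2 * a)) \<le> ennreal (1 / 2 * w x)" by (simp add: ennreal_leI)
        also have "\<dots> = ennreal (1 / 2) * ennreal (w x)" using w_props(1) by (intro ennreal_mult) auto
        finally have *: "ennreal (w (x + 2 * a)) \<le> ennreal (1 / 2) * ennreal (w x)" .
        have ind: "indicator {2 * a<..<real n} (x + 2 * a) = (1::ennreal)" "indicator {0<..<real n} x = (1::ennreal)"
          using True a0 by auto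
        show ?thesis unfolding ind mult_1_right by (rule *)
      qed (auto simp: indicator_def)
    qed
    also have "\<dots> = ennreal (1 / 2) * J n"
      unfolding J_def by (rule nn_integral_cmult) simp
    finally have "J n \<le> ennreal (2 * a) + ennreal (1 / 2) * J n"
      by (simp add: add_mono)
    also have "\<dots> = ennreal (2 * a + 1 / 2 * c)"
      unfolding c(1) using c(2) a0 by (subst ennreal_mult[symmetric], simp, simp, subst ennreal_plus[symmetric]) simp_all
    finally have "c \<le> 2 * a + 1 / 2 * c"
      unfolding c(1) using c(2) a0 by (subst (asm) ennreal_le_iff) auto
    then show ?thesis using c by (simp add: ennreal_leI)
  qed
  have \<kappa>: "(\<integral>\<^sup>+x. ennreal (w x) * indicator {0<..} x \<partial>lborel) \<le> ennreal (4 * a)"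
  proof -
    have "(\<integral>\<^sup>+x. ennreal (w x) * indicator {0<..} x \<partial>lborel)
       = (\<integral>\<^sup>+x. (SUP n. ennreal (w x) * indicator {0<..<real n} x) \<partial>lborel)"
    proof (rule nn_integral_cong)
      fix x :: real
      show "ennreal (w x) * indicator {0<..} x = (SUP n. ennreal (w x) * indicator {0<..<real n} x)"
      proof (rule antisym)
        obtain n where "x < real n" using reals_Archimedean2 by blast
        then show "ennreal (w x) * indicator {0<..} x \<le> (SUP n. ennreal (w x) * indicator {0<..<real n} x)"
          by (intro SUP_upper2[of n]) (auto simp: indicator_def)
        show "(SUP n. ennreal (w x) * indicator {0<..<real n} x) \<le> ennreal (w x) * indicator {0<..} x"
          by (intro SUP_least) (auto simp: indicator_def)
      qed
    qed
    also have "\<dots> = (SUP n. J n)"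
      unfolding J_def
      by (rule nn_integral_monotone_convergence_SUP) (auto simp: incseq_def le_fun_def indicator_def)
    also have "\<dots> \<le> ennreal (4 * a)" by (intro SUP_least J)
    finally show ?thesis .
  qed
  have "ennreal (1 / 2) = (\<integral>\<^sup>+x. ennreal (p x) * indicator {0<..} x \<partial>lborel)"
    by (simp only: nn_integral_p_half)
  also have "\<dots> \<le> (\<integral>\<^sup>+x. ennreal (p 0) * (ennreal (w x) * indicator {0<..} x) \<partial>lborel)"
  proof (rule nn_integral_mono)
    fix x :: real
    have "(w x)\<^sup>2 \<le> w x" using w_props(1,2)[of x] by (simp add: power2_eq_square mult_left_le)
    then have "p x \<le> p 0 * w x" using p_0_pos by (subst w_props(4)) simp
    then show "ennreal (p x) * indicator {0<..} x \<le> ennreal (p 0) * (ennreal (w x) * indicator {0<..} x)"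
      using p_0_pos w_props(1)[of x] by (auto simp: indicator_def ennreal_leI simp flip: ennreal_mult)
  qed
  also have "\<dots> = ennreal (p 0) * (\<integral>\<^sup>+x. ennreal (w x) * indicator {0<..} x \<partial>lborel)"
    by (rule nn_integral_cmult) simp
  also have "\<dots> \<le> ennreal (p 0) * ennreal (4 * a)" by (intro mult_left_mono \<kappa>) simp
  also have "\<dots> = ennreal (p 0 * (4 * a))" using p_0_pos a0 by (simp add: ennreal_mult)
  finally have "1 / 2 \<le> p 0 * (4 * a)" using p_0_pos a0 by (subst (asm) ennreal_le_iff) auto
  then have pa: "1 / 8 \<le> p 0 * a" by simp
  show thesis
    using that[OF a0 _ \<kappa> pa] a_lt half by (simp add: less_imp_le)
qed

end

section \<open>Tail integrals and tent functions\<close>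

definition upper_tail :: "(real \<Rightarrow> real) \<Rightarrow> real \<Rightarrow> real" where
  "upper_tail \<beta> x = (\<integral>y. \<beta> y * indicator {x<..} y \<partial>lborel)"

lemma upper_tail_measurable [measurable]:
  assumes [measurable]: "\<beta> \<in> borel_measurable borel"
  shows "upper_tail \<beta> \<in> borel_measurable borel"
proof -
  have "upper_tail \<beta> = (\<lambda>x. \<integral>y. \<beta> y * (if x < y then 1 else 0) \<partial>lborel)"
    by (auto simp: upper_tail_def fun_eq_iff indicator_def intro!: Bochner_Integration.integral_cong)
  also have "\<dots> \<in> borel_measurable borel" by measurable
  finally show ?thesis .
qed

lemma integral_step_difference:
  "integrable lborel (\<lambda>x. indicator {..<y} x - indicator {..<0} x :: real)"
  "(\<integral>x. indicator {..<y} x - indicator {..<0} x \<partial>lborel) = (y :: real)"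
  "(\<integral>x. \<bar>indicator {..<y} x - indicator {..<0} x\<bar> \<partial>lborel) = \<bar>y :: real\<bar>"
proof -
  have "(\<lambda>x. indicator {..<y} x - indicator {..<0} x :: real)
     = (if 0 \<le> y then indicator {0..<y} else (\<lambda>x. - indicator {y..<0} x))"
    by (auto simp: fun_eq_iff indicator_def)
  then show "integrable lborel (\<lambda>x. indicator {..<y} x - indicator {..<0} x :: real)"
    "(\<integral>x. indicator {..<y} x - indicator {..<0} x \<partial>lborel) = (y :: real)"
    by auto
  have "(\<lambda>x. \<bar>indicator {..<y} x - indicator {..<0} x\<bar> :: real)
     = (if 0 \<le> y then indicator {0..<y} else indicator {y..<0})"
    by (auto simp: fun_eq_iff indicator_def)
  then show "(\<integral>x. \<bar>indicator {..<y} x - indicator {..<0} x\<bar> \<partial>lborel) = \<bar>y :: real\<bar>"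
    by auto
qed

text \<open>Fubini for \<open>\<beta> y\<close> times the step in \<open>x\<close> that jumps at
  \<open>y\<close>. The step at 0 is subtracted to make the kernel integrable; this changes nothing
  because \<beta> has integral 0.\<close>

lemma upper_tail_integral:
  assumes \<beta>: "integrable lborel \<beta>" "(\<integral>x. \<beta> x \<partial>lborel) = 0" and x\<beta>: "integrable lborel (\<lambda>x. x * \<beta> x)"
  shows "integrable lborel (upper_tail \<beta>)" "(\<integral>x. upper_tail \<beta> x \<partial>lborel) = (\<integral>x. x * \<beta> x \<partial>lborel)"
proof -
  have [measurable]: "\<beta> \<in> borel_measurable borel" using \<beta>(1) by auto
  let ?f = "\<lambda>y x. \<beta> y * (indicator {..<y} x - indicator {..<0} x)"
  have f: "integrable (lborel \<Otimes>\<^sub>M lborel) (\<lambda>(y, x). ?f y x)"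
  proof (rule lborel_pair.Fubini_integrable)
    show "(\<lambda>(y, x). ?f y x) \<in> borel_measurable (lborel \<Otimes>\<^sub>M lborel)"
    proof -
      have "(\<lambda>(y, x). ?f y x) = (\<lambda>(y, x). \<beta> y * ((if x < y then 1 else 0) - (if x < 0 then 1 else 0)))"
        by (auto simp: fun_eq_iff indicator_def)
      also have "\<dots> \<in> borel_measurable (lborel \<Otimes>\<^sub>M lborel)" by measurable
      finally show ?thesis .
    qed
    show "integrable lborel (\<lambda>y. \<integral>x. norm (case (y, x) of (y, x) \<Rightarrow> ?f y x) \<partial>lborel)"
      using integrable_norm[OF x\<beta>] by (simp add: abs_mult integral_step_difference mult.commute)
    show "AE y in lborel. integrable lborel (\<lambda>x. case (y, x) of (y, x) \<Rightarrow> ?f y x)"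
      using integral_step_difference(1) by simp
  qed
  have t: "(\<integral>y. ?f y x \<partial>lborel) = upper_tail \<beta> x" for x
  proof -
    have "(\<integral>y. ?f y x \<partial>lborel) = (\<integral>y. \<beta> y * indicator {x<..} y - indicator {..<0} x * \<beta> y \<partial>lborel)"
      by (intro Bochner_Integration.integral_cong) (auto simp: indicator_def)
    also have "\<dots> = upper_tail \<beta> x"
      using \<beta> integrable_mult_indicator[of "{x<..}" lborel \<beta>]
      by (subst Bochner_Integration.integral_diff) (simp_all add: upper_tail_def mult.commute)
    finally show ?thesis .
  qed
  show "integrable lborel (upper_tail \<beta>)"
    using lborel_pair.integrable_snd[OF f] by (simp add: t)
  show "(\<integral>x. upper_tail \<beta> x \<partial>lborel) = (\<integral>x. x * \<beta> x \<partial>lborel)"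
    using lborel_pair.Fubini_integral[OF f] by (simp add: t integral_step_difference mult.commute)
qed

text \<open>The derivative of \<open>tent a\<close> away from its corners; the value 0 at the origin
  makes it odd everywhere.\<close>

definition tent' :: "real \<Rightarrow> real \<Rightarrow> real" where
  "tent' a v = (indicator {-a<..<0} v - indicator {0<..<a} v) / a\<^sup>2"

definition tent :: "real \<Rightarrow> real \<Rightarrow> real" where
  "tent a v = max 0 (a - \<bar>v\<bar>) / a\<^sup>2"

lemma tent_measurable [measurable]: "tent a \<in> borel_measurable borel" "tent' a \<in> borel_measurable borel"
  unfolding tent_def[abs_def] tent'_def[abs_def] by measurable

lemma tent'_integral:
  assumes a: "0 < a"
  shows "integrable lborel (tent' a)" "(\<integral>v. tent' a v \<partial>lborel) = 0" "upper_tail (tent' a) v = - tent a v"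
proof -
  show "integrable lborel (tent' a)"
    unfolding tent'_def[abs_def]
    by (intro integrable_divide Bochner_Integration.integrable_diff integrable_real_indicator) (use a in auto)
  show "(\<integral>v. tent' a v \<partial>lborel) = 0"
    unfolding tent'_def using a by simp
  have len: "measure lborel {c<..<d} = max 0 (d - c)" for c d :: real
    by (cases "c \<le> d") auto
  have fin: "emeasure lborel {c<..<d} < \<top>" for c d :: real
    by (cases "c \<le> d") auto
  have "tent' a y * indicator {v<..} y = (indicator {max v (-a)<..<0} y - indicator {max v 0<..<a} y) / a\<^sup>2" for y
    unfolding tent'_def by (auto simp: indicator_def)
  then have "upper_tail (tent' a) v = (measure lborel {max v (-a)<..<0} - measure lborel {max v 0<..<a}) / a\<^sup>2"
    unfolding upper_tail_def by (simp add: integrable_real_indicator fin)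
  also have "\<dots> = - tent a v"
    using a unfolding len tent_def by (auto simp: max_def abs_if field_simps)
  finally show "upper_tail (tent' a) v = - tent a v" .
qed

text \<open>Since \<open>- tent a\<close> is the tail integral of \<open>tent' a\<close>, its
  integral is the first moment of the latter, which is -1.\<close>

lemma tent_integral:
  assumes a: "0 < a"
  shows "integrable lborel (tent a)" "(\<integral>v. tent a v \<partial>lborel) = 1"
proof -
  have ivl: "(\<integral>v. v * indicator {c<..<d} v \<partial>lborel) = (d\<^sup>2 - c\<^sup>2) / 2"
    "integrable lborel (\<lambda>v. v * indicator {c<..<d} v)" if "c \<le> d" for c d :: real
  proof -
    have hb: "has_bochner_integral lborel (\<lambda>x. x * indicator {c..d} x) (d\<^sup>2 / 2 - c\<^sup>2 / 2)"
      using that by (intro has_bochner_integral_FTC_Icc_real[where F = "\<lambda>x. x\<^sup>2 / 2"]) (auto intro!: derivative_eq_intros)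
    have ae: "AE x in lborel. x * indicator {c..d} x = x * indicator {c<..<d} x"
      using AE_lborel_singleton[of c] AE_lborel_singleton[of d] by eventually_elim (auto simp: indicator_def)
    have hb': "has_bochner_integral lborel (\<lambda>x. x * indicator {c<..<d} x) (d\<^sup>2 / 2 - c\<^sup>2 / 2)"
      using has_bochner_integralI_AE[OF hb _ ae] by simp
    then show "(\<integral>v. v * indicator {c<..<d} v \<partial>lborel) = (d\<^sup>2 - c\<^sup>2) / 2"
      "integrable lborel (\<lambda>v. v * indicator {c<..<d} v)"
      by (auto simp: has_bochner_integral_iff diff_divide_distrib)
  qed
  have eq: "v * tent' a v = (v * indicator {-a<..<0} v - v * indicator {0<..<a} v) / a\<^sup>2" for v
    unfolding tent'_def by (simp add: algebra_simps)
  have i: "integrable lborel (\<lambda>v. v * tent' a v)" "(\<integral>v. v * tent' a v \<partial>lborel) = -1"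
    unfolding eq using a ivl[of "-a" 0] ivl[of 0 a] by (auto simp: field_simps)
  have ut: "upper_tail (tent' a) = (\<lambda>v. - tent a v)"
    using tent'_integral(3)[OF a] by auto
  show "integrable lborel (tent a)"
    using upper_tail_integral(1)[OF tent'_integral(1,2)[OF a] i(1)] unfolding ut by simp
  show "(\<integral>v. tent a v \<partial>lborel) = 1"
    using upper_tail_integral(2)[OF tent'_integral(1,2)[OF a] i(1)] unfolding ut i(2) by simp
qed

lemma tent_props:
  assumes a: "0 < a"
  shows "0 \<le> tent a v" "tent a v \<le> 1 / a" "a \<le> \<bar>v\<bar> \<Longrightarrow> tent a v = 0" "tent a (- v) = tent a v"
    "\<bar>tent' a v\<bar> \<le> 1 / a\<^sup>2" "a \<le> \<bar>v\<bar> \<Longrightarrow> tent' a v = 0" "tent' a (- v) = - tent' a v"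
proof -
  show "tent a v \<le> 1 / a"
  proof -
    have "tent a v \<le> a / a\<^sup>2" unfolding tent_def using a by (intro divide_right_mono) auto
    then show ?thesis using a by (simp add: power2_eq_square)
  qed
  show "\<bar>tent' a v\<bar> \<le> 1 / a\<^sup>2"
    unfolding tent'_def abs_divide using a by (intro frac_le) (auto simp: indicator_def)
qed (use a in \<open>auto simp: tent_def tent'_def indicator_def\<close>)

text \<open>\<open>\<beta> / p\<close> is an odd element of L^2(p), orthogonal to the linear
  function. In the application it is the conditional mean of one coordinate given the component
  along an axis, and \<open>\<beta>_first\<close> expresses that the two are uncorrelated.\<close>

locale odd_perturbation = even_log_concave_density +
  fixes \<beta> :: "real \<Rightarrow> real"
  assumes \<beta>_measurable [measurable]: "\<beta> \<in> borel_measurable borel"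
    and \<beta>_odd: "\<And>x. \<beta> (- x) = - \<beta> x" and \<beta>_zero: "\<And>x. p x = 0 \<Longrightarrow> \<beta> x = 0"
    and \<beta>_square: "integrable lborel (\<lambda>x. (\<beta> x)\<^sup>2 / p x)"
    and \<beta>_first: "integrable lborel (\<lambda>x. x * \<beta> x)" "(\<integral>x. x * \<beta> x \<partial>lborel) = 0"
begin

text \<open>The squared norm of \<open>\<beta> / p\<close> in L^2(p).\<close>

definition E :: real where
  "E = (\<integral>x. (\<beta> x)\<^sup>2 / p x \<partial>lborel)"

lemma E_nonneg: "0 \<le> E"
  unfolding E_def using p_nonneg by simp

lemma nn_integral_E: "(\<integral>\<^sup>+x. ennreal ((\<beta> x)\<^sup>2 / p x) \<partial>lborel) = ennreal E"
  unfolding E_def using \<beta>_square p_nonneg by (intro nn_integral_eq_integral) auto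

lemma \<beta>_integrable: "integrable lborel \<beta>"
proof (rule Bochner_Integration.integrable_bound)
  show "integrable lborel (\<lambda>x. (\<beta> x)\<^sup>2 / p x + p x)"
    using \<beta>_square p_integrable by simp
  show "AE x in lborel. norm (\<beta> x) \<le> norm ((\<beta> x)\<^sup>2 / p x + p x)"
  proof (rule AE_I2)
    fix x
    show "norm (\<beta> x) \<le> norm ((\<beta> x)\<^sup>2 / p x + p x)"
    proof (cases "p x = 0")
      case False
      then have px: "0 < p x" using p_nonneg[of x] by simp
      have "\<bar>\<beta> x\<bar> * p x \<le> (\<beta> x)\<^sup>2 + (p x)\<^sup>2"
        using zero_le_power2[of "\<bar>\<beta> x\<bar> - p x"] zero_le_power2[of "\<beta> x"] zero_le_power2[of "p x"]
        unfolding power2_diff power2_abs by linarith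
      then have "\<bar>\<beta> x\<bar> \<le> ((\<beta> x)\<^sup>2 + (p x)\<^sup>2) / p x" using px by (simp add: pos_le_divide_eq)
      also have "\<dots> = (\<beta> x)\<^sup>2 / p x + p x" using px by (simp add: add_divide_distrib power2_eq_square)
      finally show ?thesis by simp
    qed (simp add: \<beta>_zero)
  qed
qed simp

lemma \<beta>_integral: "(\<integral>x. \<beta> x \<partial>lborel) = 0"
proof -
  have "(\<integral>x. \<beta> x \<partial>lborel) = (\<integral>x. \<beta> (0 + (-1) * x) \<partial>lborel)"
    by (subst lborel_integral_real_affine[where c = "-1" and t = 0]) simp_all
  then show ?thesis by (simp add: \<beta>_odd)
qed

definition T :: "real \<Rightarrow> real" where
  "T = upper_tail \<beta>"

lemma T_measurable [measurable]: "T \<in> borel_measurable borel"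
  unfolding T_def by measurable

text \<open>Orthogonality to linear functions enters here: the integral of \<open>T\<close> is the
  first moment of \<beta>. Its vanishing removes a cross term from the contraction estimate.\<close>

lemma T_integral: "integrable lborel T" "(\<integral>x. T x \<partial>lborel) = 0"
  using upper_tail_integral[OF \<beta>_integrable \<beta>_integral \<beta>_first(1)] \<beta>_first(2) by (simp_all add: T_def)

lemma \<beta>_indicator_integrable: "S \<in> sets borel \<Longrightarrow> integrable lborel (\<lambda>y. \<beta> y * indicator S y)"
  using integrable_mult_indicator[OF _ \<beta>_integrable, of S] by (simp add: mult.commute)

lemma T_even: "T (- x) = T x"
proof -
  have "T (- x) = (\<integral>y. \<beta> (0 + (-1) * y) * indicator {-x<..} (0 + (-1) * y) \<partial>lborel)"
    unfolding T_def upper_tail_def by (subst lborel_integral_real_affine[where c = "-1" and t = 0]) simp_all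
  also have "\<dots> = (\<integral>y. \<beta> y * indicator {x<..} y - \<beta> y \<partial>lborel)"
  proof (rule integral_cong_AE)
    show "AE y in lborel. \<beta> (0 + - 1 * y) * indicator {- x<..} (0 + - 1 * y) = \<beta> y * indicator {x<..} y - \<beta> y"
      using AE_lborel_singleton[of x] by eventually_elim (auto simp: \<beta>_odd indicator_def)
  qed measurable
  also have "\<dots> = T x"
    using \<beta>_integral \<beta>_integrable
    by (simp add: T_def upper_tail_def Bochner_Integration.integral_diff \<beta>_indicator_integrable)
  finally show ?thesis .
qed

lemma T_zero: "p x = 0 \<Longrightarrow> T x = 0"
proof -
  assume px: "p x = 0"
  have "T \<bar>x\<bar> = 0"
  proof -
    have "\<beta> y * indicator {\<bar>x\<bar><..} y = 0" for y
      using p_decreasing[of x y] p_nonneg[of y] px \<beta>_zero[of y] by (auto simp: indicator_def)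
    then have "(\<lambda>y. \<beta> y * indicator {\<bar>x\<bar><..} y) = (\<lambda>_. 0)" by (rule ext)
    then show ?thesis unfolding T_def upper_tail_def by (simp only: lebesgue_integral_const) simp
  qed
  then show "T x = 0" using T_even[of x] by (auto simp: abs_if split: if_splits)
qed

text \<open>
  A Hardy inequality: \<open>p (x + v) \<le> p x * (w v)\<^sup>2\<close> turns the Cauchy--Schwarz bound of the tail
  integral, weighted by \<open>w\<close>, into a product of two one-dimensional integrals.
\<close>

lemma hardy:
  assumes \<kappa>: "(\<integral>\<^sup>+x. ennreal (w x) * indicator {0<..} x \<partial>lborel) \<le> ennreal k" and k: "0 \<le> k"
  shows "(\<integral>\<^sup>+x. ennreal ((T x)\<^sup>2 / p x) \<partial>lborel) \<le> ennreal (k\<^sup>2 * E)"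
proof -
  define e where "e x = ennreal ((\<beta> x)\<^sup>2 / p x)" for x
  have [measurable]: "e \<in> borel_measurable borel" unfolding e_def by measurable
  define W where "W v = ennreal (w v) * indicator {0<..} v" for v
  have [measurable]: "W \<in> borel_measurable borel" unfolding W_def by measurable
  have point: "ennreal ((T x)\<^sup>2 / p x) \<le> ennreal k * (\<integral>\<^sup>+v. e (x + v) * W v \<partial>lborel)" if x: "0 < x" for x
  proof (cases "p x = 0")
    case False
    then have px: "0 < p x" using p_nonneg[of x] by simp
    define f where "f v = ennreal (sqrt (w v)) * indicator {0<..} v" for v
    define g where "g v = ennreal (\<bar>\<beta> (x + v)\<bar> / sqrt (w v)) * indicator {0<..} v" for v
    have [measurable]: "f \<in> borel_measurable borel" "g \<in> borel_measurable borel"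
      unfolding f_def g_def by measurable
    have pxv: "p (x + v) \<le> p x * (w v)\<^sup>2" if "0 < v" for v
    proof -
      have "p 0 * p (x + v) \<le> p 0 * (p x * (w v)\<^sup>2)"
        using p_submultiplicative[of x v] x that w_props(4)[of v] by (simp add: mult_ac)
      then show ?thesis using p_0_pos by simp
    qed
    have \<beta>0: "\<beta> (x + v) = 0" if "0 < v" "w v = 0" for v
      using pxv[OF that(1)] that(2) p_nonneg[of "x + v"] by (intro \<beta>_zero) simp
    have "ennreal \<bar>T x\<bar> \<le> (\<integral>\<^sup>+y. ennreal (norm (\<beta> y * indicator {x<..} y)) \<partial>lborel)"
      unfolding T_def upper_tail_def real_norm_def[symmetric] by (rule integral_norm_bound_ennreal) (simp add: \<beta>_indicator_integrable)
    also have "\<dots> = (\<integral>\<^sup>+v. ennreal (norm (\<beta> (v + x) * indicator {x<..} (v + x))) \<partial>lborel)"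
      by (rule nn_integral_lborel_shift[symmetric]) simp
    also have "\<dots> = (\<integral>\<^sup>+v. f v * g v \<partial>lborel)"
    proof (rule nn_integral_cong)
      fix v :: real
      show "ennreal (norm (\<beta> (v + x) * indicator {x<..} (v + x))) = f v * g v"
      proof (cases "0 < v")
        case True
        then show ?thesis
          using \<beta>0[of v] w_props(1)[of v]
          by (cases "w v = 0") (auto simp: f_def g_def add.commute simp flip: ennreal_mult)
      qed (auto simp: f_def g_def)
    qed
    finally have "(ennreal \<bar>T x\<bar>)\<^sup>2 \<le> (\<integral>\<^sup>+v. f v * g v \<partial>lborel)\<^sup>2"
      by (rule power_mono) simp
    also have "\<dots> \<le> (\<integral>\<^sup>+v. f v ^ 2 \<partial>lborel) * (\<integral>\<^sup>+v. g v ^ 2 \<partial>lborel)"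
      by (rule Cauchy_Schwarz_nn_integral) simp_all
    also have "(\<integral>\<^sup>+v. f v ^ 2 \<partial>lborel) = (\<integral>\<^sup>+v. W v \<partial>lborel)"
      by (intro nn_integral_cong) (auto simp: f_def W_def indicator_def w_props(1) power_mult_distrib ennreal_power)
    also have "\<dots> \<le> ennreal k" unfolding W_def by (rule \<kappa>)
    finally have 1: "(ennreal \<bar>T x\<bar>)\<^sup>2 \<le> ennreal k * (\<integral>\<^sup>+v. g v ^ 2 \<partial>lborel)"
      by (simp add: mult_right_mono)
    \<comment> \<open>Log-concavity gives \<open>1 / p x \<le> (w v)\<^sup>2 / p (x + v)\<close>;
      one factor \<open>w v\<close> cancels the weight in \<open>g\<close>, and the other one
      remains as \<open>W v\<close>.\<close>
    have gp: "ennreal (1 / p x) * g v ^ 2 \<le> e (x + v) * W v" for v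
    proof (cases "0 < v \<and> w v \<noteq> 0 \<and> p (x + v) \<noteq> 0")
      case True
      then have pos: "0 < w v" "0 < p (x + v)" "0 < v" using w_props(1)[of v] p_nonneg[of "x + v"] by auto
      have "1 / (p x * w v) \<le> w v / p (x + v)"
        using pxv[OF pos(3)] pos px by (simp add: field_simps power2_eq_square)
      then have "(\<beta> (x + v))\<^sup>2 * (1 / (p x * w v)) \<le> (\<beta> (x + v))\<^sup>2 * (w v / p (x + v))"
        by (intro mult_left_mono) auto
      then have "ennreal (1 / p x * (\<bar>\<beta> (x + v)\<bar> / sqrt (w v))\<^sup>2) \<le> ennreal ((\<beta> (x + v))\<^sup>2 / p (x + v) * w v)"
        using pos by (intro ennreal_leI) (simp add: power_divide mult.commute)
      then show ?thesis
        using pos px by (simp add: g_def e_def W_def ennreal_power flip: ennreal_mult)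
    next
      case False
      then have "g v = 0" using \<beta>0[of v] \<beta>_zero[of "x + v"] by (auto simp: g_def indicator_def)
      then show ?thesis by simp
    qed
    have "ennreal ((T x)\<^sup>2 / p x) = ennreal (1 / p x) * (ennreal \<bar>T x\<bar>)\<^sup>2"
      using px by (simp add: ennreal_power flip: ennreal_mult)
    also have "\<dots> \<le> ennreal (1 / p x) * (ennreal k * (\<integral>\<^sup>+v. g v ^ 2 \<partial>lborel))"
      by (intro mult_left_mono 1) simp
    also have "\<dots> = ennreal k * (\<integral>\<^sup>+v. ennreal (1 / p x) * g v ^ 2 \<partial>lborel)"
      by (subst nn_integral_cmult) (simp_all add: mult.left_commute)
    also have "\<dots> \<le> ennreal k * (\<integral>\<^sup>+v. e (x + v) * W v \<partial>lborel)"
      by (intro mult_left_mono nn_integral_mono gp) simp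
    finally show ?thesis .
  qed (simp add: T_zero)
  have e_half: "(\<integral>\<^sup>+x. e x \<partial>lborel) = 2 * (\<integral>\<^sup>+x. e x * indicator {0<..} x \<partial>lborel)"
    by (rule nn_integral_even) (simp_all add: e_def \<beta>_odd p_even)
  have "(\<integral>\<^sup>+x. ennreal ((T x)\<^sup>2 / p x) \<partial>lborel) = 2 * (\<integral>\<^sup>+x. ennreal ((T x)\<^sup>2 / p x) * indicator {0<..} x \<partial>lborel)"
    by (rule nn_integral_even) (simp_all add: T_even p_even)
  also have "\<dots> \<le> 2 * (\<integral>\<^sup>+x. ennreal k * (\<integral>\<^sup>+v. e (x + v) * W v * indicator {0<..} x \<partial>lborel) \<partial>lborel)"
  proof (intro mult_left_mono nn_integral_mono)
    fix x :: real
    show "ennreal ((T x)\<^sup>2 / p x) * indicator {0<..} x \<le> ennreal k * (\<integral>\<^sup>+v. e (x + v) * W v * indicator {0<..} x \<partial>lborel)"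
      using point[of x] by (cases "0 < x") (auto simp: indicator_def)
  qed simp
  \<comment> \<open>Integrating in \<open>x\<close> first leaves the integral of \<open>W\<close>,
    which supplies the second factor \<open>k\<close>; the first came from Cauchy-Schwarz.\<close>
  also have "\<dots> = 2 * (ennreal k * (\<integral>\<^sup>+v. \<integral>\<^sup>+x. e (x + v) * W v * indicator {0<..} x \<partial>lborel \<partial>lborel))"
    by (subst nn_integral_cmult, simp, subst lborel_pair.Fubini') simp_all
  also have "\<dots> \<le> 2 * (ennreal k * (\<integral>\<^sup>+v. W v * (\<integral>\<^sup>+x. e x * indicator {0<..} x \<partial>lborel) \<partial>lborel))"
  proof (intro mult_left_mono nn_integral_mono)
    fix v :: real
    show "(\<integral>\<^sup>+x. e (x + v) * W v * indicator {0<..} x \<partial>lborel) \<le> W v * (\<integral>\<^sup>+x. e x * indicator {0<..} x \<partial>lborel)"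
    proof (cases "0 < v")
      case True
      have "(\<integral>\<^sup>+x. e (x + v) * W v * indicator {0<..} x \<partial>lborel) \<le> (\<integral>\<^sup>+x. W v * (e (x + v) * indicator {0<..} (x + v)) \<partial>lborel)"
        using True by (intro nn_integral_mono) (auto simp: indicator_def mult.commute)
      also have "\<dots> = W v * (\<integral>\<^sup>+x. e (x + v) * indicator {0<..} (x + v) \<partial>lborel)"
        by (rule nn_integral_cmult) simp
      also have "(\<integral>\<^sup>+x. e (x + v) * indicator {0<..} (x + v) \<partial>lborel) = (\<integral>\<^sup>+x. e x * indicator {0<..} x \<partial>lborel)"
        by (rule nn_integral_lborel_shift[of "\<lambda>x. e x * indicator {0<..} x"]) simp
      finally show ?thesis .
    qed (simp add: W_def)
  qed simp_all
  also have "\<dots> = ennreal k * ((\<integral>\<^sup>+v. W v \<partial>lborel) * (\<integral>\<^sup>+x. e x \<partial>lborel))"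
    unfolding e_half by (subst nn_integral_multc) (simp_all add: mult_ac)
  also have "\<dots> \<le> ennreal k * (ennreal k * ennreal E)"
    using \<kappa> unfolding W_def e_def nn_integral_E by (intro mult_left_mono mult_right_mono) auto
  also have "\<dots> = ennreal (k\<^sup>2 * E)"
    using k E_nonneg by (simp add: power2_eq_square ennreal_mult mult.assoc)
  finally show ?thesis .
qed

end

lemma has_bochner_integral_lborel_pair_mult:
  fixes f g :: "real \<Rightarrow> real"
  assumes f: "integrable lborel f" and g: "integrable lborel g"
  shows "has_bochner_integral (lborel \<Otimes>\<^sub>M lborel) (\<lambda>(x, y). f x * g y) ((\<integral>x. f x \<partial>lborel) * (\<integral>y. g y \<partial>lborel))"
proof -
  have [measurable]: "f \<in> borel_measurable borel" "g \<in> borel_measurable borel"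
    using f g by auto
  have i: "integrable (lborel \<Otimes>\<^sub>M lborel) (\<lambda>(x, y). f x * g y)"
  proof (rule lborel_pair.Fubini_integrable)
    show "(\<lambda>(x, y). f x * g y) \<in> borel_measurable (lborel \<Otimes>\<^sub>M lborel)" by measurable
    show "integrable lborel (\<lambda>x. \<integral>y. norm (case (x, y) of (x, y) \<Rightarrow> f x * g y) \<partial>lborel)"
      using f g by (simp add: abs_mult)
    show "AE x in lborel. integrable lborel (\<lambda>y. case (x, y) of (x, y) \<Rightarrow> f x * g y)"
      using g by simp
  qed
  moreover have "(\<integral>z. (case z of (x, y) \<Rightarrow> f x * g y) \<partial>(lborel \<Otimes>\<^sub>M lborel)) = (\<integral>x. f x \<partial>lborel) * (\<integral>y. g y \<partial>lborel)"
    using lborel_pair.integral_fst[OF i] by simp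
  ultimately show ?thesis by (simp add: has_bochner_integral_iff)
qed

lemma integrable_mult_bounded:
  fixes f g :: "real \<Rightarrow> real"
  assumes f: "integrable lborel f" and [measurable]: "g \<in> borel_measurable borel" and g: "\<And>x. \<bar>g x\<bar> \<le> c"
  shows "integrable lborel (\<lambda>x. f x * g x)"
proof (rule Bochner_Integration.integrable_bound[OF integrable_mult_right[OF f, of c]])
  have [measurable]: "f \<in> borel_measurable borel" using f by auto
  show "(\<lambda>x. f x * g x) \<in> borel_measurable lborel" by measurable
  have "0 \<le> c" using g[of 0] by simp
  moreover have "\<bar>f x\<bar> * \<bar>g x\<bar> \<le> \<bar>f x\<bar> * c" for x
    by (rule mult_left_mono[OF g]) simp
  ultimately show "AE x in lborel. norm (f x * g x) \<le> norm (c * f x)"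
    by (intro AE_I2) (simp add: abs_mult mult.commute[of c])
qed

lemma integral_odd_lborel:
  fixes f :: "real \<Rightarrow> real"
  assumes [measurable]: "f \<in> borel_measurable borel" and odd: "\<And>x. f (- x) = - f x"
  shows "(\<integral>x. f x \<partial>lborel) = 0"
proof -
  have "(\<integral>x. f x \<partial>lborel) = (\<integral>x. f (0 + (-1) * x) \<partial>lborel)"
    by (subst lborel_integral_real_affine[where c = "-1" and t = 0]) simp_all
  then show ?thesis by (simp add: odd)
qed

lemma integral_lborel_reflect:
  fixes f :: "real \<Rightarrow> real"
  shows "(\<integral>x. f (z - x) \<partial>lborel) = (\<integral>x. f x \<partial>lborel)"
  by (subst (2) lborel_integral_real_affine[where c = "-1" and t = z]) simp_all

lemma integrable_lborel_reflect:
  fixes f :: "real \<Rightarrow> real"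
  shows "integrable lborel f \<Longrightarrow> integrable lborel (\<lambda>x. f (z - x))"
  using lborel_integrable_real_affine[of f "-1" z] by simp

section \<open>Contraction of odd perturbations under sums of independent copies\<close>

context odd_perturbation
begin

definition P :: "real \<Rightarrow> real" where
  "P z = (\<integral>x. p x * p (z - x) \<partial>lborel)"

text \<open>For independent X, Y with density \<open>p\<close>, \<open>P\<close> is the density of X
  + Y, and \<open>N / P\<close> is the conditional expectation of \<open>\<beta> / p\<close> at X
  given that X + Y = \<open>z\<close>.\<close>

definition N :: "real \<Rightarrow> real" where
  "N z = (\<integral>x. \<beta> x * p (z - x) \<partial>lborel)"

lemma p_bounded: "\<bar>p (z - x)\<bar> \<le> p 0"
  using p_nonneg[of "z - x"] p_le_0[of "z - x"] by simp

lemma P_integrable: "integrable lborel (\<lambda>x. p x * p (z - x))"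
  by (rule integrable_mult_bounded[OF p_integrable _ p_bounded]) simp

lemma N_integrable: "integrable lborel (\<lambda>x. \<beta> x * p (z - x))"
  by (rule integrable_mult_bounded[OF \<beta>_integrable _ p_bounded]) simp

lemma P_nonneg: "0 \<le> P z"
  unfolding P_def using p_nonneg by simp

lemma nn_integral_P: "(\<integral>\<^sup>+x. ennreal (p x * p (z - x)) \<partial>lborel) = ennreal (P z)"
  unfolding P_def using P_integrable p_nonneg by (intro nn_integral_eq_integral) auto

text \<open>Cauchy-Schwarz against the weight \<open>p x * p (z - x)\<close>, of total mass
  \<open>P z\<close>. Where the weight vanishes so does \<psi>, which makes the quotient 0 harmless;
  a non-integrable \<psi> has integral 0 by convention.\<close>

lemma square_le_weighted:
  fixes \<psi> :: "real \<Rightarrow> real"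
  assumes [measurable]: "\<psi> \<in> borel_measurable borel" and z: "\<And>x. p x * p (z - x) = 0 \<Longrightarrow> \<psi> x = 0"
  shows "ennreal ((\<integral>x. \<psi> x \<partial>lborel)\<^sup>2) \<le> (\<integral>\<^sup>+x. ennreal ((\<psi> x)\<^sup>2 / (p x * p (z - x))) \<partial>lborel) * ennreal (P z)"
proof (cases "integrable lborel \<psi>")
  case True
  let ?q = "\<lambda>x. p x * p (z - x)"
  have q: "0 \<le> ?q x" for x using p_nonneg by simp
  have "ennreal ((\<integral>x. \<psi> x \<partial>lborel)\<^sup>2) = (ennreal (norm (\<integral>x. \<psi> x \<partial>lborel)))\<^sup>2"
    by (simp add: ennreal_power)
  also have "\<dots> \<le> (\<integral>\<^sup>+x. ennreal (norm (\<psi> x)) \<partial>lborel)\<^sup>2"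
    using True by (intro power_mono integral_norm_bound_ennreal) auto
  also have "(\<integral>\<^sup>+x. ennreal (norm (\<psi> x)) \<partial>lborel) = (\<integral>\<^sup>+x. ennreal (\<bar>\<psi> x\<bar> / sqrt (?q x)) * ennreal (sqrt (?q x)) \<partial>lborel)"
  proof (rule nn_integral_cong)
    fix x
    show "ennreal (norm (\<psi> x)) = ennreal (\<bar>\<psi> x\<bar> / sqrt (?q x)) * ennreal (sqrt (?q x))"
    proof (cases "?q x = 0")
      case False
      then have "\<bar>\<psi> x\<bar> / sqrt (?q x) * sqrt (?q x) = \<bar>\<psi> x\<bar>" by simp
      then show ?thesis using q[of x] by (subst ennreal_mult[symmetric]) auto
    qed (use z[of x] in auto)
  qed
  also have "\<dots>\<^sup>2 \<le> (\<integral>\<^sup>+x. ennreal (\<bar>\<psi> x\<bar> / sqrt (?q x)) ^ 2 \<partial>lborel) * (\<integral>\<^sup>+x. ennreal (sqrt (?q x)) ^ 2 \<partial>lborel)"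
    by (rule Cauchy_Schwarz_nn_integral) simp_all
  also have "\<dots> = (\<integral>\<^sup>+x. ennreal ((\<psi> x)\<^sup>2 / ?q x) \<partial>lborel) * ennreal (P z)"
    using q by (simp add: ennreal_power power_divide nn_integral_P)
  finally show ?thesis .
qed (simp add: not_integrable_integral_eq)

text \<open>Bounding one factor \<open>p\<close> by its maximum gives control at every point. It
  later converts the contraction in mean square into a bound for individual fibres.\<close>

lemma N_pointwise: "(N z)\<^sup>2 \<le> p 0 * E * P z"
proof -
  have "ennreal ((N z)\<^sup>2) \<le> (\<integral>\<^sup>+x. ennreal ((\<beta> x * p (z - x))\<^sup>2 / (p x * p (z - x))) \<partial>lborel) * ennreal (P z)"
    unfolding N_def by (rule square_le_weighted) (auto simp: \<beta>_zero)
  also have "\<dots> \<le> (\<integral>\<^sup>+x. ennreal (p 0) * ennreal ((\<beta> x)\<^sup>2 / p x) \<partial>lborel) * ennreal (P z)"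
  proof (intro mult_right_mono nn_integral_mono)
    fix x
    have "(\<beta> x * p (z - x))\<^sup>2 / (p x * p (z - x)) = p (z - x) * ((\<beta> x)\<^sup>2 / p x)"
      by (simp add: power2_eq_square)
    also have "\<dots> \<le> p 0 * ((\<beta> x)\<^sup>2 / p x)"
      using p_le_0 p_nonneg by (intro mult_right_mono) auto
    finally show "ennreal ((\<beta> x * p (z - x))\<^sup>2 / (p x * p (z - x))) \<le> ennreal (p 0) * ennreal ((\<beta> x)\<^sup>2 / p x)"
      using p_0_pos p_nonneg by (simp add: ennreal_leI flip: ennreal_mult)
  qed simp
  also have "\<dots> = ennreal (p 0 * E * P z)"
    using p_0_pos E_nonneg P_nonneg by (simp add: nn_integral_cmult nn_integral_E ennreal_mult)
  finally show ?thesis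
    using p_0_pos E_nonneg P_nonneg by (subst (asm) ennreal_le_iff) auto
qed

text \<open>
  With \<open>K\<close> a tent function, \<open>\<beta> x * K y + T x * K' y\<close> is a total derivative along \<open>x + y = z\<close>,
  so subtracting a multiple of it does not change the conditional expectation \<open>N / P\<close>,
  while it decreases the second moment.
\<close>

lemma contraction: "(\<integral>\<^sup>+z. ennreal ((N z)\<^sup>2 / P z) \<partial>lborel) \<le> ennreal ((1 - 1 / 2176) / 2 * E)"
proof -
  obtain a where a: "0 < a" and pa: "\<And>y. \<bar>y\<bar> < a \<Longrightarrow> p 0 / 4 \<le> p y"
    and \<kappa>: "(\<integral>\<^sup>+x. ennreal (w x) * indicator {0<..} x \<partial>lborel) \<le> ennreal (4 * a)" and a8: "1 / 8 \<le> p 0 * a"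
    using scale_exists by metis
  define K where "K = tent a"
  define k where "k = tent' a"
  \<comment> \<open>Minimises \<open>- 2 * \<eta> + 1088 * \<eta>\<^sup>2\<close>, the relative
    change of the second moment. The minimum is \<open>- \<eta>\<close> out of 2, hence the factor
    \<open>1 - 1 / 2176\<close>.\<close>
  define \<eta> :: real where "\<eta> = 1 / 1088"
  have [measurable]: "K \<in> borel_measurable borel" "k \<in> borel_measurable borel"
    by (simp_all add: K_def k_def)
  note K = tent_props[OF a, folded K_def k_def]
  note KI = tent_integral[OF a, folded K_def]
  note kI = tent'_integral[OF a, folded K_def k_def]
  have Kp: "K y = 0" "k y = 0" if "p y = 0" for y
    using pa[of y] p_0_pos that K(3)[of y] K(6)[of y] by (auto simp: not_less[symmetric])
  have pinv: "p 0 / 4 \<le> p y \<or> K y = 0 \<and> k y = 0" for y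
    using pa[of y] K(3)[of y] K(6)[of y] by (cases "\<bar>y\<bar> < a") auto
  have Kb: "\<bar>K y / p y\<bar> \<le> 4 / (p 0 * a)" for y
  proof (cases "p 0 / 4 \<le> p y")
    case True
    have "\<bar>K y\<bar> / \<bar>p y\<bar> \<le> (1 / a) / (p 0 / 4)"
      using True K(1,2)[of y] p_0_pos a by (intro frac_le) auto
    then show ?thesis by (simp add: field_simps)
  qed (use pinv[of y] p_0_pos a in auto)
  have kb: "\<bar>k y / p y\<bar> \<le> 4 / (p 0 * a\<^sup>2)" for y
  proof (cases "p 0 / 4 \<le> p y")
    case True
    have "\<bar>k y\<bar> / \<bar>p y\<bar> \<le> (1 / a\<^sup>2) / (p 0 / 4)"
      using True K(5)[of y] p_0_pos a by (intro frac_le) auto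
    then show ?thesis by (simp add: field_simps)
  qed (use pinv[of y] p_0_pos a in auto)
  \<comment> \<open>Integration by parts carried out by Fubini, as \<beta> need not be continuous:
    \<open>T\<close> is the tail integral of \<beta>, and \<open>- K\<close> that of
    \<open>k\<close>.\<close>
  have zero: "(\<integral>x. \<beta> x * K (z - x) + T x * k (z - x) \<partial>lborel) = 0" "integrable lborel (\<lambda>x. \<beta> x * K (z - x) + T x * k (z - x))" for z
  proof -
    have i1: "integrable lborel (\<lambda>x. \<beta> x * K (z - x))"
      using K(1,2) by (intro integrable_mult_bounded[OF \<beta>_integrable, where c = "1 / a"]) auto
    have i2: "integrable lborel (\<lambda>x. T x * k (z - x))"
      using K(5) by (intro integrable_mult_bounded[OF T_integral(1), where c = "1 / a\<^sup>2"]) auto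
    let ?F = "\<lambda>x y. \<beta> y * indicator {x<..} y * k (z - x)"
    have iF: "integrable (lborel \<Otimes>\<^sub>M lborel) (\<lambda>(x, y). ?F x y)"
    proof (rule Bochner_Integration.integrable_bound)
      show "integrable (lborel \<Otimes>\<^sub>M lborel) (\<lambda>(x, y). k (z - x) * \<beta> y)"
        using has_bochner_integral_lborel_pair_mult[OF integrable_lborel_reflect[OF kI(1)] \<beta>_integrable]
        by (simp add: has_bochner_integral_iff)
      have "(\<lambda>(x, y). ?F x y) = (\<lambda>(x, y). \<beta> y * (if x < y then 1 else 0) * k (z - x))"
        by (auto simp: fun_eq_iff indicator_def)
      also have "\<dots> \<in> borel_measurable (lborel \<Otimes>\<^sub>M lborel)" by measurable
      finally show "(\<lambda>(x, y). ?F x y) \<in> borel_measurable (lborel \<Otimes>\<^sub>M lborel)" .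
      show "AE v in lborel \<Otimes>\<^sub>M lborel. norm (case v of (x, y) \<Rightarrow> ?F x y) \<le> norm (case v of (x, y) \<Rightarrow> k (z - x) * \<beta> y)"
        by (intro AE_I2) (auto simp: indicator_def abs_mult mult.commute)
    qed
    have "(\<integral>x. T x * k (z - x) \<partial>lborel) = (\<integral>x. (\<integral>y. ?F x y \<partial>lborel) \<partial>lborel)"
      unfolding T_def upper_tail_def by simp
    also have "\<dots> = (\<integral>y. (\<integral>x. ?F x y \<partial>lborel) \<partial>lborel)"
      by (rule lborel_pair.Fubini_integral[OF iF, symmetric])
    also have "\<dots> = (\<integral>y. - (\<beta> y * K (z - y)) \<partial>lborel)"
    proof (intro Bochner_Integration.integral_cong refl)
      fix y
      have F: "?F x y = \<beta> y * (k (z - x) * indicator {z - y<..} (z - x))" for x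
        by (simp add: indicator_def)
      have "(\<integral>x. ?F x y \<partial>lborel) = \<beta> y * (\<integral>x. k (z - x) * indicator {z - y<..} (z - x) \<partial>lborel)"
        unfolding F by (rule integral_mult_right_zero)
      also have "(\<integral>x. k (z - x) * indicator {z - y<..} (z - x) \<partial>lborel) = upper_tail k (z - y)"
        unfolding upper_tail_def by (rule integral_lborel_reflect)
      finally show "(\<integral>x. ?F x y \<partial>lborel) = - (\<beta> y * K (z - y))" by (simp add: kI)
    qed
    finally show "(\<integral>x. \<beta> x * K (z - x) + T x * k (z - x) \<partial>lborel) = 0"
      using i1 i2 by simp
    show "integrable lborel (\<lambda>x. \<beta> x * K (z - x) + T x * k (z - x))"
      using i1 i2 by simp
  qed
  \<comment> \<open>The symmetrisation in the two copies produces \<open>2 * N\<close>, hence the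
    factor 1/4 below. With \<eta> = 0 its weighted second moment would be \<open>2 * E\<close>,
    which yields only the trivial constant 1/2.\<close>
  define \<Psi> where "\<Psi> x y = \<beta> x * p y + p x * \<beta> y - \<eta> * (\<beta> x * K y + T x * k y)" for x y
  define G where "G x y = (\<Psi> x y)\<^sup>2 / (p x * p y)" for x y
  have N\<Psi>: "(\<integral>x. \<Psi> x (z - x) \<partial>lborel) = 2 * N z" for z
  proof -
    have i: "integrable lborel (\<lambda>x. p x * \<beta> (z - x))"
      using integrable_lborel_reflect[OF N_integrable[of z], of z] by (simp add: mult.commute)
    have "(\<integral>x. p x * \<beta> (z - x) \<partial>lborel) = N z"
      using integral_lborel_reflect[of "\<lambda>x. \<beta> x * p (z - x)" z] by (simp add: N_def mult.commute)
    then show ?thesis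
      unfolding \<Psi>_def using zero[of z] N_integrable[of z] i by (simp add: N_def)
  qed
  have \<Psi>0: "\<Psi> x y = 0" if "p x * p y = 0" for x y
    using that Kp[of y] \<beta>_zero[of x] \<beta>_zero[of y] T_zero[of x] by (auto simp: \<Psi>_def)
  have NG: "ennreal ((N z)\<^sup>2 / P z) \<le> ennreal (1 / 4) * (\<integral>\<^sup>+x. ennreal (G x (z - x)) \<partial>lborel)" for z
  proof (cases "P z = 0")
    case False
    then have Pz: "0 < P z" using P_nonneg[of z] by simp
    have "ennreal ((2 * N z)\<^sup>2) \<le> (\<integral>\<^sup>+x. ennreal (G x (z - x)) \<partial>lborel) * ennreal (P z)"
      unfolding N\<Psi>[symmetric] G_def
    proof (rule square_le_weighted)
      show "(\<lambda>x. \<Psi> x (z - x)) \<in> borel_measurable borel" unfolding \<Psi>_def by measurable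
    qed (rule \<Psi>0)
    then have "ennreal (1 / (4 * P z)) * ennreal ((2 * N z)\<^sup>2)
       \<le> ennreal (1 / (4 * P z)) * ((\<integral>\<^sup>+x. ennreal (G x (z - x)) \<partial>lborel) * ennreal (P z))"
      by (rule mult_left_mono) simp
    also have "\<dots> = (ennreal (1 / (4 * P z)) * ennreal (P z)) * (\<integral>\<^sup>+x. ennreal (G x (z - x)) \<partial>lborel)"
      by (simp only: mult_ac)
    also have "ennreal (1 / (4 * P z)) * ennreal (P z) = ennreal (1 / 4)"
      using Pz by (subst ennreal_mult[symmetric]) auto
    also have "ennreal (1 / (4 * P z)) * ennreal ((2 * N z)\<^sup>2) = ennreal ((N z)\<^sup>2 / P z)"
      using Pz by (subst ennreal_mult[symmetric]) (auto simp: power_mult_distrib)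
    finally show ?thesis .
  qed simp
  have [measurable]: "(\<lambda>(x, y). G x y) \<in> borel_measurable (borel \<Otimes>\<^sub>M borel)"
    unfolding G_def \<Psi>_def by measurable
  define \<tau> where "\<tau> = (\<integral>x. (T x)\<^sup>2 / p x \<partial>lborel)"
  define \<kappa>1 where "\<kappa>1 = (\<integral>y. K y * (K y / p y) \<partial>lborel)"
  define \<kappa>2 where "\<kappa>2 = (\<integral>y. k y * (k y / p y) \<partial>lborel)"
  have hT: "(\<integral>\<^sup>+x. ennreal ((T x)\<^sup>2 / p x) \<partial>lborel) \<le> ennreal ((4 * a)\<^sup>2 * E)"
    using hardy[OF \<kappa>] a by simp
  have Tsq: "integrable lborel (\<lambda>x. (T x)\<^sup>2 / p x)"
  proof (rule integrableI_nonneg)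
    show "(\<integral>\<^sup>+x. ennreal ((T x)\<^sup>2 / p x) \<partial>lborel) < \<infinity>" using hT by (rule order_le_less_trans) simp
  qed (use p_nonneg in auto)
  have \<tau>: "\<tau> \<le> (4 * a)\<^sup>2 * E"
  proof -
    have "ennreal \<tau> \<le> ennreal ((4 * a)\<^sup>2 * E)"
      using hT Tsq p_nonneg unfolding \<tau>_def by (subst nn_integral_eq_integral[symmetric]) auto
    then show ?thesis using E_nonneg by (subst (asm) ennreal_le_iff) auto
  qed
  have \<beta>T: "integrable lborel (\<lambda>x. \<beta> x * T x / p x)"
  proof (rule Bochner_Integration.integrable_bound[OF Bochner_Integration.integrable_add[OF \<beta>_square Tsq]])
    show "AE x in lborel. norm (\<beta> x * T x / p x) \<le> norm ((\<beta> x)\<^sup>2 / p x + (T x)\<^sup>2 / p x)"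
    proof (rule AE_I2)
      fix x
      have "\<bar>\<beta> x\<bar> * \<bar>T x\<bar> \<le> (\<beta> x)\<^sup>2 + (T x)\<^sup>2"
        using zero_le_power2[of "\<bar>\<beta> x\<bar> - \<bar>T x\<bar>"] zero_le_power2[of "\<beta> x"] zero_le_power2[of "T x"]
        unfolding power2_diff power2_abs by linarith
      then have "\<bar>\<beta> x\<bar> * \<bar>T x\<bar> / p x \<le> ((\<beta> x)\<^sup>2 + (T x)\<^sup>2) / p x"
        using p_nonneg by (rule divide_right_mono)
      then show "norm (\<beta> x * T x / p x) \<le> norm ((\<beta> x)\<^sup>2 / p x + (T x)\<^sup>2 / p x)"
        using p_nonneg[of x] by (simp add: abs_mult add_divide_distrib)
    qed
  qed simp
  note M = has_bochner_integral_lborel_pair_mult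
  have iKp: "integrable lborel (\<lambda>y. \<beta> y * (K y / p y))" "integrable lborel (\<lambda>y. \<beta> y * (k y / p y))"
    by (rule integrable_mult_bounded[OF \<beta>_integrable _ Kb] integrable_mult_bounded[OF \<beta>_integrable _ kb]; measurable)+
  have iKK: "integrable lborel (\<lambda>y. K y * (K y / p y))" "integrable lborel (\<lambda>y. k y * (K y / p y))" "integrable lborel (\<lambda>y. k y * (k y / p y))"
    by (rule integrable_mult_bounded[OF KI(1) _ Kb] integrable_mult_bounded[OF kI(1) _ Kb] integrable_mult_bounded[OF kI(1) _ kb]; measurable)+
  have Kk0: "(\<integral>y. k y * (K y / p y) \<partial>lborel) = 0"
    by (rule integral_odd_lborel) (auto simp: K p_even)
  \<comment> \<open>The square expanded into products of one-dimensional integrals. Cross terms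
    vanish because \<beta>, \<open>T\<close> and \<open>k\<close> have integral 0 and
    \<open>k * K / p\<close> is odd. The linear gain \<open>2 * \<eta> * E\<close> is the product of
    \<open>\<beta>\<^sup>2 / p\<close> with the tent, whose integral is 1.\<close>
  have hb: "has_bochner_integral (lborel \<Otimes>\<^sub>M lborel)
     (\<lambda>z. (case z of (x, y) \<Rightarrow> (\<beta> x)\<^sup>2 / p x * p y) + (case z of (x, y) \<Rightarrow> p x * ((\<beta> y)\<^sup>2 / p y))
        + 2 * (case z of (x, y) \<Rightarrow> \<beta> x * \<beta> y)
        - (2 * \<eta>) * ((case z of (x, y) \<Rightarrow> (\<beta> x)\<^sup>2 / p x * K y) + (case z of (x, y) \<Rightarrow> \<beta> x * T x / p x * k y)
           + (case z of (x, y) \<Rightarrow> \<beta> x * (\<beta> y * (K y / p y))) + (case z of (x, y) \<Rightarrow> T x * (\<beta> y * (k y / p y))))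
        + \<eta>\<^sup>2 * ((case z of (x, y) \<Rightarrow> (\<beta> x)\<^sup>2 / p x * (K y * (K y / p y)))
           + 2 * (case z of (x, y) \<Rightarrow> \<beta> x * T x / p x * (k y * (K y / p y)))
           + (case z of (x, y) \<Rightarrow> (T x)\<^sup>2 / p x * (k y * (k y / p y)))))
     (E * 1 + 1 * E + 2 * (0 * 0)
        - (2 * \<eta>) * (E * 1 + (\<integral>x. \<beta> x * T x / p x \<partial>lborel) * 0 + 0 * (\<integral>y. \<beta> y * (K y / p y) \<partial>lborel)
            + 0 * (\<integral>y. \<beta> y * (k y / p y) \<partial>lborel))
        + \<eta>\<^sup>2 * (E * \<kappa>1 + 2 * ((\<integral>x. \<beta> x * T x / p x \<partial>lborel) * 0) + \<tau> * \<kappa>2))"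
    using M[OF \<beta>_square p_integrable] M[OF p_integrable \<beta>_square] M[OF \<beta>_integrable \<beta>_integrable]
      M[OF \<beta>_square KI(1)] M[OF \<beta>T kI(1)] M[OF \<beta>_integrable iKp(1)] M[OF T_integral(1) iKp(2)]
      M[OF \<beta>_square iKK(1)] M[OF \<beta>T iKK(2)] M[OF Tsq iKK(3)]
    unfolding E_def[symmetric] p_integral \<beta>_integral KI(2) kI(2) T_integral(2) Kk0 \<kappa>1_def[symmetric] \<kappa>2_def[symmetric] \<tau>_def[symmetric]
    by (intro has_bochner_integral_add has_bochner_integral_diff has_bochner_integral_mult_right)
  have Gxy: "(\<beta> x)\<^sup>2 / p x * p y + p x * ((\<beta> y)\<^sup>2 / p y) + 2 * (\<beta> x * \<beta> y)
        - (2 * \<eta>) * ((\<beta> x)\<^sup>2 / p x * K y + \<beta> x * T x / p x * k y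
           + \<beta> x * (\<beta> y * (K y / p y)) + T x * (\<beta> y * (k y / p y)))
        + \<eta>\<^sup>2 * ((\<beta> x)\<^sup>2 / p x * (K y * (K y / p y)) + 2 * (\<beta> x * T x / p x * (k y * (K y / p y)))
           + (T x)\<^sup>2 / p x * (k y * (k y / p y))) = G x y" for x y
    proof (cases "p x = 0 \<or> p y = 0")
      case True
      then show ?thesis
        using Kp[of y] \<beta>_zero[of x] \<beta>_zero[of y] T_zero[of x] by (auto simp: G_def)
    next
      case False
      define u where "u = 1 / p x"
      define v where "v = 1 / p y"
      have uv: "p x * u = 1" "p y * v = 1" using False by (simp_all add: u_def v_def)
      have d: "c / p x = c * u" "c / p y = c * v" "c / (p x * p y) = c * (u * v)" for c
        using False by (simp_all add: u_def v_def)
      show ?thesis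
        unfolding G_def \<Psi>_def d prod.case using uv by algebra
    qed
  have Geq: "(\<lambda>z. (case z of (x, y) \<Rightarrow> (\<beta> x)\<^sup>2 / p x * p y) + (case z of (x, y) \<Rightarrow> p x * ((\<beta> y)\<^sup>2 / p y))
        + 2 * (case z of (x, y) \<Rightarrow> \<beta> x * \<beta> y)
        - (2 * \<eta>) * ((case z of (x, y) \<Rightarrow> (\<beta> x)\<^sup>2 / p x * K y) + (case z of (x, y) \<Rightarrow> \<beta> x * T x / p x * k y)
           + (case z of (x, y) \<Rightarrow> \<beta> x * (\<beta> y * (K y / p y))) + (case z of (x, y) \<Rightarrow> T x * (\<beta> y * (k y / p y))))
        + \<eta>\<^sup>2 * ((case z of (x, y) \<Rightarrow> (\<beta> x)\<^sup>2 / p x * (K y * (K y / p y)))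
           + 2 * (case z of (x, y) \<Rightarrow> \<beta> x * T x / p x * (k y * (K y / p y)))
           + (case z of (x, y) \<Rightarrow> (T x)\<^sup>2 / p x * (k y * (k y / p y))))) = (\<lambda>(x, y). G x y)"
    unfolding fun_eq_iff split_paired_All prod.case using Gxy by blast
  define V where "V = 2 * E - 2 * \<eta> * E + \<eta>\<^sup>2 * (E * \<kappa>1 + \<tau> * \<kappa>2)"
  have hG: "has_bochner_integral (lborel \<Otimes>\<^sub>M lborel) (\<lambda>(x, y). G x y) V"
    using hb unfolding Geq V_def by (simp add: algebra_simps)
  have G0: "0 \<le> G x y" for x y unfolding G_def using p_nonneg by simp
  have \<kappa>1: "\<kappa>1 \<le> 8 / (p 0 * a)"
  proof -
    have "\<kappa>1 \<le> (\<integral>y. K y * (4 / (p 0 * a)) \<partial>lborel)"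
      unfolding \<kappa>1_def
    proof (rule integral_mono[OF iKK(1)])
      fix y
      have "K y / p y \<le> 4 / (p 0 * a)" using Kb[of y] by linarith
      then show "K y * (K y / p y) \<le> K y * (4 / (p 0 * a))" using K(1) by (rule mult_left_mono)
    qed (use KI in simp)
    also have "\<dots> = 4 / (p 0 * a)" using KI by simp
    also have "\<dots> \<le> 8 / (p 0 * a)" using p_0_pos a by (intro divide_right_mono) auto
    finally show ?thesis .
  qed
  have \<kappa>2: "\<kappa>2 \<le> 8 / (p 0 * a ^ 3)"
  proof -
    have ik: "integrable lborel (\<lambda>y. indicator {-a..a} y / a\<^sup>2 :: real)"
      by (intro integrable_divide integrable_real_indicator) (use a in auto)
    have "\<kappa>2 \<le> (\<integral>y. indicator {-a..a} y / a\<^sup>2 * (4 / (p 0 * a\<^sup>2)) \<partial>lborel)"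
      unfolding \<kappa>2_def
    proof (rule integral_mono[OF iKK(3)])
      fix y
      have "\<bar>k y\<bar> \<le> indicator {-a..a} y / a\<^sup>2"
        using K(5)[of y] K(6)[of y] by (auto simp: indicator_def)
      then have "\<bar>k y\<bar> * \<bar>k y / p y\<bar> \<le> indicator {-a..a} y / a\<^sup>2 * (4 / (p 0 * a\<^sup>2))"
        using kb[of y] by (intro mult_mono) auto
      then show "k y * (k y / p y) \<le> indicator {-a..a} y / a\<^sup>2 * (4 / (p 0 * a\<^sup>2))"
        using abs_ge_self[of "k y * (k y / p y)"] unfolding abs_mult by linarith
    qed (rule integrable_mult_left[OF ik])
    also have "\<dots> = 2 * a / a\<^sup>2 * (4 / (p 0 * a\<^sup>2))" using a by simp
    also have "\<dots> = 8 / (p 0 * a ^ 3)" using a p_0_pos by (simp add: field_simps power2_eq_square power3_eq_cube)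
    finally show ?thesis .
  qed
  have \<kappa>2n: "0 \<le> \<kappa>2" unfolding \<kappa>2_def using p_nonneg by (intro Bochner_Integration.integral_nonneg) simp
  \<comment> \<open>The scale \<open>a\<close> cancels: the Hardy bound for \<tau> carries
    \<open>16 * a\<^sup>2\<close>, which meets the \<open>a ^ 3\<close> in \<kappa>2. The sum is 8 +
    16 * 8 = 136 over \<open>p 0 * a\<close>, and \<open>p 0 * a\<close> is at least 1/8, whence
    1088.\<close>
  have "E * \<kappa>1 + \<tau> * \<kappa>2 \<le> E * (8 / (p 0 * a)) + ((4 * a)\<^sup>2 * E) * (8 / (p 0 * a ^ 3))"
    using \<kappa>1 \<kappa>2 \<tau> E_nonneg \<kappa>2n by (intro add_mono mult_left_mono[of \<kappa>1] mult_mono[of \<tau>]) auto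
  also have "\<dots> = 136 * E / (p 0 * a)"
    using a p_0_pos by (simp add: field_simps power2_eq_square power3_eq_cube)
  also have "\<dots> \<le> 1088 * E"
  proof -
    have "136 * E \<le> 1088 * E * (p 0 * a)"
      using mult_left_mono[OF a8, of "1088 * E"] E_nonneg by simp
    then show ?thesis using a p_0_pos by (simp add: pos_divide_le_eq)
  qed
  finally have b: "E * \<kappa>1 + \<tau> * \<kappa>2 \<le> 1088 * E" .
  have "\<eta>\<^sup>2 * (E * \<kappa>1 + \<tau> * \<kappa>2) \<le> \<eta>\<^sup>2 * (1088 * E)" by (intro mult_left_mono b) simp
  also have "\<dots> = \<eta> * E" by (simp add: \<eta>_def power2_eq_square)
  finally have V: "1 / 4 * V \<le> (1 - 1 / 2176) / 2 * E"
    by (simp add: V_def \<eta>_def algebra_simps)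
  have "(\<integral>\<^sup>+z. ennreal ((N z)\<^sup>2 / P z) \<partial>lborel) \<le> (\<integral>\<^sup>+z. ennreal (1 / 4) * (\<integral>\<^sup>+x. ennreal (G x (z - x)) \<partial>lborel) \<partial>lborel)"
    by (intro nn_integral_mono NG)
  also have "\<dots> = ennreal (1 / 4) * (\<integral>\<^sup>+z. \<integral>\<^sup>+x. ennreal (G x (z - x)) \<partial>lborel \<partial>lborel)"
    by (rule nn_integral_cmult) measurable
  also have "(\<integral>\<^sup>+z. \<integral>\<^sup>+x. ennreal (G x (z - x)) \<partial>lborel \<partial>lborel) = (\<integral>\<^sup>+x. \<integral>\<^sup>+z. ennreal (G x (z - x)) \<partial>lborel \<partial>lborel)"
    by (rule lborel_pair.Fubini') measurable
  also have "\<dots> = (\<integral>\<^sup>+x. \<integral>\<^sup>+y. ennreal (G x y) \<partial>lborel \<partial>lborel)"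
  proof (rule nn_integral_cong)
    fix x :: real
    have "(\<lambda>y. ennreal (G x y)) \<in> borel_measurable borel" by measurable
    then show "(\<integral>\<^sup>+z. ennreal (G x (z - x)) \<partial>lborel) = (\<integral>\<^sup>+y. ennreal (G x y) \<partial>lborel)"
      using nn_integral_lborel_shift[of "\<lambda>y. ennreal (G x y)" "- x"] by simp
  qed
  also have "\<dots> = (\<integral>\<^sup>+z. ennreal (case z of (x, y) \<Rightarrow> G x y) \<partial>(lborel \<Otimes>\<^sub>M lborel))"
    by (subst lborel.nn_integral_fst[symmetric]) simp_all
  also have "\<dots> = ennreal V"
    using hG G0 by (subst nn_integral_eq_integral) (auto simp: has_bochner_integral_iff)
  also have "ennreal (1 / 4) * ennreal V = ennreal (1 / 4 * V)"
    by (subst ennreal_mult') simp_all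
  also have "\<dots> \<le> ennreal ((1 - 1 / 2176) / 2 * E)" by (rule ennreal_leI[OF V])
  finally show ?thesis .
qed

end

section \<open>Marginals and fibre means\<close>

text \<open>A density relative to the one-dimensional \<open>gauss\<close>; the factor
  \<open>gauss_dens\<close> has to be added for statements about Lebesgue measure.\<close>

definition marg :: "'a::euclidean_space \<Rightarrow> ('a \<Rightarrow> real) \<Rightarrow> real \<Rightarrow> real" where
  "marg e f x = (\<integral>v. f (perp e v + x *\<^sub>R e) \<partial>gauss)"

text \<open>Not divided by the mass of the fibre, so that it transforms by a convolution under the
  rotation; the conditional mean is the quotient by \<open>marg\<close>.\<close>

definition fibre_mean :: "'a::euclidean_space \<Rightarrow> ('a \<Rightarrow> real) \<Rightarrow> 'a \<Rightarrow> real \<Rightarrow> real" where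
  "fibre_mean e f i x = (\<integral>v. f (perp e v + x *\<^sub>R e) * (perp e v \<bullet> i) \<partial>gauss)"

lemma perp_add: "perp e (x + y) = perp e x + perp e y" and perp_diff: "perp e (x - y) = perp e x - perp e y"
  and perp_scaleR: "perp e (c *\<^sub>R x) = c *\<^sub>R perp e x" and perp_minus: "perp e (- x) = - perp e x"
  by (simp_all add: perp_def inner_simps algebra_simps)

lemma perp_inner_commute: "perp e v \<bullet> i = v \<bullet> perp e i"
  by (simp add: perp_def inner_simps inner_commute)

lemma perp_props:
  assumes e: "norm e = 1"
  shows "perp e v \<bullet> e = 0" "perp e e = 0" "perp e (perp e v) = perp e v" "(perp e v + r *\<^sub>R e) \<bullet> e = r"
    "perp e (perp e v + r *\<^sub>R e) = perp e v" "norm (perp e v) \<le> norm v"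
proof -
  have ee: "e \<bullet> e = 1" using e by (simp add: norm_eq_1)
  show *: "perp e v \<bullet> e = 0" "perp e e = 0" "(perp e v + r *\<^sub>R e) \<bullet> e = r" for v
    by (simp_all add: perp_def inner_simps ee)
  show **: "perp e (perp e v) = perp e v" by (subst perp_def) (simp add: *)
  show "perp e (perp e v + r *\<^sub>R e) = perp e v"
    by (simp add: perp_add perp_scaleR ** *)
  have "(norm (perp e v))\<^sup>2 = perp e v \<bullet> v"
    unfolding power2_norm_eq_inner by (subst perp_inner_commute) (simp add: ** perp_inner_commute inner_commute)
  also have "\<dots> \<le> norm (perp e v) * norm v" by (rule norm_cauchy_schwarz)
  finally show "norm (perp e v) \<le> norm v"
    by (cases "norm (perp e v) = 0") (auto simp: power2_eq_square)
qed

lemma lcb_fibre: "lcb f \<Longrightarrow> lcb (\<lambda>v. f (perp e v + x *\<^sub>R e))"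
proof (erule lcb_compose)
  fix v w s
  have c: "(1 - s) *\<^sub>R (x *\<^sub>R e) + s *\<^sub>R (x *\<^sub>R e) = x *\<^sub>R e" by (simp add: left_diff_distrib flip: scaleR_add_left)
  have "(1 - s) *\<^sub>R (p + q) + s *\<^sub>R (p' + q) = ((1 - s) *\<^sub>R p + s *\<^sub>R p') + ((1 - s) *\<^sub>R q + s *\<^sub>R q)" for p p' q :: 'a
    by (simp only: scaleR_add_right add_ac)
  from this[of "perp e v" "x *\<^sub>R e" "perp e w"] show "perp e ((1 - s) *\<^sub>R v + s *\<^sub>R w) + x *\<^sub>R e = (1 - s) *\<^sub>R (perp e v + x *\<^sub>R e) + s *\<^sub>R (perp e w + x *\<^sub>R e)"
    unfolding perp_affine c by simp
qed measurable

lemma lcb_marg: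
  assumes f: "lcb f" shows "lcb (marg e f)"
proof -
  note [measurable] = lcbD(1)[OF f]
  obtain M where M: "f x \<le> M" for x using f by (auto simp: lcb_def)
  show ?thesis
    unfolding marg_def
  proof (rule lcb_integral_snd)
  show "(\<lambda>(x, v). f (perp e v + x *\<^sub>R e)) \<in> borel_measurable (borel \<Otimes>\<^sub>M borel)" by measurable
  show "f (perp e v + x *\<^sub>R e) \<le> M" for x v by (rule M)
  show "0 \<le> f (perp e v + x *\<^sub>R e)" for x v by (rule lcbD(3)[OF f])
  fix x v x' v' and s :: real assume s: "0 < s" "s < 1"
  show "f (perp e v + x *\<^sub>R e) powr (1 - s) * f (perp e v' + x' *\<^sub>R e) powr s
    \<le> f (perp e ((1 - s) *\<^sub>R v + s *\<^sub>R v') + ((1 - s) *\<^sub>R x + s *\<^sub>R x') *\<^sub>R e)"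
    using log_concaveD(2)[OF lcbD(2)[OF f] s] unfolding real_scaleR_def perp_add_affine by blast
  qed
qed

lemma marg_nonneg: "lcb f \<Longrightarrow> 0 \<le> marg e f x"
  by (rule lcbD(3)[OF lcb_marg])

lemma marg_even: "lcb f \<Longrightarrow> even_fun f \<Longrightarrow> marg e f (- x) = marg e f x"
proof -
  assume f: "lcb f" "even_fun f"
  have "marg e f (- x) = (\<integral>v. f (perp e (- v) + (- x) *\<^sub>R e) \<partial>gauss)"
    unfolding marg_def by (rule integral_gauss_uminus[symmetric]) (rule lcbD(1)[OF lcb_fibre[OF f(1)]])
  also have "\<dots> = (\<integral>v. f (- (perp e v + x *\<^sub>R e)) \<partial>gauss)" by (simp add: perp_minus)
  also have "\<dots> = marg e f x" using f(2) unfolding even_fun_def marg_def by (simp only:)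
  finally show ?thesis .
qed

lemma fibre_mean_odd: "lcb f \<Longrightarrow> even_fun f \<Longrightarrow> fibre_mean e f i (- x) = - fibre_mean e f i x"
proof -
  assume f: "lcb f" "even_fun f"
  note [measurable] = lcbD(1)[OF f(1)]
  have "fibre_mean e f i (- x) = (\<integral>v. f (perp e (- v) + (- x) *\<^sub>R e) * (perp e (- v) \<bullet> i) \<partial>gauss)"
    unfolding fibre_mean_def by (rule integral_gauss_uminus[symmetric]) measurable
  also have "\<dots> = (\<integral>v. - (f (- (perp e v + x *\<^sub>R e)) * (perp e v \<bullet> i)) \<partial>gauss)" by (simp add: perp_minus)
  also have "\<dots> = (\<integral>v. - (f (perp e v + x *\<^sub>R e) * (perp e v \<bullet> i)) \<partial>gauss)"
    using f(2) unfolding even_fun_def by (simp only:)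
  finally show ?thesis by (simp add: fibre_mean_def)
qed

lemma integrable_perp_inner:
  assumes e: "norm e = 1"
  shows "integrable gauss (\<lambda>v. perp e v \<bullet> i)" "integrable gauss (\<lambda>v. (perp e v \<bullet> i)\<^sup>2)"
proof -
  show "integrable gauss (\<lambda>v. perp e v \<bullet> i)"
    unfolding perp_inner_commute using integrable_gauss_id by (rule integrable_inner_left)
  show "integrable gauss (\<lambda>v. (perp e v \<bullet> i)\<^sup>2)"
  proof (rule Bochner_Integration.integrable_bound[OF integrable_mult_left[OF integrable_gauss_norm_square, of "(norm (perp e i))\<^sup>2"]])
    show "AE v in gauss. norm ((perp e v \<bullet> i)\<^sup>2) \<le> norm ((norm v)\<^sup>2 * (norm (perp e i))\<^sup>2)"
    proof (rule AE_I2)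
      fix v
      have "\<bar>v \<bullet> perp e i\<bar>\<^sup>2 \<le> (norm v * norm (perp e i))\<^sup>2"
        by (intro power_mono Cauchy_Schwarz_ineq2) simp
      then show "norm ((perp e v \<bullet> i)\<^sup>2) \<le> norm ((norm v)\<^sup>2 * (norm (perp e i))\<^sup>2)"
        by (simp add: perp_inner_commute power_mult_distrib)
    qed
  qed measurable
qed

text \<open>The rotation acts separately along \<open>e\<close> and orthogonally to it. Here
  \<open>r\<close> is the component along \<open>e\<close> of the integration variable of
  \<open>conv\<close>; the rotation is undone only in the orthogonal variables, which become
  \<open>x\<close> and \<open>y\<close>.\<close>

lemma conv_fibre:
  fixes \<omega> :: "'a::euclidean_space \<Rightarrow> real"
  assumes f: "lcb f" and e: "norm e = 1" and \<omega>: "integrable gauss \<omega>"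
  shows "(\<integral>v. conv f (perp e v + u *\<^sub>R e) * \<omega> v \<partial>gauss)
    = (\<integral>r. (\<integral>x. (\<integral>y. f (perp e x + ((u - r) / sqrt 2) *\<^sub>R e) * f (perp e y + ((u + r) / sqrt 2) *\<^sub>R e)
         * \<omega> ((x + y) /\<^sub>R sqrt 2) \<partial>gauss) \<partial>gauss) \<partial>gauss)"
proof -
  have [measurable]: "\<omega> \<in> borel_measurable borel" using \<omega> by (auto dest: borel_measurable_integrable)
  note [measurable] = lcbD(1)[OF f]
  obtain M where M: "f x \<le> M" for x using f by (auto simp: lcb_def)
  have nn: "0 \<le> f x" for x by (rule lcbD(3)[OF f])
  have M0: "0 \<le> M" using M nn order_trans by blast
  have ff: "\<bar>f x * f y\<bar> \<le> M * M" for x y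
    using M nn M0 by (simp add: mult_mono)
  define \<Phi> where "\<Phi> r x y = f (perp e x + ((u - r) / sqrt 2) *\<^sub>R e) * f (perp e y + ((u + r) / sqrt 2) *\<^sub>R e)" for r x y
  have \<Phi>b: "\<bar>\<Phi> r x y\<bar> \<le> M * M" for r x y unfolding \<Phi>_def by (rule ff)
  have tw: "twist f (perp e v + u *\<^sub>R e) (perp e w + r *\<^sub>R e) = \<Phi> r ((v - w) /\<^sub>R sqrt 2) ((v + w) /\<^sub>R sqrt 2)" for v w r
    unfolding twist_def \<Phi>_def perp_scaleR perp_add perp_diff
    by (simp add: scaleR_add_right scaleR_diff_right algebra_simps divide_inverse)
  have conv: "conv f (perp e v + u *\<^sub>R e) = (\<integral>r. (\<integral>w. \<Phi> r ((v - w) /\<^sub>R sqrt 2) ((v + w) /\<^sub>R sqrt 2) \<partial>gauss) \<partial>gauss)" for v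
    unfolding conv_def tw[symmetric]
    by (rule integral_gauss_perp(2)[OF lcbD(4)[OF lcb_twist[OF f]] e, symmetric])
  have int1: "integrable (gauss \<Otimes>\<^sub>M gauss) (\<lambda>(v, r::real). (\<integral>w. \<Phi> r ((v - w) /\<^sub>R sqrt 2) ((v + w) /\<^sub>R sqrt 2) \<partial>gauss) * \<omega> v)"
  proof (rule Bochner_Integration.integrable_bound)
    show "integrable (gauss \<Otimes>\<^sub>M gauss) (\<lambda>(v, r::real). \<omega> v *\<^sub>R (M * M))"
      by (rule integrable_pair_mult[OF \<omega>]) simp
    show "(\<lambda>(v, r::real). (\<integral>w. \<Phi> r ((v - w) /\<^sub>R sqrt 2) ((v + w) /\<^sub>R sqrt 2) \<partial>gauss) * \<omega> v) \<in> borel_measurable (gauss \<Otimes>\<^sub>M gauss)"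
      unfolding \<Phi>_def by measurable
    have "\<bar>\<integral>w. \<Phi> r ((v - w) /\<^sub>R sqrt 2) ((v + w) /\<^sub>R sqrt 2) \<partial>gauss\<bar> \<le> M * M" for v r
    proof -
      have i: "integrable gauss (\<lambda>w. \<Phi> r ((v - w) /\<^sub>R sqrt 2) ((v + w) /\<^sub>R sqrt 2))"
        using \<Phi>b by (intro gauss.integrable_const_bound[where B = "M * M"]) (auto simp: \<Phi>_def)
      have "\<bar>\<integral>w. \<Phi> r ((v - w) /\<^sub>R sqrt 2) ((v + w) /\<^sub>R sqrt 2) \<partial>gauss\<bar> \<le> (\<integral>w. \<bar>\<Phi> r ((v - w) /\<^sub>R sqrt 2) ((v + w) /\<^sub>R sqrt 2)\<bar> \<partial>gauss)"
        by (rule integral_abs_bound)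
      also have "\<dots> \<le> M * M" using i \<Phi>b by (intro gauss.integral_le_const) auto
      finally show ?thesis .
    qed
    then show "AE z in gauss \<Otimes>\<^sub>M gauss. norm (case z of (v, r) \<Rightarrow> (\<integral>w. \<Phi> r ((v - w) /\<^sub>R sqrt 2) ((v + w) /\<^sub>R sqrt 2) \<partial>gauss) * \<omega> v)
       \<le> norm (case z of (v, r) \<Rightarrow> \<omega> v *\<^sub>R (M * M))"
      using M0 by (intro AE_I2) (auto simp: abs_mult mult.commute intro!: mult_left_mono)
  qed
  have "(\<integral>v. conv f (perp e v + u *\<^sub>R e) * \<omega> v \<partial>gauss)
     = (\<integral>v. (\<integral>r. (\<integral>w. \<Phi> r ((v - w) /\<^sub>R sqrt 2) ((v + w) /\<^sub>R sqrt 2) \<partial>gauss) * \<omega> v \<partial>gauss) \<partial>gauss)"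
    unfolding conv by simp
  also have "\<dots> = (\<integral>r. (\<integral>v. (\<integral>w. \<Phi> r ((v - w) /\<^sub>R sqrt 2) ((v + w) /\<^sub>R sqrt 2) \<partial>gauss) * \<omega> v \<partial>gauss) \<partial>gauss)"
    by (rule gauss2.Fubini_integral[OF int1, symmetric])
  also have "\<dots> = (\<integral>r. (\<integral>x. (\<integral>y. \<Phi> r x y * \<omega> ((x + y) /\<^sub>R sqrt 2) \<partial>gauss) \<partial>gauss) \<partial>gauss)"
  proof (rule Bochner_Integration.integral_cong[OF refl])
    fix r :: real
    have io: "integrable (gauss \<Otimes>\<^sub>M gauss) (\<lambda>(x::'a, y). \<omega> ((x + y) /\<^sub>R sqrt 2))"
    proof -
      have "integrable (gauss \<Otimes>\<^sub>M gauss) (\<lambda>(x::'a, y). (1::real) *\<^sub>R \<omega> y)"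
        by (rule integrable_pair_mult[OF _ \<omega>]) simp
      from integral_gauss_rotation(2)[OF this] show ?thesis by simp
    qed
    have i: "integrable (gauss \<Otimes>\<^sub>M gauss) (\<lambda>(x, y). \<Phi> r x y * \<omega> ((x + y) /\<^sub>R sqrt 2))"
    proof (rule Bochner_Integration.integrable_bound[OF integrable_mult_right[OF io, of "M * M"]])
      show "(\<lambda>(x, y). \<Phi> r x y * \<omega> ((x + y) /\<^sub>R sqrt 2)) \<in> borel_measurable (gauss \<Otimes>\<^sub>M gauss)"
        unfolding \<Phi>_def by measurable
      show "AE z in gauss \<Otimes>\<^sub>M gauss. norm (case z of (x, y) \<Rightarrow> \<Phi> r x y * \<omega> ((x + y) /\<^sub>R sqrt 2))
        \<le> norm (M * M * (case z of (x, y) \<Rightarrow> \<omega> ((x + y) /\<^sub>R sqrt 2)))"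
        using \<Phi>b M0 by (intro AE_I2) (auto simp: abs_mult intro!: mult_right_mono)
    qed
    have sum: "((v - w) /\<^sub>R sqrt 2 + (v + w) /\<^sub>R sqrt 2) /\<^sub>R sqrt 2 = v" for v w :: 'a
    proof -
      have "(v - w) /\<^sub>R sqrt 2 + (v + w) /\<^sub>R sqrt 2 = inverse (sqrt 2) *\<^sub>R (2 *\<^sub>R v)"
        by (simp only: scaleR_add_right[symmetric]) (simp add: scaleR_2)
      then have "((v - w) /\<^sub>R sqrt 2 + (v + w) /\<^sub>R sqrt 2) /\<^sub>R sqrt 2 = (inverse (sqrt 2) * inverse (sqrt 2) * 2) *\<^sub>R v"
        by simp
      also have "inverse (sqrt 2) * inverse (sqrt 2) * 2 = (1::real)" by (simp add: field_simps)
      finally show ?thesis by simp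
    qed
    have "(\<integral>v. (\<integral>w. \<Phi> r ((v - w) /\<^sub>R sqrt 2) ((v + w) /\<^sub>R sqrt 2) \<partial>gauss) * \<omega> v \<partial>gauss)
       = (\<integral>v. (\<integral>w. \<Phi> r ((v - w) /\<^sub>R sqrt 2) ((v + w) /\<^sub>R sqrt 2) * \<omega> v \<partial>gauss) \<partial>gauss)"
      by simp
    also have "\<dots> = (\<integral>x. (\<integral>y. \<Phi> r x y * \<omega> ((x + y) /\<^sub>R sqrt 2) \<partial>gauss) \<partial>gauss)"
      using integral_gauss_rotation(1)[OF i] by (simp only: prod.case sum)
    finally show "(\<integral>v. (\<integral>w. \<Phi> r ((v - w) /\<^sub>R sqrt 2) ((v + w) /\<^sub>R sqrt 2) \<partial>gauss) * \<omega> v \<partial>gauss)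
       = (\<integral>x. (\<integral>y. \<Phi> r x y * \<omega> ((x + y) /\<^sub>R sqrt 2) \<partial>gauss) \<partial>gauss)" .
  qed
  finally show ?thesis unfolding \<Phi>_def .
qed

lemma marg_conv:
  assumes f: "lcb f" and e: "norm e = 1"
  shows "marg e (conv f) u = (\<integral>r. marg e f ((u - r) / sqrt 2) * marg e f ((u + r) / sqrt 2) \<partial>gauss)"
proof -
  have "marg e (conv f) u = (\<integral>v. conv f (perp e v + u *\<^sub>R e) * 1 \<partial>gauss)" by (simp add: marg_def)
  also have "\<dots> = (\<integral>r. marg e f ((u - r) / sqrt 2) * marg e f ((u + r) / sqrt 2) \<partial>gauss)"
    by (subst conv_fibre[OF f e]) (simp_all add: marg_def)
  finally show ?thesis .
qed

lemma fibre_mean_conv: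
  assumes f: "lcb f" and e: "norm e = 1"
  shows "fibre_mean e (conv f) i u = (\<integral>r. (fibre_mean e f i ((u - r) / sqrt 2) * marg e f ((u + r) / sqrt 2)
      + marg e f ((u - r) / sqrt 2) * fibre_mean e f i ((u + r) / sqrt 2)) / sqrt 2 \<partial>gauss)"
proof -
  note [measurable] = lcbD(1)[OF f]
  have i0: "integrable gauss (\<lambda>v. f (perp e v + x *\<^sub>R e))" for x by (rule lcbD(4)[OF lcb_fibre[OF f]])
  have i1: "integrable gauss (\<lambda>v. f (perp e v + x *\<^sub>R e) * (perp e v \<bullet> i))" for x
    using integrable_lcb_mult[OF lcb_fibre[OF f] integrable_perp_inner(1)[OF e]] by simp
  have "fibre_mean e (conv f) i u = (\<integral>r. (\<integral>x. (\<integral>y. f (perp e x + ((u - r) / sqrt 2) *\<^sub>R e) * f (perp e y + ((u + r) / sqrt 2) *\<^sub>R e)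
         * (perp e ((x + y) /\<^sub>R sqrt 2) \<bullet> i) \<partial>gauss) \<partial>gauss) \<partial>gauss)"
    unfolding fibre_mean_def by (rule conv_fibre[OF f e integrable_perp_inner(1)[OF e]])
  also have "\<dots> = (\<integral>r. (\<integral>x. (\<integral>y. (f (perp e x + ((u - r) / sqrt 2) *\<^sub>R e) * (perp e x \<bullet> i) / sqrt 2) * f (perp e y + ((u + r) / sqrt 2) *\<^sub>R e)
       + (f (perp e x + ((u - r) / sqrt 2) *\<^sub>R e) / sqrt 2) * (f (perp e y + ((u + r) / sqrt 2) *\<^sub>R e) * (perp e y \<bullet> i)) \<partial>gauss) \<partial>gauss) \<partial>gauss)"
    by (simp add: perp_add perp_scaleR inner_simps field_simps)
  also have "\<dots> = (\<integral>r. (\<integral>x. (f (perp e x + ((u - r) / sqrt 2) *\<^sub>R e) * (perp e x \<bullet> i) / sqrt 2) * marg e f ((u + r) / sqrt 2)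
       + (f (perp e x + ((u - r) / sqrt 2) *\<^sub>R e) / sqrt 2) * fibre_mean e f i ((u + r) / sqrt 2) \<partial>gauss) \<partial>gauss)"
    using i0 i1 unfolding marg_def fibre_mean_def by simp
  also have "\<dots> = (\<integral>r. (fibre_mean e f i ((u - r) / sqrt 2) / sqrt 2) * marg e f ((u + r) / sqrt 2)
       + (marg e f ((u - r) / sqrt 2) / sqrt 2) * fibre_mean e f i ((u + r) / sqrt 2) \<partial>gauss)"
    using i0 i1 by (simp add: marg_def[of e f "(u - _) / sqrt 2"] fibre_mean_def[of e f i "(u - _) / sqrt 2"])
  finally show ?thesis by (simp add: add_divide_distrib)
qed

text \<open>On \<open>(-a, a)\<close> the integrand is at least \<open>(p 0 / 4)\<^sup>2\<close>, so
  \<open>P 0\<close> is at least \<open>p 0\<close> times \<open>p 0 * a / 8\<close>. This makes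
  lower bounds relative to \<open>P 0\<close> comparable with \<open>p 0\<close>.\<close>

lemma (in odd_perturbation) P_0_lower: "p 0 / 64 \<le> P 0"
proof -
  obtain a where a: "0 < a" and pa: "\<And>y. \<bar>y\<bar> < a \<Longrightarrow> p 0 / 4 \<le> p y" and a8: "1 / 8 \<le> p 0 * a"
    using scale_exists by metis
  have "(\<integral>x. (p 0 / 4)\<^sup>2 * indicator {-a<..<a} x \<partial>lborel) \<le> P 0"
    unfolding P_def
  proof (rule integral_mono[OF _ P_integrable])
    show "integrable lborel (\<lambda>x. (p 0 / 4)\<^sup>2 * indicator {-a<..<a} x)"
      using a by (intro integrable_mult_right integrable_real_indicator) auto
    fix x
    show "(p 0 / 4)\<^sup>2 * indicator {-a<..<a} x \<le> p x * p (0 - x)"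
    proof (cases "\<bar>x\<bar> < a")
      case True
      then have "p 0 / 4 * (p 0 / 4) \<le> p x * p x" using pa[of x] p_0_pos by (intro mult_mono) auto
      then show ?thesis using True by (simp add: p_even power2_eq_square abs_less_iff)
    qed (auto simp: indicator_def p_nonneg abs_less_iff)
  qed
  then have "p 0 * (p 0 * a) / 8 \<le> P 0" using a by (simp add: power2_eq_square mult_ac)
  moreover have "p 0 * (1 / 8) \<le> p 0 * (p 0 * a)" using a8 p_0_pos by (intro mult_left_mono) auto
  ultimately show ?thesis by simp
qed

lemma gauss_lborel_real:
  fixes g :: "real \<Rightarrow> real"
  assumes [measurable]: "g \<in> borel_measurable borel"
  shows "integrable gauss g \<longleftrightarrow> integrable lborel (\<lambda>x. g x * gauss_dens x)"
    and "(\<integral>x. g x \<partial>gauss) = (\<integral>x. g x * gauss_dens x \<partial>lborel)"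
  by (simp_all add: gauss_eq integrable_density integral_density gauss_dens_pos less_imp_le mult.commute)

text \<open>For \<open>f\<close> of mass 1, the second moment of the conditional mean of the
  coordinate \<open>i\<close> of \<open>perp e x\<close> given the component along \<open>e\<close>.
  It measures how far the fibres are from being centred and is the quantity \<open>E\<close> of the
  one-dimensional problem.\<close>

definition mean_var :: "'a::euclidean_space \<Rightarrow> ('a \<Rightarrow> real) \<Rightarrow> 'a \<Rightarrow> real" where
  "mean_var e f i = (\<integral>x. (fibre_mean e f i x)\<^sup>2 / marg e f x \<partial>gauss)"

lemma marg_measurable: "lcb f \<Longrightarrow> marg e f \<in> borel_measurable borel"
  by (rule lcbD(1)[OF lcb_marg])

lemma fibre_mean_measurable:
  assumes f: "lcb f" shows "fibre_mean e f i \<in> borel_measurable borel"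
proof -
  note [measurable] = lcbD(1)[OF f]
  show ?thesis unfolding fibre_mean_def[abs_def] by measurable
qed

lemma integral_marg:
  assumes f: "lcb f" and e: "norm e = 1"
  shows "(\<integral>x. marg e f x \<partial>gauss) = (\<integral>x. f x \<partial>gauss)"
  unfolding marg_def by (rule integral_gauss_perp(2)[OF lcbD(4)[OF f] e])

lemma integrable_fibre_integral:
  fixes \<phi> :: "'a::euclidean_space \<Rightarrow> real"
  assumes \<phi>: "integrable gauss \<phi>" and e: "norm e = 1"
  shows "integrable gauss (\<lambda>r::real. \<integral>v. \<phi> (perp e v + r *\<^sub>R e) \<partial>gauss)"
  using gauss2.integrable_snd[OF integral_gauss_perp(3)[OF \<phi> e]] by simp

lemma fibre_mean_square_le:
  assumes f: "lcb f" and e: "norm e = 1"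
  shows "(fibre_mean e f i x)\<^sup>2 \<le> marg e f x * (\<integral>v. f (perp e v + x *\<^sub>R e) * (perp e v \<bullet> i)\<^sup>2 \<partial>gauss)"
proof -
  let ?f = "\<lambda>v. f (perp e v + x *\<^sub>R e)"
  have lf: "lcb ?f" by (rule lcb_fibre[OF f])
  have nn: "0 \<le> ?f v" for v by (rule lcbD(3)[OF lf])
  note [measurable] = lcbD(1)[OF f]
  have i1: "integrable gauss (\<lambda>v. ?f v * (perp e v \<bullet> i))"
    using integrable_lcb_mult[OF lf integrable_perp_inner(1)[OF e]] by simp
  have i2: "integrable gauss (\<lambda>v. ?f v * (perp e v \<bullet> i)\<^sup>2)"
    using integrable_lcb_mult[OF lf integrable_perp_inner(2)[OF e]] by simp
  have "ennreal ((fibre_mean e f i x)\<^sup>2) = (ennreal (norm (\<integral>v. ?f v * (perp e v \<bullet> i) \<partial>gauss)))\<^sup>2"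
    by (simp add: fibre_mean_def ennreal_power)
  also have "\<dots> \<le> (\<integral>\<^sup>+v. ennreal (norm (?f v * (perp e v \<bullet> i))) \<partial>gauss)\<^sup>2"
    using i1 by (intro power_mono integral_norm_bound_ennreal) auto
  also have "(\<integral>\<^sup>+v. ennreal (norm (?f v * (perp e v \<bullet> i))) \<partial>gauss)
      = (\<integral>\<^sup>+v. ennreal (sqrt (?f v)) * ennreal (sqrt (?f v) * \<bar>perp e v \<bullet> i\<bar>) \<partial>gauss)"
    using nn by (intro nn_integral_cong) (simp add: abs_mult mult.assoc[symmetric] flip: ennreal_mult)
  also have "\<dots>\<^sup>2 \<le> (\<integral>\<^sup>+v. ennreal (sqrt (?f v)) ^ 2 \<partial>gauss) * (\<integral>\<^sup>+v. ennreal (sqrt (?f v) * \<bar>perp e v \<bullet> i\<bar>) ^ 2 \<partial>gauss)"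
    by (rule Cauchy_Schwarz_nn_integral) simp_all
  also have "\<dots> = (\<integral>\<^sup>+v. ennreal (?f v) \<partial>gauss) * (\<integral>\<^sup>+v. ennreal (?f v * (perp e v \<bullet> i)\<^sup>2) \<partial>gauss)"
    using nn by (simp add: ennreal_power power_mult_distrib)
  also have "\<dots> = ennreal (marg e f x) * ennreal (\<integral>v. ?f v * (perp e v \<bullet> i)\<^sup>2 \<partial>gauss)"
    using i2 nn by (simp add: nn_integral_lcb[OF lf] marg_def nn_integral_eq_integral)
  also have "\<dots> = ennreal (marg e f x * (\<integral>v. ?f v * (perp e v \<bullet> i)\<^sup>2 \<partial>gauss))"
    using nn marg_nonneg[OF f] by (intro ennreal_mult[symmetric]) auto
  finally show ?thesis
    using nn marg_nonneg[OF f] by (subst (asm) ennreal_le_iff) auto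
qed

text \<open>Taking conditional means does not increase second moments: Cauchy-Schwarz on every
  fibre, integrated over the fibres.\<close>

lemma mean_var_props:
  assumes f: "lcb f" and e: "norm e = 1"
  shows "integrable gauss (\<lambda>x. (fibre_mean e f i x)\<^sup>2 / marg e f x)"
    and "mean_var e f i \<le> (\<integral>x. f x * (perp e x \<bullet> i)\<^sup>2 \<partial>gauss)" "0 \<le> mean_var e f i"
proof -
  have nn: "0 \<le> f x" for x by (rule lcbD(3)[OF f])
  have [measurable]: "marg e f \<in> borel_measurable borel" "fibre_mean e f i \<in> borel_measurable borel"
    using f by (simp_all add: marg_measurable fibre_mean_measurable)
  define sec where "sec x = (\<integral>v. f (perp e v + x *\<^sub>R e) * (perp e v \<bullet> i)\<^sup>2 \<partial>gauss)" for x
  have i2: "integrable gauss (\<lambda>x. f x * (perp e x \<bullet> i)\<^sup>2)"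
    using integrable_lcb_mult[OF f integrable_perp_inner(2)[OF e]] by simp
  have iS: "integrable gauss sec"
    using integrable_fibre_integral[OF i2 e] by (simp add: sec_def[abs_def] perp_props[OF e])
  have sI: "(\<integral>x. sec x \<partial>gauss) = (\<integral>x. f x * (perp e x \<bullet> i)\<^sup>2 \<partial>gauss)"
    unfolding sec_def using integral_gauss_perp(2)[OF i2 e] by (simp add: perp_props[OF e])
  have le: "(fibre_mean e f i x)\<^sup>2 / marg e f x \<le> sec x" for x
  proof (cases "marg e f x = 0")
    case True
    then show ?thesis using nn by (simp add: sec_def)
  next
    case False
    then show ?thesis
      using fibre_mean_square_le[OF f e, of i x] marg_nonneg[OF f, of e x]
      by (simp add: sec_def pos_divide_le_eq mult.commute)
  qed
  show i: "integrable gauss (\<lambda>x. (fibre_mean e f i x)\<^sup>2 / marg e f x)"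
    using iS by (rule Bochner_Integration.integrable_bound)
      (auto intro!: AE_I2 order_trans[OF le] simp: marg_nonneg[OF f])
  show "mean_var e f i \<le> (\<integral>x. f x * (perp e x \<bullet> i)\<^sup>2 \<partial>gauss)"
    unfolding mean_var_def sI[symmetric] by (rule integral_mono[OF i iS le])
  show "0 \<le> mean_var e f i"
    unfolding mean_var_def using marg_nonneg[OF f] by simp
qed

lemma even_log_concave_density_marg:
  assumes f: "lcb f" "even_fun f" "(\<integral>x. f x \<partial>gauss) = 1" and e: "norm e = 1"
  shows "even_log_concave_density (\<lambda>x. marg e f x * gauss_dens x)"
proof
  show "log_concave (\<lambda>x. marg e f x * gauss_dens x)"
    by (rule log_concave_mult[OF lcbD(2)[OF lcb_marg[OF f(1)]] log_concave_gauss_dens])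
  show "marg e f (- x) * gauss_dens (- x) = marg e f x * gauss_dens x" for x
    by (simp add: marg_even[OF f(1,2)] gauss_dens_def)
  have [measurable]: "marg e f \<in> borel_measurable borel" by (rule marg_measurable[OF f(1)])
  show "(\<lambda>x. marg e f x * gauss_dens x) \<in> borel_measurable borel" by measurable
  show "integrable lborel (\<lambda>x. marg e f x * gauss_dens x)"
    using lcbD(4)[OF lcb_marg[OF f(1)], of e] by (subst (asm) gauss_lborel_real) auto
  show "(\<integral>x. marg e f x * gauss_dens x \<partial>lborel) = 1"
    using integral_marg[OF f(1) e] f(3) by (subst (asm) gauss_lborel_real) auto
qed

lemma integrable_inner_perp_inner:
  assumes f: "lcb f" and e: "norm e = 1"
  shows "integrable gauss (\<lambda>x. f x * ((x \<bullet> e) * (perp e x \<bullet> i)))"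
proof -
  have "integrable gauss (\<lambda>x. (x \<bullet> e) * (perp e x \<bullet> i))"
  proof (rule Bochner_Integration.integrable_bound[OF integrable_mult_left[OF integrable_gauss_norm_square, of "norm (perp e i)"]])
    show "AE x in gauss. norm ((x \<bullet> e) * (perp e x \<bullet> i)) \<le> norm ((norm x)\<^sup>2 * norm (perp e i))"
    proof (rule AE_I2)
      fix x
      have "\<bar>x \<bullet> e\<bar> * \<bar>x \<bullet> perp e i\<bar> \<le> (norm x * norm e) * (norm x * norm (perp e i))"
        by (intro mult_mono Cauchy_Schwarz_ineq2) auto
      then show "norm ((x \<bullet> e) * (perp e x \<bullet> i)) \<le> norm ((norm x)\<^sup>2 * norm (perp e i))"
        using e by (simp add: perp_inner_commute abs_mult power2_eq_square mult_ac)
    qed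
  qed measurable
  from integrable_lcb_mult[OF f this] show ?thesis by simp
qed

text \<open>The integral of \<open>r\<close> times the fibre mean is the covariance of the component
  along \<open>e\<close> with a coordinate orthogonal to it, so \<open>orth\<close> is precisely the
  vanishing first moment.\<close>

lemma odd_perturbation_marg:
  assumes f: "lcb f" "even_fun f" "(\<integral>x. f x \<partial>gauss) = 1" and e: "norm e = 1"
    and orth: "(\<integral>x. f x * ((x \<bullet> e) * (perp e x \<bullet> i)) \<partial>gauss) = 0"
  shows "odd_perturbation (\<lambda>x. marg e f x * gauss_dens x) (\<lambda>x. fibre_mean e f i x * gauss_dens x)"
proof (intro odd_perturbation.intro odd_perturbation_axioms.intro)
  show "even_log_concave_density (\<lambda>x. marg e f x * gauss_dens x)"
    by (rule even_log_concave_density_marg[OF f e])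
  have [measurable]: "marg e f \<in> borel_measurable borel" "fibre_mean e f i \<in> borel_measurable borel"
    using f by (simp_all add: marg_measurable fibre_mean_measurable)
  show "(\<lambda>x. fibre_mean e f i x * gauss_dens x) \<in> borel_measurable borel" by measurable
  show "fibre_mean e f i (- x) * gauss_dens (- x) = - (fibre_mean e f i x * gauss_dens x)" for x
    by (simp add: fibre_mean_odd[OF f(1,2)] gauss_dens_def)
  show "fibre_mean e f i x * gauss_dens x = 0" if "marg e f x * gauss_dens x = 0" for x
    using that fibre_mean_square_le[OF f(1) e, of i x] gauss_dens_pos[of x] by auto
  have "(fibre_mean e f i x * gauss_dens x)\<^sup>2 / (marg e f x * gauss_dens x) = (fibre_mean e f i x)\<^sup>2 / marg e f x * gauss_dens x" for x
    using gauss_dens_pos[of x] by (simp add: power2_eq_square)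
  then show "integrable lborel (\<lambda>x. (fibre_mean e f i x * gauss_dens x)\<^sup>2 / (marg e f x * gauss_dens x))"
    using mean_var_props(1)[OF f(1) e, of i] by (subst (asm) gauss_lborel_real) auto
  note ii = integrable_inner_perp_inner[OF f(1) e, of i]
  have eq: "(\<integral>v. f (perp e v + r *\<^sub>R e) * (((perp e v + r *\<^sub>R e) \<bullet> e) * (perp e (perp e v + r *\<^sub>R e) \<bullet> i)) \<partial>gauss)
     = r * fibre_mean e f i r" for r
    unfolding perp_props[OF e] fibre_mean_def by (simp add: mult.left_commute[of _ r] mult.assoc)
  have "integrable gauss (\<lambda>r. r * fibre_mean e f i r)"
    using integrable_fibre_integral[OF ii e] unfolding eq .
  then show "integrable lborel (\<lambda>x. x * (fibre_mean e f i x * gauss_dens x))"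
    by (subst (asm) gauss_lborel_real) (auto simp: mult.assoc)
  have "(\<integral>r. r * fibre_mean e f i r \<partial>gauss) = 0"
    using integral_gauss_perp(2)[OF ii e] orth unfolding eq by simp
  then show "(\<integral>x. x * (fibre_mean e f i x * gauss_dens x) \<partial>lborel) = 0"
    by (subst (asm) gauss_lborel_real) (auto simp: mult.assoc)
qed

lemma gauss_dens_rotation:
  "gauss_dens u * gauss_dens (r::real) = gauss_dens ((u - r) / sqrt 2) * gauss_dens ((u + r) / sqrt 2)"
proof -
  have "((u - r) / sqrt 2)\<^sup>2 + ((u + r) / sqrt 2)\<^sup>2 = u\<^sup>2 + r\<^sup>2"
    by (simp add: power_divide power2_sum power2_diff field_simps)
  then have "exp (- u\<^sup>2 / 2) * exp (- r\<^sup>2 / 2) = exp (- ((u - r) / sqrt 2)\<^sup>2 / 2) * exp (- ((u + r) / sqrt 2)\<^sup>2 / 2)"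
    by (simp flip: exp_add)
  then show ?thesis unfolding gauss_dens_def real_norm_def power2_abs by simp
qed

lemma gauss_dens_rotation_mult:
  "c * d * gauss_dens r * gauss_dens u
    = (c * gauss_dens ((u - r) / sqrt 2)) * (d * gauss_dens ((u + r) / sqrt 2))" for c d r u :: real
proof -
  have "c * d * gauss_dens r * gauss_dens u = c * d * (gauss_dens u * gauss_dens r)" by simp
  also have "\<dots> = (c * gauss_dens ((u - r) / sqrt 2)) * (d * gauss_dens ((u + r) / sqrt 2))"
    by (subst gauss_dens_rotation) (simp only: mult_ac)
  finally show ?thesis .
qed

text \<open>The substitution of \<open>u - sqrt 2 * x\<close> for \<open>r\<close>, with the
  Gaussian densities carried along by their rotation invariance, turns the Gaussian rotation into an
  ordinary convolution at \<open>sqrt 2 * u\<close>.\<close>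

lemma integral_gauss_convolution:
  fixes g h :: "real \<Rightarrow> real"
  assumes [measurable]: "g \<in> borel_measurable borel" "h \<in> borel_measurable borel"
  shows "(\<integral>r. g ((u - r) / sqrt 2) * h ((u + r) / sqrt 2) \<partial>gauss) * gauss_dens u
    = sqrt 2 * (\<integral>x. (g x * gauss_dens x) * (h (sqrt 2 * u - x) * gauss_dens (sqrt 2 * u - x)) \<partial>lborel)"
proof -
  have "(\<integral>r. g ((u - r) / sqrt 2) * h ((u + r) / sqrt 2) \<partial>gauss) * gauss_dens u
     = (\<integral>r. g ((u - r) / sqrt 2) * h ((u + r) / sqrt 2) * gauss_dens r * gauss_dens u \<partial>lborel)"
    by (subst gauss_lborel_real) simp_all
  also have "\<dots> = (\<integral>r. (g ((u - r) / sqrt 2) * gauss_dens ((u - r) / sqrt 2)) * (h ((u + r) / sqrt 2) * gauss_dens ((u + r) / sqrt 2)) \<partial>lborel)"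
    by (simp only: gauss_dens_rotation_mult)
  also have "\<dots> = \<bar>- sqrt 2\<bar> *\<^sub>R (\<integral>x. (g ((u - (u + - sqrt 2 * x)) / sqrt 2) * gauss_dens ((u - (u + - sqrt 2 * x)) / sqrt 2))
        * (h ((u + (u + - sqrt 2 * x)) / sqrt 2) * gauss_dens ((u + (u + - sqrt 2 * x)) / sqrt 2)) \<partial>lborel)"
    by (rule lborel_integral_real_affine) simp
  also have "\<dots> = sqrt 2 * (\<integral>x. (g x * gauss_dens x) * (h (sqrt 2 * u - x) * gauss_dens (sqrt 2 * u - x)) \<partial>lborel)"
  proof -
    have 1: "(u - (u + - sqrt 2 * x)) / sqrt 2 = x" for x by simp
    have "(u + u) / sqrt 2 = sqrt 2 * u" by (simp add: field_simps)
    then have 2: "(u + (u + - sqrt 2 * x)) / sqrt 2 = sqrt 2 * u - x" for x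
      by (simp add: diff_divide_distrib add_divide_distrib)
    show ?thesis unfolding 1 2 by simp
  qed
  finally show ?thesis .
qed

text \<open>After multiplication by \<open>gauss_dens\<close>, the new marginal is
  \<open>sqrt 2 * P\<close> and the new fibre mean \<open>2 * N\<close>, both at
  \<open>sqrt 2 * u\<close>; rescaling the integral yields twice that of
  \<open>N\<^sup>2 / P\<close>, so the 1/2 in \<open>contraction\<close> disappears. The second part
  bounds the conditional mean at single points where the density is not too small: there
  \<open>P\<close> is at least \<delta>/64 of the maximum of the density, and \<open>2 * 64\<close>
  gives 128.\<close>

lemma mean_var_conv:
  fixes f :: "'a::euclidean_space \<Rightarrow> real"
  assumes f: "lcb f" "even_fun f" "(\<integral>x. f x \<partial>gauss) = 1" and e: "norm e = 1"
    and orth: "(\<integral>x. f x * ((x \<bullet> e) * (perp e x \<bullet> i)) \<partial>gauss) = 0"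
  shows "mean_var e (conv f) i \<le> (1 - 1 / 2176) * mean_var e f i"
    and "\<delta> * marg e (conv f) 0 * gauss_dens (0::real) \<le> marg e (conv f) u * gauss_dens u \<Longrightarrow> 0 < \<delta> \<Longrightarrow>
      (fibre_mean e (conv f) i u / marg e (conv f) u)\<^sup>2 \<le> 128 / \<delta> * mean_var e f i"
proof -
  interpret odd_perturbation "\<lambda>x. marg e f x * gauss_dens x" "\<lambda>x. fibre_mean e f i x * gauss_dens x"
    by (rule odd_perturbation_marg[OF f e orth])
  have [measurable]: "marg e f \<in> borel_measurable borel" "fibre_mean e f i \<in> borel_measurable borel"
    "marg e (conv f) \<in> borel_measurable borel" "fibre_mean e (conv f) i \<in> borel_measurable borel"
    using f by (simp_all add: marg_measurable fibre_mean_measurable lcb_conv)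
  have sq: "(c * gauss_dens x)\<^sup>2 / (d * gauss_dens x) = c\<^sup>2 / d * gauss_dens x" for c d :: real and x :: real
    using gauss_dens_pos[of x] by (simp add: power2_eq_square)
  have EE: "E = mean_var e f i"
    unfolding E_def mean_var_def sq by (subst gauss_lborel_real) simp_all
  have p': "marg e (conv f) u * gauss_dens u = sqrt 2 * P (sqrt 2 * u)" for u
    unfolding marg_conv[OF f(1) e] P_def by (rule integral_gauss_convolution) measurable
  have \<beta>': "fibre_mean e (conv f) i u * gauss_dens u = 2 * N (sqrt 2 * u)" for u
  proof -
    obtain M where M: "marg e f x \<le> M" for x using lcb_marg[OF f(1)] by (auto simp: lcb_def)
    have fm_int: "integrable gauss (fibre_mean e f i)"
      using \<beta>_integrable by (subst gauss_lborel_real) auto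
    have lb: "(\<integral>r. fibre_mean e f i ((u - r) / sqrt 2) * marg e f ((u + r) / sqrt 2) \<partial>gauss) * gauss_dens u = sqrt 2 * N (sqrt 2 * u)"
      unfolding N_def by (rule integral_gauss_convolution) measurable
    have int: "integrable gauss (\<lambda>r. fibre_mean e f i ((u - r) / sqrt 2) * marg e f ((u + r) / sqrt 2))"
    proof -
      have "integrable lborel (\<lambda>x. (fibre_mean e f i x * gauss_dens x) * (marg e f (sqrt 2 * u - x) * gauss_dens (sqrt 2 * u - x)))"
        using N_integrable by simp
      from lborel_integrable_real_affine[OF this, of "- 1 / sqrt 2" "u / sqrt 2"]
      have "integrable lborel (\<lambda>r. (fibre_mean e f i ((u - r) / sqrt 2) * gauss_dens ((u - r) / sqrt 2))
          * (marg e f ((u + r) / sqrt 2) * gauss_dens ((u + r) / sqrt 2)))"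
      proof -
        have a1: "u / sqrt 2 + - 1 / sqrt 2 * r = (u - r) / sqrt 2" for r by (simp add: diff_divide_distrib)
        have a2: "sqrt 2 * u - (u - r) / sqrt 2 = (u + r) / sqrt 2" for r
          by (simp add: field_simps)
        show ?thesis using \<open>- 1 / sqrt 2 \<noteq> 0 \<Longrightarrow> _\<close> unfolding a1 a2 by simp
      qed
      also have "(\<lambda>r. (fibre_mean e f i ((u - r) / sqrt 2) * gauss_dens ((u - r) / sqrt 2))
          * (marg e f ((u + r) / sqrt 2) * gauss_dens ((u + r) / sqrt 2)))
        = (\<lambda>r. gauss_dens u * (fibre_mean e f i ((u - r) / sqrt 2) * marg e f ((u + r) / sqrt 2) * gauss_dens r))"
        by (intro ext) (subst gauss_dens_rotation_mult[symmetric], simp only: mult_ac)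
      finally show ?thesis
        using gauss_dens_pos[of u] by (subst gauss_lborel_real) (auto simp: integrable_mult_right_iff)
    qed
    have eq: "(\<integral>r. marg e f ((u - r) / sqrt 2) * fibre_mean e f i ((u + r) / sqrt 2) \<partial>gauss)
      = (\<integral>r. fibre_mean e f i ((u - r) / sqrt 2) * marg e f ((u + r) / sqrt 2) \<partial>gauss)"
      using integral_gauss_uminus[of "\<lambda>r. fibre_mean e f i ((u - r) / sqrt 2) * marg e f ((u + r) / sqrt 2)"]
      by (simp add: mult.commute)
    have int': "integrable gauss (\<lambda>r. marg e f ((u - r) / sqrt 2) * fibre_mean e f i ((u + r) / sqrt 2))"
    proof -
      have "integrable (distr gauss borel uminus) (\<lambda>r. fibre_mean e f i ((u - r) / sqrt 2) * marg e f ((u + r) / sqrt 2))"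
        using int by (simp add: distr_gauss_uminus)
      then show ?thesis by (subst (asm) integrable_distr_eq) (simp_all add: mult.commute)
    qed
    have "fibre_mean e (conv f) i u = (2 / sqrt 2) * (\<integral>r. fibre_mean e f i ((u - r) / sqrt 2) * marg e f ((u + r) / sqrt 2) \<partial>gauss)"
      unfolding fibre_mean_conv[OF f(1) e] using int int' by (simp add: eq)
    then have "fibre_mean e (conv f) i u * gauss_dens u = (2 / sqrt 2) * (sqrt 2 * N (sqrt 2 * u))"
      unfolding lb[symmetric] by simp
    then show ?thesis by simp
  qed
  show "mean_var e (conv f) i \<le> (1 - 1 / 2176) * mean_var e f i"
  proof -
    have i: "integrable lborel (\<lambda>x. (fibre_mean e (conv f) i x)\<^sup>2 / marg e (conv f) x * gauss_dens x)"
      using mean_var_props(1)[OF lcb_conv[OF f(1)] e, of i] by (subst (asm) gauss_lborel_real) auto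
    have "ennreal (mean_var e (conv f) i) = (\<integral>\<^sup>+x. ennreal ((fibre_mean e (conv f) i x)\<^sup>2 / marg e (conv f) x * gauss_dens x) \<partial>lborel)"
      unfolding mean_var_def using i marg_nonneg[OF lcb_conv[OF f(1)]]
      by (subst gauss_lborel_real) (auto simp: nn_integral_eq_integral gauss_dens_pos less_imp_le)
    also have "\<dots> = (\<integral>\<^sup>+x. ennreal (4 / sqrt 2) * ennreal ((N (0 + sqrt 2 * x))\<^sup>2 / P (0 + sqrt 2 * x)) \<partial>lborel)"
    proof (intro nn_integral_cong)
      fix x
      have "(fibre_mean e (conv f) i x)\<^sup>2 / marg e (conv f) x * gauss_dens x = 4 / sqrt 2 * ((N (0 + sqrt 2 * x))\<^sup>2 / P (0 + sqrt 2 * x))"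
        unfolding sq[symmetric] p' \<beta>' by (simp add: power_mult_distrib)
      then show "ennreal ((fibre_mean e (conv f) i x)\<^sup>2 / marg e (conv f) x * gauss_dens x)
          = ennreal (4 / sqrt 2) * ennreal ((N (0 + sqrt 2 * x))\<^sup>2 / P (0 + sqrt 2 * x))"
        by (subst ennreal_mult[symmetric]) (simp_all add: P_nonneg)
    qed
    also have "\<dots> = ennreal (4 / sqrt 2) * (\<integral>\<^sup>+x. ennreal ((N (0 + sqrt 2 * x))\<^sup>2 / P (0 + sqrt 2 * x)) \<partial>lborel)"
      unfolding N_def P_def by (rule nn_integral_cmult) measurable
    also have "\<dots> = ennreal 2 * (ennreal \<bar>sqrt 2\<bar> * (\<integral>\<^sup>+x. ennreal ((N (0 + sqrt 2 * x))\<^sup>2 / P (0 + sqrt 2 * x)) \<partial>lborel))"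
    proof -
      have "4 / sqrt 2 = 2 * sqrt (2::real)" by (simp add: field_simps)
      then have "ennreal (4 / sqrt 2) = ennreal 2 * ennreal \<bar>sqrt 2\<bar>" by (subst ennreal_mult[symmetric]) auto
      then show ?thesis by (simp only: mult.assoc)
    qed
    also have "\<dots> = ennreal 2 * (\<integral>\<^sup>+z. ennreal ((N z)\<^sup>2 / P z) \<partial>lborel)"
    proof -
      have "(\<lambda>z. ennreal ((N z)\<^sup>2 / P z)) \<in> borel_measurable borel" unfolding N_def P_def by measurable
      from nn_integral_real_affine[OF this, of "sqrt 2" 0] show ?thesis by simp
    qed
    also have "\<dots> \<le> ennreal 2 * ennreal ((1 - 1 / 2176) / 2 * E)"
      by (intro mult_left_mono contraction) simp
    also have "\<dots> = ennreal ((1 - 1 / 2176) * E)"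
      using E_nonneg by (subst ennreal_mult[symmetric]) auto
    finally show ?thesis unfolding EE[symmetric] using E_nonneg by (subst (asm) ennreal_le_iff) auto
  qed
  assume u: "\<delta> * marg e (conv f) 0 * gauss_dens (0::real) \<le> marg e (conv f) u * gauss_dens u" and \<delta>: "0 < \<delta>"
  define q where "q = P (sqrt 2 * u)"
  define m where "m = marg e f 0 * gauss_dens (0::real)"
  have m: "0 < m" unfolding m_def using p_0_pos by simp
  have "\<delta> * (sqrt 2 * P 0) \<le> sqrt 2 * q"
    using u p'[of 0] p'[of u] by (simp add: q_def mult.assoc)
  then have "\<delta> * P 0 \<le> q" by simp
  moreover have "\<delta> * (m / 64) \<le> \<delta> * P 0" using P_0_lower \<delta> unfolding m_def by (intro mult_left_mono) auto
  ultimately have q: "\<delta> * (m / 64) \<le> q" by simp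
  have q0: "0 < q" using q \<delta> m by (smt (verit) divide_pos_pos mult_pos_pos)
  have "(fibre_mean e (conv f) i u / marg e (conv f) u)\<^sup>2
      = ((fibre_mean e (conv f) i u * gauss_dens u) / (marg e (conv f) u * gauss_dens u))\<^sup>2"
    using gauss_dens_pos[of u] by simp
  also have "\<dots> = 2 * (N (sqrt 2 * u))\<^sup>2 / q\<^sup>2"
    unfolding p' \<beta>' q_def by (simp add: power_divide power_mult_distrib)
  also have "\<dots> \<le> 2 * (m * E * q) / q\<^sup>2"
    using N_pointwise[of "sqrt 2 * u"] by (intro divide_right_mono) (simp_all add: m_def q_def)
  also have "\<dots> = 2 * m * E / q" using q0 by (simp add: power2_eq_square)
  also have "\<dots> \<le> 2 * m * E / (\<delta> * (m / 64))"
    using q q0 \<delta> m E_nonneg by (intro divide_left_mono) auto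
  also have "\<dots> = 128 / \<delta> * E" using m \<delta> by (simp add: field_simps)
  finally show "(fibre_mean e (conv f) i u / marg e (conv f) u)\<^sup>2 \<le> 128 / \<delta> * mean_var e f i"
    by (simp add: EE)
qed

section \<open>Covariances and principal axes\<close>

lemma integrable_gauss_inner_inner:
  "integrable gauss (\<lambda>x::'a::euclidean_space. (x \<bullet> a) * (x \<bullet> b))"
proof (rule Bochner_Integration.integrable_bound[OF integrable_mult_left[OF integrable_gauss_norm_square, of "norm a * norm b"]])
  show "AE x in gauss. norm ((x \<bullet> a) * (x \<bullet> b)) \<le> norm ((norm x)\<^sup>2 * (norm a * norm b))"
  proof (rule AE_I2)
    fix x :: 'a
    have "\<bar>x \<bullet> a\<bar> * \<bar>x \<bullet> b\<bar> \<le> (norm x * norm a) * (norm x * norm b)"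
      by (intro mult_mono Cauchy_Schwarz_ineq2) auto
    then show "norm ((x \<bullet> a) * (x \<bullet> b)) \<le> norm ((norm x)\<^sup>2 * (norm a * norm b))"
      by (simp add: abs_mult power2_eq_square mult_ac)
  qed
qed measurable

lemma integrable_gauss_inner: "integrable gauss (\<lambda>x::'a::euclidean_space. x \<bullet> a)"
  by (rule integrable_inner_left[OF integrable_gauss_id])

lemma integrable_lcb_inner:
  assumes "lcb f"
  shows "integrable gauss (\<lambda>x. f x * (x \<bullet> a))" "integrable gauss (\<lambda>x. f x * ((x \<bullet> a) * (x \<bullet> b)))"
  using integrable_lcb_mult[OF assms integrable_gauss_inner] integrable_lcb_mult[OF assms integrable_gauss_inner_inner]
  by simp_all

text \<open>The cross terms vanish because an even function is centred. A principal axis of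
  \<open>f\<close> therefore stays one for all iterates, so a single \<open>e\<close> serves
  throughout.\<close>

lemma covariance_conv:
  fixes f :: "'a::euclidean_space \<Rightarrow> real"
  assumes f: "lcb f" "even_fun f" "(\<integral>x. f x \<partial>gauss) = 1"
  shows "(\<integral>x. conv f x * ((x \<bullet> a) * (x \<bullet> b)) \<partial>gauss) = (\<integral>x. f x * ((x \<bullet> a) * (x \<bullet> b)) \<partial>gauss)"
proof -
  note [measurable] = lcbD(1)[OF f(1)]
  note int = lcbD(4)[OF f(1)] integrable_lcb_inner[OF f(1)]
  define S where "S = (\<integral>x. f x * ((x \<bullet> a) * (x \<bullet> b)) \<partial>gauss)"
  have odd: "(\<integral>x. f x * (x \<bullet> v) \<partial>gauss) = 0" for v
    using f(2) by (intro integral_gauss_odd) (auto simp: even_fun_def)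
  have expand: "(f x * f y) *\<^sub>R ((((x + y) /\<^sub>R sqrt 2) \<bullet> a) * (((x + y) /\<^sub>R sqrt 2) \<bullet> b))
      = (f x * ((x \<bullet> a) * (x \<bullet> b)) / 2) * f y + (f x * (x \<bullet> a) / 2) * (f y * (y \<bullet> b))
        + (f x * (x \<bullet> b) / 2) * (f y * (y \<bullet> a)) + (f x / 2) * (f y * ((y \<bullet> a) * (y \<bullet> b)))" for x y
    by (simp add: inner_add_left divide_simps) (simp add: algebra_simps)
  have "(\<integral>x. conv f x *\<^sub>R ((x \<bullet> a) * (x \<bullet> b)) \<partial>gauss)
      = (\<integral>x. (\<integral>y. (f x * f y) *\<^sub>R ((((x + y) /\<^sub>R sqrt 2) \<bullet> a) * (((x + y) /\<^sub>R sqrt 2) \<bullet> b)) \<partial>gauss) \<partial>gauss)"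
  proof (rule integral_conv[OF f(1)])
    show "integrable (gauss \<Otimes>\<^sub>M gauss) (\<lambda>(x, y). (f x * f y) *\<^sub>R ((((x + y) /\<^sub>R sqrt 2) \<bullet> a) * (((x + y) /\<^sub>R sqrt 2) \<bullet> b)))"
      unfolding expand split_def
      using integrable_pair_mult[of "\<lambda>x. f x * ((x \<bullet> a) * (x \<bullet> b)) / 2" f]
        integrable_pair_mult[of "\<lambda>x. f x * (x \<bullet> a) / 2" "\<lambda>y. f y * (y \<bullet> b)"]
        integrable_pair_mult[of "\<lambda>x. f x * (x \<bullet> b) / 2" "\<lambda>y. f y * (y \<bullet> a)"]
        integrable_pair_mult[of "\<lambda>x. f x / 2" "\<lambda>y. f y * ((y \<bullet> a) * (y \<bullet> b))"] int
      by (intro Bochner_Integration.integrable_add) (simp_all add: split_def)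
  qed measurable
  also have "\<dots> = (\<integral>x. f x * ((x \<bullet> a) * (x \<bullet> b)) / 2 + f x / 2 * S \<partial>gauss)"
    unfolding expand using int odd f(3) by (simp add: S_def)
  also have "\<dots> = S"
    using int f(3) by (simp add: S_def)
  finally show ?thesis by (simp add: S_def)
qed

lemma even_conv_iterate:
  fixes f :: "'a::euclidean_space \<Rightarrow> real"
  assumes f: "lcb f" "even_fun f" "(\<integral>x. f x \<partial>gauss) = 1"
  shows "lcb ((conv ^^ j) f)" "even_fun ((conv ^^ j) f)" "(\<integral>x. (conv ^^ j) f x \<partial>gauss) = 1"
    "(\<integral>x. (conv ^^ j) f x * ((x \<bullet> a) * (x \<bullet> b)) \<partial>gauss) = (\<integral>x. f x * ((x \<bullet> a) * (x \<bullet> b)) \<partial>gauss)"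
proof -
  have "lcb ((conv ^^ j) f) \<and> even_fun ((conv ^^ j) f) \<and> (\<integral>x. (conv ^^ j) f x \<partial>gauss) = 1 \<and>
    (\<integral>x. (conv ^^ j) f x * ((x \<bullet> a) * (x \<bullet> b)) \<partial>gauss) = (\<integral>x. f x * ((x \<bullet> a) * (x \<bullet> b)) \<partial>gauss)"
    by (induction j) (simp_all add: f lcb_conv conv_even integral_conv_1 covariance_conv)
  then show "lcb ((conv ^^ j) f)" "even_fun ((conv ^^ j) f)" "(\<integral>x. (conv ^^ j) f x \<partial>gauss) = 1"
    "(\<integral>x. (conv ^^ j) f x * ((x \<bullet> a) * (x \<bullet> b)) \<partial>gauss) = (\<integral>x. f x * ((x \<bullet> a) * (x \<bullet> b)) \<partial>gauss)"
    by auto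
qed

lemma marg_decreasing:
  assumes f: "lcb f" "even_fun f" and le: "\<bar>y\<bar> \<le> \<bar>x\<bar>"
  shows "marg e f x \<le> marg e f y"
  by (rule even_log_concave_decreasing[OF lcbD(2)[OF lcb_marg[OF f(1)]] marg_even[OF f] le])

text \<open>Reduces to the marginal along \<open>w\<close>. The pivot 1 is where
  \<open>r\<^sup>2 - 1\<close> changes sign, and this function has Gaussian mean 0, so the
  comparison term integrates to 0.\<close>

lemma even_lcb_second_moment:
  fixes f :: "'a::euclidean_space \<Rightarrow> real"
  assumes f: "lcb f" "even_fun f"
  shows "(\<integral>x. f x * (x \<bullet> w)\<^sup>2 \<partial>gauss) \<le> (norm w)\<^sup>2 * (\<integral>x. f x \<partial>gauss)"
proof (cases "w = 0")
  case False
  define e where "e = w /\<^sub>R norm w"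
  have e: "norm e = 1" and w: "w = norm w *\<^sub>R e" using False by (auto simp: e_def)
  have int: "integrable gauss (\<lambda>x. f x * (x \<bullet> e)\<^sup>2)"
    using integrable_lcb_inner(2)[OF f(1), of e e] by (simp add: power2_eq_square)
  have eq: "(\<integral>v. f (perp e v + r *\<^sub>R e) * ((perp e v + r *\<^sub>R e) \<bullet> e)\<^sup>2 \<partial>gauss) = marg e f r * r\<^sup>2" for r
    unfolding perp_props[OF e] marg_def by simp
  have iM: "integrable gauss (marg e f)" by (rule lcbD(4)[OF lcb_marg[OF f(1)]])
  have "(\<integral>x. f x * (x \<bullet> e)\<^sup>2 \<partial>gauss) = (\<integral>r. marg e f r * r\<^sup>2 \<partial>gauss)"
    using integral_gauss_perp(2)[OF int e] unfolding eq by simp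
  also have "\<dots> \<le> (\<integral>r. marg e f r + marg e f 1 * (r\<^sup>2 - 1) \<partial>gauss)"
  proof (rule integral_mono)
    show "integrable gauss (\<lambda>r. marg e f r * r\<^sup>2)"
      using integrable_fibre_integral[OF int e] unfolding eq .
    show "integrable gauss (\<lambda>r. marg e f r + marg e f 1 * (r\<^sup>2 - 1))"
      using iM integrable_gauss_real_square(1) by auto
    \<comment> \<open>Chebyshev's association inequality: \<open>marg e f\<close> decreases and \<open>r\<^sup>2\<close> increases in \<open>\<bar>r\<bar>\<close>.\<close>
    fix r :: real
    have "(marg e f r - marg e f 1) * (r\<^sup>2 - 1) \<le> 0"
    proof (cases "\<bar>r\<bar> \<le> 1")
      case True
      then have "r\<^sup>2 \<le> 1" by (simp add: abs_square_le_1)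
      with True marg_decreasing[OF f, of r 1 e] show ?thesis by (intro mult_nonneg_nonpos) auto
    next
      case False
      then have "1 \<le> r\<^sup>2" using abs_square_le_1[of r] by linarith
      with False marg_decreasing[OF f, of 1 r e] show ?thesis by (intro mult_nonpos_nonneg) auto
    qed
    then show "marg e f r * r\<^sup>2 \<le> marg e f r + marg e f 1 * (r\<^sup>2 - 1)" by (simp add: algebra_simps)
  qed
  also have "\<dots> = (\<integral>x. f x \<partial>gauss)"
    using iM integrable_gauss_real_square integral_marg[OF f(1) e] gauss.prob_space[where ?'a = real, simplified] by simp
  finally have "(\<integral>x. f x * (x \<bullet> e)\<^sup>2 \<partial>gauss) \<le> (\<integral>x. f x \<partial>gauss)" .
  moreover have "(\<integral>x. f x * (x \<bullet> w)\<^sup>2 \<partial>gauss) = (norm w)\<^sup>2 * (\<integral>x. f x * (x \<bullet> e)\<^sup>2 \<partial>gauss)"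
    by (subst w) (simp add: power_mult_distrib mult.left_commute[of _ "(norm w)\<^sup>2"])
  ultimately show ?thesis by (simp add: mult_left_mono)
qed simp

text \<open>A starting value for the geometric decay that does not depend on
  \<open>f\<close>.\<close>

lemma mean_var_le_1:
  fixes f :: "'a::euclidean_space \<Rightarrow> real"
  assumes f: "lcb f" "even_fun f" "(\<integral>x. f x \<partial>gauss) = 1" and e: "norm e = 1" and i: "i \<in> Basis"
  shows "mean_var e f i \<le> 1"
proof -
  have "mean_var e f i \<le> (\<integral>x. f x * (x \<bullet> perp e i)\<^sup>2 \<partial>gauss)"
    using mean_var_props(2)[OF f(1) e, of i] by (simp add: perp_inner_commute)
  also have "\<dots> \<le> (norm (perp e i))\<^sup>2" using even_lcb_second_moment[OF f(1,2), of "perp e i"] f(3) by simp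
  also have "\<dots> \<le> 1" using perp_props(6)[OF e, of i] i by (simp add: abs_square_le_1)
  finally show ?thesis .
qed

lemma integral_gauss_perp_odd:
  fixes \<phi> :: "'a::euclidean_space \<Rightarrow> real"
  assumes int: "integrable gauss (\<lambda>x. \<phi> x * (x \<bullet> v))" and v: "norm v = 1"
    and inv: "\<And>x r. \<phi> (perp v x + r *\<^sub>R v) = \<phi> (perp v x)"
  shows "(\<integral>x. \<phi> x * (x \<bullet> v) \<partial>gauss) = 0"
proof -
  have "(\<integral>r. (r::real) \<partial>gauss) = 0" by (rule integral_gauss_odd) auto
  then have "(\<integral>r. \<phi> (perp v w + r *\<^sub>R v) * ((perp v w + r *\<^sub>R v) \<bullet> v) \<partial>gauss) = 0" for w
    unfolding inv perp_props[OF v] by simp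
  then show ?thesis using integral_gauss_perp(1)[OF int v] by simp
qed

text \<open>The first-order condition at a maximum, tested at \<open>c / D\<close> with
  \<open>D\<close> positive and at least \<open>K\<close>.\<close>

lemma quadratic_nonneg_imp_linear_zero:
  fixes c K :: real
  assumes "\<And>\<epsilon>. 2 * \<epsilon> * c \<le> \<epsilon>\<^sup>2 * K"
  shows "c = 0"
proof (rule ccontr)
  assume "c \<noteq> 0"
  define D where "D = \<bar>K\<bar> + 1"
  have D: "0 < D" "K \<le> D" by (auto simp: D_def)
  have "2 * (c / D) * c \<le> (c / D)\<^sup>2 * K" by (rule assms)
  also have "\<dots> \<le> (c / D)\<^sup>2 * D" using D by (intro mult_left_mono) auto
  also have "\<dots> = c\<^sup>2 / D" using D by (simp add: power2_eq_square)
  finally have "c\<^sup>2 / D \<le> 0" by (simp add: power2_eq_square)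
  then show False using \<open>c \<noteq> 0\<close> D by (simp add: divide_le_0_iff)
qed

text \<open>The Rayleigh quotient of the second moment form attains its maximum on the unit sphere
  of \<open>L\<close>, and its first variation vanishes in all directions of \<open>L\<close>
  orthogonal to \<open>e\<close>. In directions orthogonal to \<open>L\<close> the function is
  constant, so the Gaussian symmetry makes the mixed moment 0.\<close>

lemma covariance_principal_axis:
  fixes f :: "'a::euclidean_space \<Rightarrow> real"
  assumes f: "lcb f" "depends_on L f" and L: "subspace L" "L \<noteq> {0}"
  obtains e where "e \<in> L" "norm e = 1" "\<And>v. v \<bullet> e = 0 \<Longrightarrow> (\<integral>x. f x * ((x \<bullet> e) * (x \<bullet> v)) \<partial>gauss) = 0"
proof -
  define T where "T a b = (\<integral>x. f x * ((x \<bullet> a) * (x \<bullet> b)) \<partial>gauss)" for a b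
  note int = integrable_lcb_inner(2)[OF f(1)]
  have T_add: "T (a + b) c = T a c + T b c" "T c (a + b) = T c a + T c b" for a b c
    unfolding T_def using int by (simp_all add: inner_add_right algebra_simps)
  have T_scale: "T (u *\<^sub>R a) c = u * T a c" "T c (u *\<^sub>R a) = u * T c a" for a c u
    unfolding T_def by (simp_all add: mult.assoc mult.left_commute[of _ u])
  have T_comm: "T a b = T b a" for a b unfolding T_def by (simp add: mult.commute[of "_ \<bullet> a"])
  have cont: "continuous_on X (\<lambda>a. T a a)" for X
  proof -
    have "bilinear T" unfolding bilinear_def by (auto intro!: linearI simp: T_add T_scale)
    then have "bounded_bilinear T" by (simp add: bilinear_conv_bounded_bilinear)
    then show ?thesis by (intro bounded_bilinear.continuous_on[of T] continuous_on_id)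
  qed
  obtain l where l: "l \<in> L" "l \<noteq> 0" using L subspace_0 by blast
  have "l /\<^sub>R norm l \<in> sphere 0 1 \<inter> L" using l L(1) by (auto simp: subspace_mul)
  then have "sphere 0 1 \<inter> L \<noteq> {}" by blast
  moreover have "compact (sphere 0 1 \<inter> L)" using closed_subspace[OF L(1)] by (intro compact_Int_closed compact_sphere)
  ultimately obtain e where e: "e \<in> sphere 0 1 \<inter> L" and emax: "\<And>a. a \<in> sphere 0 1 \<inter> L \<Longrightarrow> T a a \<le> T e e"
    using continuous_attains_sup[OF _ _ cont, of "sphere 0 1 \<inter> L"] by blast
  have e1: "norm e = 1" and eL: "e \<in> L" using e by auto
  have max: "T a a \<le> T e e * (norm a)\<^sup>2" if "a \<in> L" for a
  proof (cases "a = 0")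
    case True
    then show ?thesis by (simp add: T_def)
  next
    case False
    have "a /\<^sub>R norm a \<in> sphere 0 1 \<inter> L" using that False L(1) by (auto simp: subspace_mul)
    from emax[OF this] have "T a a / (norm a)\<^sup>2 \<le> T e e"
      by (simp add: T_scale power2_eq_square divide_inverse mult_ac)
    then show ?thesis using False by (simp add: pos_divide_le_eq)
  qed
  have inL: "T e v = 0" if v: "v \<in> L" "v \<bullet> e = 0" for v
  proof (rule quadratic_nonneg_imp_linear_zero)
    fix \<epsilon> :: real
    have "T (e + \<epsilon> *\<^sub>R v) (e + \<epsilon> *\<^sub>R v) \<le> T e e * (norm (e + \<epsilon> *\<^sub>R v))\<^sup>2"
      using v L(1) eL by (intro max) (auto simp: subspace_add subspace_mul)
    moreover have "(norm (e + \<epsilon> *\<^sub>R v))\<^sup>2 = 1 + \<epsilon>\<^sup>2 * (norm v)\<^sup>2"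
      using v(2) e1 by (simp add: power2_norm_eq_inner inner_add_left inner_add_right inner_commute norm_eq_1 power2_eq_square[of \<epsilon>])
    moreover have "T (e + \<epsilon> *\<^sub>R v) (e + \<epsilon> *\<^sub>R v) = T e e + 2 * \<epsilon> * T e v + \<epsilon>\<^sup>2 * T v v"
      by (simp add: T_add T_scale T_comm[of v e] power2_eq_square algebra_simps)
    ultimately show "2 * \<epsilon> * T e v \<le> \<epsilon>\<^sup>2 * (T e e * (norm v)\<^sup>2 - T v v)"
      by (simp add: algebra_simps)
  qed
  have perpL: "T e v = 0" if v: "\<And>l. l \<in> L \<Longrightarrow> v \<bullet> l = 0" for v
  proof (cases "v = 0")
    case False
    define w where "w = v /\<^sub>R norm v"
    have w: "norm w = 1" "v = norm v *\<^sub>R w" and wl: "w \<bullet> l = 0" if "l \<in> L" for l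
      using False v that by (auto simp: w_def)
    note w1 = w(1)[OF eL] and w2 = w(2)[OF eL]
    have "T e w = (\<integral>x. (f x * (x \<bullet> e)) * (x \<bullet> w) \<partial>gauss)" by (simp add: T_def mult.assoc)
    also have "\<dots> = 0"
    proof (rule integral_gauss_perp_odd[OF _ w1])
      show "integrable gauss (\<lambda>x. f x * (x \<bullet> e) * (x \<bullet> w))" using int[of e w] by (simp add: mult.assoc)
      fix x r
      have l: "(perp w x + r *\<^sub>R w) \<bullet> l = perp w x \<bullet> l" if "l \<in> L" for l
        using wl[OF that] by (simp add: inner_add_left)
      then have "f (perp w x + r *\<^sub>R w) = f (perp w x)" using f(2) unfolding depends_on_def by blast
      then show "f (perp w x + r *\<^sub>R w) * ((perp w x + r *\<^sub>R w) \<bullet> e) = f (perp w x) * (perp w x \<bullet> e)"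
        using l[OF eL] by simp
    qed
    finally show ?thesis by (subst w2) (simp add: T_scale)
  qed (simp add: T_def)
  show thesis
  proof (rule that[OF eL e1])
    fix v assume v: "v \<bullet> e = 0"
    obtain y z where y: "y \<in> span L" and z: "\<And>l. l \<in> span L \<Longrightarrow> orthogonal z l" and yz: "v = y + z"
      using orthogonal_subspace_decomp_exists[of L v] by metis
    have yL: "y \<in> L" using y L(1) by (simp add: span_eq_iff[THEN iffD2])
    have zL: "z \<bullet> l = 0" if "l \<in> L" for l using z[of l] that by (simp add: span_base orthogonal_def)
    have "y \<bullet> e = 0" using v zL[OF eL] yz by (simp add: inner_add_left)
    then have "T e v = 0" unfolding yz T_add using inL[OF yL] perpL[OF zL] by simp
    then show "(\<integral>x. f x * ((x \<bullet> e) * (x \<bullet> v)) \<partial>gauss) = 0" by (simp add: T_def)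
  qed
qed

text \<open>The fibre function ignores the component along \<open>e\<close>, whose Gaussian mean is
  0; only the orthogonal coordinates contribute.\<close>

lemma fibre_barycenter:
  fixes F :: "'a::euclidean_space \<Rightarrow> real"
  assumes F: "lcb F" and e: "norm e = 1"
  shows "(norm (\<integral>v. F (perp e v + x *\<^sub>R e) *\<^sub>R v \<partial>gauss))\<^sup>2 = (\<Sum>i\<in>Basis. (fibre_mean e F i x)\<^sup>2)"
proof -
  let ?F = "\<lambda>v. F (perp e v + x *\<^sub>R e)"
  have lF: "lcb ?F" by (rule lcb_fibre[OF F])
  have "(\<integral>v. ?F v *\<^sub>R v \<partial>gauss) \<bullet> i = fibre_mean e F i x" for i
  proof -
    have 0: "(\<integral>v. ?F v * (v \<bullet> e) \<partial>gauss) = 0"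
      by (rule integral_gauss_perp_odd[OF integrable_lcb_inner(1)[OF lF] e])
        (simp add: perp_props[OF e])
    have "(\<integral>v. ?F v *\<^sub>R v \<partial>gauss) \<bullet> i = (\<integral>v. ?F v * (v \<bullet> i) \<partial>gauss)"
      using integrable_lcb_mult[OF lF integrable_gauss_id] by (subst integral_inner_left[symmetric]) simp_all
    also have "\<dots> = (\<integral>v. ?F v * (perp e v \<bullet> i) + (?F v * (v \<bullet> e)) * (e \<bullet> i) \<partial>gauss)"
      by (simp add: perp_def inner_diff_left algebra_simps)
    also have "\<dots> = fibre_mean e F i x + (\<integral>v. ?F v * (v \<bullet> e) \<partial>gauss) * (e \<bullet> i)"
      using integrable_lcb_inner(1)[OF lF, of e] integrable_lcb_mult[OF lF integrable_perp_inner(1)[OF e, of i]]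
      by (simp add: fibre_mean_def)
    finally show ?thesis using 0 by simp
  qed
  then show ?thesis
    unfolding power2_norm_eq_inner by (subst euclidean_inner) (simp add: power2_eq_square)
qed

section \<open>Slicing along an axis\<close>

lemma depends_on_fibre:
  assumes f: "depends_on L f" and L: "subspace L" "e \<in> L" and e: "norm e = 1"
  shows "depends_on {l \<in> L. l \<bullet> e = 0} (\<lambda>v. f (perp e v + r *\<^sub>R e))"
  unfolding depends_on_def
proof (intro allI impI)
  fix x y :: 'a
  assume xy: "\<forall>l\<in>{l \<in> L. l \<bullet> e = 0}. x \<bullet> l = y \<bullet> l"
  have "(perp e x + r *\<^sub>R e) \<bullet> l = (perp e y + r *\<^sub>R e) \<bullet> l" if l: "l \<in> L" for l
  proof -
    have "perp e l \<in> L" unfolding perp_def using l L by (intro subspace_diff subspace_mul)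
    then have "x \<bullet> perp e l = y \<bullet> perp e l" using xy perp_props(1)[OF e] by blast
    then show ?thesis by (simp add: inner_add_left perp_inner_commute)
  qed
  then show "f (perp e x + r *\<^sub>R e) = f (perp e y + r *\<^sub>R e)" using f unfolding depends_on_def by blast
qed

text \<open>Completing the square in \<open>b\<close>, which is possible as the coefficient
  \<open>s - t\<^sup>2\<close> of its squared norm is positive. The bound involves \<open>a\<close>
  only: the axis is adapted to one function, and the fibre barycenters of the other are
  arbitrary.\<close>

lemma barycenter_form_lower:
  fixes a b :: "'a::real_inner"
  assumes s: "0 < s" "s < 1" and ts: "t\<^sup>2 < s"
  shows "- ((1 - t)\<^sup>2 * (1 + t\<^sup>2 / (s - t\<^sup>2))) * (norm a)\<^sup>2
    \<le> (1 - s) * (norm a)\<^sup>2 + s * (norm b)\<^sup>2 - (norm ((1 - t) *\<^sub>R a + t *\<^sub>R b))\<^sup>2"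
proof -
  define u where "u = (1 - t) *\<^sub>R a"
  define d where "d = s - t\<^sup>2"
  have d: "0 < d" "s = d + t\<^sup>2" using ts by (simp_all add: d_def)
  have "0 \<le> d * (norm (b - (t / d) *\<^sub>R u))\<^sup>2" using d by simp
  also have "\<dots> = d * (norm b)\<^sup>2 - 2 * t * (u \<bullet> b) + t\<^sup>2 / d * (norm u)\<^sup>2"
    using d(1) unfolding power2_norm_eq_inner
    by (simp add: inner_diff_left inner_diff_right inner_commute power2_eq_square field_simps)
  finally have 1: "0 \<le> d * (norm b)\<^sup>2 - 2 * t * (u \<bullet> b) + t\<^sup>2 / d * (norm u)\<^sup>2" .
  have 2: "(norm (u + t *\<^sub>R b))\<^sup>2 = (norm u)\<^sup>2 + 2 * t * (u \<bullet> b) + t\<^sup>2 * (norm b)\<^sup>2"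
    unfolding power2_norm_eq_inner
    by (simp add: inner_add_left inner_add_right inner_commute power2_eq_square algebra_simps)
  have 3: "(1 - t)\<^sup>2 * (1 + t\<^sup>2 / d) * (norm a)\<^sup>2 = (norm u)\<^sup>2 + t\<^sup>2 / d * (norm u)\<^sup>2"
  proof -
    have "(norm u)\<^sup>2 = (1 - t)\<^sup>2 * (norm a)\<^sup>2" by (simp add: u_def power_mult_distrib)
    then show ?thesis by (simp add: distrib_left distrib_right mult_ac)
  qed
  have 4: "s * (norm b)\<^sup>2 = d * (norm b)\<^sup>2 + t\<^sup>2 * (norm b)\<^sup>2" unfolding d(2) by (simp add: algebra_simps)
  have 5: "0 \<le> (1 - s) * (norm a)\<^sup>2" using s by simp
  show ?thesis using 1 3 5 unfolding u_def[symmetric] 2 4 d_def[symmetric] minus_mult_left[symmetric] by linarith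
qed

text \<open>The constant has one factor per step: \<open>c\<close> for the fibres,
  \<open>exp (- (K * \<eta> / 2))\<close> for their barycenters being off centre by at most \<eta>
  in square, \<open>exp (- kl s t)\<close> for the remaining problem on the line, and
  \<open>1 - 2 * \<delta>\<close> for the discarded tail of the marginal.\<close>

lemma even_const_slicing:
  fixes F G :: "'a::euclidean_space \<Rightarrow> real"
  assumes s: "0 < s" "s < 1" and t: "0 < t" "t < 1" and ts: "t\<^sup>2 < s"
    and L: "subspace L" "e \<in> L" and e: "norm e = 1"
    and c: "0 < c" "even_const {l \<in> L. l \<bullet> e = 0} s t c"
    and F: "lcb F" "even_fun F" "depends_on L F" "(\<integral>x. F x \<partial>gauss) = 1"
    and G: "lcb G" "even_fun G" "depends_on L G" "(\<integral>x. G x \<partial>gauss) = 1"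
    and adm: "admissible s t F G h"
    and \<delta>: "0 < \<delta>" "\<delta> < 1 / 2"
    and \<eta>: "\<And>x. \<delta> * marg e F 0 * gauss_dens (0::real) \<le> marg e F x * gauss_dens x \<Longrightarrow>
      (\<Sum>i\<in>Basis. (fibre_mean e F i x / marg e F x)\<^sup>2) \<le> \<eta>"
  defines "K \<equiv> (1 - t)\<^sup>2 * (1 + t\<^sup>2 / (s - t\<^sup>2))"
  shows "ennreal (c * exp (- (K * \<eta> / 2)) * exp (- kl s t) * (1 - 2 * \<delta>)) \<le> (\<integral>\<^sup>+x. h x \<partial>gauss)"
proof -
  have [measurable]: "h \<in> borel_measurable borel" and hle: "\<And>x y. ennreal (F x powr (1 - s) * G y powr s) \<le> h ((1 - t) *\<^sub>R x + t *\<^sub>R y)"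
    using adm by (auto simp: admissible_def)
  have K: "0 \<le> K" using ts by (simp add: K_def)
  interpret even_log_concave_density "\<lambda>x. marg e F x * gauss_dens x"
    by (rule even_log_concave_density_marg[OF F(1,2,4) e])
  define J where "J = {x. \<delta> * (marg e F 0 * gauss_dens (0::real)) \<le> marg e F x * gauss_dens x}"
  \<comment> \<open>The fibre barycenters of \<open>F\<close> are controlled only over
    \<open>J\<close>. As \<open>J\<close> is symmetric and cut out by a decreasing density, the
    truncated marginal is still decreasing in the modulus.\<close>
  define a where "a x = marg e F x * indicator J x" for x
  define b where "b = marg e G"
  have [measurable]: "marg e F \<in> borel_measurable borel" "b \<in> borel_measurable borel"
    using F(1) G(1) by (simp_all add: marg_measurable b_def)
  have [measurable]: "J \<in> sets borel" unfolding J_def by measurable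
  have [measurable]: "a \<in> borel_measurable borel" unfolding a_def[abs_def] by measurable
  define H where "H r = (\<integral>\<^sup>+v. h (perp e v + r *\<^sub>R e) \<partial>gauss)" for r
  have "ennreal (c * exp (- (K * \<eta> / 2)) * exp (- kl s t) * ((\<integral>x. a x \<partial>gauss) powr (1 - s) * (\<integral>x. b x \<partial>gauss) powr s))
      \<le> (\<integral>\<^sup>+r. H r \<partial>gauss)"
  proof (rule even_mean_gauss_real[OF s t])
    show "0 \<le> a x" "0 \<le> b x" for x using marg_nonneg[OF F(1)] marg_nonneg[OF G(1)] by (simp_all add: a_def b_def)
    show "a y \<le> a x" if "\<bar>x\<bar> \<le> \<bar>y\<bar>" for x y
      using marg_decreasing[OF F(1,2) that, of e] p_decreasing[OF that] marg_nonneg[OF F(1), of e x]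
      by (auto simp: a_def J_def indicator_def)
    show "b y \<le> b x" if "\<bar>x\<bar> \<le> \<bar>y\<bar>" for x y
      unfolding b_def by (rule marg_decreasing[OF G(1,2) that])
    show "0 \<le> c * exp (- (K * \<eta> / 2))" using c by simp
    show "H \<in> borel_measurable borel" unfolding H_def[abs_def] by measurable
    fix x y
    show "ennreal (c * exp (- (K * \<eta> / 2)) * (a x powr (1 - s) * b y powr s)) \<le> H ((1 - t) * x + t * y)"
    proof (cases "a x = 0 \<or> b y = 0")
      case False
      let ?f = "\<lambda>v. F (perp e v + x *\<^sub>R e)" and ?g = "\<lambda>v. G (perp e v + y *\<^sub>R e)"
      let ?k = "\<lambda>v. h (perp e v + ((1 - t) * x + t * y) *\<^sub>R e)"
      have xJ: "x \<in> J" and ax: "a x = marg e F x" using False by (auto simp: a_def indicator_def split: if_splits)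
      have A: "0 < (\<integral>v. ?f v \<partial>gauss)" and B: "0 < (\<integral>v. ?g v \<partial>gauss)"
        using False ax marg_nonneg[OF F(1), of e x] marg_nonneg[OF G(1), of e y] by (auto simp: b_def marg_def)
      have adm': "admissible s t ?f ?g ?k"
        unfolding admissible_def
      proof (intro conjI allI)
        fix v w
        show "ennreal (?f v powr (1 - s) * ?g w powr s) \<le> ?k ((1 - t) *\<^sub>R v + t *\<^sub>R w)"
          unfolding perp_add_affine by (rule hle)
      qed measurable
      define a' where "a' = (\<integral>v. ?f v *\<^sub>R v \<partial>gauss) /\<^sub>R (\<integral>v. ?f v \<partial>gauss)"
      define b' where "b' = (\<integral>v. ?g v *\<^sub>R v \<partial>gauss) /\<^sub>R (\<integral>v. ?g v \<partial>gauss)"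
      define Q where "Q = (1 - s) * (norm a')\<^sup>2 + s * (norm b')\<^sup>2 - (norm ((1 - t) *\<^sub>R a' + t *\<^sub>R b'))\<^sup>2"
      have "(norm a')\<^sup>2 = (\<Sum>i\<in>Basis. (fibre_mean e F i x)\<^sup>2) / (marg e F x)\<^sup>2"
        unfolding a'_def marg_def fibre_barycenter[OF F(1) e, symmetric]
        by (simp add: power_mult_distrib power_inverse divide_inverse mult.commute)
      also have "\<dots> \<le> \<eta>" using \<eta>[of x] xJ by (simp add: J_def power_divide sum_divide_distrib mult.assoc)
      finally have "K * (norm a')\<^sup>2 \<le> K * \<eta>" using K by (rule mult_left_mono)
      moreover have "- K * (norm a')\<^sup>2 \<le> Q"
        unfolding K_def Q_def by (rule barycenter_form_lower[OF s ts])
      ultimately have "- (K * \<eta> / 2) \<le> Q / 2" by simp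
      then have "c * exp (- (K * \<eta> / 2)) * (a x powr (1 - s) * b y powr s)
          \<le> c * exp (Q / 2) * ((\<integral>v. ?f v \<partial>gauss) powr (1 - s) * (\<integral>v. ?g v \<partial>gauss) powr s)"
        unfolding ax b_def marg_def using c(1) by (intro mult_right_mono mult_left_mono) auto
      then have "ennreal (c * exp (- (K * \<eta> / 2)) * (a x powr (1 - s) * b y powr s))
          \<le> ennreal (c * exp (Q / 2) * ((\<integral>v. ?f v \<partial>gauss) powr (1 - s) * (\<integral>v. ?g v \<partial>gauss) powr s))"
        by (rule ennreal_leI)
      also have "\<dots> \<le> (\<integral>\<^sup>+v. ?k v \<partial>gauss)"
        unfolding Q_def a'_def b'_def
        by (rule even_const_barycenter[OF s t c lcb_fibre[OF F(1)] depends_on_fibre[OF F(3) L e]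
              lcb_fibre[OF G(1)] depends_on_fibre[OF G(3) L e] adm' A B])
      finally show ?thesis by (simp add: H_def)
    qed auto
  qed measurable
  also have "(\<integral>\<^sup>+r. H r \<partial>gauss) = (\<integral>\<^sup>+x. h x \<partial>gauss)"
    unfolding H_def by (rule nn_integral_gauss_perp(2)[OF _ e]) measurable
  finally have main: "ennreal (c * exp (- (K * \<eta> / 2)) * exp (- kl s t) * ((\<integral>x. a x \<partial>gauss) powr (1 - s) * (\<integral>x. b x \<partial>gauss) powr s))
      \<le> (\<integral>\<^sup>+x. h x \<partial>gauss)" .
  have bI: "(\<integral>x. b x \<partial>gauss) = 1" unfolding b_def using integral_marg[OF G(1) e] G(4) by simp
  have iM: "integrable gauss (marg e F)" by (rule lcbD(4)[OF lcb_marg[OF F(1)]])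
  have ia: "integrable gauss a"
    unfolding a_def[abs_def] using iM by (rule integrable_real_mult_indicator[rotated]) simp
  have im: "integrable gauss (\<lambda>x. marg e F x * indicator (- J) x)"
    using iM by (rule integrable_real_mult_indicator[rotated]) simp
  have "ennreal (\<integral>x. marg e F x * indicator (- J) x \<partial>gauss)
      = (\<integral>\<^sup>+x. ennreal (marg e F x * indicator (- J) x) \<partial>gauss)"
    using im marg_nonneg[OF F(1)] by (subst nn_integral_eq_integral) auto
  also have "\<dots> = (\<integral>\<^sup>+x. ennreal (marg e F x * gauss_dens x) * indicator {x. marg e F x * gauss_dens x < \<delta> * (marg e F 0 * gauss_dens (0::real))} x \<partial>lborel)"
    unfolding gauss_eq
  proof (subst nn_integral_density, simp, simp, intro nn_integral_cong)
    fix x :: real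
    have "ennreal (marg e F x * gauss_dens x) = ennreal (gauss_dens x) * ennreal (marg e F x)"
      using marg_nonneg[OF F(1)] by (simp add: ennreal_mult gauss_dens_pos less_imp_le mult.commute)
    then show "ennreal (gauss_dens x) * ennreal (marg e F x * indicator (- J) x) = ennreal (marg e F x * gauss_dens x)
        * indicator {x. marg e F x * gauss_dens x < \<delta> * (marg e F 0 * gauss_dens (0::real))} x"
      by (auto simp: J_def indicator_def)
  qed
  also have "\<dots> \<le> ennreal (2 * \<delta>)" by (rule p_tail) (use \<delta> in simp)
  finally have tail: "(\<integral>x. marg e F x * indicator (- J) x \<partial>gauss) \<le> 2 * \<delta>"
    using \<delta> by (simp add: ennreal_le_iff)
  have "1 = (\<integral>x. a x + marg e F x * indicator (- J) x \<partial>gauss)"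
    using integral_marg[OF F(1) e] F(4) by (simp add: a_def indicator_compl flip: distrib_left)
  also have "\<dots> = (\<integral>x. a x \<partial>gauss) + (\<integral>x. marg e F x * indicator (- J) x \<partial>gauss)"
    using ia im by simp
  finally have aI: "1 - 2 * \<delta> \<le> (\<integral>x. a x \<partial>gauss)" using tail by simp
  have "1 - 2 * \<delta> = (1 - 2 * \<delta>) powr 1" using \<delta> by simp
  also have "\<dots> \<le> (1 - 2 * \<delta>) powr (1 - s)" using \<delta> s by (intro powr_mono') auto
  also have "\<dots> \<le> (\<integral>x. a x \<partial>gauss) powr (1 - s)" using \<delta> s aI by (intro powr_mono2) auto
  finally have "1 - 2 * \<delta> \<le> (\<integral>x. a x \<partial>gauss) powr (1 - s) * (\<integral>x. b x \<partial>gauss) powr s" unfolding bI by simp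
  then have "c * exp (- (K * \<eta> / 2)) * exp (- kl s t) * (1 - 2 * \<delta>)
      \<le> c * exp (- (K * \<eta> / 2)) * exp (- kl s t) * ((\<integral>x. a x \<partial>gauss) powr (1 - s) * (\<integral>x. b x \<partial>gauss) powr s)"
    using c(1) by (intro mult_left_mono) auto
  from order_trans[OF ennreal_leI[OF this] main] show ?thesis .
qed

section \<open>The sharp constant for even functions\<close>

lemma lcb_const: "0 \<le> k \<Longrightarrow> lcb (\<lambda>_. k)"
  unfolding lcb_def log_concave_def by (auto simp flip: powr_add)

lemma even_constD:
  assumes "even_const L s t c" "lcb f" "lcb g" "even_fun f" "even_fun g" "depends_on L f" "depends_on L g"
    and "admissible s t f g h" "(\<integral>x. f x \<partial>gauss) = 1" "(\<integral>x. g x \<partial>gauss) = 1"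
  shows "ennreal c \<le> (\<integral>\<^sup>+x. h x \<partial>gauss)"
proof -
  have "ennreal (c * ((\<integral>x. f x \<partial>gauss) powr (1 - s) * (\<integral>x. g x \<partial>gauss) powr s)) \<le> (\<integral>\<^sup>+x. h x \<partial>gauss)"
    using assms(1-8) unfolding even_const_def by blast
  then show ?thesis using assms(9,10) by simp
qed

text \<open>Homogeneity: \<open>f\<close> and \<open>g\<close> are divided by their masses, and
  \<open>h\<close> by the corresponding geometric mean.\<close>

lemma even_constI_normalized:
  assumes c: "0 \<le> c"
    and le: "\<And>f g h. lcb f \<Longrightarrow> lcb g \<Longrightarrow> even_fun f \<Longrightarrow> even_fun g \<Longrightarrow> depends_on L f \<Longrightarrow> depends_on L g \<Longrightarrow>
      admissible s t f g h \<Longrightarrow> (\<integral>x. f x \<partial>gauss) = 1 \<Longrightarrow> (\<integral>x. g x \<partial>gauss) = 1 \<Longrightarrow> ennreal c \<le> (\<integral>\<^sup>+x. h x \<partial>gauss)"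
  shows "even_const L s t c"
  unfolding even_const_def
proof (intro allI impI, elim conjE)
  fix f g :: "'a \<Rightarrow> real" and h
  assume f: "lcb f" "even_fun f" "depends_on L f" and g: "lcb g" "even_fun g" "depends_on L g" and adm: "admissible s t f g h"
  define A where "A = (\<integral>x. f x \<partial>gauss)"
  define B where "B = (\<integral>x. g x \<partial>gauss)"
  have AB: "0 \<le> A" "0 \<le> B" using lcbD(3)[OF f(1)] lcbD(3)[OF g(1)] by (simp_all add: A_def B_def)
  have [measurable]: "h \<in> borel_measurable borel" and hle: "\<And>x y. ennreal (f x powr (1 - s) * g y powr s) \<le> h ((1 - t) *\<^sub>R x + t *\<^sub>R y)"
    using adm by (auto simp: admissible_def)
  show "ennreal (c * ((\<integral>x. f x \<partial>gauss) powr (1 - s) * (\<integral>x. g x \<partial>gauss) powr s)) \<le> (\<integral>\<^sup>+x. h x \<partial>gauss)"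
  proof (cases "A = 0 \<or> B = 0")
    case False
    then have pos: "0 < A" "0 < B" using AB by auto
    define k where "k = A powr (1 - s) * B powr s"
    have k: "0 < k" using pos by (simp add: k_def)
    have "ennreal c \<le> (\<integral>\<^sup>+x. ennreal (1 / k) * h x \<partial>gauss)"
    proof (rule le)
      show "lcb (\<lambda>x. f x * (1 / A))" "lcb (\<lambda>x. g x * (1 / B))"
        using f g pos by (simp_all only: lcb_mult lcb_const zero_le_divide_iff less_imp_le zero_le_one simp_thms)
      show "even_fun (\<lambda>x. f x * (1 / A))" "even_fun (\<lambda>x. g x * (1 / B))"
        using f(2) g(2) by (simp_all add: even_fun_def)
      show "depends_on L (\<lambda>x. f x * (1 / A))" "depends_on L (\<lambda>x. g x * (1 / B))"
        using f(3) g(3) unfolding depends_on_def by metis+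
      show "(\<integral>x. f x * (1 / A) \<partial>gauss) = 1" "(\<integral>x. g x * (1 / B) \<partial>gauss) = 1"
        using pos by (simp_all add: A_def B_def)
      show "admissible s t (\<lambda>x. f x * (1 / A)) (\<lambda>x. g x * (1 / B)) (\<lambda>x. ennreal (1 / k) * h x)"
        unfolding admissible_def
      proof (intro conjI allI)
        fix x y
        have "(f x * (1 / A)) powr (1 - s) * (g y * (1 / B)) powr s = 1 / k * (f x powr (1 - s) * g y powr s)"
          using pos lcbD(3)[OF f(1)] lcbD(3)[OF g(1)] by (simp add: powr_divide k_def)
        then have "ennreal ((f x * (1 / A)) powr (1 - s) * (g y * (1 / B)) powr s) = ennreal (1 / k) * ennreal (f x powr (1 - s) * g y powr s)"
          using k by (subst ennreal_mult[symmetric]) simp_all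
        then show "ennreal ((f x * (1 / A)) powr (1 - s) * (g y * (1 / B)) powr s) \<le> ennreal (1 / k) * h ((1 - t) *\<^sub>R x + t *\<^sub>R y)"
          using hle[of x y] by (simp add: mult_left_mono)
      qed measurable
    qed
    also have "\<dots> = ennreal (1 / k) * (\<integral>\<^sup>+x. h x \<partial>gauss)" by (rule nn_integral_cmult) measurable
    finally have "ennreal k * ennreal c \<le> ennreal k * (ennreal (1 / k) * (\<integral>\<^sup>+x. h x \<partial>gauss))" by (rule mult_left_mono) simp
    also have "\<dots> = (\<integral>\<^sup>+x. h x \<partial>gauss)"
      using k by (subst mult.assoc[symmetric], subst ennreal_mult[symmetric]) auto
    finally have "ennreal (k * c) \<le> (\<integral>\<^sup>+x. h x \<partial>gauss)" using k c by (simp add: ennreal_mult)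
    then show ?thesis unfolding k_def A_def B_def by (simp add: mult_ac)
  qed (auto simp: A_def B_def)
qed

lemma even_const_le_1: "even_const (L :: 'a::euclidean_space set) s t c \<Longrightarrow> c \<le> 1"
proof -
  assume c: "even_const L s t c"
  have "ennreal c \<le> (\<integral>\<^sup>+x. 1 \<partial>(gauss :: 'a measure))"
    by (rule even_constD[OF c, of "\<lambda>_. 1" "\<lambda>_. 1"])
      (auto simp: lcb_const even_fun_def depends_on_def admissible_def gauss.prob_space[simplified])
  then show "c \<le> 1" by (simp add: emeasure_gauss_UNIV)
qed

text \<open>Each coordinate has second moment at most 1, hence the total variance is at most the
  dimension, and Chebyshev gives a ball that is the same for all functions.\<close>

lemma even_lcb_mass_near_0:
  fixes f :: "'a::euclidean_space \<Rightarrow> real"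
  assumes f: "lcb f" "even_fun f" "(\<integral>x. f x \<partial>gauss) = 1"
  shows "1 / 2 \<le> (\<integral>x. indicator (cball 0 (sqrt (2 * real DIM('a) + 1))) x * f x \<partial>gauss)"
proof -
  have "(\<integral>x. f x * (norm (x - 0))\<^sup>2 \<partial>gauss) = (\<integral>x. (\<Sum>i\<in>Basis. f x * (x \<bullet> i)\<^sup>2) \<partial>gauss)"
  proof (intro Bochner_Integration.integral_cong refl)
    fix x :: 'a
    have "(norm x)\<^sup>2 = (\<Sum>i\<in>Basis. (x \<bullet> i)\<^sup>2)"
      unfolding power2_norm_eq_inner by (subst euclidean_inner) (simp add: power2_eq_square)
    then show "f x * (norm (x - 0))\<^sup>2 = (\<Sum>i\<in>Basis. f x * (x \<bullet> i)\<^sup>2)" by (simp add: sum_distrib_left)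
  qed
  also have "\<dots> = (\<Sum>i\<in>Basis. \<integral>x. f x * (x \<bullet> i)\<^sup>2 \<partial>gauss)"
    using integrable_lcb_inner(2)[OF f(1)] by (intro Bochner_Integration.integral_sum) (simp add: power2_eq_square)
  also have "\<dots> \<le> (\<Sum>i\<in>(Basis :: 'a set). 1)"
    using even_lcb_second_moment[OF f(1,2)] f(3) by (intro sum_mono) (metis mult.right_neutral norm_Basis one_power2)
  finally have "(\<integral>x. f x * (norm (x - 0))\<^sup>2 \<partial>gauss) \<le> real DIM('a) * (\<integral>x. f x \<partial>gauss)" using f(3) by simp
  from lcb_chebyshev[OF f(1) this] show ?thesis using f(3) by simp
qed

text \<open>Both functions have half of their mass in a common ball around 0, so the crude bound
  with both centres at 0 gives a constant that depends on neither of them. It only has to be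
  positive, for the rotation to be applicable with the supremum of all constants.\<close>

lemma even_const_exists_pos:
  assumes s: "0 < s" "s < 1" and t: "0 < t" "t < 1"
  shows "\<exists>c>0. even_const (L :: 'a::euclidean_space set) s t c"
proof -
  define \<rho> where "\<rho> = sqrt (2 * real DIM('a) + 1)"
  define c where "c = exp (real DIM('a) * ((1 - s) * ln (1 - t) + s * ln t) - ln 2 - (2 * \<rho> * (norm (0::'a) + norm (0::'a)) + \<rho>\<^sup>2)
      + ((1 - s) * (norm (0::'a))\<^sup>2 + s * (norm (0::'a))\<^sup>2 - (norm ((1 - t) *\<^sub>R (0::'a) + t *\<^sub>R 0))\<^sup>2) / 2
      + (1 - s) * ln (1 / 2) + s * ln (1 / 2))"
  have "even_const L s t c"
  proof (rule even_constI_normalized)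
    fix f g :: "'a \<Rightarrow> real" and h
    assume f: "lcb f" "even_fun f" "(\<integral>x. f x \<partial>gauss) = 1" and g: "lcb g" "even_fun g" "(\<integral>x. g x \<partial>gauss) = 1"
      and adm: "admissible s t f g h"
    show "ennreal c \<le> (\<integral>\<^sup>+x. h x \<partial>gauss)"
      unfolding c_def
    proof (rule admissible_lower[OF s t f(1) g(1) adm])
      show "1 / 2 \<le> (\<integral>x. indicator (cball 0 \<rho>) x * f x \<partial>gauss)" unfolding \<rho>_def by (rule even_lcb_mass_near_0[OF f])
      show "1 / 2 \<le> (\<integral>x. indicator (cball 0 \<rho>) x * g x \<partial>gauss)" unfolding \<rho>_def by (rule even_lcb_mass_near_0[OF g])
    qed (simp_all add: \<rho>_def)
  qed (simp add: c_def)
  then show ?thesis by (intro exI[of _ c]) (simp add: c_def)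
qed

text \<open>The defining inequality is closed in \<open>c\<close>, so the supremum is itself a valid
  constant and can be used for the rotations.\<close>

lemma even_const_Sup:
  fixes L :: "'a::euclidean_space set"
  assumes s: "0 < s" "s < 1" and t: "0 < t" "t < 1"
  defines "C \<equiv> Sup {c. even_const (L :: 'a::euclidean_space set) s t c}"
  shows "0 < C" "even_const L s t C" "\<And>c. even_const L s t c \<Longrightarrow> c \<le> C"
proof -
  obtain c0 where c0: "0 < c0" "even_const L s t c0" using even_const_exists_pos[OF s t] by blast
  have bdd: "bdd_above {c. even_const L s t c}" by (auto intro: bdd_aboveI[of _ 1] even_const_le_1)
  show upper: "c \<le> C" if "even_const L s t c" for c
    unfolding C_def using that bdd by (intro cSup_upper) auto
  then show pos: "0 < C" using c0 by fastforce
  show "even_const L s t C"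
  proof (rule even_constI_normalized)
    fix f g :: "'a \<Rightarrow> real" and h
    assume fg: "lcb f" "lcb g" "even_fun f" "even_fun g" "depends_on L f" "depends_on L g"
      "admissible s t f g h" "(\<integral>x. f x \<partial>gauss) = 1" "(\<integral>x. g x \<partial>gauss) = 1"
    show "ennreal C \<le> (\<integral>\<^sup>+x. h x \<partial>gauss)"
    proof (cases "\<integral>\<^sup>+x. h x \<partial>gauss")
      case (real I)
      have "C \<le> I"
        unfolding C_def
      proof (rule cSup_least)
        fix c assume "c \<in> {c. even_const L s t c}"
        then have "ennreal c \<le> ennreal I" using even_constD[OF _ fg] real by auto
        then show "c \<le> I" using real by (simp add: ennreal_le_iff)
      qed (use c0 in auto)
      then show ?thesis using real by (simp add: ennreal_leI)
    qed simp
  qed (use pos in simp)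
qed

text \<open>The first \<open>j\<close> rotations contract the mean square, starting from at most 1
  in each coordinate; the last one converts the mean square into a pointwise bound, hence the
  \<open>Suc j\<close>.\<close>

lemma even_fibre_mean_conv_bound:
  fixes f :: "'a::euclidean_space \<Rightarrow> real"
  assumes f: "lcb f" "even_fun f" "(\<integral>x. f x \<partial>gauss) = 1" and e: "norm e = 1"
    and orth: "\<And>v. v \<bullet> e = 0 \<Longrightarrow> (\<integral>x. f x * ((x \<bullet> e) * (x \<bullet> v)) \<partial>gauss) = 0" and \<delta>: "0 < \<delta>"
    and x: "\<delta> * marg e ((conv ^^ Suc j) f) 0 * gauss_dens (0::real) \<le> marg e ((conv ^^ Suc j) f) x * gauss_dens x"
  shows "(\<Sum>i\<in>Basis. (fibre_mean e ((conv ^^ Suc j) f) i x / marg e ((conv ^^ Suc j) f) x)\<^sup>2)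
    \<le> 128 / \<delta> * real DIM('a) * (1 - 1 / 2176) ^ j"
proof -
  note it = even_conv_iterate[OF f]
  have orth': "(\<integral>x. (conv ^^ j) f x * ((x \<bullet> e) * (perp e x \<bullet> i)) \<partial>gauss) = 0" for i j
    unfolding perp_inner_commute it(4)
    by (rule orth) (simp add: perp_props(1)[OF e])
  have mv: "mean_var e ((conv ^^ j) f) i \<le> (1 - 1 / 2176) ^ j" if i: "i \<in> Basis" for i j
  proof (induction j)
    case 0
    then show ?case using mean_var_le_1[OF f e i] by simp
  next
    case (Suc j)
    have "mean_var e ((conv ^^ Suc j) f) i \<le> (1 - 1 / 2176) * mean_var e ((conv ^^ j) f) i"
      using mean_var_conv(1)[OF it(1-3) e orth', of j i] by simp
    also have "\<dots> \<le> (1 - 1 / 2176) * (1 - 1 / 2176) ^ j" using Suc.IH by (intro mult_left_mono) auto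
    finally show ?case by simp
  qed
  have "(\<Sum>i\<in>Basis. (fibre_mean e ((conv ^^ Suc j) f) i x / marg e ((conv ^^ Suc j) f) x)\<^sup>2)
      \<le> (\<Sum>i\<in>(Basis :: 'a set). 128 / \<delta> * (1 - 1 / 2176) ^ j)"
  proof (rule sum_mono)
    fix i :: 'a assume i: "i \<in> Basis"
    have "(fibre_mean e ((conv ^^ Suc j) f) i x / marg e ((conv ^^ Suc j) f) x)\<^sup>2 \<le> 128 / \<delta> * mean_var e ((conv ^^ j) f) i"
      using mean_var_conv(2)[OF it(1-3) e orth', of \<delta> j x i] x \<delta> by simp
    also have "\<dots> \<le> 128 / \<delta> * (1 - 1 / 2176) ^ j" using mv[OF i, of j] \<delta> by (intro mult_left_mono) auto
    finally show "(fibre_mean e ((conv ^^ Suc j) f) i x / marg e ((conv ^^ Suc j) f) x)\<^sup>2 \<le> 128 / \<delta> * (1 - 1 / 2176) ^ j" .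
  qed
  then show ?thesis by (simp add: mult_ac)
qed

lemma dim_orthogonal_slice:
  fixes L :: "'a::euclidean_space set"
  assumes L: "subspace L" "e \<in> L" and e: "norm e = 1"
  shows "subspace {l \<in> L. l \<bullet> e = 0}" "dim {l \<in> L. l \<bullet> e = 0} + 1 = dim L"
proof -
  have eq: "{l \<in> L. l \<bullet> e = 0} = {y \<in> L. \<forall>x\<in>span {e}. orthogonal x y}"
    by (auto simp: span_singleton orthogonal_def inner_commute)
  show "subspace {l \<in> L. l \<bullet> e = 0}"
    using L(1) by (auto simp: subspace_def inner_add_left)
  have "dim {y \<in> L. \<forall>x\<in>span {e}. orthogonal x y} + dim (span {e}) = dim L"
    using L by (intro dim_subspace_orthogonal_to_vectors) (auto simp: span_minimal)
  moreover have "dim (span {e}) = 1" using e by (auto simp: dim_span dim_singleton)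
  ultimately show "dim {l \<in> L. l \<bullet> e = 0} + 1 = dim L" unfolding eq by simp
qed

text \<open>
  If the best constant were smaller than claimed, slicing the iterates of the rotation along a
  principal axis, whose fibres become centred exponentially fast, would improve it.
\<close>

lemma even_const_exp_kl:
  fixes L :: "'a::euclidean_space set"
  assumes s: "0 < s" "s < 1" and t: "0 < t" "t < 1" and ts: "t\<^sup>2 < s"
    and L: "subspace L" "dim L = k"
  shows "even_const L s t (exp (- (real k * kl s t)))"
  using L
proof (induction k arbitrary: L)
  case 0
  show ?case
  proof (rule even_constI_normalized)
    fix f g :: "'a \<Rightarrow> real" and h
    assume f: "depends_on L f" "(\<integral>x. f x \<partial>gauss) = 1" and g: "depends_on L g" "(\<integral>x. g x \<partial>gauss) = 1" and adm: "admissible s t f g h"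
    have "L \<subseteq> {0}" using 0(2) by simp
    then have "f x = f 0" "g x = g 0" for x using f(1) g(1) unfolding depends_on_def by (metis inner_zero_right singletonD subsetD)+
    then have "f = (\<lambda>_. f 0)" "g = (\<lambda>_. g 0)" by auto
    then have fg: "f = (\<lambda>_. 1)" "g = (\<lambda>_. 1)"
      using f(2) g(2) gauss.prob_space[where ?'a = 'a, simplified] by (metis lebesgue_integral_const real_scaleR_def mult.left_neutral space_gauss)+
    have "1 \<le> h z" for z
    proof -
      have "ennreal (1 powr (1 - s) * 1 powr s) \<le> h ((1 - t) *\<^sub>R z + t *\<^sub>R z)"
        using adm unfolding admissible_def fg by blast
      then show ?thesis by (simp flip: scaleR_left_distrib)
    qed
    then have "(\<integral>\<^sup>+x. 1 \<partial>(gauss :: 'a measure)) \<le> (\<integral>\<^sup>+x. h x \<partial>gauss)" by (intro nn_integral_mono) auto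
    then show "ennreal (exp (- (real 0 * kl s t))) \<le> (\<integral>\<^sup>+x. h x \<partial>gauss)" by (simp add: emeasure_gauss_UNIV)
  qed simp
next
  case (Suc k)
  define \<kappa> where "\<kappa> = exp (- (real (Suc k) * kl s t))"
  define C where "C = Sup {c. even_const L s t c}"
  note C = even_const_Sup[OF s t, of L, folded C_def]
  define K where "K = (1 - t)\<^sup>2 * (1 + t\<^sup>2 / (s - t\<^sup>2))"
  have "\<kappa> \<le> C"
  proof (rule ccontr)
    assume "\<not> \<kappa> \<le> C"
    then have less: "C < \<kappa>" by simp
    \<comment> \<open>Chosen so that \<open>\<kappa> * (1 - 2 * \<delta>)\<close> is the midpoint of
      \<open>C\<close> and \<kappa>: discarding the tail costs only half of the gap.\<close>
    define \<delta> where "\<delta> = (1 - C / \<kappa>) / 4"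
    have \<kappa>0: "0 < \<kappa>" by (simp add: \<kappa>_def)
    have \<delta>: "0 < \<delta>" "\<delta> < 1 / 2" using less C(1) \<kappa>0 by (simp_all add: \<delta>_def field_simps)
    have "\<kappa> * (1 - 2 * \<delta>) = (\<kappa> + C) / 2" using \<kappa>0 by (simp add: \<delta>_def field_simps)
    then have lim: "C < \<kappa> * (1 - 2 * \<delta>) * exp 0" using less by simp
    \<comment> \<open>This bound holds for all normalised even functions at once, so
      \<open>j\<close> and the gain \<open>m\<close> can be fixed before \<open>f\<close>,
      \<open>g\<close> and \<open>h\<close>.\<close>
    define \<eta> where "\<eta> j = 128 / \<delta> * real DIM('a) * (1 - 1 / 2176) ^ j" for j :: nat
    have "(\<lambda>j. \<kappa> * (1 - 2 * \<delta>) * exp (- (K * \<eta> j / 2))) \<longlonglongrightarrow> \<kappa> * (1 - 2 * \<delta>) * exp (- (K * (128 / \<delta> * real DIM('a) * 0) / 2))"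
      unfolding \<eta>_def by (intro tendsto_intros) auto
    then have "\<forall>\<^sub>F j in sequentially. C < \<kappa> * (1 - 2 * \<delta>) * exp (- (K * \<eta> j / 2))"
      using lim by (intro order_tendstoD) simp_all
    then obtain j where j: "C < \<kappa> * (1 - 2 * \<delta>) * exp (- (K * \<eta> j / 2))" by (auto simp: eventually_sequentially)
    define m where "m = \<kappa> * (1 - 2 * \<delta>) * exp (- (K * \<eta> j / 2)) / C"
    have m: "1 < m" using j C(1) by (simp add: m_def)
    \<comment> \<open>The number of copies after \<open>Suc j\<close> rotations. Slicing the
      iterates shows \<open>m \<le> (I / C) ^ N\<close>, so the gain for the original triple is the
      root of order \<open>N\<close>, still larger than 1.\<close>
    define N :: nat where "N = 2 ^ Suc j"
    have N: "0 < N" by (simp add: N_def)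
    have "even_const L s t (C * root N m)"
    proof (rule even_constI_normalized)
      fix f g :: "'a \<Rightarrow> real" and h
      assume f: "lcb f" "even_fun f" "depends_on L f" "(\<integral>x. f x \<partial>gauss) = 1"
        and g: "lcb g" "even_fun g" "depends_on L g" "(\<integral>x. g x \<partial>gauss) = 1" and adm: "admissible s t f g h"
      have "L \<noteq> {0}" using Suc.prems by auto
      then obtain e where e: "e \<in> L" "norm e = 1" and orth: "\<And>v. v \<bullet> e = 0 \<Longrightarrow> (\<integral>x. f x * ((x \<bullet> e) * (x \<bullet> v)) \<partial>gauss) = 0"
        using covariance_principal_axis[OF f(1,3) Suc.prems(1)] by metis
      note fit = even_conv_iterate[OF f(1,2,4)] and git = even_conv_iterate[OF g(1,2,4)]
      have c: "even_const {l \<in> L. l \<bullet> e = 0} s t (exp (- (real k * kl s t)))"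
        using dim_orthogonal_slice[OF Suc.prems(1) e] Suc.prems(2) by (intro Suc.IH) auto
      show "ennreal (C * root N m) \<le> (\<integral>\<^sup>+x. h x \<partial>gauss)"
      proof (cases "\<integral>\<^sup>+x. h x \<partial>gauss")
        case (real I)
        note it = conv_iterate[OF s C(1,2) f(1,3) g(1,3) adm real(2,1), of "Suc j"]
        obtain h' where h': "admissible s t ((conv ^^ Suc j) f) ((conv ^^ Suc j) g) h'" "(\<integral>\<^sup>+x. h' x \<partial>gauss) = ennreal (C * (I / C) ^ N)"
          using it(5) unfolding N_def by blast
        have "ennreal (exp (- (real k * kl s t)) * exp (- (K * \<eta> j / 2)) * exp (- kl s t) * (1 - 2 * \<delta>)) \<le> (\<integral>\<^sup>+x. h' x \<partial>gauss)"
          unfolding K_def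
          by (rule even_const_slicing[OF s t ts Suc.prems(1) e _ c fit(1,2) it(2) fit(3) git(1,2) it(4) git(3) h'(1) \<delta>])
            (simp, unfold \<eta>_def, rule even_fibre_mean_conv_bound[OF f(1,2,4) e(2) orth \<delta>(1)])
        also have "exp (- (real k * kl s t)) * exp (- (K * \<eta> j / 2)) * exp (- kl s t) * (1 - 2 * \<delta>) = C * m"
        proof -
          have "exp (- (real k * kl s t)) * exp (- kl s t) = \<kappa>"
            by (simp add: \<kappa>_def algebra_simps flip: exp_add)
          then have \<kappa>: "\<kappa> = exp (- (real k * kl s t)) * exp (- kl s t)" ..
          have "exp (- (real k * kl s t)) * exp (- (K * \<eta> j / 2)) * exp (- kl s t) * (1 - 2 * \<delta>)
            = \<kappa> * (1 - 2 * \<delta>) * exp (- (K * \<eta> j / 2))" unfolding \<kappa> by (simp only: mult_ac)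
          then show ?thesis using C(1) by (simp add: m_def)
        qed
        finally have "C * m \<le> C * (I / C) ^ N"
          using C(1) real(1) unfolding h'(2) by (simp add: ennreal_le_iff)
        then have "m \<le> (I / C) ^ N" using C(1) by simp
        then have "root N m \<le> root N ((I / C) ^ N)" using N by (simp add: real_root_le_mono)
        also have "\<dots> = I / C" using N C(1) real(1) by (simp add: real_root_power_cancel)
        finally have "C * root N m \<le> I" using C(1) by (simp add: pos_le_divide_eq mult.commute)
        then show ?thesis using real by (simp add: ennreal_leI)
      qed simp
    qed (use C(1) m N in \<open>simp add: real_root_ge_zero\<close>)
    then have "C * root N m \<le> C" by (rule C(3))
    moreover have "1 < root N m" using m N by simp
    ultimately show False using C(1) by simp
  qed
  then have le: "\<kappa> \<le> C" .
  have "even_const L s t \<kappa>"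
  proof (rule even_constI_normalized)
    fix f g :: "'a \<Rightarrow> real" and h
    assume "lcb f" "lcb g" "even_fun f" "even_fun g" "depends_on L f" "depends_on L g"
      "admissible s t f g h" "(\<integral>x. f x \<partial>gauss) = 1" "(\<integral>x. g x \<partial>gauss) = 1"
    from even_constD[OF C(2) this] show "ennreal \<kappa> \<le> (\<integral>\<^sup>+x. h x \<partial>gauss)"
      using le by (rule order_trans[OF ennreal_leI, rotated])
  qed (simp add: \<kappa>_def)
  then show ?case by (simp add: \<kappa>_def)
qed

lemma kl_swap: "kl (1 - s) (1 - t) = kl s t"
  by (simp add: kl_def)

text \<open>Taking the whole space as \<open>L\<close> and its dimension as \<open>k\<close> turns
  the sharp constant for even functions into the general bound. The restriction
  \<open>t\<^sup>2 < s\<close> is removed by exchanging \<open>f\<close> and \<open>g\<close>, which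
  leaves \<open>kl\<close> and \<open>Q\<close> unchanged.\<close>

theorem gauss_mean_bounded:
  fixes f g :: "'a::euclidean_space \<Rightarrow> real"
  assumes s: "0 < s" "s < 1" and t: "0 < t" "t < 1"
    and f: "lcb f" and g: "lcb g" and adm: "admissible s t f g h"
    and A: "A = (\<integral>x. f x \<partial>gauss)" "0 < A" and B: "B = (\<integral>x. g x \<partial>gauss)" "0 < B"
    and a: "a = (\<integral>x. f x *\<^sub>R x \<partial>gauss) /\<^sub>R A" and b: "b = (\<integral>x. g x *\<^sub>R x \<partial>gauss) /\<^sub>R B"
    and Q: "Q = (1 - s) * (norm a)\<^sup>2 + s * (norm b)\<^sup>2 - (norm ((1 - t) *\<^sub>R a + t *\<^sub>R b))\<^sup>2"
  shows "ennreal (exp (- (real DIM('a) * kl s t)) * exp (Q / 2) * (A powr (1 - s) * B powr s)) \<le> (\<integral>\<^sup>+x. h x \<partial>gauss)"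
proof -
  have dep: "depends_on UNIV u" for u :: "'a \<Rightarrow> real"
    unfolding depends_on_def by (metis UNIV_I vector_eq_rdot)
  show ?thesis
  proof (cases "t\<^sup>2 < s")
    case True
    have "even_const (UNIV :: 'a set) s t (exp (- (real DIM('a) * kl s t)))"
      by (rule even_const_exp_kl[OF s t True]) auto
    from even_const_barycenter[OF s t _ this f dep g dep adm] show ?thesis using A B unfolding a b Q by simp
  next
    case False
    \<comment> \<open>With \<open>s \<le> t\<^sup>2\<close>, \<open>1 - s\<close> is at least
      \<open>1 - t\<^sup>2\<close>, which exceeds \<open>(1 - t)\<^sup>2\<close> by
      \<open>2 * t * (1 - t)\<close>.\<close>
    have "0 < t * (1 - t)" using t by simp
    then have ts: "(1 - t)\<^sup>2 < 1 - s" using False by (simp add: power2_eq_square algebra_simps)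
    have s': "0 < 1 - s" "1 - s < 1" and t': "0 < 1 - t" "1 - t < 1" using s t by auto
    have "even_const (UNIV :: 'a set) (1 - s) (1 - t) (exp (- (real DIM('a) * kl (1 - s) (1 - t))))"
      by (rule even_const_exp_kl[OF s' t' ts]) auto
    from even_const_barycenter[OF s' t' _ this g dep f dep admissible_swap[OF adm]] show ?thesis
      using A B unfolding a b Q kl_swap by (simp add: mult_ac add_ac)
  qed
qed

section \<open>Unbounded log-concave functions\<close>

text \<open>Openness of the support and continuity on it give open superlevel sets at nonnegative
  heights. This makes the functions Borel, and it passes to suprema of their translates and
  multiples.\<close>

definition lcc :: "('a::euclidean_space \<Rightarrow> real) \<Rightarrow> bool" where
  "lcc f \<longleftrightarrow> log_concave f \<and> open {x. 0 < f x} \<and> continuous_on {x. 0 < f x} f"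

lemma log_concave_support_convex:
  assumes f: "log_concave f" shows "convex {x. 0 < f x}"
  unfolding convex_alt
proof (intro ballI allI impI)
  fix x y and u :: real assume xy: "x \<in> {x. 0 < f x}" "y \<in> {x. 0 < f x}" and u: "0 \<le> u \<and> u \<le> 1"
  define l where "l = min (f x) (f y) / 2"
  have l: "0 < l" "l < f x" "l < f y" using xy by (auto simp: l_def min_def)
  have "l < f ((1 - u) *\<^sub>R x + u *\<^sub>R y)" using log_concave_level_convex[OF f l] u by simp
  then show "(1 - u) *\<^sub>R x + u *\<^sub>R y \<in> {x. 0 < f x}" using l(1) by simp
qed

text \<open>The function is set to 0 outside the interior of its support. The support is convex, so
  only its frontier, a null set, is affected; on the open interior \<open>- ln (f x)\<close> is
  convex and hence continuous. As the version lies below \<open>f\<close>, lower bounds on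
  \<open>h\<close> carry over to it.\<close>

lemma log_concave_regular_version:
  fixes f :: "'a::euclidean_space \<Rightarrow> real"
  assumes f: "log_concave f"
  obtains F where "lcc F" "\<And>x. F x \<le> f x" "negligible {x. f x \<noteq> F x}"
proof
  define S where "S = {x. 0 < f x}"
  define I where "I = interior S"
  define F where "F x = f x * indicator I x" for x
  have S: "convex S" unfolding S_def by (rule log_concave_support_convex[OF f])
  have I: "convex I" "open I" "I \<subseteq> S" unfolding I_def using S by (auto simp: convex_interior interior_subset)
  note nn = log_concaveD(1)[OF f]
  have pos: "{x. 0 < F x} = I" using I(3) nn by (auto simp: F_def S_def indicator_def)
  show "F x \<le> f x" for x using nn by (auto simp: F_def indicator_def)
  show "negligible {x. f x \<noteq> F x}"
  proof (rule negligible_subset[OF negligible_convex_frontier[OF S]])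
    show "{x. f x \<noteq> F x} \<subseteq> frontier S"
      using nn closure_subset[of S] by (auto simp: F_def frontier_def I_def S_def indicator_def less_le split: if_splits)
  qed
  have "convex_on I (\<lambda>x. - ln (f x))"
  proof (rule convex_onI)
    fix u x y assume u: "0 < u" "u < (1::real)" and xy: "x \<in> I" "y \<in> I"
    then have p: "0 < f x" "0 < f y" using I(3) by (auto simp: S_def)
    have "(1 - u) * ln (f x) + u * ln (f y) = ln (f x powr (1 - u) * f y powr u)"
      using p by (simp add: ln_mult ln_powr)
    also have "\<dots> \<le> ln (f ((1 - u) *\<^sub>R x + u *\<^sub>R y))"
      using log_concaveD(2)[OF f u, of x y] p by (intro ln_mono) auto
    finally show "- ln (f ((1 - u) *\<^sub>R x + u *\<^sub>R y)) \<le> (1 - u) * - ln (f x) + u * - ln (f y)" by simp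
  qed (rule I(1))
  then have "continuous_on I (\<lambda>x. - ln (f x))" by (rule convex_on_continuous[OF I(2)])
  then have "continuous_on I (\<lambda>x. exp (- (- ln (f x))))" by (rule continuous_on_exp[OF continuous_on_minus])
  then have "continuous_on I F"
    by (rule continuous_on_eq) (use I(3) in \<open>auto simp: F_def S_def\<close>)
  moreover have "log_concave F"
    unfolding log_concave_def
  proof (intro conjI allI impI)
    show "0 \<le> F x" for x using nn by (simp add: F_def)
    fix x y and u :: real assume u: "0 < u \<and> u < 1"
    show "F x powr (1 - u) * F y powr u \<le> F ((1 - u) *\<^sub>R x + u *\<^sub>R y)"
    proof (cases "x \<in> I \<and> y \<in> I")
      case True
      then have "(1 - u) *\<^sub>R x + u *\<^sub>R y \<in> I" using I(1) u by (simp add: convex_alt)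
      with True log_concaveD(2)[OF f, of u x y] u show ?thesis by (simp add: F_def)
    qed (use nn u in \<open>auto simp: F_def\<close>)
  qed
  ultimately show "lcc F" unfolding lcc_def pos using I(2) by simp
qed

lemma lccD:
  assumes f: "lcc f"
  shows "log_concave f" "0 \<le> f x" "f \<in> borel_measurable borel"
proof -
  show lc: "log_concave f" using f by (simp add: lcc_def)
  show nn: "0 \<le> f x" for x by (rule log_concaveD(1)[OF lc])
  show "f \<in> borel_measurable borel"
  proof (rule borel_measurableI_greater)
    fix c :: real
    show "{x \<in> space borel. c < f x} \<in> sets borel"
    proof (cases "c < 0")
      case True
      then have "{x \<in> space borel. c < f x} = UNIV" using nn by (auto intro: less_le_trans)
      then show ?thesis by simp
    next
      case False
      then have "{x \<in> space borel. c < f x} = {x. 0 < f x} \<inter> f -` {c<..}" by auto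
      also have "open \<dots>" using f unfolding lcc_def by (intro continuous_open_preimage) auto
      finally show ?thesis by simp
    qed
  qed
qed

text \<open>Each of the two functions whose minimum is taken bounds the geometric mean of the
  minima.\<close>

lemma lcc_min:
  assumes f: "lcc f" and M: "0 < M"
  shows "lcb (\<lambda>x. min (f x) M)"
  unfolding lcb_def
proof (intro conjI)
  note [measurable] = lccD(3)[OF f]
  show "(\<lambda>x. min (f x) M) \<in> borel_measurable borel" by measurable
  show "\<exists>K. \<forall>x. min (f x) M \<le> K" by (auto intro: exI[of _ M])
  show "log_concave (\<lambda>x. min (f x) M)"
    unfolding log_concave_def
  proof (intro conjI allI impI)
    show "0 \<le> min (f x) M" for x using lccD(2)[OF f] M by simp
    fix x y and u :: real assume u: "0 < u \<and> u < 1"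
    have "min (f x) M powr (1 - u) * min (f y) M powr u \<le> f x powr (1 - u) * f y powr u"
      using u lccD(2)[OF f] M by (intro mult_mono powr_mono2) auto
    also have "\<dots> \<le> f ((1 - u) *\<^sub>R x + u *\<^sub>R y)" using log_concaveD(2)[OF lccD(1)[OF f]] u by simp
    finally have 1: "min (f x) M powr (1 - u) * min (f y) M powr u \<le> f ((1 - u) *\<^sub>R x + u *\<^sub>R y)" .
    have "min (f x) M powr (1 - u) * min (f y) M powr u \<le> M powr (1 - u) * M powr u"
      using u lccD(2)[OF f] M by (intro mult_mono powr_mono2) auto
    also have "\<dots> = M" using M by (simp flip: powr_add)
    finally show "min (f x) M powr (1 - u) * min (f y) M powr u \<le> min (f ((1 - u) *\<^sub>R x + u *\<^sub>R y)) M"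
      using 1 by simp
  qed
qed

text \<open>The smallest function that satisfies the inequality. For fixed \<open>x\<close> the
  expression has open superlevel sets in \<open>z\<close>, and these survive the uncountable
  supremum, so \<open>h\<close> is lower semicontinuous.\<close>

lemma admissible_sup_convolution:
  fixes F G :: "'a::euclidean_space \<Rightarrow> real"
  assumes F: "lcc F" and G: "lcc G" and s: "0 < s" "s < 1" and t: "0 < t" "t < 1"
  defines "h \<equiv> \<lambda>z. SUP x. ennreal (F x powr (1 - s) * G ((z - (1 - t) *\<^sub>R x) /\<^sub>R t) powr s)"
  shows "admissible s t F G h"
  unfolding admissible_def
proof (intro conjI allI)
  show "h \<in> borel_measurable borel"
  proof (rule borel_measurableI_greater)
    fix c :: ennreal
    let ?T = "\<lambda>x z. (z - (1 - t) *\<^sub>R x) /\<^sub>R t"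
    have "open {z. c < ennreal (F x powr (1 - s) * G (?T x z) powr s)}" for x
    proof -
      have T: "continuous_on UNIV (?T x)" by (intro continuous_intros)
      have o: "open (?T x -` {y. 0 < G y})"
        using G T unfolding lcc_def by (intro open_vimage) auto
      have "continuous_on (?T x -` {y. 0 < G y}) (\<lambda>z. G (?T x z))"
        using G T unfolding lcc_def
        by (intro continuous_on_compose2[of "{y. 0 < G y}" G _ "?T x"]) (auto intro: continuous_on_subset)
      then have "continuous_on (?T x -` {y. 0 < G y}) (\<lambda>z. ennreal (F x powr (1 - s) * G (?T x z) powr s))"
        by (intro continuous_on_ennreal continuous_on_mult continuous_on_const continuous_on_powr) auto
      then have "open ((?T x -` {y. 0 < G y}) \<inter> (\<lambda>z. ennreal (F x powr (1 - s) * G (?T x z) powr s)) -` {c<..})"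
        by (rule continuous_open_preimage[OF _ o]) simp
      also have "(?T x -` {y. 0 < G y}) \<inter> (\<lambda>z. ennreal (F x powr (1 - s) * G (?T x z) powr s)) -` {c<..}
          = {z. c < ennreal (F x powr (1 - s) * G (?T x z) powr s)}"
        using lccD(2)[OF G] by (fastforce simp: less_le)
      finally show ?thesis .
    qed
    then have "open (\<Union>x. {z. c < ennreal (F x powr (1 - s) * G (?T x z) powr s)})" by (intro open_UN) simp
    moreover have "{z \<in> space borel. c < h z} = (\<Union>x. {z. c < ennreal (F x powr (1 - s) * G (?T x z) powr s)})"
      unfolding h_def by (auto simp: less_SUP_iff)
    ultimately show "{z \<in> space borel. c < h z} \<in> sets borel" by simp
  qed
  fix x y :: 'a
  have "((1 - t) *\<^sub>R x + t *\<^sub>R y - (1 - t) *\<^sub>R x) /\<^sub>R t = y"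
    unfolding add_diff_cancel_left' using t by simp
  then show "ennreal (F x powr (1 - s) * G y powr s) \<le> h ((1 - t) *\<^sub>R x + t *\<^sub>R y)"
    unfolding h_def by (intro SUP_upper2[of x]) simp_all
qed

text \<open>Stretching by sqrt 2 leaves a spare factor \<open>exp (- (norm x)\<^sup>2 / 2)\<close>
  relative to \<open>gauss\<close>, which absorbs the exponential uniformly after completing the
  square.\<close>

lemma integrable_gauss_exp_norm:
  "integrable gauss (\<lambda>x::'a::euclidean_space. exp (c * norm x))"
proof (rule integrableI_bounded)
  have "(\<integral>\<^sup>+x. ennreal (norm (exp (c * norm x))) \<partial>(gauss :: 'a measure))
      = (\<integral>\<^sup>+x. ennreal (norm (exp (c * norm (0 + sqrt 2 *\<^sub>R x)))) *
        ennreal (sqrt 2 ^ DIM('a) * exp (((norm x)\<^sup>2 - (norm (0 + sqrt 2 *\<^sub>R x))\<^sup>2) / 2)) \<partial>(gauss :: 'a measure))"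
    by (rule nn_integral_gauss_affine) simp_all
  also have "\<dots> \<le> (\<integral>\<^sup>+x. ennreal (exp (c\<^sup>2) * sqrt 2 ^ DIM('a)) \<partial>(gauss :: 'a measure))"
  proof (rule nn_integral_mono)
    fix x :: 'a
    have "0 \<le> (c - norm x / sqrt 2)\<^sup>2" by simp
    then have "c * (sqrt 2 * norm x) - (norm x)\<^sup>2 / 2 \<le> c\<^sup>2"
      by (simp add: power2_diff power_divide field_simps)
    then have "exp (c * (sqrt 2 * norm x) + ((norm x)\<^sup>2 - (sqrt 2 * norm x)\<^sup>2) / 2) \<le> exp (c\<^sup>2)"
      by (simp add: power_mult_distrib)
    then have "exp (c * (sqrt 2 * norm x)) * exp (((norm x)\<^sup>2 - (sqrt 2 * norm x)\<^sup>2) / 2) * sqrt 2 ^ DIM('a) \<le> exp (c\<^sup>2) * sqrt 2 ^ DIM('a)"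
      unfolding exp_add by (intro mult_right_mono) auto
    then show "ennreal (norm (exp (c * norm (0 + sqrt 2 *\<^sub>R x)))) *
        ennreal (sqrt 2 ^ DIM('a) * exp (((norm x)\<^sup>2 - (norm (0 + sqrt 2 *\<^sub>R x))\<^sup>2) / 2)) \<le> ennreal (exp (c\<^sup>2) * sqrt 2 ^ DIM('a))"
      by (subst ennreal_mult[symmetric]) (auto intro!: ennreal_leI simp: mult_ac)
  qed
  also have "\<dots> < \<infinity>" by (simp add: emeasure_gauss_UNIV)
  finally show "(\<integral>\<^sup>+x. ennreal (norm (exp (c * norm x))) \<partial>(gauss :: 'a measure)) < \<infinity>" .
qed measurable

text \<open>Concavity of the logarithm along the line through \<open>x\<close> and an interior point
  \<open>x0\<close> of the support: the drop of \<open>ln (f _)\<close> from \<open>x0\<close> to a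
  point at distance \<open>r\<close> on the far side bounds the slope on the side of
  \<open>x\<close>.\<close>

lemma lcc_exp_bound:
  fixes f :: "'a::euclidean_space \<Rightarrow> real"
  assumes f: "lcc f"
  obtains C c where "0 \<le> C" "0 \<le> c" "\<And>x. f x \<le> C * exp (c * norm x)"
proof (cases "\<exists>x0. 0 < f x0")
  case True
  then obtain x0 where x0: "x0 \<in> {x. 0 < f x}" by auto
  have op: "open {x. 0 < f x}" and co: "continuous_on {x. 0 < f x} f" using f by (auto simp: lcc_def)
  obtain r where r: "0 < r" "cball x0 r \<subseteq> {x. 0 < f x}" using op x0 open_contains_cball by blast
  obtain z where z: "z \<in> cball x0 r" and zmin: "\<And>y. y \<in> cball x0 r \<Longrightarrow> f z \<le> f y"
    using continuous_attains_inf[of "cball x0 r" f] continuous_on_subset[OF co r(2)] r(1) by (metis centre_in_cball compact_cball empty_iff less_imp_le)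
  define m where "m = f z"
  have m: "0 < m" using z r(2) by (auto simp: m_def)
  have mx0: "m \<le> f x0" using zmin[of x0] r(1) by (simp add: m_def)
  define c where "c = ln (f x0 / m) / r"
  have c: "0 \<le> c" using mx0 m r(1) by (simp add: c_def)
  have bd: "f x \<le> f x0 * exp (c * norm (x - x0))" for x
  proof (cases "x = x0 \<or> f x = 0")
    case False
    then have fx: "0 < f x" and d: "0 < norm (x - x0)" using lccD(2)[OF f, of x] by auto
    define d where "d = norm (x - x0)"
    have d0: "0 < d" using d by (simp add: d_def)
    \<comment> \<open>The point opposite to \<open>x\<close> at distance \<open>r\<close> from
      \<open>x0\<close>; \<open>x0\<close> then divides the segment from \<open>y\<close> to
      \<open>x\<close> with weight \<open>u\<close>.\<close>
    define y where "y = x0 - (r / d) *\<^sub>R (x - x0)"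
    have y: "m \<le> f y"
      unfolding m_def using d0 r(1) by (intro zmin) (simp add: y_def dist_norm d_def)
    define u where "u = r / (r + d)"
    have u: "0 < u" "u < 1" using r(1) d0 by (simp_all add: u_def field_simps)
    have u1: "1 - u = d / (r + d)" using r(1) d0 by (simp add: u_def field_simps)
    have "(1 - u) *\<^sub>R y + u *\<^sub>R x = x0 + (u - (1 - u) * (r / d)) *\<^sub>R (x - x0)"
      by (simp add: y_def algebra_simps)
    also have "(1 - u) * (r / d) = u" unfolding u1 using d0 by (simp add: u_def)
    finally have eq: "(1 - u) *\<^sub>R y + u *\<^sub>R x = x0" by simp
    have "m powr (1 - u) * f x powr u \<le> f y powr (1 - u) * f x powr u"
      using y m u by (intro mult_right_mono powr_mono2) auto
    also have "\<dots> \<le> f x0" using log_concaveD(2)[OF lccD(1)[OF f] u, of y x] unfolding eq .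
    finally have "ln (m powr (1 - u) * f x powr u) \<le> ln (f x0)" using m fx x0 by (intro ln_mono) auto
    then have "(1 - u) * ln m + u * ln (f x) \<le> ln (f x0)" using m fx by (simp add: ln_mult ln_powr)
    then have "(r + d) * ((1 - u) * ln m + u * ln (f x)) \<le> (r + d) * ln (f x0)"
      using r(1) d0 by (intro mult_left_mono) auto
    moreover have "(r + d) * ((1 - u) * ln m + u * ln (f x)) = d * ln m + r * ln (f x)"
    proof -
      have "(r + d) * u = r" "(r + d) * (1 - u) = d" unfolding u1 unfolding u_def using r(1) d0 by simp_all
      then show ?thesis by (simp only: distrib_left mult.assoc[symmetric])
    qed
    ultimately have "r * ln (f x) \<le> r * ln (f x0) + d * (ln (f x0) - ln m)" by (simp add: algebra_simps)
    then have "ln (f x) \<le> ln (f x0) + d * (ln (f x0) - ln m) / r" using r(1) by (simp add: field_simps)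
    also have "\<dots> = ln (f x0 * exp (c * d))" using x0 m by (simp add: ln_mult c_def ln_div)
    finally have "f x \<le> f x0 * exp (c * d)" using fx x0 by (subst (asm) ln_le_cancel_iff) auto
    then show ?thesis by (simp add: d_def)
  qed (use x0 in auto)
  show thesis
  proof (rule that[of "f x0 * exp (c * norm x0)" c])
    fix x
    have "exp (c * norm (x - x0)) \<le> exp (c * norm x0) * exp (c * norm x)"
      using c mult_left_mono[OF norm_triangle_ineq4[of x x0] c] by (simp add: distrib_left flip: exp_add)
    then have "f x0 * exp (c * norm (x - x0)) \<le> f x0 * exp (c * norm x0) * exp (c * norm x)"
      using x0 by (simp add: mult.assoc)
    with bd[of x] show "f x \<le> f x0 * exp (c * norm x0) * exp (c * norm x)" by simp
  qed (use x0 c in auto)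
next
  case False
  then show thesis using lccD(2)[OF f] by (intro that[of 0 0]) (auto simp: not_less)
qed

lemma integrable_lcc:
  fixes f :: "'a::euclidean_space \<Rightarrow> real"
  assumes f: "lcc f"
  shows "integrable gauss f" "integrable gauss (\<lambda>x. f x *\<^sub>R x)"
proof -
  obtain C c where Cc: "0 \<le> C" "0 \<le> c" and bd: "\<And>x. f x \<le> C * exp (c * norm x)" using lcc_exp_bound[OF f] by metis
  note [measurable] = lccD(3)[OF f]
  show "integrable gauss f"
  proof (rule Bochner_Integration.integrable_bound[of _ "\<lambda>x. C * exp (c * norm x)"])
    show "AE x in gauss. norm (f x) \<le> norm (C * exp (c * norm x))"
      using bd lccD(2)[OF f] Cc by (intro AE_I2) simp
  qed (auto intro: integrable_gauss_exp_norm)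
  show "integrable gauss (\<lambda>x. f x *\<^sub>R x)"
  proof (rule Bochner_Integration.integrable_bound[of _ "\<lambda>x. C * exp ((c + 1) * norm x)"])
    show "AE x in gauss. norm (f x *\<^sub>R x) \<le> norm (C * exp ((c + 1) * norm x))"
    proof (intro AE_I2)
      fix x
      have "f x * norm x \<le> (C * exp (c * norm x)) * exp (norm x)"
      proof (rule mult_mono[OF bd])
        show "norm x \<le> exp (norm x)" using exp_ge_add_one_self[of "norm x"] by linarith
      qed (use Cc in auto)
      then show "norm (f x *\<^sub>R x) \<le> norm (C * exp ((c + 1) * norm x))"
        using lccD(2)[OF f, of x] Cc by (simp add: distrib_right exp_add mult.assoc)
    qed
  qed (auto intro: integrable_gauss_exp_norm)
qed

lemma truncation_tendsto:
  fixes f :: "'a::euclidean_space \<Rightarrow> real"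
  assumes f: "lcc f"
  shows "(\<lambda>k. \<integral>x. min (f x) (real (Suc k)) \<partial>gauss) \<longlonglongrightarrow> (\<integral>x. f x \<partial>gauss)"
    and "(\<lambda>k. \<integral>x. min (f x) (real (Suc k)) *\<^sub>R x \<partial>gauss) \<longlonglongrightarrow> (\<integral>x. f x *\<^sub>R x \<partial>gauss)"
proof -
  note [measurable] = lccD(3)[OF f]
  have lim: "(\<lambda>k. min (f x) (real (Suc k))) \<longlonglongrightarrow> f x" for x
  proof (rule tendsto_eventually)
    obtain N where N: "f x \<le> real N" using real_arch_simple by blast
    show "\<forall>\<^sub>F k in sequentially. min (f x) (real (Suc k)) = f x"
      using eventually_ge_at_top[of N] by eventually_elim (use N in \<open>auto simp: min_def\<close>)
  qed
  show "(\<lambda>k. \<integral>x. min (f x) (real (Suc k)) \<partial>gauss) \<longlonglongrightarrow> (\<integral>x. f x \<partial>gauss)"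
    using lim lccD(2)[OF f]
    by (intro integral_dominated_convergence[where w = f] integrable_lcc(1)[OF f]) (auto simp: abs_if)
  show "(\<lambda>k. \<integral>x. min (f x) (real (Suc k)) *\<^sub>R x \<partial>gauss) \<longlonglongrightarrow> (\<integral>x. f x *\<^sub>R x \<partial>gauss)"
    using lim lccD(2)[OF f]
    by (intro integral_dominated_convergence[where w = "\<lambda>x. norm (f x *\<^sub>R x)"] integrable_norm[OF integrable_lcc(2)[OF f]])
      (auto intro!: tendsto_intros mult_right_mono simp: abs_if)
qed

text \<open>Truncating \<open>f\<close> and \<open>g\<close> from above preserves log-concavity and
  only weakens the condition on \<open>h\<close>, so the same \<open>h\<close> serves for all
  truncations. The masses and barycenters converge by dominated convergence.\<close>

theorem gauss_mean:
  fixes f g :: "'a::euclidean_space \<Rightarrow> real"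
  assumes s: "0 < s" "s < 1" and t: "0 < t" "t < 1"
    and f: "lcc f" and g: "lcc g" and adm: "admissible s t f g h"
    and A: "A = (\<integral>x. f x \<partial>gauss)" "0 < A" and B: "B = (\<integral>x. g x \<partial>gauss)" "0 < B"
    and a: "a = (\<integral>x. f x *\<^sub>R x \<partial>gauss) /\<^sub>R A" and b: "b = (\<integral>x. g x *\<^sub>R x \<partial>gauss) /\<^sub>R B"
    and Q: "Q = (1 - s) * (norm a)\<^sup>2 + s * (norm b)\<^sup>2 - (norm ((1 - t) *\<^sub>R a + t *\<^sub>R b))\<^sup>2"
  shows "ennreal (exp (- (real DIM('a) * kl s t)) * exp (Q / 2) * (A powr (1 - s) * B powr s)) \<le> (\<integral>\<^sup>+x. h x \<partial>gauss)"
proof -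
  have hle: "ennreal (f x powr (1 - s) * g y powr s) \<le> h ((1 - t) *\<^sub>R x + t *\<^sub>R y)" for x y
    using adm by (simp add: admissible_def)
  define A' where "A' k = (\<integral>x. min (f x) (real (Suc k)) \<partial>gauss)" for k
  define B' where "B' k = (\<integral>x. min (g x) (real (Suc k)) \<partial>gauss)" for k
  define a' where "a' k = (\<integral>x. min (f x) (real (Suc k)) *\<^sub>R x \<partial>gauss) /\<^sub>R A' k" for k
  define b' where "b' k = (\<integral>x. min (g x) (real (Suc k)) *\<^sub>R x \<partial>gauss) /\<^sub>R B' k" for k
  define Q' where "Q' k = (1 - s) * (norm (a' k))\<^sup>2 + s * (norm (b' k))\<^sup>2 - (norm ((1 - t) *\<^sub>R a' k + t *\<^sub>R b' k))\<^sup>2" for k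
  have lA: "A' \<longlonglongrightarrow> A" unfolding A'_def[abs_def] A by (rule truncation_tendsto(1)[OF f])
  have lB: "B' \<longlonglongrightarrow> B" unfolding B'_def[abs_def] B by (rule truncation_tendsto(1)[OF g])
  have la: "a' \<longlonglongrightarrow> a" unfolding a'_def[abs_def] a using A(2) by (intro tendsto_intros truncation_tendsto(2)[OF f] lA) simp
  have lb: "b' \<longlonglongrightarrow> b" unfolding b'_def[abs_def] b using B(2) by (intro tendsto_intros truncation_tendsto(2)[OF g] lB) simp
  have lQ: "Q' \<longlonglongrightarrow> Q" unfolding Q'_def[abs_def] Q by (intro tendsto_intros la lb)
  have lim: "(\<lambda>k. ennreal (exp (- (real DIM('a) * kl s t)) * exp (Q' k / 2) * (A' k powr (1 - s) * B' k powr s)))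
      \<longlonglongrightarrow> ennreal (exp (- (real DIM('a) * kl s t)) * exp (Q / 2) * (A powr (1 - s) * B powr s))"
    using A(2) B(2) by (intro tendsto_intros lA lB lQ) auto
  have "\<forall>\<^sub>F k in sequentially. 0 < A' k" "\<forall>\<^sub>F k in sequentially. 0 < B' k"
    using order_tendstoD(1)[OF lA A(2)] order_tendstoD(1)[OF lB B(2)] by auto
  then have "\<forall>\<^sub>F k in sequentially. ennreal (exp (- (real DIM('a) * kl s t)) * exp (Q' k / 2) * (A' k powr (1 - s) * B' k powr s))
      \<le> (\<integral>\<^sup>+x. h x \<partial>gauss)"
  proof eventually_elim
    case (elim k)
    show ?case
    proof (rule gauss_mean_bounded[OF s t _ _ _ A'_def elim(1) B'_def elim(2) a'_def b'_def Q'_def])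
      show "lcb (\<lambda>x. min (f x) (real (Suc k)))" "lcb (\<lambda>x. min (g x) (real (Suc k)))"
        by (rule lcc_min[OF f], simp, rule lcc_min[OF g], simp)
      have "min (f x) (real (Suc k)) powr (1 - s) * min (g y) (real (Suc k)) powr s \<le> f x powr (1 - s) * g y powr s" for x y
        using s lccD(2)[OF f] lccD(2)[OF g] by (intro mult_mono powr_mono2) auto
      then show "admissible s t (\<lambda>x. min (f x) (real (Suc k))) (\<lambda>x. min (g x) (real (Suc k))) h"
        using adm unfolding admissible_def by (blast intro: order_trans[OF ennreal_leI])
    qed
  qed
  then show ?thesis by (rule tendsto_upperbound[OF lim]) simp
qed

section \<open>Power means\<close>

lemma weighted_am_gm_kl_powr:
  assumes s: "0 < s" "s < 1" and t: "0 < t" "t < 1" and P: "0 < P" and a: "0 < a" "0 < b"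
  shows "exp (- (kl s t / P)) * (a powr (1 - s) * b powr s) \<le> ((1 - t) * a powr P + t * b powr P) powr (1 / P)"
proof -
  have "exp (- kl s t) * ((a powr P) powr (1 - s) * (b powr P) powr s) \<le> (1 - t) * a powr P + t * b powr P"
    by (rule weighted_am_gm_kl[OF s t]) simp_all
  then have "(exp (- kl s t) * ((a powr P) powr (1 - s) * (b powr P) powr s)) powr (1 / P)
      \<le> ((1 - t) * a powr P + t * b powr P) powr (1 / P)"
    using P by (intro powr_mono2) auto
  moreover have "(exp (- kl s t) * ((a powr P) powr (1 - s) * (b powr P) powr s)) powr (1 / P)
      = exp (- (kl s t / P)) * (a powr (1 - s) * b powr s)"
    using a P by (simp add: powr_mult powr_powr exp_powr_real)
  ultimately show ?thesis by simp
qed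

text \<open>Equality in Jensen's inequality: the maximising \<open>s\<close> is the share of the
  second term in the weighted sum of the powers.\<close>

lemma weighted_am_gm_kl_eq:
  assumes t: "0 < t" "t < 1" and P: "0 < P" and a: "0 < a" "0 < b"
  obtains s where "0 < s" "s < 1"
    "exp (- (kl s t / P)) * (a powr (1 - s) * b powr s) = ((1 - t) * a powr P + t * b powr P) powr (1 / P)"
proof -
  define D where "D = (1 - t) * a powr P + t * b powr P"
  have D: "0 < D" using t a by (simp add: D_def add_pos_pos)
  define s where "s = t * b powr P / D"
  have s: "0 < s" using t a D by (simp add: s_def)
  have s1: "1 - s = (1 - t) * a powr P / D" using D by (simp add: s_def field_simps) (simp add: D_def algebra_simps)
  have "0 < 1 - s" unfolding s1 using t a D by simp
  then have s': "s < 1" by simp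
  have "ln ((1 - s) / (1 - t)) = P * ln a - ln D" unfolding s1 using t a D by (simp add: ln_div ln_powr)
  moreover have "ln (s / t) = P * ln b - ln D" unfolding s_def using t a D by (simp add: ln_div ln_powr)
  ultimately have "kl s t = P * ((1 - s) * ln a + s * ln b) - ln D" by (simp only: kl_def) (simp add: algebra_simps)
  then have "- (kl s t / P) = ln D / P - ((1 - s) * ln a + s * ln b)" using P by (simp add: field_simps)
  then have "exp (- (kl s t / P)) * (a powr (1 - s) * b powr s) = exp (ln D / P)"
    using a by (simp add: powr_def mult_exp_exp)
  also have "\<dots> = D powr (1 / P)" using D by (simp add: powr_def)
  finally show thesis using that[OF s s'] unfolding D_def by simp
qed

text \<open>The factor multiplying \<open>kl\<close> plays the role of \<open>1 / p\<close>. It is 0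
  at infinite order, where every \<open>s\<close> is free of charge; at order 0 it would be
  infinite, and the value 0 is correct only because \<open>s = t\<close> is imposed there.\<close>

lemma power_mean_ge_geometric:
  assumes s: "0 < s" "s < 1" and t: "0 < t" "t < 1" and a: "0 \<le> a" "0 \<le> b" and p: "p = 0 \<Longrightarrow> s = t"
  shows "exp (- (kl s t * (if p = \<infinity> \<or> p = 0 then 0 else 1 / enn2real p))) * (a powr (1 - s) * b powr s) \<le> power_mean p t a b"
proof (cases "a * b = 0")
  case True
  then show ?thesis by (auto simp: power_mean_def)
next
  case False
  then have pos: "0 < a" "0 < b" using a by auto
  show ?thesis
  proof (cases "p = 0 \<or> p = \<infinity>")
    case False
    then have "0 < enn2real p" by (simp add: enn2real_positive_iff less_top zero_less_iff_neq_zero)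
    from weighted_am_gm_kl_powr[OF s t this pos] show ?thesis using False pos by (simp add: power_mean_def)
  next
    case True
    have "a powr (1 - s) * b powr s \<le> max a b powr (1 - s) * max a b powr s"
      using pos s by (intro mult_mono powr_mono2) auto
    also have "\<dots> = max a b" using pos by (simp flip: powr_add)
    finally show ?thesis using True p pos by (auto simp: power_mean_def)
  qed
qed

lemma power_mean_homogeneous:
  assumes k: "0 < k" and a: "0 < a" "0 < b" and t: "0 < t" "t < 1"
  shows "power_mean r t (a * k) (b * k) = power_mean r t a b * k"
proof -
  consider "r = 0" | "r = \<infinity>" | "r \<noteq> 0" "r \<noteq> \<infinity>" by blast
  then show ?thesis
  proof cases
    case 1
    have "(a * k) powr (1 - t) * (b * k) powr t = a powr (1 - t) * b powr t * (k powr (1 - t) * k powr t)"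
      using a k by (simp add: powr_mult)
    also have "k powr (1 - t) * k powr t = k" using k by (simp flip: powr_add)
    finally show ?thesis using 1 a k by (simp add: power_mean_def)
  next
    case 2
    then show ?thesis using a k by (simp add: power_mean_def max_mult_distrib_right)
  next
    case 3
    define R where "R = enn2real r"
    have R: "0 < R" using 3 by (simp add: R_def enn2real_positive_iff less_top zero_less_iff_neq_zero)
    have "(1 - t) * (a * k) powr R + t * (b * k) powr R = ((1 - t) * a powr R + t * b powr R) * k powr R"
      using a k by (simp add: powr_mult algebra_simps)
    then have "((1 - t) * (a * k) powr R + t * (b * k) powr R) powr (1 / R)
        = ((1 - t) * a powr R + t * b powr R) powr (1 / R) * (k powr R) powr (1 / R)"
      using t a k by (simp add: powr_mult)
    also have "(k powr R) powr (1 / R) = k" using R k by (simp add: powr_powr)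
    finally show ?thesis using 3 a k by (simp add: power_mean_def R_def)
  qed
qed

section \<open>Transfer between the Lebesgue and the Borel version of the Gaussian measure\<close>

lemma std_gaussian_eq: "(std_gaussian :: (real ^ 'n) measure) = density lebesgue (\<lambda>x. ennreal (gauss_dens x))"
  by (simp add: std_gaussian_def gauss_dens_def)

lemma
  fixes \<phi> :: "real ^ 'n \<Rightarrow> 'b::euclidean_space"
  assumes [measurable]: "\<phi> \<in> borel_measurable borel"
  shows integrable_std_gaussian: "integrable std_gaussian \<phi> \<longleftrightarrow> integrable gauss \<phi>"
    and integral_std_gaussian: "(\<integral>x. \<phi> x \<partial>std_gaussian) = (\<integral>x. \<phi> x \<partial>gauss)"
proof -
  have m: "\<phi> \<in> borel_measurable lebesgue" "gauss_dens \<in> borel_measurable (lebesgue :: (real ^ 'n) measure)"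
    by (rule measurable_completion, measurable)+
  note n = gauss_dens_pos[THEN less_imp_le]
  show "integrable std_gaussian \<phi> \<longleftrightarrow> integrable gauss \<phi>"
    unfolding std_gaussian_eq gauss_eq using n
    by (subst (1 2) integrable_density) (auto simp: m integrable_completion)
  show "(\<integral>x. \<phi> x \<partial>std_gaussian) = (\<integral>x. \<phi> x \<partial>gauss)"
    unfolding std_gaussian_eq gauss_eq using n
    by (subst (1 2) integral_density) (auto simp: m integral_completion)
qed

lemma nn_integral_std_gaussian:
  fixes \<phi> :: "real ^ 'n \<Rightarrow> ennreal"
  assumes [measurable]: "\<phi> \<in> borel_measurable borel"
  shows "(\<integral>\<^sup>+x. \<phi> x \<partial>std_gaussian) = (\<integral>\<^sup>+x. \<phi> x \<partial>gauss)"
proof -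
  have m: "\<phi> \<in> borel_measurable lebesgue" "(\<lambda>x. ennreal (gauss_dens x)) \<in> borel_measurable (lebesgue :: (real ^ 'n) measure)"
    by (rule measurable_completion, measurable)+
  show ?thesis
    unfolding std_gaussian_eq gauss_eq
    by (subst (1 2) nn_integral_density) (auto simp: m nn_integral_completion)
qed

lemma measurable_std_gaussian:
  "\<phi> \<in> borel_measurable borel \<Longrightarrow> \<phi> \<in> borel_measurable std_gaussian"
  unfolding std_gaussian_def by (simp add: measurable_completion)

text \<open>Mass and barycenter do not see the null set on which \<open>f\<close> and its regular
  version differ, so both can be computed with the Borel measure.\<close>

lemma std_gaussian_regular_version:
  fixes f F :: "real ^ 'n \<Rightarrow> real"
  assumes F: "lcc F" and eq: "negligible {x. f x \<noteq> F x}" and f: "integrable std_gaussian f"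
    and A: "A = (\<integral>x. f x \<partial>std_gaussian)" and nn: "\<And>x. 0 \<le> f x" and A0: "0 < A"
  shows "A = (\<integral>x. F x \<partial>gauss)"
    and "barycenter (density std_gaussian (\<lambda>x. ennreal (f x / A))) = (\<integral>x. F x *\<^sub>R x \<partial>gauss) /\<^sub>R A"
proof -
  note [measurable] = lccD(3)[OF F] borel_measurable_integrable[OF f]
  have "AE x in lebesgue. f x = F x"
    using eq by (intro AE_I'[of "{x. f x \<noteq> F x}"]) (auto simp: negligible_iff_null_sets)
  then have ae: "AE x in std_gaussian. f x = F x"
    unfolding std_gaussian_def by (subst AE_density) (auto intro: measurable_completion)
  have "A = (\<integral>x. F x \<partial>std_gaussian)" unfolding A
    by (rule integral_cong_AE[OF _ _ ae]) (simp_all add: measurable_std_gaussian)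
  then show "A = (\<integral>x. F x \<partial>gauss)" by (simp add: integral_std_gaussian)
  have "barycenter (density std_gaussian (\<lambda>x. ennreal (f x / A))) = (\<integral>x. (f x / A) *\<^sub>R x \<partial>std_gaussian)"
    unfolding barycenter_def using nn A0 measurable_std_gaussian[of "\<lambda>x. x"] by (subst integral_density) auto
  also have "\<dots> = (\<integral>x. (F x / A) *\<^sub>R x \<partial>std_gaussian)"
  proof (rule integral_cong_AE)
    show "AE x in std_gaussian. (f x / A) *\<^sub>R x = (F x / A) *\<^sub>R x" using ae by eventually_elim simp
    show "(\<lambda>x. (f x / A) *\<^sub>R x) \<in> borel_measurable std_gaussian"
      using measurable_std_gaussian[of "\<lambda>x. x"] by (intro borel_measurable_scaleR borel_measurable_divide) auto
    show "(\<lambda>x. (F x / A) *\<^sub>R x) \<in> borel_measurable std_gaussian" by (rule measurable_std_gaussian) measurable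
  qed
  also have "\<dots> = (\<integral>x. (F x / A) *\<^sub>R x \<partial>gauss)" by (rule integral_std_gaussian) measurable
  also have "\<dots> = (\<integral>x. (1 / A) *\<^sub>R (F x *\<^sub>R x) \<partial>gauss)" by simp
  also have "\<dots> = (\<integral>x. F x *\<^sub>R x \<partial>gauss) /\<^sub>R A" by (simp only: integral_scaleR_right inverse_eq_divide)
  finally show "barycenter (density std_gaussian (\<lambda>x. ennreal (f x / A))) = (\<integral>x. F x *\<^sub>R x \<partial>gauss) /\<^sub>R A" .
qed

text \<open>Splits \<open>Q\<close> into the part of the combined barycenter and the parts of the
  two individual ones, which are absorbed into the masses as in the final inequality.\<close>

lemma barycenter_form_exp:
  fixes a b c :: "'a::real_inner" and A B s :: real
  shows "exp (((1 - s) * (norm a)\<^sup>2 + s * (norm b)\<^sup>2 - (norm c)\<^sup>2) / 2) * (A powr (1 - s) * B powr s)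
    = exp (- (norm c)\<^sup>2 / 2) * ((A * exp ((norm a)\<^sup>2 / 2)) powr (1 - s) * (B * exp ((norm b)\<^sup>2 / 2)) powr s)"
proof -
  define u where "u = (norm a)\<^sup>2 / 2"
  define v where "v = (norm b)\<^sup>2 / 2"
  define w where "w = - (norm c)\<^sup>2 / 2"
  have "((1 - s) * (norm a)\<^sup>2 + s * (norm b)\<^sup>2 - (norm c)\<^sup>2) / 2 = w + (u * (1 - s) + v * s)"
  proof -
    have "((1 - s) * x + s * y - z) / 2 = - z / 2 + (x / 2 * (1 - s) + y / 2 * s)" for x y z :: real by algebra
    then show ?thesis unfolding u_def v_def w_def .
  qed
  then have 1: "exp (((1 - s) * (norm a)\<^sup>2 + s * (norm b)\<^sup>2 - (norm c)\<^sup>2) / 2) = exp w * (exp (u * (1 - s)) * exp (v * s))"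
    by (simp only: exp_add)
  have 2: "(A * exp u) powr (1 - s) * (B * exp v) powr s = A powr (1 - s) * B powr s * (exp (u * (1 - s)) * exp (v * s))"
    by (simp only: powr_mult exp_powr_real) (simp only: mult_ac)
  show ?thesis unfolding 1 2 u_def[symmetric] v_def[symmetric] w_def[symmetric]
    by (simp only: mult_ac)
qed

theorem theorem5p2:
  fixes f g h :: "real ^ 'n \<Rightarrow> real"
    and t A B :: real
    and p r :: ennreal
    and \<mu>\<^sub>f \<mu>\<^sub>g :: "(real ^ 'n) measure"
    and b\<^sub>f b\<^sub>g b\<^sub>t :: "real ^ 'n"
  assumes t: "0 < t" "t < 1"
    and f_nonneg: "\<And>x. 0 \<le> f x"
    and g_nonneg: "\<And>x. 0 \<le> g x"
    and h_nonneg: "\<And>x. 0 \<le> h x"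
    and f_int: "integrable std_gaussian f"
    and g_int: "integrable std_gaussian g"
    and h_int: "integrable std_gaussian h"
    and f_lc: "log_concave f"
    and g_lc: "log_concave g"
    and A: "A = (\<integral>x. f x \<partial>std_gaussian)" "A > 0"
    and B: "B = (\<integral>x. g x \<partial>std_gaussian)" "B > 0"
    and fgh: "\<And>x y. h ((1 - t) *\<^sub>R x + t *\<^sub>R y) \<ge> power_mean p t (f x) (g y)"
    and \<mu>\<^sub>f: "\<mu>\<^sub>f = density std_gaussian (\<lambda>x. ennreal (f x / A))"
    and \<mu>\<^sub>g: "\<mu>\<^sub>g = density std_gaussian (\<lambda>x. ennreal (g x / B))"
    and b\<^sub>f: "b\<^sub>f = barycenter \<mu>\<^sub>f"
    and b\<^sub>g: "b\<^sub>g = barycenter \<mu>\<^sub>g"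
    and b\<^sub>t: "b\<^sub>t = (1 - t) *\<^sub>R b\<^sub>f + t *\<^sub>R b\<^sub>g"
    and r: "r = (if p = \<infinity> then 1 / of_nat CARD('n) else p / (1 + of_nat CARD('n) * p))"
  shows "(\<integral>x. h x \<partial>std_gaussian) \<ge>
           exp (- (norm b\<^sub>t)\<^sup>2 / 2) *
           power_mean r t (A * exp ((norm b\<^sub>f)\<^sup>2 / 2)) (B * exp ((norm b\<^sub>g)\<^sup>2 / 2))
         \<and> (b\<^sub>f = b\<^sub>g \<longrightarrow> (\<integral>x. h x \<partial>std_gaussian) \<ge> power_mean r t A B)"
proof -
  obtain F where F: "lcc F" "\<And>x. F x \<le> f x" "negligible {x. f x \<noteq> F x}"
    using log_concave_regular_version[OF f_lc] by blast
  obtain G where G: "lcc G" "\<And>x. G x \<le> g x" "negligible {x. g x \<noteq> G x}"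
    using log_concave_regular_version[OF g_lc] by blast
  note FA = std_gaussian_regular_version[OF F(1,3) f_int A(1) f_nonneg A(2), folded \<mu>\<^sub>f, folded b\<^sub>f]
  note GB = std_gaussian_regular_version[OF G(1,3) g_int B(1) g_nonneg B(2), folded \<mu>\<^sub>g, folded b\<^sub>g]
  define I where "I = (\<integral>x. h x \<partial>std_gaussian)"
  define A' where "A' = A * exp ((norm b\<^sub>f)\<^sup>2 / 2)"
  define B' where "B' = B * exp ((norm b\<^sub>g)\<^sup>2 / 2)"
  have A': "0 < A'" and B': "0 < B'" using A(2) B(2) by (simp_all add: A'_def B'_def)
  \<comment> \<open>The reciprocal of \<open>p\<close>. The entropy costs of the hypothesis and of
    the dimension add up to \<open>kl s t\<close> times \<open>CARD('n) + q\<close>, which is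
    \<open>1 / r\<close> when \<open>p\<close> is not 0.\<close>
  define q where "q = (if p = \<infinity> \<or> p = 0 then 0 else 1 / enn2real p)"
  have main: "exp (- (norm b\<^sub>t)\<^sup>2 / 2) * (exp (- (kl s t * (real CARD('n) + q))) * (A' powr (1 - s) * B' powr s)) \<le> I"
    if s: "0 < s" "s < 1" and ps: "p = 0 \<Longrightarrow> s = t" for s
  proof -
    define Q where "Q = (1 - s) * (norm b\<^sub>f)\<^sup>2 + s * (norm b\<^sub>g)\<^sup>2 - (norm b\<^sub>t)\<^sup>2"
    \<comment> \<open>\<open>h\<close> is only Lebesgue measurable. The supremal convolution of the
      regular versions is Borel and lies below \<open>exp (kl s t * q) * h\<close> everywhere, so it
      carries the bound over to \<open>h\<close>.\<close>
    define h0 where "h0 = (\<lambda>z. SUP x. ennreal (F x powr (1 - s) * G ((z - (1 - t) *\<^sub>R x) /\<^sub>R t) powr s))"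
    have adm: "admissible s t F G h0"
      unfolding h0_def by (rule admissible_sup_convolution[OF F(1) G(1) s t])
    have "ennreal (exp (- (real DIM(real ^ 'n) * kl s t)) * exp (Q / 2) * (A powr (1 - s) * B powr s)) \<le> (\<integral>\<^sup>+x. h0 x \<partial>gauss)"
      by (rule gauss_mean[OF s t F(1) G(1) adm FA(1) A(2) GB(1) B(2) FA(2) GB(2)]) (simp add: Q_def b\<^sub>t)
    also have "\<dots> = (\<integral>\<^sup>+x. h0 x \<partial>std_gaussian)"
      using adm by (simp add: admissible_def nn_integral_std_gaussian)
    also have "\<dots> \<le> (\<integral>\<^sup>+x. ennreal (exp (kl s t * q) * h x) \<partial>std_gaussian)"
    proof (rule nn_integral_mono)
      fix z
      show "h0 z \<le> ennreal (exp (kl s t * q) * h z)"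
        unfolding h0_def
      proof (rule SUP_least)
        fix x
        define y where "y = (z - (1 - t) *\<^sub>R x) /\<^sub>R t"
        have z: "(1 - t) *\<^sub>R x + t *\<^sub>R y = z" using t by (simp add: y_def)
        have "F x powr (1 - s) * G y powr s \<le> f x powr (1 - s) * g y powr s"
          using s F(2)[of x] G(2)[of y] lccD(2)[OF F(1)] lccD(2)[OF G(1)] f_nonneg
          by (intro mult_mono powr_mono2) auto
        also have "\<dots> = exp (kl s t * q) * (exp (- (kl s t * q)) * (f x powr (1 - s) * g y powr s))"
          by (simp add: mult.assoc[symmetric] flip: exp_add)
        also have "\<dots> \<le> exp (kl s t * q) * h z"
        proof (rule mult_left_mono)
          have "exp (- (kl s t * q)) * (f x powr (1 - s) * g y powr s) \<le> power_mean p t (f x) (g y)"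
            unfolding q_def by (rule power_mean_ge_geometric[OF s t f_nonneg g_nonneg ps])
          also have "\<dots> \<le> h z" using fgh[of x y] unfolding z .
          finally show "exp (- (kl s t * q)) * (f x powr (1 - s) * g y powr s) \<le> h z" .
        qed simp
        finally show "ennreal (F x powr (1 - s) * G ((z - (1 - t) *\<^sub>R x) /\<^sub>R t) powr s) \<le> ennreal (exp (kl s t * q) * h z)"
          unfolding y_def by (rule ennreal_leI)
      qed
    qed
    also have "\<dots> = ennreal (exp (kl s t * q) * I)"
      using h_int h_nonneg unfolding I_def by (subst nn_integral_eq_integral) auto
    finally have le: "exp (- (real CARD('n) * kl s t)) * exp (Q / 2) * (A powr (1 - s) * B powr s) \<le> exp (kl s t * q) * I"
      using h_nonneg by (subst (asm) ennreal_le_iff) (auto simp: I_def)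
    have split: "exp (- (kl s t * (real CARD('n) + q))) = exp (- (kl s t * q)) * exp (- (real CARD('n) * kl s t))"
      by (simp add: algebra_simps flip: exp_add)
    have "exp (- (norm b\<^sub>t)\<^sup>2 / 2) * (exp (- (kl s t * (real CARD('n) + q))) * (A' powr (1 - s) * B' powr s))
        = exp (- (kl s t * (real CARD('n) + q))) * (exp (Q / 2) * (A powr (1 - s) * B powr s))"
      unfolding Q_def barycenter_form_exp A'_def B'_def by (simp only: mult_ac)
    also have "\<dots> = exp (- (kl s t * q)) * (exp (- (real CARD('n) * kl s t)) * exp (Q / 2) * (A powr (1 - s) * B powr s))"
      unfolding split by (simp only: mult_ac)
    also have "\<dots> \<le> exp (- (kl s t * q)) * (exp (kl s t * q) * I)"
      using le by (intro mult_left_mono) auto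
    also have "\<dots> = I" by (simp add: mult.assoc[symmetric] flip: exp_add)
    finally show ?thesis .
  qed
  have bound: "exp (- (norm b\<^sub>t)\<^sup>2 / 2) * power_mean r t A' B' \<le> I"
  proof (cases "p = 0")
    case True
    then have "r = 0" by (simp add: r)
    then have "power_mean r t A' B' = A' powr (1 - t) * B' powr t" using A' B' by (simp add: power_mean_def)
    then show ?thesis using main[of t] t kl_self[OF t] by simp
  next
    case False
    have R: "r \<noteq> 0 \<and> r \<noteq> \<infinity> \<and> 0 < enn2real r \<and> 1 / enn2real r = real CARD('n) + q"
    proof (cases p)
      case (real P)
      with False have P: "0 < P" by (auto simp: less_le)
      define R where "R = P / (1 + real CARD('n) * P)"
      have "r = ennreal P / ennreal (1 + real CARD('n) * P)"
        using real by (simp add: r ennreal_mult ennreal_of_nat_eq_real_of_nat)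
      also have "\<dots> = ennreal R" unfolding R_def using P by (intro divide_ennreal) (auto intro: add_pos_nonneg)
      finally have "r = ennreal R" .
      moreover have "0 < R" using P by (simp add: R_def add_pos_nonneg)
      moreover have "1 / R = real CARD('n) + 1 / P" using P by (simp add: R_def field_simps)
      moreover have "q = 1 / P" using real P by (simp add: q_def)
      ultimately show ?thesis by simp
    next
      case top
      have "r = ennreal 1 / ennreal (real CARD('n))" using top by (simp add: r ennreal_of_nat_eq_real_of_nat)
      also have "\<dots> = ennreal (1 / real CARD('n))" by (intro divide_ennreal) auto
      finally show ?thesis using top by (simp add: q_def)
    qed
    \<comment> \<open>The maximising \<open>s\<close> for the pair \<open>A'\<close>,
      \<open>B'\<close> and order \<open>r\<close>. It depends on these masses, which is why
      \<open>main\<close> was needed for all \<open>s\<close>.\<close>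
    obtain s where s: "0 < s" "s < 1"
      "exp (- (kl s t / enn2real r)) * (A' powr (1 - s) * B' powr s) = ((1 - t) * A' powr enn2real r + t * B' powr enn2real r) powr (1 / enn2real r)"
      using weighted_am_gm_kl_eq[OF t _ A' B', of "enn2real r"] R by metis
    have "power_mean r t A' B' = exp (- (kl s t * (1 / enn2real r))) * (A' powr (1 - s) * B' powr s)"
    proof -
      have "power_mean r t A' B' = ((1 - t) * A' powr enn2real r + t * B' powr enn2real r) powr (1 / enn2real r)"
        unfolding power_mean_def using conjunct1[OF R] conjunct1[OF conjunct2[OF R]] A' B' by simp
      then show ?thesis unfolding s(3)[symmetric] by simp
    qed
    also have "\<dots> = exp (- (kl s t * (real CARD('n) + q))) * (A' powr (1 - s) * B' powr s)" using R by simp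
    finally show ?thesis using main[OF s(1,2)] False by simp
  qed
  moreover have "power_mean r t A B \<le> I" if eq: "b\<^sub>f = b\<^sub>g"
  proof -
    define k where "k = exp ((norm b\<^sub>f)\<^sup>2 / 2)"
    have "b\<^sub>t = b\<^sub>f" unfolding b\<^sub>t using eq by (simp flip: scaleR_left_distrib)
    then have k1: "exp (- (norm b\<^sub>t)\<^sup>2 / 2) * k = 1" by (simp add: k_def flip: exp_add)
    have "power_mean r t A' B' = power_mean r t A B * k"
      unfolding A'_def B'_def eq[symmetric] k_def by (rule power_mean_homogeneous[OF _ A(2) B(2) t]) simp
    then have "exp (- (norm b\<^sub>t)\<^sup>2 / 2) * power_mean r t A' B' = power_mean r t A B * (exp (- (norm b\<^sub>t)\<^sup>2 / 2) * k)"
      by (simp only: mult_ac)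
    then show ?thesis using bound unfolding k1 by simp
  qed
  ultimately show ?thesis unfolding A'_def B'_def I_def by simp
qed


end
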